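(* Let $\tau=(\tau^{(1)},\dots,\tau^{(N)})$ be the absorption times of $N$ i.i.d. copies $X^{(1)},\dots,X^{(N)}$ of a time-inhomogeneous Markov jump process on $E=\{1,\dots,p,p+1\}$ with absorbing state $p+1$, and let $L^{X}(\pi,\theta)$ be the complete-data log-likelihood. For $m\in\mathbb{N}_0$, the conditional expected log-likelihood $\bar{L}^{(m)}(\pi,\theta)=\mathbb{E}_{(\pi^{(m)},\theta^{(m)})}[L^{X}(\pi,\theta)\mid\tau]$ given the data $\tau$ under the parameters $(\pi^{(m)},\theta^{(m)})$ is given by $$\bar{L}^{(m)}(\pi,\theta)=\bar{L}_0^{(m)}(\pi)+\sum_{i,j\in E,\ j\ne i}\bar{L}_{ij}^{(m)}(\theta),\qquad \bar{L}_0^{(m)}(\pi)=\sum_{i=1}^p\bar{B}_i^{(m)}\log(\pi_i),$$ $$\bar{L}_{ij}^{(m)}(\theta)=\sum_{n=1}^N\left(\int_{(0,\tau^{(n)}]}\log(\mu_{ij}(s;\theta))\,d\bar{N}_{ij}^{(n,m)}(s)-\int_0^{\tau^{(n)}}\bar{I}_i^{(n,m)}(s)\,\mu_{ij}(s;\theta)\,ds\right),$$ with all the non-zero conditional expected statistics given by, for $i,j\in\{1,\dots,p\}$, $j\neq i$, and $n\in\{1,\dots,N\}$, $$\bar{B}_i^{(m)}=\sum_{n=1}^N\frac{\pi_i^{(m)}e_i'\bar{\mathbf{P}}(0,\tau^{(n)};\theta^{(m)})\,\mathbf{t}(\tau^{(n)};\theta^{(m)})}{f(\tau^{(n)};\pi^{(m)},\theta^{(m)})},$$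 $$\bar{I}_i^{(n,m)}(s)=\frac{\pi^{(m)}\bar{\mathbf{P}}(0,s;\theta^{(m)})\,e_ie_i'\,\bar{\mathbf{P}}(s,\tau^{(n)};\theta^{(m)})\,\mathbf{t}(\tau^{(n)};\theta^{(m)})}{f(\tau^{(n)};\pi^{(m)},\theta^{(m)})},\quad s\in(0,\tau^{(n)}),$$ $$d\bar{N}_{ij}^{(n,m)}(s)=\frac{\pi^{(m)}\bar{\mathbf{P}}(0,s;\theta^{(m)})\,e_i\,\mu_{ij}(s;\theta^{(m)})\,e_j'\,\bar{\mathbf{P}}(s,\tau^{(n)};\theta^{(m)})\,\mathbf{t}(\tau^{(n)};\theta^{(m)})}{f(\tau^{(n)};\pi^{(m)},\theta^{(m)})}\,ds,\quad s\in(0,\tau^{(n)}],$$ and, for $j=p+1$, $$d\bar{N}_{i,p+1}^{(n,m)}(s)=\frac{\pi^{(m)}\bar{\mathbf{P}}(0,s;\theta^{(m)})\,e_i\,t_i(s;\theta^{(m)})}{f(\tau^{(n)};\pi^{(m)},\theta^{(m)})}\,d\varepsilon_{\tau^{(n)}}(s),\quad s\in(0,\tau^{(n)}],$$ where $\varepsilon_{\tau^{(n)}}$ is the Dirac measure at $\tau^{(n)}$.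
   Context: Process: each $X^{(n)}$ has transient states $1,\dots,p$, initial distribution $(\pi,0)$ with $\pi=(\pi_1,\dots,\pi_p)$ a row vector, and intensity matrix function $\mathbf{\Lambda}(t;\theta)=\{\mu_{ij}(t;\theta)\}_{i,j\in E}=\begin{pmatrix}\mathbf{T}(t;\theta)&\mathbf{t}(t;\theta)\\0&0\end{pmatrix}$, where $\mathbf{t}(t;\theta)=-\mathbf{T}(t;\theta)\mathbf{e}$ has entries $t_i(t;\theta)=\mu_{i,p+1}(t;\theta)$, $\mathbf{e}=(1,\dots,1)'$, and $\theta\in\Theta$, a finite-dimensional parameter space with non-empty interior. $e_i$ is the $i$-th standard column unit vector of $\mathbb{R}^p$ and $'$ denotes transpose. The absorption time is $\tau^{(n)}=\inf\{t\ge0:X^{(n)}(t)=p+1\}$, a.s. finite. The intensity functions are such that the product integral $\bar{\mathbf{P}}(s,t;\theta)=\prod_s^t(\mathbf{I}+\mathbf{T}(u;\theta)du)$ exists, i.e. the solution of $\bar{\mathbf{P}}(s,t;\theta)=\mathbf{I}+\int_s^t\bar{\mathbf{P}}(s,u;\theta)\mathbf{T}(u;\theta)du$; it is the transition (sub-)probability matrix between the transient states. The density of $\tau^{(n)}$ is $f(x;\pi,\theta)=\pi\bar{\mathbf{P}}(0,x;\theta)\mathbf{t}(x;\theta)$. Complete-data quantities: $I_i^{(n)}(s)=\mathbf{1}_{(X^{(n)}(s)=i)}$, $B_i=\sum_{n=1}^N I_i^{(n)}(0)$, $N_{ij}^{(n)}(t)=\#\{s\in(0,t]:X^{(n)}(s-)=i,\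 X^{(n)}(s)=j\}$. With horizon $T=\max_n\tau^{(n)}$, the complete-data log-likelihood is $$L^{X}(\pi,\theta)=\sum_{i=1}^pB_i\log(\pi_i)+\sum_{i,j\in E,\,j\ne i}\ \sum_{n=1}^N\left(\int_{(0,T]}\log(\mu_{ij}(s;\theta))\,dN_{ij}^{(n)}(s)-\int_0^TI_i^{(n)}(s)\mu_{ij}(s;\theta)\,ds\right).$$ Convention: $0\cdot\log 0=0$, so the integral of $\log 0$ against a zero measure is $0$; in particular the terms with $i=p+1$ vanish. The integrals and conditional expectations involved are assumed well defined. $\mathbb{E}_{(\pi,\theta)}$ is expectation when the processes have initial distribution $\pi$ and sub-intensity matrix function $\mathbf{T}(\cdot\,;\theta)$; $(\pi^{(m)},\theta^{(m)})$ is any current parameter value. The conditional expected statistics are $\bar{B}_i^{(m)}=\mathbb{E}_{(\pi^{(m)},\theta^{(m)})}[B_i\mid\tau]$, $\bar{I}_i^{(n,m)}(s)=\mathbb{E}_{(\pi^{(m)},\theta^{(m)})}[I_i^{(n)}(s)\mid\tau]$, $\bar{N}_{ij}^{(n,m)}(s)=\mathbb{E}_{(\pi^{(m)},\theta^{(m)})}[N_{ij}^{(n)}(s)\mid\tau]$, and $d\bar{N}_{ij}^{(n,m)}$ is the measure generated by $s\mapsto\bar{N}_{ij}^{(n,m)}(s)$. "Non-zero" refers to the fact that the statistics that are not listed and enter the likelihood (those with $i=p+1$, for $s<\tau^{(n)}$) are identically zero. Identities between conditional expectations hold almost surely under $(\pi^{(m)},\theta^{(m)})$. *)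

theory Defs
  imports "HOL-Probability.Probability"
begin

text \<open>
  The transient states are the elements of a finite type \<open>'p\<close>; the state space \<open>E\<close> is
  \<open>'p option\<close>, with \<open>Some i\<close> the transient state \<open>i\<close> and \<open>None\<close> the absorbing state.
  Matrix functions are only evaluated at nonnegative times.
\<close>


section \<open>Product integrals and intensity matrix functions\<close>

definition solves_product_integral ::
  "(real \<Rightarrow> real^'n^'n) \<Rightarrow> real \<Rightarrow> (real \<Rightarrow> real^'n^'n) \<Rightarrow> bool" where
  "solves_product_integral A s P \<longleftrightarrow>
     (\<forall>t\<ge>s. set_integrable lborel {s..t} (\<lambda>u. P u ** A u) \<and>
            P t = mat 1 + (LINT u:{s..t}|lborel. P u ** A u))"

definition product_integrable :: "(real \<Rightarrow> real^'n^'n) \<Rightarrow> bool" where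
  "product_integrable A \<longleftrightarrow> (\<forall>s\<ge>0. \<exists>P. solves_product_integral A s P)"

text \<open>
  If \<open>A\<close> is product integrable, then for \<open>0 \<le> s \<le> t\<close> the value at \<open>t\<close> is the same for all
  solutions started in \<open>s\<close>. Only below \<open>s\<close> is a solution unconstrained, whence the choice
  operator rather than a definite description. Local integrability of \<open>A\<close> itself is not
  required, so that lifetimes with bounded support (such as \<open>A u = -1/(1-u)\<close> for \<open>u < 1\<close>)
  are covered.
\<close>

definition product_integral :: "(real \<Rightarrow> real^'n^'n) \<Rightarrow> real \<Rightarrow> real \<Rightarrow> real^'n^'n" where
  "product_integral A s t = (SOME P. solves_product_integral A s P) t"

definition exit_rates :: "(real \<Rightarrow> real^'p^'p) \<Rightarrow> real \<Rightarrow> real^'p" where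
  "exit_rates A u = - (A u *v (\<chi> j. 1))"

definition intensity_matrix ::
  "(real \<Rightarrow> real^'p^'p) \<Rightarrow> real \<Rightarrow> real^('p option)^('p option)" where
  "intensity_matrix A u = (\<chi> i j.
     case i of None \<Rightarrow> 0
     | Some k \<Rightarrow> (case j of Some l \<Rightarrow> A u $ k $ l | None \<Rightarrow> exit_rates A u $ k))"

definition sub_intensity :: "(real \<Rightarrow> real^'p^'p) \<Rightarrow> bool" where
  "sub_intensity A \<longleftrightarrow>
     A \<in> borel_measurable (restrict_space borel {0..}) \<and>
     (\<forall>u\<ge>0. \<forall>i j. i \<noteq> j \<longrightarrow> 0 \<le> intensity_matrix A u $ i $ j)"

definition probability_vectors :: "(real^'p) set" where
  "probability_vectors = {a. (\<forall>i. 0 \<le> a $ i) \<and> (\<Sum>i\<in>UNIV. a $ i) = 1}"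


section \<open>Time-inhomogeneous Markov jump processes with an absorbing state\<close>

definition past :: "'w measure \<Rightarrow> (real \<Rightarrow> 'w \<Rightarrow> 's) \<Rightarrow> real \<Rightarrow> 'w measure" where
  "past M X s = vimage_algebra (space M) (\<lambda>\<omega>. \<lambda>u\<in>{0..s}. X u \<omega>)
                  (PiM {0..s} (\<lambda>_. count_space UNIV))"

text \<open>
  Paths are right-continuous with left limits for the discrete topology of the state space,
  i.e. piecewise constant with finitely many jumps in bounded time intervals.
\<close>

definition jump_paths :: "'w measure \<Rightarrow> (real \<Rightarrow> 'w \<Rightarrow> 's) \<Rightarrow> bool" where
  "jump_paths M X \<longleftrightarrow> (\<forall>\<omega>\<in>space M.
     (\<forall>t\<ge>0. \<forall>\<^sub>F u in at_right t. X u \<omega> = X t \<omega>) \<and>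
     (\<forall>t>0. \<exists>i. \<forall>\<^sub>F u in at_left t. X u \<omega> = i))"

definition markov_jump_process ::
  "'w measure \<Rightarrow> (real \<Rightarrow> 'w \<Rightarrow> 'p option) \<Rightarrow> real^'p \<Rightarrow> (real \<Rightarrow> real^'p^'p) \<Rightarrow> bool" where
  "markov_jump_process M X a A \<longleftrightarrow>
     prob_space M \<and>
     (\<forall>t\<ge>0. X t \<in> measurable M (count_space UNIV)) \<and>
     jump_paths M X \<and>
     (\<forall>i. measure M {\<omega>\<in>space M. X 0 \<omega> = Some i} = a $ i) \<and>
     measure M {\<omega>\<in>space M. X 0 \<omega> = None} = 0 \<and>
     (\<forall>s t j. 0 \<le> s \<and> s \<le> t \<longrightarrow>
        (AE \<omega> in M. real_cond_exp M (past M X s) (indicator {\<omega>\<in>space M. X t \<omega> = j}) \<omega>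
                   = product_integral (intensity_matrix A) s t $ X s \<omega> $ j))"

definition iid_markov_jump_processes ::
  "'w measure \<Rightarrow> nat \<Rightarrow> (nat \<Rightarrow> real \<Rightarrow> 'w \<Rightarrow> 'p option) \<Rightarrow> real^'p \<Rightarrow>
   (real \<Rightarrow> real^'p^'p) \<Rightarrow> bool" where
  "iid_markov_jump_processes M N X a A \<longleftrightarrow>
     prob_space M \<and>
     (\<forall>n\<in>{1..N}. markov_jump_process M (X n) a A) \<and>
     prob_space.indep_vars M (\<lambda>_. PiM {0..} (\<lambda>_. count_space UNIV))
       (\<lambda>n \<omega>. \<lambda>t\<in>{0..}. X n t \<omega>) {1..N}"

definition absorption_time :: "(real \<Rightarrow> 'w \<Rightarrow> 'p option) \<Rightarrow> 'w \<Rightarrow> real" where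
  "absorption_time X \<omega> = Inf {t. 0 \<le> t \<and> X t \<omega> = None}"

definition absorption_density :: "real^'p \<Rightarrow> (real \<Rightarrow> real^'p^'p) \<Rightarrow> real \<Rightarrow> real" where
  "absorption_density a A x = (a v* product_integral A 0 x) \<bullet> exit_rates A x"

definition absorption_algebra ::
  "'w measure \<Rightarrow> nat \<Rightarrow> (nat \<Rightarrow> real \<Rightarrow> 'w \<Rightarrow> 'p option) \<Rightarrow> 'w measure" where
  "absorption_algebra M N X = vimage_algebra (space M)
     (\<lambda>\<omega>. \<lambda>n\<in>{1..N}. absorption_time (X n) \<omega>) (PiM {1..N} (\<lambda>_. borel))"


section \<open>Complete-data statistics\<close>

definition occ :: "(real \<Rightarrow> 'w \<Rightarrow> 's) \<Rightarrow> 's \<Rightarrow> real \<Rightarrow> 'w \<Rightarrow> real" where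
  "occ X i s \<omega> = (if X s \<omega> = i then 1 else 0)"

definition jump_count :: "(real \<Rightarrow> 'w \<Rightarrow> 's) \<Rightarrow> 's \<Rightarrow> 's \<Rightarrow> real \<Rightarrow> 'w \<Rightarrow> real" where
  "jump_count X i j t \<omega> =
     real (card {s\<in>{0<..t}. (\<forall>\<^sub>F u in at_left s. X u \<omega> = i) \<and> X s \<omega> = j})"

definition initial_count ::
  "nat \<Rightarrow> (nat \<Rightarrow> real \<Rightarrow> 'w \<Rightarrow> 'p option) \<Rightarrow> 'p \<Rightarrow> 'w \<Rightarrow> real" where
  "initial_count N X i \<omega> = (\<Sum>n\<in>{1..N}. occ (X n) (Some i) 0 \<omega>)"

definition horizon :: "nat \<Rightarrow> (nat \<Rightarrow> real \<Rightarrow> 'w \<Rightarrow> 'p option) \<Rightarrow> 'w \<Rightarrow> real" where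
  "horizon N X \<omega> = Max ((\<lambda>n. absorption_time (X n) \<omega>) ` {1..N})"


section \<open>Extended-real integrals, conditional expectations and the log-likelihood\<close>

text \<open>
  The log-likelihood takes values in \<open>[-\<infinity>, \<infinity>)\<close>: \<open>log 0 = -\<infinity>\<close>, while \<open>0 * (-\<infinity>) = 0\<close> holds in
  \<^typ>\<open>ereal\<close>. Since \<open>\<infinity> - \<infinity> = \<infinity>\<close> there, the next two notions are meaningful only where the
  positive or the negative part is finite.
\<close>

definition elog :: "real \<Rightarrow> ereal" where
  "elog x = (if 0 < x then ereal (ln x) else -\<infinity>)"

definition set_ereal_integral :: "'a measure \<Rightarrow> 'a set \<Rightarrow> ('a \<Rightarrow> ereal) \<Rightarrow> ereal" where
  "set_ereal_integral M S f =
     enn2ereal (\<integral>\<^sup>+x\<in>S. e2ennreal (f x) \<partial>M) - enn2ereal (\<integral>\<^sup>+x\<in>S. e2ennreal (- f x) \<partial>M)"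

definition ereal_cond_exp ::
  "'w measure \<Rightarrow> 'w measure \<Rightarrow> ('w \<Rightarrow> ereal) \<Rightarrow> 'w \<Rightarrow> ereal" where
  "ereal_cond_exp M F f \<omega> =
     enn2ereal (nn_cond_exp M F (\<lambda>\<omega>. e2ennreal (f \<omega>)) \<omega>)
     - enn2ereal (nn_cond_exp M F (\<lambda>\<omega>. e2ennreal (- f \<omega>)) \<omega>)"

definition complete_loglik ::
  "nat \<Rightarrow> (nat \<Rightarrow> real \<Rightarrow> 'w \<Rightarrow> 'p option) \<Rightarrow> real^'p \<Rightarrow> (real \<Rightarrow> real^'p^'p) \<Rightarrow> 'w \<Rightarrow> ereal" where
  "complete_loglik N X a A \<omega> =
     (\<Sum>i\<in>UNIV. ereal (initial_count N X i \<omega>) * elog (a $ i))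
     + (\<Sum>i\<in>UNIV. \<Sum>j\<in>UNIV - {i}. \<Sum>n\<in>{1..N}.
          set_ereal_integral (interval_measure (\<lambda>s. jump_count (X n) i j s \<omega>))
            {0<..horizon N X \<omega>} (\<lambda>s. elog (intensity_matrix A s $ i $ j))
          - enn2ereal (\<integral>\<^sup>+s\<in>{0..horizon N X \<omega>}.
              ennreal (occ (X n) i s \<omega> * intensity_matrix A s $ i $ j) \<partial>lborel))"

text \<open>
  The conditional expectations of the terms of \<^const>\<open>complete_loglik\<close> given the absorption
  times can be added up: almost surely, either no positive part or no negative part among
  these terms has an infinite conditional expectation. (The initial terms are \<open>\<le> 0\<close>, as is
  minus the occupation integral.)
\<close>

definition loglik_cond_exp_well_defined ::
  "'w measure \<Rightarrow> nat \<Rightarrow> (nat \<Rightarrow> real \<Rightarrow> 'w \<Rightarrow> 'p option) \<Rightarrow> real^'p \<Rightarrow>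
   (real \<Rightarrow> real^'p^'p) \<Rightarrow> bool" where
  "loglik_cond_exp_well_defined M N X a A \<longleftrightarrow>
     (let E = nn_cond_exp M (absorption_algebra M N X);
          dN = (\<lambda>n i j \<omega>. interval_measure (\<lambda>s. jump_count (X n) i j s \<omega>));
          Lam = intensity_matrix A;
          H = horizon N X
      in AE \<omega> in M.
        (\<forall>n\<in>{1..N}. \<forall>i j. i \<noteq> j \<longrightarrow>
           E (\<lambda>\<omega>. \<integral>\<^sup>+s\<in>{0<..H \<omega>}. e2ennreal (elog (Lam s $ i $ j)) \<partial>dN n i j \<omega>) \<omega> < \<infinity>)
        \<or> (\<forall>i. E (\<lambda>\<omega>. e2ennreal (- (ereal (initial_count N X i \<omega>) * elog (a $ i)))) \<omega> < \<infinity>) \<and>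
          (\<forall>n\<in>{1..N}. \<forall>i j. i \<noteq> j \<longrightarrow>
             E (\<lambda>\<omega>. \<integral>\<^sup>+s\<in>{0<..H \<omega>}. e2ennreal (- elog (Lam s $ i $ j)) \<partial>dN n i j \<omega>) \<omega> < \<infinity> \<and>
             E (\<lambda>\<omega>. \<integral>\<^sup>+s\<in>{0..H \<omega>}. ennreal (occ (X n) i s \<omega> * Lam s $ i $ j) \<partial>lborel) \<omega> < \<infinity>))"


section \<open>Conditional expected statistics\<close>

definition cond_initial_count ::
  "'w measure \<Rightarrow> nat \<Rightarrow> (nat \<Rightarrow> real \<Rightarrow> 'w \<Rightarrow> 'p option) \<Rightarrow> 'p \<Rightarrow> 'w \<Rightarrow> real" where
  "cond_initial_count M N X i =
     real_cond_exp M (absorption_algebra M N X) (initial_count N X i)"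

text \<open>
  For each time, a conditional expectation is determined only up to a null set. Integrating
  over time requires choosing versions: jointly measurable ones for the occupation statistics,
  and ones with right-continuous nondecreasing paths for the jump counts, so that these paths
  generate measures.
\<close>

definition cond_occ_version ::
  "'w measure \<Rightarrow> nat \<Rightarrow> (nat \<Rightarrow> real \<Rightarrow> 'w \<Rightarrow> 'p option) \<Rightarrow>
   (nat \<Rightarrow> 'p option \<Rightarrow> real \<Rightarrow> 'w \<Rightarrow> real) \<Rightarrow> bool" where
  "cond_occ_version M N X Ibar \<longleftrightarrow> (\<forall>n\<in>{1..N}. \<forall>i.
     (\<lambda>(s, \<omega>). Ibar n i s \<omega>) \<in> borel_measurable (lborel \<Otimes>\<^sub>M M) \<and>
     (\<forall>s\<ge>0. AE \<omega> in M. Ibar n i s \<omega>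
        = real_cond_exp M (absorption_algebra M N X) (occ (X n) i s) \<omega>))"

definition cond_jump_count_version ::
  "'w measure \<Rightarrow> nat \<Rightarrow> (nat \<Rightarrow> real \<Rightarrow> 'w \<Rightarrow> 'p option) \<Rightarrow>
   (nat \<Rightarrow> 'p option \<Rightarrow> 'p option \<Rightarrow> real \<Rightarrow> 'w \<Rightarrow> real) \<Rightarrow> bool" where
  "cond_jump_count_version M N X Nbar \<longleftrightarrow> (\<forall>n\<in>{1..N}. \<forall>i j. i \<noteq> j \<longrightarrow>
     (AE \<omega> in M. mono (\<lambda>s. Nbar n i j s \<omega>) \<and>
        (\<forall>s. continuous (at_right s) (\<lambda>s. Nbar n i j s \<omega>)) \<and>
        (\<forall>s\<le>0. Nbar n i j s \<omega> = 0)) \<and>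
     (\<forall>s\<ge>0. AE \<omega> in M. Nbar n i j s \<omega>
        = real_cond_exp M (absorption_algebra M N X) (jump_count (X n) i j s) \<omega>))"

definition cond_loglik_initial ::
  "'w measure \<Rightarrow> nat \<Rightarrow> (nat \<Rightarrow> real \<Rightarrow> 'w \<Rightarrow> 'p option) \<Rightarrow> real^'p \<Rightarrow> 'w \<Rightarrow> ereal" where
  "cond_loglik_initial M N X a \<omega> =
     (\<Sum>i\<in>UNIV. ereal (cond_initial_count M N X i \<omega>) * elog (a $ i))"

definition cond_loglik_jump ::
  "nat \<Rightarrow> (nat \<Rightarrow> real \<Rightarrow> 'w \<Rightarrow> 'p option) \<Rightarrow>
   (nat \<Rightarrow> 'p option \<Rightarrow> real \<Rightarrow> 'w \<Rightarrow> real) \<Rightarrow>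
   (nat \<Rightarrow> 'p option \<Rightarrow> 'p option \<Rightarrow> real \<Rightarrow> 'w \<Rightarrow> real) \<Rightarrow>
   (real \<Rightarrow> real^'p^'p) \<Rightarrow> 'p option \<Rightarrow> 'p option \<Rightarrow> 'w \<Rightarrow> ereal" where
  "cond_loglik_jump N X Ibar Nbar A i j \<omega> = (\<Sum>n\<in>{1..N}.
     set_ereal_integral (interval_measure (\<lambda>s. Nbar n i j s \<omega>))
       {0<..absorption_time (X n) \<omega>} (\<lambda>s. elog (intensity_matrix A s $ i $ j))
     - enn2ereal (\<integral>\<^sup>+s\<in>{0..absorption_time (X n) \<omega>}.
         ennreal (Ibar n i s \<omega> * intensity_matrix A s $ i $ j) \<partial>lborel))"

end

theory Submission
  imports Defs
begin

text \<open>
  Throughout, expectations are taken under the current parameter value. The argument has three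
  layers.

  One process. Adding the absorbing state to the product integral of the sub-intensities gives
  the product integral of the full intensity matrix (\<open>product_integral_intensity_matrix\<close>), whose
  defining integral equation is the forward equation for the transition probabilities. Read off
  at the absorbing state, it says that \<open>P(X s = i, tau \<le> v)\<close> is the integral over \<open>[s, v]\<close> of
  \<open>pi P(0,s) e_i e_i' P(s,w) t(w)\<close>. Summing over \<open>i\<close> at \<open>s = 0\<close> shows that \<open>tau\<close> has density \<open>f\<close>,
  and dividing by \<open>f\<close> is Bayes' formula for \<open>P(X s = i | tau = w)\<close>; this is the content of
  \<open>occupation_and_absorption\<close>. For the jumps, the expected number of jumps from \<open>i\<close> to \<open>j\<close> on the
  event \<open>X v = k\<close> is obtained by counting pairs of states at neighbouring points of a grid: by the
  Markov property the expected count is an integral of step functions, and it converges to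
  \<open>\<integral> P(X u = i) \<mu>_ij(u) P(X v = k | X u = j) du\<close> by dominated convergence
  (\<open>expected_jumps_local\<close>). With \<open>k\<close> the absorbing state and Fubini's theorem, this becomes an
  integral against the density of \<open>tau\<close> of the kernel displayed in the theorem
  (\<open>jumps_and_absorption\<close>): it has a Lebesgue density for jumps between transient states, while the
  jump into the absorbing state happens exactly at \<open>tau\<close>.

  Two features of the hypotheses shape this layer. Existence of the product integral makes the
  intensities integrable only on short intervals to the right of each time
  (\<open>product_integrable_imp_locally_integrable_right\<close>), so that they may fail to be integrable towards a
  finite time, and expected jump counts may be infinite. All statements about jumps are therefore
  first proved on such short intervals and then propagated along the time axis by
  \<open>right_induct\<close>; at the limit times, the absence of jumps at fixed times (\<open>no_fixed_jump\<close>) closes the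
  gap. Moreover, conditional probabilities given \<open>X u = j\<close> make no sense at times when \<open>X u = j\<close> has
  probability zero. At almost all such times there is no probability flux into \<open>j\<close> either
  (\<open>AE_no_influx_to_null_state\<close>), so these times do not contribute.

  Several processes. By independence, conditioning a functional of the \<open>n\<close>-th path on all absorption
  times is the same as conditioning on its own one (\<open>is_cond_exp_path_functional\<close>). This turns the
  identities for one process into conditional expectations of occupation indicators and of jump
  counts (\<open>is_cond_exp_jumps\<close>), and a monotone class argument extends the latter to integrals with
  respect to the random measures generated by the jump counts (\<open>is_cond_exp_random_measure\<close>). Any
  version of the conditional statistics agrees with the explicit one in the sense needed for
  integration over time (\<open>interval_measure_version\<close>, \<open>occ_integral_version\<close>).

  The log-likelihood. It is a difference \<open>U - V\<close> of nonnegative functions, \<open>U\<close> consisting of the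
  integrals of the positive parts of the logarithms and \<open>V\<close> of everything else, and \<open>U\<close> is finite
  on every path. Conditional expectations of \<open>U\<close> and \<open>V\<close> are known from the preceding layer, and
  conditioning commutes with the subtraction wherever one of the two conditional expectations is
  finite (\<open>cond_exp_loglik\<close>).
\<close>

section \<open>Induction along a half-line\<close>

text \<open>
  Real induction: the infimum of the counterexamples can neither satisfy \<open>Q\<close>, by \<open>right\<close>, nor fail
  it, by \<open>base\<close> and \<open>left\<close>.
\<close>

lemma right_induct [consumes 1, case_names base right left]:
  fixes a t :: real
  assumes "a \<le> t" and base: "Q a"
    and right: "\<And>s. a \<le> s \<Longrightarrow> Q s \<Longrightarrow> \<exists>e>0. \<forall>u\<in>{s..s+e}. Q u"
    and left: "\<And>s. a < s \<Longrightarrow> (\<And>u. a \<le> u \<Longrightarrow> u < s \<Longrightarrow> Q u) \<Longrightarrow> Q s"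
  shows "Q t"
proof (rule ccontr)
  assume "\<not> Q t"
  define B where "B = {u. a \<le> u \<and> \<not> Q u}"
  have ne: "B \<noteq> {}" and bd: "bdd_below B"
    using \<open>a \<le> t\<close> \<open>\<not> Q t\<close> by (auto simp: B_def intro: bdd_belowI)
  define s where "s = Inf B"
  have as: "a \<le> s"
    unfolding s_def using ne by (rule cInf_greatest) (auto simp: B_def)
  have before: "Q u" if "a \<le> u" "u < s" for u
    using that cInf_lower[OF _ bd, of u] unfolding s_def B_def by force
  have "Q s"
    using base left[of s] before as by (cases "s = a") auto
  then obtain e where "e > 0" and e: "\<And>u. u \<in> {s..s+e} \<Longrightarrow> Q u"
    using right[OF as] by blast
  have "s + e \<le> Inf B"
  proof (rule cInf_greatest[OF ne])
    fix u assume u: "u \<in> B"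
    then have "a \<le> u" "\<not> Q u" by (auto simp: B_def)
    then show "s + e \<le> u"
      using before[of u] e[of u] by (cases "u < s"; cases "u \<le> s + e") (auto simp: not_le)
  qed
  then show False
    using \<open>e > 0\<close> by (simp add: s_def)
qed

section \<open>Product integrals\<close>

lemma sum_UNIV_option:
  fixes h :: "'a::finite option \<Rightarrow> 'b::comm_monoid_add"
  shows "(\<Sum>x\<in>UNIV. h x) = h None + (\<Sum>i\<in>UNIV. h (Some i))"
  by (simp add: UNIV_option_conv sum.reindex)

lemma bounded_linear_matrix_component:
  "bounded_linear (\<lambda>M::real^'m^'n. M $ i $ j)"
  by (intro bounded_linear_compose[OF bounded_linear_vec_nth bounded_linear_vec_nth])

lemma matrix_eq_sum_components:
  fixes M :: "real^'m^'n"
  shows "M = (\<Sum>i\<in>UNIV. \<Sum>j\<in>UNIV. (M $ i $ j) *\<^sub>R axis i (axis j 1))"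
proof -
  have [simp]: "(\<Sum>y\<in>UNIV. if b then g y else (0::real)) = (if b then (\<Sum>y\<in>UNIV. g y) else 0)"
    for b and g :: "'m \<Rightarrow> real" by auto
  show ?thesis
    by (simp add: vec_eq_iff axis_def if_distrib[where f="\<lambda>x. _ * x"] if_distrib[where f="\<lambda>v. v $ _"] cong: if_cong)
qed

lemma set_integrable_matrixI:
  fixes H :: "real \<Rightarrow> real^'m^'n"
  assumes "\<And>i j. set_integrable M S (\<lambda>u. H u $ i $ j)"
  shows "set_integrable M S H"
proof -
  have "set_integrable M S (\<lambda>u. \<Sum>i\<in>UNIV. \<Sum>j\<in>UNIV. (H u $ i $ j) *\<^sub>R axis i (axis j (1::real)))"
    unfolding set_integrable_def scaleR_sum_right scaleR_scaleR[of "indicator _ _"]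
    by (intro Bochner_Integration.integrable_sum integrable_scaleR_left)
       (use assms in \<open>simp add: set_integrable_def\<close>)
  then show ?thesis
    by (subst (asm) matrix_eq_sum_components[symmetric])
qed

lemma set_integral_matrix_component:
  fixes H :: "real \<Rightarrow> real^'m^'n"
  assumes "set_integrable M S H"
  shows "set_integrable M S (\<lambda>u. H u $ i $ j)"
    and "(LINT u:S|M. H u) $ i $ j = (LINT u:S|M. H u $ i $ j)"
  using integrable_bounded_linear[OF bounded_linear_matrix_component assms[unfolded set_integrable_def], of i j]
    integral_bounded_linear[OF bounded_linear_matrix_component assms[unfolded set_integrable_def], of i j]
  by (simp_all add: set_integrable_def set_lebesgue_integral_def)

text \<open>
  The Lebesgue integral of matrix-valued functions is only used through its entries from here on.
\<close>

lemma solves_product_integral_iff_components: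
  fixes A P :: "real \<Rightarrow> real^'n^'n"
  shows "solves_product_integral A s P \<longleftrightarrow>
    (\<forall>t\<ge>s. \<forall>i j. set_integrable lborel {s..t} (\<lambda>u. \<Sum>k\<in>UNIV. P u $ i $ k * A u $ k $ j) \<and>
      P t $ i $ j = of_bool (i = j) + (LINT u:{s..t}|lborel. \<Sum>k\<in>UNIV. P u $ i $ k * A u $ k $ j))"
    (is "_ \<longleftrightarrow> ?R")
proof
  assume S: "solves_product_integral A s P"
  show ?R
  proof (intro allI impI)
    fix t i j assume "s \<le> t"
    with S have I: "set_integrable lborel {s..t} (\<lambda>u. P u ** A u)"
      and E: "P t = mat 1 + (LINT u:{s..t}|lborel. P u ** A u)"
      by (auto simp: solves_product_integral_def)
    show "set_integrable lborel {s..t} (\<lambda>u. \<Sum>k\<in>UNIV. P u $ i $ k * A u $ k $ j) \<and>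
      P t $ i $ j = of_bool (i = j) + (LINT u:{s..t}|lborel. \<Sum>k\<in>UNIV. P u $ i $ k * A u $ k $ j)"
      using set_integral_matrix_component[OF I, of i j] arg_cong[OF E, of "\<lambda>M. M $ i $ j"]
      by (simp add: matrix_matrix_mult_def mat_def)
  qed
next
  assume R: ?R
  show "solves_product_integral A s P"
    unfolding solves_product_integral_def
  proof (intro allI impI)
    fix t assume t: "s \<le> t"
    have I: "set_integrable lborel {s..t} (\<lambda>u. P u ** A u)"
      using R t by (intro set_integrable_matrixI) (simp add: matrix_matrix_mult_def)
    have "P t $ i $ j = (mat 1 + (LINT u:{s..t}|lborel. P u ** A u)) $ i $ j" for i j
      using R t set_integral_matrix_component(2)[OF I, of i j]
      by (simp add: matrix_matrix_mult_def mat_def)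
    with I show "set_integrable lborel {s..t} (\<lambda>u. P u ** A u) \<and>
      P t = mat 1 + (LINT u:{s..t}|lborel. P u ** A u)"
      by (simp add: vec_eq_iff)
  qed
qed

lemma set_integral_sum:
  fixes g :: "'i \<Rightarrow> 'a \<Rightarrow> real"
  assumes "\<And>i. i \<in> I \<Longrightarrow> set_integrable M S (g i)"
  shows "set_integrable M S (\<lambda>u. \<Sum>i\<in>I. g i u)"
    and "(LINT u:S|M. \<Sum>i\<in>I. g i u) = (\<Sum>i\<in>I. LINT u:S|M. g i u)"
  using assms unfolding set_integrable_def set_lebesgue_integral_def scaleR_sum_right
  by (auto intro!: Bochner_Integration.integrable_sum Bochner_Integration.integral_sum)

lemma set_integral_singleton: "(LINT u:{s}|lborel. g u) = (0::real)"
  unfolding set_lebesgue_integral_def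
  by (rule integral_eq_zero_AE) (use AE_lborel_singleton[of s] in eventually_elim, auto)

lemma continuous_on_indefinite_set_integral:
  fixes g :: "real \<Rightarrow> real"
  assumes "set_integrable lborel {s..b} g"
  shows "continuous_on {s..b} (\<lambda>t. LINT u:{s..t}|lborel. g u)"
proof -
  have "(LINT u:{s..t}|lborel. g u) = integral {s..t} g" if "t \<in> {s..b}" for t
    using that by (intro set_borel_integral_eq_integral set_integrable_subset[OF assms]) auto
  moreover have "continuous_on {s..b} (\<lambda>t. integral {s..t} g)"
    by (intro indefinite_integral_continuous_1 set_borel_integral_eq_integral(1) assms)
  ultimately show ?thesis
    by (subst continuous_on_cong[OF refl]) auto
qed

lemma set_integral_nonneg:
  "(\<And>u. u \<in> S \<Longrightarrow> 0 \<le> g u) \<Longrightarrow> 0 \<le> (LINT u:S|M. (g u :: real))"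
  unfolding set_lebesgue_integral_def by (intro integral_nonneg_AE AE_I2) (auto simp: indicator_def)

lemma set_integral_split:
  fixes g :: "real \<Rightarrow> real"
  assumes "set_integrable lborel {s..t} g" "s \<le> r" "r \<le> t"
  shows "(LINT u:{s..t}|lborel. g u) = (LINT u:{s..r}|lborel. g u) + (LINT u:{r..t}|lborel. g u)"
proof -
  have 1: "set_integrable lborel {s..r} g" "set_integrable lborel {r..t} g"
    using assms by (auto intro!: set_integrable_subset[OF assms(1)])
  have "integral {s..r} g + integral {r..t} g = integral {s..t} g"
    using assms by (intro Henstock_Kurzweil_Integration.integral_combine set_borel_integral_eq_integral(1))
  with 1 assms(1) show ?thesis
    by (simp add: set_borel_integral_eq_integral(2))
qed

lemma continuous_on_solution:
  assumes "solves_product_integral A s P"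
  shows "continuous_on {s..b} (\<lambda>t. P t $ i $ j)"
proof (cases "s \<le> b")
  case True
  then have "continuous_on {s..b} (\<lambda>t. of_bool (i = j) +
      (LINT u:{s..t}|lborel. \<Sum>k\<in>UNIV. P u $ i $ k * A u $ k $ j))"
    using assms unfolding solves_product_integral_iff_components
    by (intro continuous_intros continuous_on_indefinite_set_integral) auto
  then show ?thesis
    using assms unfolding solves_product_integral_iff_components
    by (subst continuous_on_cong) auto
qed auto

text \<open>
  Integrability is asked for only to the right of each time: the intensities may have a
  non-integrable singularity on the left of a time, such as the end of a bounded lifetime.
\<close>

definition locally_integrable_right :: "(real \<Rightarrow> real^'m^'n) \<Rightarrow> bool" where
  "locally_integrable_right A \<longleftrightarrow>
     (\<forall>s\<ge>0. \<exists>e>0. \<forall>i j. set_integrable lborel {s..s+e} (\<lambda>u. A u $ i $ j))"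

text \<open>
  A solution \<open>P\<close> started in \<open>s\<close> stays close to the identity matrix for a short while. There \<open>A\<close> can
  be recovered from the integrable function \<open>P A\<close>: the absolute entries of \<open>A - P A\<close> add up to at most
  half of those of \<open>A\<close>, so those of \<open>A\<close> add up to at most twice those of \<open>P A\<close>.
\<close>

lemma product_integrable_imp_locally_integrable_right:
  fixes A :: "real \<Rightarrow> real^'n^'n"
  assumes prod: "product_integrable A"
    and meas: "A \<in> borel_measurable (restrict_space borel {0..})"
  shows "locally_integrable_right A"
  unfolding locally_integrable_right_def
proof (intro allI impI)
  fix s :: real assume s: "0 \<le> s"
  from prod s obtain P where P: "solves_product_integral A s P"
    by (auto simp: product_integrable_def)
  \<comment> \<open>If all entries of \<open>P u\<close> differ from those of the identity by at most
      \<open>c\<close>, the error made in replacing \<open>A\<close> by \<open>P A\<close> sums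
      up to at most \<open>n c = 1/2\<close> times the size of \<open>A\<close>.\<close>
  define c :: real where "c = 1 / (2 * real CARD('n))"
  have c: "0 < c" by (simp add: c_def)
  have "\<forall>i j. \<exists>d>0. \<forall>u\<in>{s..s+1}. dist u s < d \<longrightarrow> dist (P u $ i $ j) (P s $ i $ j) < c"
    using continuous_on_solution[OF P, of "s+1"] c
    unfolding continuous_on_iff by (metis atLeastAtMost_iff less_add_one order_refl less_eq_real_def)
  then obtain d where d: "\<And>i j. d i j > 0"
    "\<And>i j u. u \<in> {s..s+1} \<Longrightarrow> dist u s < d i j \<Longrightarrow> dist (P u $ i $ j) (P s $ i $ j) < c"
    by metis
  define e where "e = min 1 (Min (range (\<lambda>(i,j). d i j)) / 2)"
  have "Min (range (\<lambda>(i,j). d i j)) > 0"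
    using d(1) by (auto simp: Min_gr_iff)
  then have e: "e > 0" "e \<le> 1" and e_less: "\<And>i j. e < d i j"
  proof -
    assume m: "Min (range (\<lambda>(i,j). d i j)) > 0"
    show "e > 0" "e \<le> 1" using m by (auto simp: e_def)
    fix i j
    have "Min (range (\<lambda>(i,j). d i j)) \<le> d i j"
      by (rule Min_le) (auto intro: image_eqI[of _ _ "(i,j)"])
    moreover have "e \<le> Min (range (\<lambda>(i,j). d i j)) / 2"
      unfolding e_def by (rule min.cobounded2)
    ultimately show "e < d i j" using m d(1)[of i j] by linarith
  qed
  have Ps: "P s $ i $ j = of_bool (i = j)" for i j
  proof -
    show ?thesis
      using P unfolding solves_product_integral_iff_components by (force simp: set_integral_singleton)
  qed
  have near: "\<bar>of_bool (i = j) - P u $ i $ j\<bar> \<le> c" if "u \<in> {s..s+e}" for u i j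
    using d(2)[of u i j] that e e_less[of i j] by (auto simp: dist_real_def Ps)
  define PA where "PA u i j = (\<Sum>k\<in>UNIV. P u $ i $ k * A u $ k $ j)" for u i j
  have PA: "set_integrable lborel {s..s+e} (\<lambda>u. PA u i j)" for i j
    using P e unfolding solves_product_integral_iff_components PA_def by auto
  have bound: "(\<Sum>i\<in>UNIV. \<Sum>j\<in>UNIV. \<bar>A u $ i $ j\<bar>) \<le> 2 * (\<Sum>i\<in>UNIV. \<Sum>j\<in>UNIV. \<bar>PA u i j\<bar>)"
    if u: "u \<in> {s..s+e}" for u
  proof -
    have "\<bar>A u $ i $ j\<bar> \<le> \<bar>PA u i j\<bar> + c * (\<Sum>k\<in>UNIV. \<bar>A u $ k $ j\<bar>)" for i j
    proof -
      have "A u $ i $ j = PA u i j + (\<Sum>k\<in>UNIV. (of_bool (i = k) - P u $ i $ k) * A u $ k $ j)"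
        by (simp add: PA_def left_diff_distrib sum_subtractf of_bool_def if_distrib[where f="\<lambda>x. x * _"] cong: if_cong)
      also have "\<bar>\<dots>\<bar> \<le> \<bar>PA u i j\<bar> + (\<Sum>k\<in>UNIV. \<bar>(of_bool (i = k) - P u $ i $ k) * A u $ k $ j\<bar>)"
        by (rule order_trans[OF abs_triangle_ineq]) (intro add_left_mono sum_abs)
      also have "(\<Sum>k\<in>UNIV. \<bar>(of_bool (i = k) - P u $ i $ k) * A u $ k $ j\<bar>) \<le> (\<Sum>k\<in>UNIV. c * \<bar>A u $ k $ j\<bar>)"
        unfolding abs_mult by (intro sum_mono mult_right_mono near u) auto
      finally show ?thesis by (simp add: sum_distrib_left)
    qed
    then have "(\<Sum>i\<in>UNIV. \<Sum>j\<in>UNIV. \<bar>A u $ i $ j\<bar>)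
        \<le> (\<Sum>i\<in>UNIV. \<Sum>j\<in>UNIV. \<bar>PA u i j\<bar> + c * (\<Sum>k\<in>UNIV. \<bar>A u $ k $ j\<bar>))"
      by (intro sum_mono)
    also have "\<dots> = (\<Sum>i\<in>UNIV. \<Sum>j\<in>UNIV. \<bar>PA u i j\<bar>)
        + real CARD('n) * c * (\<Sum>j\<in>UNIV. \<Sum>k\<in>UNIV. \<bar>A u $ k $ j\<bar>)"
      by (simp add: sum.distrib sum_distrib_left mult.assoc)
    also have "(\<Sum>j\<in>UNIV. \<Sum>k\<in>UNIV. \<bar>A u $ k $ j\<bar>) = (\<Sum>i\<in>UNIV. \<Sum>j\<in>UNIV. \<bar>A u $ i $ j\<bar>)"
      by (rule sum.swap)
    also have "real CARD('n) * c = 1/2" by (simp add: c_def)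
    finally show ?thesis by simp
  qed
  have "set_integrable lborel {s..s+e} (\<lambda>u. A u $ i $ j)" for i j
  proof -
    have m: "(\<lambda>u. indicator {s..s+e} u *\<^sub>R A u $ i $ j) \<in> borel_measurable lborel"
    proof -
      have "A \<in> borel_measurable (restrict_space borel {s..s+e})"
        using measurable_restrict_mono[OF meas, of "{s..s+e}"] s by auto
      moreover have "(\<lambda>M::real^'n^'n. M $ i $ j) \<in> borel_measurable borel"
        by (intro borel_measurable_continuous_onI continuous_intros)
      ultimately have "(\<lambda>u. A u $ i $ j) \<in> borel_measurable (restrict_space borel {s..s+e})"
        by (rule measurable_compose)
      then show ?thesis
        by (subst (asm) borel_measurable_restrict_space_iff) auto
    qed
    have "set_integrable lborel {s..s+e} (\<lambda>u. 2 * (\<Sum>i\<in>UNIV. \<Sum>j\<in>UNIV. \<bar>PA u i j\<bar>))"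
      by (intro set_integrable_mult_right set_integrable_abs PA set_integral_sum(1))
    then show ?thesis
      unfolding set_integrable_def
    proof (rule Bochner_Integration.integrable_bound[OF _ m])
      show "AE u in lborel. norm (indicator {s..s+e} u *\<^sub>R A u $ i $ j)
        \<le> norm (indicator {s..s+e} u *\<^sub>R (2 * (\<Sum>i\<in>UNIV. \<Sum>j\<in>UNIV. \<bar>PA u i j\<bar>)))"
      proof (rule AE_I2)
        fix u
        have "\<bar>A u $ i $ j\<bar> \<le> (\<Sum>i\<in>UNIV. \<Sum>j\<in>UNIV. \<bar>A u $ i $ j\<bar>)"
          by (rule order_trans[OF member_le_sum[of j UNIV "\<lambda>j. \<bar>A u $ i $ j\<bar>"]])
             (auto intro!: member_le_sum[of i UNIV "\<lambda>i. \<Sum>j\<in>UNIV. \<bar>A u $ i $ j\<bar>"] sum_nonneg)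
        then show "norm (indicator {s..s+e} u *\<^sub>R A u $ i $ j)
          \<le> norm (indicator {s..s+e} u *\<^sub>R (2 * (\<Sum>i\<in>UNIV. \<Sum>j\<in>UNIV. \<bar>PA u i j\<bar>)))"
          using bound[of u] by (auto simp: indicator_def)
      qed
    qed
  qed
  with e(1) show "\<exists>e>0. \<forall>i j. set_integrable lborel {s..s+e} (\<lambda>u. A u $ i $ j)" by blast
qed

lemma ex_small_set_integral:
  fixes g :: "real \<Rightarrow> real"
  assumes "set_integrable lborel {s..s+e} g" "0 < e" "0 < c"
  obtains d where "0 < d" "d \<le> e" "(LINT u:{s..s+d}|lborel. g u) < c"
proof -
  have "continuous_on {s..s+e} (\<lambda>t. LINT u:{s..t}|lborel. g u)"
    by (rule continuous_on_indefinite_set_integral[OF assms(1)])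
  moreover have "(LINT u:{s..s}|lborel. g u) = 0"
    by (simp add: set_integral_singleton)
  ultimately obtain d where d: "d > 0"
    "\<And>t. t \<in> {s..s+e} \<Longrightarrow> dist t s < d \<Longrightarrow> \<bar>LINT u:{s..t}|lborel. g u\<bar> < c"
    using assms(2,3) unfolding continuous_on_iff dist_real_def
    by (metis atLeastAtMost_iff diff_zero less_add_same_cancel1 less_eq_real_def)
  define d' where "d' = min e (d/2)"
  have "\<bar>LINT u:{s..s+d'}|lborel. g u\<bar> < c"
    using d(1) assms(2) by (intro d(2)) (auto simp: d'_def dist_real_def)
  then show ?thesis
    using d(1) assms(2) by (intro that[of d']) (auto simp: d'_def)
qed

lemma abs_set_integral_le:
  fixes g h :: "real \<Rightarrow> real"
  assumes "set_integrable M S g" "set_integrable M S h" "\<And>u. u \<in> S \<Longrightarrow> \<bar>g u\<bar> \<le> h u"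
  shows "\<bar>LINT u:S|M. g u\<bar> \<le> (LINT u:S|M. h u)"
proof -
  have "norm (LINT u:S|M. g u) \<le> (LINT u:S|M. h u)"
    using assms(3) unfolding set_lebesgue_integral_def
    by (intro Bochner_Integration.integral_norm_bound_integral assms(1,2)[unfolded set_integrable_def])
       (auto simp: indicator_def)
  then show ?thesis by simp
qed

lemma solution_increment:
  assumes "solves_product_integral A s P" "s \<le> r" "r \<le> t"
  shows "set_integrable lborel {r..t} (\<lambda>u. \<Sum>k\<in>UNIV. P u $ i $ k * A u $ k $ j)"
    and "P t $ i $ j = P r $ i $ j + (LINT u:{r..t}|lborel. \<Sum>k\<in>UNIV. P u $ i $ k * A u $ k $ j)"
proof -
  have I: "set_integrable lborel {s..t} (\<lambda>u. \<Sum>k\<in>UNIV. P u $ i $ k * A u $ k $ j)"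
    using assms unfolding solves_product_integral_iff_components by auto
  show "set_integrable lborel {r..t} (\<lambda>u. \<Sum>k\<in>UNIV. P u $ i $ k * A u $ k $ j)"
    using assms by (intro set_integrable_subset[OF I]) auto
  show "P t $ i $ j = P r $ i $ j + (LINT u:{r..t}|lborel. \<Sum>k\<in>UNIV. P u $ i $ k * A u $ k $ j)"
    using assms set_integral_split[OF I, of r] unfolding solves_product_integral_iff_components by auto
qed

text \<open>
  Gronwall's argument on a short interval where \<open>A\<close> has integral less than one: the maximum of
  the difference of two solutions is at most a fraction of itself. \<open>right_induct\<close> extends the
  equality to all times, the limit steps being continuity.
\<close>

lemma solves_product_integral_unique:
  fixes A P Q :: "real \<Rightarrow> real^'n^'n"
  assumes A: "locally_integrable_right A" and s: "0 \<le> s"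
    and P: "solves_product_integral A s P" and Q: "solves_product_integral A s Q"
    and t: "s \<le> t"
  shows "P t = Q t"
  using t
proof (induction rule: right_induct)
  case base
  show ?case
    using P Q unfolding solves_product_integral_iff_components
    by (simp add: vec_eq_iff set_integral_singleton)
next
  case (right r)
  define D where "D u i j = P u $ i $ j - Q u $ i $ j" for u i j
  from A right s obtain e where e: "e > 0"
    and Ai: "\<And>i j. set_integrable lborel {r..r+e} (\<lambda>u. A u $ i $ j)"
    unfolding locally_integrable_right_def by (meson order_trans)
  define a where "a u = (\<Sum>k\<in>UNIV. \<Sum>j\<in>UNIV. \<bar>A u $ k $ j\<bar>)" for u
  have a: "set_integrable lborel {r..r+e} a"
    unfolding a_def by (intro set_integral_sum(1) set_integrable_abs Ai)
  then obtain d where d: "0 < d" "d \<le> e" "(LINT u:{r..r+d}|lborel. a u) < 1"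
    using ex_small_set_integral[OF a e, of 1] by auto
  define m where "m u = (\<Sum>i\<in>UNIV. \<Sum>k\<in>UNIV. \<bar>D u i k\<bar>)" for u
  have Dc: "continuous_on {r..r+d} (\<lambda>u. D u i j)" for i j
    unfolding D_def using right
    by (intro continuous_intros continuous_on_subset[OF continuous_on_solution[OF P, of "r+d"]]
        continuous_on_subset[OF continuous_on_solution[OF Q, of "r+d"]]) auto
  then have "continuous_on {r..r+d} m"
    unfolding m_def by (intro continuous_intros)
  \<comment> \<open>The maximum \<open>m v\<close> satisfies \<open>m v \<le> m v * (\<integral> a)\<close>
      with \<open>\<integral> a < 1\<close>, so it vanishes.\<close>
  then obtain v where v: "v \<in> {r..r+d}" and vmax: "\<And>u. u \<in> {r..r+d} \<Longrightarrow> m u \<le> m v"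
    using continuous_attains_sup[of "{r..r+d}" m] d by auto
  have m0: "0 \<le> m u" for u unfolding m_def by (intro sum_nonneg) auto
  have a0: "0 \<le> a u" for u unfolding a_def by (intro sum_nonneg) auto
  have DA: "set_integrable lborel {r..v} (\<lambda>u. \<Sum>k\<in>UNIV. D u i k * A u $ k $ j)"
    "D v i j = (LINT u:{r..v}|lborel. \<Sum>k\<in>UNIV. D u i k * A u $ k $ j)" for i j
  proof -
    have eq: "(\<Sum>k\<in>UNIV. D u i k * A u $ k $ j)
      = (\<Sum>k\<in>UNIV. P u $ i $ k * A u $ k $ j) - (\<Sum>k\<in>UNIV. Q u $ i $ k * A u $ k $ j)" for u
      by (simp add: D_def left_diff_distrib sum_subtractf)
    note iP = solution_increment[OF P, of r v i j] and iQ = solution_increment[OF Q, of r v i j]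
    show "set_integrable lborel {r..v} (\<lambda>u. \<Sum>k\<in>UNIV. D u i k * A u $ k $ j)"
      unfolding eq using right v iP iQ by (intro set_integral_diff) auto
    show "D v i j = (LINT u:{r..v}|lborel. \<Sum>k\<in>UNIV. D u i k * A u $ k $ j)"
      unfolding eq using right v iP iQ by (subst set_integral_diff) (auto simp: D_def)
  qed
  have am: "set_integrable lborel {r..v} (\<lambda>u. m v * a u)"
    using v d by (intro set_integrable_mult_right set_integrable_subset[OF a]) auto
  have "m v \<le> (\<Sum>i\<in>UNIV. \<Sum>j\<in>UNIV. LINT u:{r..v}|lborel. \<bar>\<Sum>k\<in>UNIV. D u i k * A u $ k $ j\<bar>)"
    unfolding m_def DA(2)
    by (intro sum_mono abs_set_integral_le set_integrable_abs DA(1)) auto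
  also have "\<dots> = (LINT u:{r..v}|lborel. \<Sum>i\<in>UNIV. \<Sum>j\<in>UNIV. \<bar>\<Sum>k\<in>UNIV. D u i k * A u $ k $ j\<bar>)"
    by (subst set_integral_sum(2), intro set_integral_sum(1) set_integrable_abs DA(1))
      (intro sum.cong refl set_integral_sum(2)[symmetric] set_integrable_abs DA(1))
  also have "\<dots> \<le> (LINT u:{r..v}|lborel. m v * a u)"
  proof (rule set_integral_mono)
    show "set_integrable lborel {r..v} (\<lambda>u. \<Sum>i\<in>UNIV. \<Sum>j\<in>UNIV. \<bar>\<Sum>k\<in>UNIV. D u i k * A u $ k $ j\<bar>)"
      by (intro set_integral_sum(1) set_integrable_abs DA(1))
    show "set_integrable lborel {r..v} (\<lambda>u. m v * a u)" by (rule am)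
    fix u assume u: "u \<in> {r..v}"
    have "\<bar>\<Sum>k\<in>UNIV. D u i k * A u $ k $ j\<bar> \<le> (\<Sum>k\<in>UNIV. \<bar>D u i k\<bar> * \<bar>A u $ k $ j\<bar>)" for i j
      by (rule order_trans[OF sum_abs]) (simp add: abs_mult)
    then have "(\<Sum>i\<in>UNIV. \<Sum>j\<in>UNIV. \<bar>\<Sum>k\<in>UNIV. D u i k * A u $ k $ j\<bar>)
        \<le> (\<Sum>i\<in>UNIV. \<Sum>j\<in>UNIV. \<Sum>k\<in>UNIV. \<bar>D u i k\<bar> * \<bar>A u $ k $ j\<bar>)"
      by (intro sum_mono)
    also have "\<dots> = (\<Sum>i\<in>UNIV. \<Sum>k\<in>UNIV. \<bar>D u i k\<bar> * (\<Sum>j\<in>UNIV. \<bar>A u $ k $ j\<bar>))"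
      by (subst sum.swap) (simp add: sum_distrib_left)
    also have "\<dots> \<le> (\<Sum>i\<in>UNIV. \<Sum>k\<in>UNIV. \<bar>D u i k\<bar> * a u)"
      unfolding a_def by (intro sum_mono mult_left_mono member_le_sum) (auto intro: sum_nonneg)
    also have "\<dots> = m u * a u"
      by (simp add: m_def sum_distrib_right)
    also have "\<dots> \<le> m v * a u"
      using u v by (intro mult_right_mono vmax a0) auto
    finally show "(\<Sum>i\<in>UNIV. \<Sum>j\<in>UNIV. \<bar>\<Sum>k\<in>UNIV. D u i k * A u $ k $ j\<bar>) \<le> m v * a u" .
  qed
  also have "\<dots> = m v * (LINT u:{r..v}|lborel. a u)" by simp
  also have "\<dots> \<le> m v * (LINT u:{r..r+d}|lborel. a u)"
  proof (intro mult_left_mono m0)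
    show "(LINT u:{r..v}|lborel. a u) \<le> (LINT u:{r..r+d}|lborel. a u)"
    proof -
      have "set_integrable lborel {r..r+d} a"
        using d by (intro set_integrable_subset[OF a]) auto
      from set_integral_split[OF this, of v] v a0 show ?thesis
        by (simp add: set_integral_nonneg)
    qed
  qed
  finally have "m v * (1 - (LINT u:{r..r+d}|lborel. a u)) \<le> 0"
    by (simp add: algebra_simps)
  then have "m v \<le> 0" using d(3) by (simp add: mult_le_0_iff)
  then have m_zero: "m u = 0" if "u \<in> {r..r+d}" for u
    using vmax[OF that] m0[of u] by simp
  have "P u = Q u" if "u \<in> {r..r+d}" for u
  proof -
    have "D u i j = 0" for i j
      using m_zero[OF that] by (simp add: m_def sum_nonneg_eq_0_iff sum_nonneg)
    then show ?thesis by (simp add: D_def vec_eq_iff)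
  qed
  then show ?case using d(1) by blast
next
  case (left r)
  have "P r $ i $ j = Q r $ i $ j" for i j
  proof -
    have "((\<lambda>u. P u $ i $ j) \<longlongrightarrow> P r $ i $ j) (at_left r)"
      using left(1) by (rule continuous_on_Icc_at_leftD[OF continuous_on_solution[OF P]])
    moreover have "((\<lambda>u. Q u $ i $ j) \<longlongrightarrow> Q r $ i $ j) (at_left r)"
      using left(1) by (rule continuous_on_Icc_at_leftD[OF continuous_on_solution[OF Q]])
    moreover have "\<forall>\<^sub>F u in at_left r. P u $ i $ j = Q u $ i $ j"
      using eventually_at_left_real[OF left(1)]
      by eventually_elim (use left(2) in auto)
    ultimately show ?thesis
      using tendsto_cong[of "\<lambda>u. P u $ i $ j" "\<lambda>u. Q u $ i $ j" "at_left r"]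
      by (auto intro: tendsto_unique[OF trivial_limit_at_left_real])
  qed
  then show ?case by (simp add: vec_eq_iff)
qed

lemma locally_integrable_right_intensity_matrix:
  assumes "locally_integrable_right A"
  shows "locally_integrable_right (intensity_matrix A)"
  unfolding locally_integrable_right_def
proof (intro allI impI)
  fix s :: real assume "0 \<le> s"
  then obtain e where e: "e > 0" "\<And>i j. set_integrable lborel {s..s+e} (\<lambda>u. A u $ i $ j)"
    using assms by (auto simp: locally_integrable_right_def)
  have "set_integrable lborel {s..s+e} (\<lambda>u. intensity_matrix A u $ i $ j)" for i j
  proof -
    have "set_integrable lborel {s..s+e} (\<lambda>u. - (\<Sum>l\<in>UNIV. A u $ k $ l))" for k
      unfolding set_integrable_def scaleR_minus_right
      using set_integral_sum(1)[of UNIV lborel "{s..s+e}" "\<lambda>l u. A u $ k $ l"] e(2)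
      by (intro Bochner_Integration.integrable_minus) (auto simp: set_integrable_def)
    then show ?thesis
      using e(2) by (cases i; cases j)
        (simp_all add: intensity_matrix_def exit_rates_def matrix_vector_mult_def set_integrable_def)
  qed
  with e(1) show "\<exists>e>0. \<forall>i j. set_integrable lborel {s..s+e} (\<lambda>u. intensity_matrix A u $ i $ j)"
    by blast
qed

text \<open>
  Completes a sub-stochastic matrix to a stochastic one; the missing mass of each row is the
  probability of absorption.
\<close>

definition with_absorption :: "real^'p^'p \<Rightarrow> real^('p option)^('p option)" where
  "with_absorption P = (\<chi> i j. case i of None \<Rightarrow> of_bool (j = None)
     | Some k \<Rightarrow> (case j of Some l \<Rightarrow> P $ k $ l | None \<Rightarrow> 1 - (\<Sum>l\<in>UNIV. P $ k $ l)))"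

text \<open>
  The exit rates are minus the row sums of \<open>A\<close>, so the equation for the absorption probabilities
  is minus the sum of the equations of the row.
\<close>

lemma solves_product_integral_with_absorption:
  assumes P: "solves_product_integral A s P"
  shows "solves_product_integral (intensity_matrix A) s (\<lambda>t. with_absorption (P t))"
  unfolding solves_product_integral_iff_components
proof (intro allI impI)
  fix t :: real and x y :: "'a option" assume t: "s \<le> t"
  let ?g = "\<lambda>x y u. \<Sum>z\<in>UNIV. with_absorption (P u) $ x $ z * intensity_matrix A u $ z $ y"
  note I = P[unfolded solves_product_integral_iff_components, rule_format, OF t]
  have row: "?g (Some i) None u = - (\<Sum>l\<in>UNIV. \<Sum>k\<in>UNIV. P u $ i $ k * A u $ k $ l)" for i u
  proof -
    have "?g (Some i) None u = (\<Sum>k\<in>UNIV. P u $ i $ k * - (\<Sum>l\<in>UNIV. A u $ k $ l))"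
      by (simp add: sum_UNIV_option with_absorption_def intensity_matrix_def exit_rates_def
          matrix_vector_mult_def)
    also have "\<dots> = - (\<Sum>k\<in>UNIV. \<Sum>l\<in>UNIV. P u $ i $ k * A u $ k $ l)"
      by (simp add: sum_negf sum_distrib_left)
    finally show ?thesis by (subst (asm) sum.swap)
  qed
  show "set_integrable lborel {s..t} (?g x y) \<and>
    with_absorption (P t) $ x $ y = of_bool (x = y) + (LINT u:{s..t}|lborel. ?g x y u)"
  proof (cases x)
    case None
    then have "?g x y u = 0" for u
      by (simp add: sum_UNIV_option with_absorption_def intensity_matrix_def)
    then show ?thesis
      using None by (simp add: with_absorption_def set_integrable_def set_lebesgue_integral_def)
  next
    case (Some i)
    show ?thesis
    proof (cases y)
      case (Some j)
      have "?g x y u = (\<Sum>k\<in>UNIV. P u $ i $ k * A u $ k $ j)" for u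
        unfolding Some \<open>x = Some i\<close>
        by (simp add: sum_UNIV_option with_absorption_def intensity_matrix_def)
      then show ?thesis
        using I[of i j] Some \<open>x = Some i\<close> by (simp add: with_absorption_def)
    next
      case None
      have int: "set_integrable lborel {s..t} (\<lambda>u. \<Sum>l\<in>UNIV. \<Sum>k\<in>UNIV. P u $ i $ k * A u $ k $ l)"
        using I[of i] by (auto intro: set_integral_sum(1)[where I = UNIV, simplified])
      have "(\<Sum>l\<in>UNIV. P t $ i $ l) = 1 + (\<Sum>l\<in>UNIV. LINT u:{s..t}|lborel. \<Sum>k\<in>UNIV. P u $ i $ k * A u $ k $ l)"
        using I[of i] by (simp add: sum.distrib of_bool_def)
      also have "(\<Sum>l\<in>UNIV. LINT u:{s..t}|lborel. \<Sum>k\<in>UNIV. P u $ i $ k * A u $ k $ l)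
        = (LINT u:{s..t}|lborel. \<Sum>l\<in>UNIV. \<Sum>k\<in>UNIV. P u $ i $ k * A u $ k $ l)"
        using I[of i] by (subst set_integral_sum(2)) auto
      finally show ?thesis
        using int unfolding None \<open>x = Some i\<close> row
        by (simp add: with_absorption_def set_integrable_def set_lebesgue_integral_def)
    qed
  qed
qed

lemma solves_product_integral_chosen:
  assumes "solves_product_integral A s P"
  shows "solves_product_integral A s (product_integral A s)"
proof -
  have "product_integral A s = (SOME P. solves_product_integral A s P)"
    by (simp add: product_integral_def fun_eq_iff)
  then show ?thesis using assms by (metis someI_ex)
qed

text \<open>
  Both sides solve the equation of the full intensity matrix, and solutions are unique.
\<close>

lemma product_integral_intensity_matrix:
  fixes A :: "real \<Rightarrow> real^'p^'p"
  assumes prod: "product_integrable A"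
    and meas: "A \<in> borel_measurable (restrict_space borel {0..})" and s: "0 \<le> s"
  shows "solves_product_integral (intensity_matrix A) s (product_integral (intensity_matrix A) s)"
    and "s \<le> t \<Longrightarrow> product_integral (intensity_matrix A) s t = with_absorption (product_integral A s t)"
proof -
  from prod s obtain P where "solves_product_integral A s P"
    by (auto simp: product_integrable_def)
  then have 1: "solves_product_integral (intensity_matrix A) s (\<lambda>t. with_absorption (product_integral A s t))"
    by (intro solves_product_integral_with_absorption solves_product_integral_chosen)
  then show 2: "solves_product_integral (intensity_matrix A) s (product_integral (intensity_matrix A) s)"
    by (rule solves_product_integral_chosen)
  show "product_integral (intensity_matrix A) s t = with_absorption (product_integral A s t)" if "s \<le> t"
    using that by (intro solves_product_integral_unique[OF _ s 2 1]
        locally_integrable_right_intensity_matrix product_integrable_imp_locally_integrable_right prod meas)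
qed

section \<open>Jumps of a path\<close>

definition jump_path :: "(real \<Rightarrow> 's) \<Rightarrow> bool" where
  "jump_path x \<longleftrightarrow> (\<forall>t\<ge>0. \<forall>\<^sub>F u in at_right t. x u = x t) \<and> (\<forall>t>0. \<exists>i. \<forall>\<^sub>F u in at_left t. x u = i)"

definition jump_times :: "(real \<Rightarrow> 's) \<Rightarrow> real set" where
  "jump_times x = {s. 0 < s \<and> \<not> (\<forall>\<^sub>F u in at_left s. x u = x s)}"

definition jumps :: "(real \<Rightarrow> 's) \<Rightarrow> 's \<Rightarrow> 's \<Rightarrow> real set" where
  "jumps x i j = {s. 0 < s \<and> (\<forall>\<^sub>F u in at_left s. x u = i) \<and> x s = j}"

lemma jump_pathsD: "jump_paths M X \<Longrightarrow> \<omega> \<in> space M \<Longrightarrow> jump_path (\<lambda>t. X t \<omega>)"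
  by (simp add: jump_paths_def jump_path_def)

lemma jump_count_eq: "jump_count X i j t \<omega> = real (card (jumps (\<lambda>t. X t \<omega>) i j \<inter> {0<..t}))"
  unfolding jump_count_def jumps_def by (rule arg_cong[where f="\<lambda>S. real (card S)"]) auto

lemma eventually_at_left_unique:
  fixes s :: real
  assumes "\<forall>\<^sub>F u in at_left s. x u = i" "\<forall>\<^sub>F u in at_left s. x u = j"
  shows "i = j"
proof -
  have "\<forall>\<^sub>F u in at_left s. i = j"
    using assms by eventually_elim auto
  then show ?thesis by (simp add: trivial_limit_at_left_real)
qed

lemma jumps_subset_jump_times: "i \<noteq> j \<Longrightarrow> jumps x i j \<subseteq> jump_times x"
  by (auto simp: jumps_def jump_times_def dest: eventually_at_left_unique)

lemma constant_without_jumps: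
  assumes x: "jump_path x" and "0 \<le> c" "c \<le> d" and no: "jump_times x \<inter> {c<..d} = {}"
  shows "x d = x c"
proof -
  have "d \<le> d \<longrightarrow> x d = x c" using \<open>c \<le> d\<close>
  proof (induction rule: right_induct[where Q = "\<lambda>u. u \<le> d \<longrightarrow> x u = x c"])
    case (right r)
    have "\<forall>\<^sub>F u in at_right r. x u = x r"
      using x right \<open>0 \<le> c\<close> by (auto simp: jump_path_def)
    then obtain b where b: "b > r" "\<And>u. u > r \<Longrightarrow> u < b \<Longrightarrow> x u = x r"
      by (auto simp: eventually_at_right_field)
    have "\<forall>u\<in>{r..r + (b-r)/2}. u \<le> d \<longrightarrow> x u = x c"
    proof
      fix u assume "u \<in> {r..r + (b-r)/2}"
      then have "u = r \<or> r < u" "u < b" "r \<le> u" using b(1) by (auto simp: field_simps)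
      then show "u \<le> d \<longrightarrow> x u = x c"
        using b(2)[of u] right(2) by (metis order_trans)
    qed
    then show ?case using b(1) by (intro exI[of _ "(b-r)/2"]) auto
  next
    case (left r)
    show ?case
    proof
      assume "r \<le> d"
      with left(1) have "r \<in> {c<..d}" by simp
      with no have "r \<notin> jump_times x" by blast
      with left(1) \<open>0 \<le> c\<close> have "\<forall>\<^sub>F u in at_left r. x u = x r"
        by (auto simp: jump_times_def)
      moreover have "\<forall>\<^sub>F u in at_left r. x u = x c"
        using eventually_at_left_real[OF left(1)]
      proof eventually_elim
        case (elim u)
        then have "c \<le> u" "u < r" "u \<le> d" using \<open>r \<le> d\<close> by simp_all
        then show ?case using left(2) by blast
      qed
      ultimately show "x r = x c" by (rule eventually_at_left_unique)
    qed
  qed simp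
  then show ?thesis by blast
qed

lemma left_limit_without_jumps:
  assumes "jump_path x" "0 \<le> c" "c < s" and no: "jump_times x \<inter> {c<..<s} = {}"
  shows "\<forall>\<^sub>F u in at_left s. x u = x c"
  using eventually_at_left_real[OF \<open>c < s\<close>]
proof eventually_elim
  case (elim u)
  then have "jump_times x \<inter> {c<..u} = {}" using no by auto
  then show ?case using elim assms by (intro constant_without_jumps) auto
qed

text \<open>
  Induction along the time axis: right of any time there is a jump-free interval by right
  continuity, and left of any time there is one by the existence of the left limit.
\<close>

lemma finite_jump_times:
  assumes x: "jump_path x"
  shows "finite (jump_times x \<inter> {..t})"
proof (cases "0 \<le> t")
  case True
  then show ?thesis
  proof (induction rule: right_induct)
    case base
    then show ?case by (auto simp: jump_times_def intro: finite_subset[of _ "{}"])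
  next
    case (right r)
    have "\<forall>\<^sub>F u in at_right r. x u = x r"
      using x right by (auto simp: jump_path_def)
    then obtain b where b: "b > r" "\<And>u. u > r \<Longrightarrow> u < b \<Longrightarrow> x u = x r"
      by (auto simp: eventually_at_right_field)
    have no: "s \<notin> jump_times x" if "r < s" "s < b" for s
    proof -
      have "\<forall>\<^sub>F u in at_left s. x u = x s"
        using eventually_at_left_real[OF that(1)]
        by eventually_elim (use b(2) that in auto)
      then show ?thesis by (simp add: jump_times_def)
    qed
    have "finite (jump_times x \<inter> {..u})" if "u \<in> {r..r + (b-r)/2}" for u
    proof (rule finite_subset[OF _ right(2)])
      have "u < b" using that b(1) by (auto simp: field_simps)
      then have "s \<le> r" if "s \<in> jump_times x" "s \<le> u" for s
        using no[of s] that by linarith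
      then show "jump_times x \<inter> {..u} \<subseteq> jump_times x \<inter> {..r}" by auto
    qed
    then show ?case using b(1) by (intro exI[of _ "(b-r)/2"]) auto
  next
    case (left r)
    from x left(1) obtain i where "\<forall>\<^sub>F u in at_left r. x u = i"
      by (auto simp: jump_path_def)
    then obtain b where b: "b < r" "\<And>u. u > b \<Longrightarrow> u < r \<Longrightarrow> x u = i"
      by (auto simp: eventually_at_left_field)
    have no: "s \<notin> jump_times x" if "b < s" "s < r" for s
    proof -
      have "\<forall>\<^sub>F u in at_left s. x u = x s"
        using eventually_at_left_real[OF that(1)]
        by eventually_elim (use b(2) that in auto)
      then show ?thesis by (simp add: jump_times_def)
    qed
    define c where "c = max 0 ((b + r) / 2)"
    have c: "0 \<le> c" "c < r" "b < c" using left(1) b(1) by (auto simp: c_def less_max_iff_disj)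
    have "jump_times x \<inter> {..r} \<subseteq> jump_times x \<inter> {..c} \<union> {r}"
    proof
      fix s assume s: "s \<in> jump_times x \<inter> {..r}"
      then have "\<not> (c < s \<and> s < r)" using no[of s] c by auto
      with s show "s \<in> jump_times x \<inter> {..c} \<union> {r}" by auto
    qed
    then show ?case
      by (rule finite_subset) (use left(2)[OF c(1,2)] in auto)
  qed
next
  case False
  then have "jump_times x \<inter> {..t} = {}" by (auto simp: jump_times_def)
  then show ?thesis by simp
qed

lemma finite_jumps:
  assumes "jump_path x" "i \<noteq> j"
  shows "finite (jumps x i j \<inter> {a<..b})"
  by (rule finite_subset[OF _ finite_jump_times[OF assms(1), of b]])
     (use jumps_subset_jump_times[OF assms(2)] in auto)

text \<open>
  The path is constant on both sides of the only jump, so its states at the ends of the interval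
  are the states before and after the jump.
\<close>

lemma cell_with_at_most_one_jump:
  assumes x: "jump_path x" and cd: "0 \<le> c" "c \<le> d" and "i \<noteq> j"
    and one: "card (jump_times x \<inter> {c<..d}) \<le> 1"
  shows "card (jumps x i j \<inter> {c<..d}) = of_bool (x c = i \<and> x d = j)"
proof -
  have fin: "finite (jump_times x \<inter> {c<..d})"
    by (rule finite_subset[OF _ finite_jump_times[OF x, of d]]) auto
  show ?thesis
  proof (cases "jump_times x \<inter> {c<..d} = {}")
    case True
    then have "x d = x c" using x cd by (intro constant_without_jumps)
    moreover have "jumps x i j \<inter> {c<..d} = {}"
      using True jumps_subset_jump_times[OF \<open>i \<noteq> j\<close>, of x] by blast
    ultimately show ?thesis using \<open>i \<noteq> j\<close> by auto
  next
    case False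
    with one fin have "card (jump_times x \<inter> {c<..d}) = 1"
      by (metis One_nat_def card_0_eq le_SucE le_zero_eq)
    then obtain s where s: "jump_times x \<inter> {c<..d} = {s}"
      by (auto simp: card_1_singleton_iff)
    have "s \<in> jump_times x \<inter> {c<..d}" using s by simp
    then have cs: "c < s" "s \<le> d" "0 < s" using cd by auto
    have left: "\<forall>\<^sub>F u in at_left s. x u = x c"
    proof (rule left_limit_without_jumps[OF x cd(1) cs(1)])
      show "jump_times x \<inter> {c<..<s} = {}"
      proof (rule ccontr)
        assume "jump_times x \<inter> {c<..<s} \<noteq> {}"
        then obtain r where "r \<in> jump_times x" "c < r" "r < s" by auto
        then have "r \<in> jump_times x \<inter> {c<..d}" using cs by auto
        with s \<open>r < s\<close> show False by auto
      qed
    qed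
    have right: "x d = x s"
    proof (rule constant_without_jumps[OF x])
      show "jump_times x \<inter> {s<..d} = {}"
      proof (rule ccontr)
        assume "jump_times x \<inter> {s<..d} \<noteq> {}"
        then obtain r where "r \<in> jump_times x" "s < r" "r \<le> d" by auto
        then have "r \<in> jump_times x \<inter> {c<..d}" using cs by auto
        with s \<open>s < r\<close> show False by auto
      qed
    qed (use cs in auto)
    show ?thesis
    proof -
      have only: "r = s \<and> x c = i \<and> x d = j" if "r \<in> jumps x i j \<inter> {c<..d}" for r
      proof -
        have "r = s" using that s jumps_subset_jump_times[OF \<open>i \<noteq> j\<close>, of x] by auto
        then show ?thesis
          using that right eventually_at_left_unique[OF left, of i] by (auto simp: jumps_def)
      qed
      have "jumps x i j \<inter> {c<..d} = {s}" if "x c = i" "x d = j"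
      proof -
        have "s \<in> jumps x i j"
          unfolding jumps_def using left \<open>x d = x s\<close> that cs by auto
        then have "s \<in> jumps x i j \<inter> {c<..d}" using cs by simp
        then show ?thesis using only by blast
      qed
      moreover have "jumps x i j \<inter> {c<..d} = {}" if "\<not> (x c = i \<and> x d = j)"
        using only that by blast
      ultimately show ?thesis
        by (cases "x c = i \<and> x d = j") (simp_all del: Int_greaterThanAtMost)
    qed
  qed
qed

definition grid :: "real \<Rightarrow> real \<Rightarrow> nat \<Rightarrow> nat \<Rightarrow> real" where
  "grid a b n k = a + (b - a) * real k / real n"

text \<open>
  Unlike the number of jumps, this count depends on finitely many time points only; its law is
  therefore determined by the transition probabilities.
\<close>

definition cell_count :: "(real \<Rightarrow> 's) \<Rightarrow> 's \<Rightarrow> 's \<Rightarrow> real \<Rightarrow> real \<Rightarrow> nat \<Rightarrow> nat" where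
  "cell_count x i j a b n =
     (\<Sum>k<n. of_bool (x (grid a b n k) = i \<and> x (grid a b n (Suc k)) = j))"

lemma grid_0 [simp]: "grid a b n 0 = a" and grid_n [simp]: "0 < n \<Longrightarrow> grid a b n n = b"
  by (simp_all add: grid_def)

lemma grid_mono: "a \<le> b \<Longrightarrow> k \<le> l \<Longrightarrow> grid a b n k \<le> grid a b n l"
  unfolding grid_def by (intro add_left_mono divide_right_mono mult_left_mono) auto

lemma grid_ge: "a \<le> b \<Longrightarrow> a \<le> grid a b n k"
  using grid_mono[of a b 0 k n] by simp

lemma grid_le: "a \<le> b \<Longrightarrow> k \<le> n \<Longrightarrow> grid a b n k \<le> b"
  using grid_mono[of a b k n n] by (cases "n = 0") (auto simp: grid_def)

lemma grid_Suc: "grid a b n (Suc k) = grid a b n k + (b - a) / real n"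
  proof -
  have "(b - a) * real (Suc k) = (b - a) * real k + (b - a)"
    by (simp only: of_nat_Suc ring_distribs mult_1_right add.commute)
  then show ?thesis by (simp only: grid_def add_divide_distrib add.assoc)
qed

lemma sum_card_cells:
  fixes g :: "nat \<Rightarrow> real"
  assumes mono: "\<And>k l. k \<le> l \<Longrightarrow> g k \<le> g l" and fin: "finite (S \<inter> {g 0<..g n})"
  shows "card (S \<inter> {g 0<..g n}) = (\<Sum>k<n. card (S \<inter> {g k<..g (Suc k)}))"
  using fin
proof (induction n)
  case (Suc n)
  have split: "S \<inter> {g 0<..g (Suc n)} = (S \<inter> {g 0<..g n}) \<union> (S \<inter> {g n<..g (Suc n)})"
    using mono[of 0 n] mono[of n "Suc n"] by auto
  have fin: "finite (S \<inter> {g 0<..g n})" "finite (S \<inter> {g n<..g (Suc n)})"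
    using Suc.prems unfolding split by auto
  show ?case
    unfolding split by (subst card_Un_disjoint) (use fin Suc.IH in auto)
qed auto

lemma sum_card_grid:
  assumes "a \<le> b" "0 < n" "finite (S \<inter> {a<..b})"
  shows "card (S \<inter> {a<..b}) = (\<Sum>k<n. card (S \<inter> {grid a b n k<..grid a b n (Suc k)}))"
  using sum_card_cells[of "grid a b n" S n] assms by (simp add: grid_mono)

lemma cell_count_le:
  assumes x: "jump_path x" and ab: "0 \<le> a" "a \<le> b" and "i \<noteq> j"
  shows "cell_count x i j a b n \<le> card (jump_times x \<inter> {a<..b})"
proof (cases "n = 0")
  case False
  have fin: "finite (jump_times x \<inter> {c<..d})" for c d
    by (rule finite_subset[OF _ finite_jump_times[OF x, of d]]) auto
  have "of_bool (x c = i \<and> x d = j) \<le> card (jump_times x \<inter> {c<..d})" if "0 \<le> c" "c \<le> d" for c d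
  proof (cases "x c = i \<and> x d = j")
    case True
    then have "jump_times x \<inter> {c<..d} \<noteq> {}"
      using constant_without_jumps[OF x that] \<open>i \<noteq> j\<close> by auto
    then show ?thesis using True fin[of c d] by (simp add: Suc_le_eq card_gt_0_iff)
  next
    case False
    then have "of_bool (x c = i \<and> x d = j) = (0::nat)" by simp
    then show ?thesis by (simp only:)
  qed
  then have "cell_count x i j a b n \<le> (\<Sum>k<n. card (jump_times x \<inter> {grid a b n k<..grid a b n (Suc k)}))"
    unfolding cell_count_def using ab
    by (intro sum_mono) (simp add: grid_mono order_trans[OF ab(1) grid_ge])
  then show ?thesis using sum_card_grid[OF ab(2) _ fin] False by simp
qed (simp add: cell_count_def)

lemma finite_set_separated:
  fixes S :: "real set"
  assumes "finite S"
  obtains d where "0 < d" "\<And>s t. s \<in> S \<Longrightarrow> t \<in> S \<Longrightarrow> s \<noteq> t \<Longrightarrow> d \<le> \<bar>s - t\<bar>"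
proof -
  define D where "D = insert 1 ((\<lambda>(s,t). \<bar>s - t\<bar>) ` {(s,t). s \<in> S \<and> t \<in> S \<and> s \<noteq> t})"
  have "finite {(s,t). s \<in> S \<and> t \<in> S \<and> s \<noteq> t}"
    by (rule finite_subset[of _ "S \<times> S"]) (use assms in auto)
  then have D: "finite D" "D \<noteq> {}" by (auto simp: D_def)
  show ?thesis
  proof (rule that[of "Min D"])
    show "0 < Min D" using D by (subst Min_gr_iff) (auto simp: D_def)
    show "Min D \<le> \<bar>s - t\<bar>" if "s \<in> S" "t \<in> S" "s \<noteq> t" for s t
      using that D(1) by (intro Min_le) (auto simp: D_def)
  qed
qed

text \<open>
  Only finitely many jumps occur up to time \<open>b\<close>, so the cells of a fine grid contain at most one
  of them each, and the jump in a cell can be read off from the states at its endpoints.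
\<close>

lemma eventually_cell_count_eq:
  assumes x: "jump_path x" and ab: "0 \<le> a" "a \<le> b" and "i \<noteq> j"
  shows "\<forall>\<^sub>F n in sequentially. cell_count x i j a b n = card (jumps x i j \<inter> {a<..b})"
proof -
  have fin: "finite (jump_times x \<inter> {..b})" by (rule finite_jump_times[OF x])
  then obtain d where d: "0 < d"
    "\<And>s t. s \<in> jump_times x \<inter> {..b} \<Longrightarrow> t \<in> jump_times x \<inter> {..b} \<Longrightarrow> s \<noteq> t \<Longrightarrow> d \<le> \<bar>s - t\<bar>"
    using finite_set_separated by blast
  obtain m :: nat where m: "(b - a) / d < real m" using reals_Archimedean2 by blast
  show ?thesis
    using eventually_gt_at_top[of m]
  proof eventually_elim
    case (elim n)
    then have n: "0 < n" by simp
    have "(b - a) / d < real n" using m elim by simp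
    then have mesh: "(b - a) / real n < d"
      using d(1) n by (simp add: pos_divide_less_eq mult.commute)
    have "card (jumps x i j \<inter> {grid a b n k<..grid a b n (Suc k)})
        = of_bool (x (grid a b n k) = i \<and> x (grid a b n (Suc k)) = j)" if "k < n" for k
    proof (rule cell_with_at_most_one_jump[OF x _ _ \<open>i \<noteq> j\<close>])
      show "0 \<le> grid a b n k" using grid_ge[OF ab(2), of n k] ab(1) by linarith
      show "grid a b n k \<le> grid a b n (Suc k)" by (intro grid_mono ab) auto
      have "grid a b n (Suc k) \<le> b" using that by (intro grid_le ab) auto
      then have sub: "jump_times x \<inter> {grid a b n k<..grid a b n (Suc k)} \<subseteq> jump_times x \<inter> {..b}"
        by auto
      have "s = t" if "s \<in> jump_times x \<inter> {grid a b n k<..grid a b n (Suc k)}"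
        "t \<in> jump_times x \<inter> {grid a b n k<..grid a b n (Suc k)}" for s t
      proof (rule ccontr)
        assume "s \<noteq> t"
        with d(2) that sub have "d \<le> \<bar>s - t\<bar>" by blast
        moreover have "\<bar>s - t\<bar> < (b - a) / real n"
          using that by (auto simp: grid_Suc)
        ultimately show False using mesh by simp
      qed
      then show "card (jump_times x \<inter> {grid a b n k<..grid a b n (Suc k)}) \<le> 1"
        using finite_subset[OF sub fin] by (simp add: card_le_Suc0_iff_eq)
    qed
    then show ?case
      using sum_card_grid[OF ab(2) n finite_jumps[OF x \<open>i \<noteq> j\<close>]] by (simp add: cell_count_def)
  qed
qed

lemma measurable_card_jumps:
  assumes X: "\<And>t. 0 \<le> t \<Longrightarrow> X t \<in> measurable K (count_space UNIV)"
    and jp: "\<And>\<omega>. \<omega> \<in> space K \<Longrightarrow> jump_path (\<lambda>t. X t \<omega>)"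
    and ab: "0 \<le> a" "a \<le> b" and "i \<noteq> j"
  shows "(\<lambda>\<omega>. real (card (jumps (\<lambda>t. X t \<omega>) i j \<inter> {a<..b}))) \<in> borel_measurable K"
proof (rule borel_measurable_LIMSEQ_real)
  show "(\<lambda>n. real (cell_count (\<lambda>t. X t \<omega>) i j a b n)) \<longlonglongrightarrow> real (card (jumps (\<lambda>t. X t \<omega>) i j \<inter> {a<..b}))"
    if "\<omega> \<in> space K" for \<omega>
    using eventually_cell_count_eq[OF jp[OF that] ab \<open>i \<noteq> j\<close>]
    by (intro tendsto_eventually) (erule eventually_mono, simp only:)
  fix n
  have [measurable]: "X (grid a b n k) \<in> measurable K (count_space UNIV)" for k
    using order_trans[OF ab(1) grid_ge[OF ab(2)]] by (rule X)
  show "(\<lambda>\<omega>. real (cell_count (\<lambda>t. X t \<omega>) i j a b n)) \<in> borel_measurable K"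
    unfolding cell_count_def of_bool_def of_nat_sum by measurable
qed

lemma sum_integral_cells:
  fixes g :: "real \<Rightarrow> real" and c :: "nat \<Rightarrow> real"
  assumes mono: "\<And>k l. k \<le> l \<Longrightarrow> c k \<le> c l" and int: "set_integrable lborel {c 0..c n} g"
  shows "(\<Sum>k<n. LINT u:{c k..c (Suc k)}|lborel. g u) = (LINT u:{c 0..c n}|lborel. g u)"
  using int
proof (induction n)
  case (Suc n)
  have "set_integrable lborel {c 0..c n} g"
    using mono[of n "Suc n"] by (intro set_integrable_subset[OF Suc.prems]) auto
  then show ?case
    using Suc.IH set_integral_split[OF Suc.prems mono[of 0 n] mono[of n "Suc n"]] by simp
qed (simp add: set_integral_singleton)

lemma grid_cell:
  assumes "a < b" "0 < n" "a \<le> u" "u < b"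
  shows "\<exists>k<n. \<forall>l<n. (grid a b n l \<le> u \<and> u < grid a b n (Suc l)) \<longleftrightarrow> l = k"
proof -
  \<comment> \<open>The cell index is the rescaled distance to the left end, rounded down.\<close>
  define k where "k = nat \<lfloor>(u - a) * real n / (b - a)\<rfloor>"
  have pos: "0 \<le> (u - a) * real n / (b - a)" using assms by simp
  then have k: "real k \<le> (u - a) * real n / (b - a)" by (simp add: k_def of_nat_nat)
  have k': "(u - a) * real n / (b - a) < real (Suc k)"
    using real_of_int_floor_add_one_gt[of "(u - a) * real n / (b - a)"] pos
    by (simp add: k_def of_nat_nat add.commute)
  have "(u - a) * real n / (b - a) < real n"
    using assms by (simp add: pos_divide_less_eq mult.commute)
  then have "k < n" using k by simp
  have cell: "grid a b n k \<le> u" "u < grid a b n (Suc k)"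
  proof -
    have u: "(b - a) * ((u - a) * real n / (b - a)) / real n = u - a" using assms by simp
    have "(b - a) * real k / real n \<le> (b - a) * ((u - a) * real n / (b - a)) / real n"
      using k assms by (intro divide_right_mono mult_left_mono) auto
    then show "grid a b n k \<le> u" unfolding u by (simp add: grid_def)
    have "(b - a) * ((u - a) * real n / (b - a)) / real n < (b - a) * real (Suc k) / real n"
      using k' assms by (intro divide_strict_right_mono mult_strict_left_mono) auto
    then show "u < grid a b n (Suc k)" unfolding u by (simp only: grid_def)
  qed
  have "l = k" if "grid a b n l \<le> u" "u < grid a b n (Suc l)" for l
  proof (rule linorder_cases[of l k])
    assume "l < k"
    then have "grid a b n (Suc l) \<le> grid a b n k" using assms by (intro grid_mono) auto
    then show ?thesis using that cell by simp
  next
    assume "k < l"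
    then have "grid a b n (Suc k) \<le> grid a b n l" using assms by (intro grid_mono) auto
    then show ?thesis using that cell by simp
  qed
  then show ?thesis using \<open>k < n\<close> cell by blast
qed

section \<open>The measure generated by a jump count\<close>

lemma measure_eqI_Ioc:
  fixes M N :: "real measure"
  assumes sets: "sets M = sets borel" "sets N = sets borel"
    and eq: "\<And>a b. a < b \<Longrightarrow> emeasure M {a<..b} = emeasure N {a<..b}"
    and fin: "\<And>a b. a < b \<Longrightarrow> emeasure M {a<..b} < \<infinity>"
  shows "M = N"
proof (rule measure_eqI_generator_eq[where E = "range (\<lambda>(a, b). {a<..b})"
      and A = "\<lambda>n::nat. {- real n<..real n}" and \<Omega> = UNIV])
  show "Int_stable (range (\<lambda>(a::real, b). {a<..b}))"
  proof (rule Int_stableI)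
    fix A B :: "real set"
    assume "A \<in> range (\<lambda>(a, b). {a<..b})" "B \<in> range (\<lambda>(a, b). {a<..b})"
    then obtain a b c d where "A = {a<..b}" "B = {c<..d}" by auto
    then have "A \<inter> B = (\<lambda>(a, b). {a<..b}) (max a c, min b d)" by auto
    then show "A \<inter> B \<in> range (\<lambda>(a, b). {a<..b})" by (rule range_eqI)
  qed
  show "emeasure M Y = emeasure N Y" if Y: "Y \<in> range (\<lambda>(a, b). {a<..b})" for Y
  proof -
    from Y obtain a b where "Y = {a<..b}" by auto
    then show ?thesis using eq[of a b] by (cases "a < b") auto
  qed
  show "(\<Union>n::nat. {- real n<..real n}) = UNIV"
  proof (intro equalityI subsetI UNIV_I UN_I)
    fix x :: real
    have "\<bar>x\<bar> + 1 \<le> real (nat \<lceil>\<bar>x\<bar> + 1\<rceil>)" by (rule real_nat_ceiling_ge)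
    then show "x \<in> {- real (nat \<lceil>\<bar>x\<bar> + 1\<rceil>)<..real (nat \<lceil>\<bar>x\<bar> + 1\<rceil>)}"
      unfolding greaterThanAtMost_iff by linarith
  qed
  show "emeasure M {- real n<..real n} \<noteq> \<infinity>" for n
    using fin[of "- real n" "real n"] by (cases "n = 0") auto
qed (auto simp: sets borel_sigma_sets_Ioc)

text \<open>
  Applied to the law of the absorption time, for which the half-lines are the events of absorption
  by a given time.
\<close>

lemma measure_eqI_atMost:
  fixes M N :: "real measure"
  assumes sets: "sets M = sets borel" "sets N = sets borel"
    and eq: "\<And>v. emeasure M {..v} = emeasure N {..v}"
    and fin: "\<And>v. emeasure M {..v} < \<infinity>"
  shows "M = N"
proof (rule measure_eqI_Ioc[OF sets])
  fix a b :: real assume "a < b"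
  then have *: "{a<..b} = {..b} - {..a}" "{..a} \<subseteq> {..b}" by auto
  have "emeasure M {a<..b} = emeasure M {..b} - emeasure M {..a}"
    unfolding *(1) using fin[of a] * sets by (intro emeasure_Diff) (auto simp: less_top)
  moreover have "emeasure N {a<..b} = emeasure N {..b} - emeasure N {..a}"
    unfolding *(1) using fin[of a] eq[of a] * sets by (intro emeasure_Diff) (auto simp: less_top)
  ultimately show "emeasure M {a<..b} = emeasure N {a<..b}" by (simp add: eq)
  have "emeasure M {a<..b} \<le> emeasure M {..b}"
    using * sets by (intro emeasure_mono) auto
  then show "emeasure M {a<..b} < \<infinity>" using fin[of b] by (rule le_less_trans)
qed

text \<open>
  Right continuity of the counting function holds because the set is locally finite.
\<close>

lemma interval_measure_counting:
  assumes fin: "\<And>t. finite (J \<inter> {0<..t})" and pos: "J \<subseteq> {0<..}"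
  shows "interval_measure (\<lambda>t::real. real (card (J \<inter> {0<..t}))) = distr (count_space J) borel (\<lambda>s. s)"
    (is "?I = ?D")
proof (rule measure_eqI_Ioc)
  let ?F = "\<lambda>t::real. real (card (J \<inter> {0<..t}))"
  have fin': "finite (J \<inter> {a<..b})" for a b
    by (rule finite_subset[OF _ fin[of b]]) (use pos in auto)
  have D: "emeasure ?D {a<..b} = card (J \<inter> {a<..b})" for a b
    using fin'[of a b] by (subst emeasure_distr)
      (auto simp: Int_commute emeasure_count_space_finite)
  have I: "emeasure ?I {a<..b} = card (J \<inter> {a<..b})" if "a < b" for a b
  proof -
    have mono: "?F s \<le> ?F t" if "s \<le> t" for s t
      using that by (auto intro!: card_mono fin)
    have cont: "continuous (at_right c) ?F" for c
    proof -
      obtain e where e: "e > 0" "\<And>s. s \<in> J \<inter> {c<..c+1} \<Longrightarrow> c + e \<le> s"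
      proof (cases "J \<inter> {c<..c+1} = {}")
        case True then show ?thesis by (intro that[of 1]) auto
      next
        case False
        then show ?thesis using Min_in[OF fin' False]
          by (intro that[of "Min (J \<inter> {c<..c+1}) - c"]) (auto simp: fin')
      qed
      have "\<forall>\<^sub>F t in at_right c. t \<in> {c<..<c + min 1 e}"
        using e(1) by (intro eventually_at_right_real) auto
      then have "\<forall>\<^sub>F t in at_right c. ?F t = ?F c"
      proof eventually_elim
        case (elim t)
        then have "J \<inter> {0<..t} = J \<inter> {0<..c}"
          using e(2) by (force simp: not_le[symmetric])
        then show ?case by simp
      qed
      then show ?thesis by (simp add: continuous_within tendsto_eventually)
    qed
    have "emeasure ?I {a<..b} = ?F b - ?F a"
      using that mono cont by (intro emeasure_interval_measure_Ioc) auto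
    also have "?F b - ?F a = card (J \<inter> {a<..b})"
    proof -
      have "J \<inter> {0<..b} = (J \<inter> {0<..a}) \<union> (J \<inter> {a<..b})"
        using that pos by auto
      then have "card (J \<inter> {0<..b}) = card (J \<inter> {0<..a}) + card (J \<inter> {a<..b})"
        by (simp, subst card_Un_disjoint) (use fin' in auto)
      then show ?thesis by simp
    qed
    finally show ?thesis by (simp add: ennreal_of_nat_eq_real_of_nat)
  qed
  show "emeasure ?I {a<..b} = emeasure ?D {a<..b}" "emeasure ?I {a<..b} < \<infinity>" if "a < b" for a b
    using I[OF that] D by (auto simp: ennreal_of_nat_eq_real_of_nat)
qed auto

lemma interval_measure_jump_count:
  assumes "jump_path (\<lambda>t. X t \<omega>)" "i \<noteq> j"
  shows "interval_measure (\<lambda>t. jump_count X i j t \<omega>)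
    = distr (count_space (jumps (\<lambda>t. X t \<omega>) i j)) borel (\<lambda>s. s)"
  unfolding jump_count_eq
  by (rule interval_measure_counting) (use finite_jumps[OF assms] in \<open>auto simp: jumps_def\<close>)

text \<open>
  A locally finite measure on the positive half-line is generated by its own distribution
  function. This produces versions of the conditional jump counts whose paths generate the
  intended measures.
\<close>

lemma interval_measure_of_measure:
  fixes \<mu> :: "real measure"
  assumes sets: "sets \<mu> = sets borel" and zero: "emeasure \<mu> {..0} = 0"
    and fin: "\<And>t. emeasure \<mu> {0<..t} < \<infinity>"
  defines "G \<equiv> \<lambda>t. enn2real (emeasure \<mu> {0<..t})"
  shows "mono G" "\<And>t. continuous (at_right t) G" "\<And>t. t \<le> 0 \<Longrightarrow> G t = 0" "interval_measure G = \<mu>"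
proof -
  have G: "ennreal (G t) = emeasure \<mu> {0<..t}" for t
    using fin[of t] by (simp add: G_def less_top)
  have le: "emeasure \<mu> {0<..s} \<le> emeasure \<mu> {0<..t}" if "s \<le> t" for s t
    using that sets by (intro emeasure_mono) auto
  show mono: "mono G"
    unfolding G_def using fin le by (intro monoI enn2real_mono) auto
  show "G t = 0" if "t \<le> 0" for t using that by (simp add: G_def)
  show cont: "continuous (at_right t) G" for t
  proof -
    \<comment> \<open>Cutting the measure off makes it finite, so that the theory of distribution functions
        applies.\<close>
    define \<nu> where "\<nu> = density \<mu> (indicator {0<..t+1})"
    have \<nu>: "emeasure \<nu> B = emeasure \<mu> (B \<inter> {0<..t+1})" if "B \<in> sets borel" for B
    proof -
      have "emeasure \<nu> B = (\<integral>\<^sup>+x. indicator {0<..t+1} x * indicator B x \<partial>\<mu>)"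
        unfolding \<nu>_def using that sets by (intro emeasure_density) auto
      also have "\<dots> = (\<integral>\<^sup>+x. indicator (B \<inter> {0<..t+1}) x \<partial>\<mu>)"
        by (intro nn_integral_cong) (auto split: split_indicator)
      finally have "emeasure \<nu> B = (\<integral>\<^sup>+x. indicator (B \<inter> {0<..t+1}) x \<partial>\<mu>)" .
      then show ?thesis using that sets by simp
    qed
    have [simp]: "sets \<nu> = sets borel" "space \<nu> = UNIV"
      using sets sets_eq_imp_space_eq[OF sets] by (simp_all add: \<nu>_def)
    have "finite_measure \<nu>"
      using \<nu>[of UNIV] fin[of "t+1"] by (intro finite_measureI) simp
    then interpret \<nu>: finite_borel_measure \<nu>
      by (simp add: finite_borel_measure_def finite_borel_measure_axioms_def)
    have "cdf \<nu> x = G x" if "x \<le> t + 1" for x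
    proof -
      have "{..x} \<inter> {0<..t+1} = {0<..x}" using that by auto
      then show ?thesis using \<nu>[of "{..x}"] by (simp add: cdf_def measure_def G_def)
    qed
    moreover have "(cdf \<nu> \<longlongrightarrow> cdf \<nu> t) (at_right t)"
      using \<nu>.cdf_is_right_cont[of t] by (simp add: continuous_within)
    moreover have "\<forall>\<^sub>F x in at_right t. x \<in> {t<..<t+1}" by (rule eventually_at_right_real) simp
    then have "\<forall>\<^sub>F x in at_right t. x \<le> t + 1" by eventually_elim simp
    then have "\<forall>\<^sub>F x in at_right t. cdf \<nu> x = G x"
      by eventually_elim (rule \<open>\<And>x. x \<le> t + 1 \<Longrightarrow> cdf \<nu> x = G x\<close>)
    ultimately have "(G \<longlongrightarrow> cdf \<nu> t) (at_right t)" using tendsto_cong by fast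
    then show ?thesis
      using \<open>\<And>x. x \<le> t + 1 \<Longrightarrow> cdf \<nu> x = G x\<close>[of t] by (simp add: continuous_within)
  qed
  show "interval_measure G = \<mu>"
  proof (rule measure_eqI_Ioc)
    fix a b :: real assume "a < b"
    have "emeasure (interval_measure G) {a<..b} = ennreal (G b - G a)"
      using \<open>a < b\<close> mono cont by (intro emeasure_interval_measure_Ioc) (auto simp: mono_def)
    also have "\<dots> = emeasure \<mu> {0<..b} - emeasure \<mu> {0<..a}"
      using ennreal_minus[of "G a" "G b"] G by (simp add: G_def)
    also have "\<dots> = emeasure \<mu> ({0<..b} - {0<..a})"
      using fin[of a] \<open>a < b\<close> sets by (intro emeasure_Diff[symmetric]) (auto simp: less_top)
    also have "\<dots> = emeasure \<mu> {a<..b}"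
    proof -
      have "emeasure \<mu> ({a<..b} - {..0}) = emeasure \<mu> {a<..b}"
        using sets zero by (intro emeasure_Diff_null_set) (auto simp: null_sets_def)
      moreover have "{0<..b} - {0<..a} = {a<..b} - {..0}" by auto
      ultimately show ?thesis by simp
    qed
    finally show "emeasure (interval_measure G) {a<..b} = emeasure \<mu> {a<..b}" .
    show "emeasure (interval_measure G) {a<..b} < \<infinity>"
      using \<open>emeasure (interval_measure G) {a<..b} = ennreal (G b - G a)\<close> by simp
  qed (simp_all add: sets)
qed

section \<open>Absorption times\<close>

text \<open>
  By right continuity, a path that is absorbed before \<open>u\<close> is in the absorbing state at some
  rational time before \<open>u\<close>. On the paths that are never absorbed the time has the default value
  of the infimum of the empty set, which may or may not lie below \<open>u\<close>.
\<close>

lemma measurable_absorption_time: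
  fixes X :: "real \<Rightarrow> 'w \<Rightarrow> 's option"
  assumes X: "\<And>t. 0 \<le> t \<Longrightarrow> X t \<in> measurable K (count_space UNIV)"
    and jp: "\<And>\<omega>. \<omega> \<in> space K \<Longrightarrow> jump_path (\<lambda>t. X t \<omega>)"
  shows "absorption_time X \<in> borel_measurable K"
proof (rule borel_measurableI_less)
  fix u :: real
  define D where "D v = (\<Union>q\<in>{q\<in>\<rat>. 0 \<le> q \<and> q < v}. {\<omega>\<in>space K. X q \<omega> = None})" for v :: real
  have meas: "{\<omega>\<in>space K. X q \<omega> = None} \<in> sets K" if "0 \<le> q" for q
  proof -
    have "X q -` {None} \<inter> space K \<in> sets K"
      using X[OF that] by (rule measurable_sets) simp
    then show ?thesis by (simp add: vimage_def Int_def conj_commute)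
  qed
  have D: "D v \<in> sets K" for v
    unfolding D_def
    by (intro sets.countable_UN' countable_subset[OF _ countable_rat]) (use meas in auto)
  have D_iff: "\<omega> \<in> D v \<longleftrightarrow> (\<exists>s\<ge>0. s < v \<and> X s \<omega> = None)" if \<omega>: "\<omega> \<in> space K" for \<omega> v
  proof
    assume "\<exists>s\<ge>0. s < v \<and> X s \<omega> = None"
    then obtain s where s: "0 \<le> s" "s < v" "X s \<omega> = None" by auto
    then obtain b where b: "b > s" "\<And>u. u > s \<Longrightarrow> u < b \<Longrightarrow> X u \<omega> = X s \<omega>"
      using jp[OF \<omega>] by (auto simp: jump_path_def eventually_at_right_field)
    obtain q where "q \<in> \<rat>" "s < q" "q < min b v"
      using Rats_dense_in_real[of s "min b v"] b s by auto
    then show "\<omega> \<in> D v" using b(2)[of q] s \<omega> by (auto simp: D_def intro!: bexI[of _ q])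
  qed (auto simp: D_def)
  have "{\<omega>\<in>space K. absorption_time X \<omega> < u}
    = D u \<union> (if Inf {} < u then space K - (\<Union>n::nat. D (real n)) else {})"
  proof (intro set_eqI)
    fix \<omega>
    show "\<omega> \<in> {\<omega>\<in>space K. absorption_time X \<omega> < u} \<longleftrightarrow>
      \<omega> \<in> D u \<union> (if Inf {} < u then space K - (\<Union>n::nat. D (real n)) else {})"
    proof (cases "\<omega> \<in> space K")
      case True
      define S where "S = {t. 0 \<le> t \<and> X t \<omega> = None}"
      have at: "absorption_time X \<omega> = Inf S" by (simp add: absorption_time_def S_def)
      have never: "\<omega> \<in> (\<Union>n::nat. D (real n)) \<longleftrightarrow> S \<noteq> {}"
        unfolding UN_iff D_iff[OF True] S_def using reals_Archimedean2 by blast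
      have "S \<noteq> {} \<Longrightarrow> Inf S < u \<longleftrightarrow> \<omega> \<in> D u"
        unfolding D_iff[OF True]
        by (subst cInf_less_iff) (auto simp: S_def intro: bdd_belowI)
      moreover have "S = {} \<Longrightarrow> \<omega> \<notin> D u"
        unfolding D_iff[OF True] by (auto simp: S_def)
      ultimately show ?thesis using True never at by (cases "S = {}") auto
    next
      case False
      then show ?thesis by (auto simp: D_def)
    qed
  qed
  also have "\<dots> \<in> sets K" using D by auto
  finally show "{\<omega>\<in>space K. absorption_time X \<omega> < u} \<in> sets K" .
qed

text \<open>
  Joint measurability of a right-continuous process: it is the limit of processes that are
  constant in time on the cells of a grid, evaluated at the right end of the cell.
\<close>

lemma measurable_path_indicator:
  assumes X: "\<And>t. 0 \<le> t \<Longrightarrow> X t \<in> measurable K (count_space UNIV)"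
    and jp: "\<And>\<omega>. \<omega> \<in> space K \<Longrightarrow> jump_path (\<lambda>t. X t \<omega>)"
  shows "(\<lambda>(u, \<omega>). of_bool (0 \<le> u \<and> X u \<omega> = i) :: real) \<in> borel_measurable (borel \<Otimes>\<^sub>M K)"
proof -
  \<comment> \<open>The first point after \<open>u\<close> of the grid with mesh \<open>1 / (n + 1)\<close>.\<close>
  define d where "d n u = (real (nat \<lfloor>u * real (Suc n)\<rfloor>) + 1) / real (Suc n)" for n u
  have d: "u < d n u" "d n u \<le> u + 1 / real (Suc n)" if "0 \<le> u" for n u
  proof -
    have "0 \<le> u * real (Suc n)" using that by simp
    then have "real (nat \<lfloor>u * real (Suc n)\<rfloor>) \<le> u * real (Suc n)"
      "u * real (Suc n) < real (nat \<lfloor>u * real (Suc n)\<rfloor>) + 1"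
      by (simp_all add: of_nat_nat)
    then show "u < d n u" "d n u \<le> u + 1 / real (Suc n)"
      unfolding d_def by (simp_all add: pos_less_divide_eq pos_divide_le_eq distrib_right del: of_nat_Suc)
  qed
  define h :: "nat \<Rightarrow> real \<times> 'a \<Rightarrow> real" where
    "h n = (\<lambda>x. of_bool (0 \<le> fst x \<and> X (d n (fst x)) (snd x) = i))" for n
  have "(\<lambda>x. of_bool (0 \<le> fst x \<and> X (fst x) (snd x) = i) :: real) \<in> borel_measurable (borel \<Otimes>\<^sub>M K)"
  proof (rule borel_measurable_LIMSEQ_real[where u = h])
    fix n
    have cell: "(\<lambda>x::real \<times> 'a. of_bool (0 \<le> fst x \<and> X ((real k + 1) / real (Suc n)) (snd x) = i) :: real)
        \<in> borel_measurable (borel \<Otimes>\<^sub>M K)" for k :: nat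
    proof -
      have "X ((real k + 1) / real (Suc n)) \<in> measurable K (count_space UNIV)"
        by (intro X) simp
      then have m: "(\<lambda>\<omega>. of_bool (X ((real k + 1) / real (Suc n)) \<omega> = i) :: real) \<in> borel_measurable K"
        by (rule measurable_compose) simp
      have "(\<lambda>x::real \<times> 'a. indicator {0..} (fst x) * (of_bool (X ((real k + 1) / real (Suc n)) (snd x) = i) :: real))
          \<in> borel_measurable (borel \<Otimes>\<^sub>M K)"
        by (intro borel_measurable_times measurable_compose[OF measurable_fst borel_measurable_indicator]
            measurable_compose[OF measurable_snd m]) simp
      then show ?thesis
        by (rule measurable_cong[THEN iffD1, rotated]) (auto simp: indicator_def)
    qed
    have "(\<lambda>x. (\<lambda>k x. of_bool (0 \<le> fst x \<and> X ((real k + 1) / real (Suc n)) (snd x) = i) :: real)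
        (nat \<lfloor>fst x * real (Suc n)\<rfloor>) x) \<in> borel_measurable (borel \<Otimes>\<^sub>M K)"
      by (rule measurable_compose_countable[OF cell]) measurable
    then show "h n \<in> borel_measurable (borel \<Otimes>\<^sub>M K)" by (simp add: h_def d_def)
  next
    fix x :: "real \<times> 'a" assume x: "x \<in> space (borel \<Otimes>\<^sub>M K)"
    obtain u \<omega> where x_eq: "x = (u, \<omega>)" by (cases x)
    have \<omega>: "\<omega> \<in> space K" using x by (simp add: x_eq space_pair_measure)
    show "(\<lambda>n. h n x) \<longlonglongrightarrow> of_bool (0 \<le> fst x \<and> X (fst x) (snd x) = i)"
    proof (cases "0 \<le> u")
      case True
      then obtain b where b: "b > u" "\<And>s. s > u \<Longrightarrow> s < b \<Longrightarrow> X s \<omega> = X u \<omega>"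
        using jp[OF \<omega>] by (auto simp: jump_path_def eventually_at_right_field)
      have "\<forall>\<^sub>F n in sequentially. inverse (real (Suc n)) < b - u"
        using b(1) by (intro order_tendstoD(2)[OF LIMSEQ_inverse_real_of_nat]) simp
      then have "\<forall>\<^sub>F n in sequentially. h n x = of_bool (0 \<le> fst x \<and> X (fst x) (snd x) = i)"
      proof eventually_elim
        case (elim n)
        then have "X (d n u) \<omega> = X u \<omega>"
          using d[OF True, of n] by (intro b(2)) (auto simp: inverse_eq_divide)
        then show ?case by (simp add: h_def x_eq)
      qed
      then show ?thesis by (rule tendsto_eventually)
    next
      case False
      then show ?thesis by (simp add: h_def x_eq)
    qed
  qed
  then show ?thesis by (simp add: case_prod_unfold)
qed

section \<open>The law of an absorbed Markov jump process\<close>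

lemma intensity_matrix_measurable:
  fixes A :: "real \<Rightarrow> real^'p^'p"
  assumes "sub_intensity A"
  shows "(\<lambda>u. indicator {0..} u * intensity_matrix A u $ i $ j) \<in> borel_measurable borel"
proof -
  have c: "(\<lambda>M::real^'p^'p. M $ k $ l) \<in> borel_measurable borel" for k l
    by (intro borel_measurable_continuous_onI continuous_intros)
  have "A \<in> borel_measurable (restrict_space borel {0..})" using assms by (simp add: sub_intensity_def)
  then have "(\<lambda>u. A u $ k $ l) \<in> borel_measurable (restrict_space borel {0..})" for k l
    by (rule measurable_compose[OF _ c])
  then have "(\<lambda>u. intensity_matrix A u $ i $ j) \<in> borel_measurable (restrict_space borel {0..})"
    by (cases i; cases j)
      (auto simp: intensity_matrix_def exit_rates_def matrix_vector_mult_def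
        intro!: borel_measurable_uminus borel_measurable_sum)
  then show ?thesis by (subst (asm) borel_measurable_restrict_space_iff) auto
qed

text \<open>
  Piecewise constancy of the paths makes events involving one-sided limits pointwise limits of
  events at fixed times; dominated convergence transfers this to the probabilities.
\<close>

lemma (in prob_space) prob_tendsto:
  assumes E: "\<And>n::nat. E n \<in> events" and E': "E' \<subseteq> space M"
    and ev: "\<And>\<omega>. \<omega> \<in> space M \<Longrightarrow> \<forall>\<^sub>F n in sequentially. \<omega> \<in> E n \<longleftrightarrow> \<omega> \<in> E'"
  shows "E' \<in> events" "(\<lambda>n. prob (E n)) \<longlonglongrightarrow> prob E'"
proof -
  have lim: "(\<lambda>n. indicator (E n) \<omega> :: real) \<longlonglongrightarrow> indicator E' \<omega>" if "\<omega> \<in> space M" for \<omega>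
    by (rule tendsto_eventually) (use ev[OF that] in eventually_elim, auto simp: indicator_def)
  have "(indicator E' :: _ \<Rightarrow> real) \<in> borel_measurable M"
    by (rule borel_measurable_LIMSEQ_real[OF lim]) (use E in auto)
  then show E'_ev: "E' \<in> events"
    using E' by (simp add: borel_measurable_indicator_iff Int_absorb2)
  have "(\<lambda>n. \<integral>\<omega>. indicator (E n) \<omega> \<partial>M) \<longlonglongrightarrow> (\<integral>\<omega>. (indicator E' \<omega> :: real) \<partial>M)"
    by (rule integral_dominated_convergence[where w = "\<lambda>_. 1"])
       (use E E'_ev lim in \<open>auto simp: indicator_def\<close>)
  then show "(\<lambda>n. prob (E n)) \<longlonglongrightarrow> prob E'"
    using E E'_ev by simp
qed

lemma ennreal_set_integral:
  fixes g :: "'a \<Rightarrow> real"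
  assumes "set_integrable M S g" "\<And>u. u \<in> S \<Longrightarrow> 0 \<le> g u"
  shows "ennreal (LINT u:S|M. g u) = (\<integral>\<^sup>+u. indicator S u * ennreal (g u) \<partial>M)"
proof -
  have "(\<integral>\<^sup>+u. ennreal (indicator S u *\<^sub>R g u) \<partial>M) = ennreal (LINT u:S|M. g u)"
    unfolding set_lebesgue_integral_def using assms
    by (intro nn_integral_eq_integral) (auto simp: set_integrable_def indicator_def)
  moreover have "ennreal (indicator S u *\<^sub>R g u) = indicator S u * ennreal (g u)" for u
    by (auto simp: indicator_def)
  ultimately show ?thesis by simp
qed

locale absorbed_markov_process =
  fixes M :: "'w measure" and X :: "real \<Rightarrow> 'w \<Rightarrow> 'p::finite option"
    and a :: "real^'p" and A :: "real \<Rightarrow> real^'p^'p"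
  assumes mjp: "markov_jump_process M X a A"
    and sub: "sub_intensity A" and prod: "product_integrable A"
    and absorbed: "AE \<omega> in M. \<exists>s\<ge>0. X s \<omega> = None"

sublocale absorbed_markov_process \<subseteq> prob_space M
  using mjp by (simp add: markov_jump_process_def)

context absorbed_markov_process
begin

abbreviation "L u i j \<equiv> intensity_matrix A u $ i $ j"
abbreviation "G s t i j \<equiv> product_integral (intensity_matrix A) s t $ i $ j"
abbreviation "\<tau> \<equiv> absorption_time X"

definition q :: "real \<Rightarrow> 'p option \<Rightarrow> real" where
  "q s i = measure M {\<omega>\<in>space M. X s \<omega> = i}"

definition qq :: "real \<Rightarrow> real \<Rightarrow> 'p option \<Rightarrow> 'p option \<Rightarrow> real" where
  "qq s t i j = measure M {\<omega>\<in>space M. X s \<omega> = i \<and> X t \<omega> = j}"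

lemma X_measurable: "0 \<le> t \<Longrightarrow> X t \<in> measurable M (count_space UNIV)"
  using mjp by (simp add: markov_jump_process_def)

lemma path: "\<omega> \<in> space M \<Longrightarrow> jump_path (\<lambda>t. X t \<omega>)"
  using mjp by (intro jump_pathsD) (simp_all add: markov_jump_process_def)

lemma X_sets: "0 \<le> t \<Longrightarrow> {\<omega>\<in>space M. X t \<omega> = i} \<in> sets M"
  using measurable_sets[OF X_measurable, of t "{i}"] by (simp add: vimage_def Int_def conj_commute)

lemma X_sets2: "0 \<le> s \<Longrightarrow> 0 \<le> t \<Longrightarrow> {\<omega>\<in>space M. X s \<omega> = i \<and> X t \<omega> = j} \<in> sets M"
  using sets.Int[OF X_sets[of s i] X_sets[of t j]] by (simp add: Int_def conj_ac)

lemma \<tau>_measurable [measurable]: "\<tau> \<in> borel_measurable M"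
  by (intro measurable_absorption_time X_measurable path)

lemma A_measurable: "A \<in> borel_measurable (restrict_space borel {0..})"
  using sub by (simp add: sub_intensity_def)

lemma L_nonneg: "0 \<le> u \<Longrightarrow> i \<noteq> j \<Longrightarrow> 0 \<le> L u i j"
  using sub by (simp add: sub_intensity_def)

lemma L_None [simp]: "L u None j = 0"
  by (simp add: intensity_matrix_def)

lemma L_measurable: "(\<lambda>u. indicator {0..} u * L u i j) \<in> borel_measurable borel"
  by (rule intensity_matrix_measurable[OF sub])

lemma locally_integrable: "locally_integrable_right (intensity_matrix A)"
  by (intro locally_integrable_right_intensity_matrix product_integrable_imp_locally_integrable_right
      prod A_measurable)

lemma G_solves: "0 \<le> s \<Longrightarrow> solves_product_integral (intensity_matrix A) s (product_integral (intensity_matrix A) s)"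
  by (rule product_integral_intensity_matrix(1)[OF prod A_measurable])

lemma G_block: "0 \<le> s \<Longrightarrow> s \<le> t \<Longrightarrow> product_integral (intensity_matrix A) s t = with_absorption (product_integral A s t)"
  by (rule product_integral_intensity_matrix(2)[OF prod A_measurable])

lemma G_refl: "0 \<le> s \<Longrightarrow> G s s i j = of_bool (i = j)"
  using G_solves[of s] unfolding solves_product_integral_iff_components
  by (auto simp: set_integral_singleton)

lemma G_None: "0 \<le> s \<Longrightarrow> s \<le> t \<Longrightarrow> G s t None j = of_bool (j = None)"
  by (simp add: G_block with_absorption_def)

lemma past_subalgebra: "0 \<le> s \<Longrightarrow> subalgebra M (past M X s)"
  using sets_image_in_sets[of M "space M" "\<lambda>\<omega>. \<lambda>u\<in>{0..s}. X u \<omega>" "PiM {0..s} (\<lambda>_. count_space UNIV)"]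
    measurable_restrict[of "{0..s}" X M "\<lambda>_. count_space UNIV"] X_measurable
  by (auto simp: subalgebra_def past_def)

lemma past_measurable:
  assumes "r \<in> {0..s}"
  shows "X r \<in> measurable (past M X s) (count_space UNIV)"
proof -
  have "(\<lambda>\<omega>. \<lambda>u\<in>{0..s}. X u \<omega>) \<in> measurable (past M X s) (PiM {0..s} (\<lambda>_. count_space UNIV))"
    unfolding past_def by (rule measurable_vimage_algebra1) (auto simp: space_PiM)
  from measurable_compose[OF this measurable_component_singleton[OF assms]]
  show ?thesis using assms by simp
qed

text \<open>
  The Markov property is used in this integrated form only: the conditional expectation given the
  past is integrated over the event that the process is in \<open>h\<close> at time \<open>r\<close> and in \<open>i\<close> at time \<open>s\<close>.
\<close>

lemma markov_three_times:
  assumes "0 \<le> r" "r \<le> s" "s \<le> t"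
  shows "measure M {\<omega>\<in>space M. X r \<omega> = h \<and> X s \<omega> = i \<and> X t \<omega> = j} = qq r s h i * G s t i j"
proof -
  define B where "B = {\<omega>\<in>space M. X r \<omega> = h \<and> X s \<omega> = i}"
  define C where "C = {\<omega>\<in>space M. X t \<omega> = j}"
  interpret sub: finite_measure_subalgebra M "past M X s"
    by standard (use past_subalgebra assms in auto)
  have "B = (X r -` {h} \<inter> space (past M X s)) \<inter> (X s -` {i} \<inter> space (past M X s))"
    by (auto simp: B_def past_def)
  then have B: "B \<in> sets (past M X s)"
    using assms by (auto intro!: sets.Int measurable_sets[OF past_measurable])
  then have BM: "B \<in> sets M" using sub.subalg by (auto simp: subalgebra_def)
  have C: "C \<in> sets M" unfolding C_def using assms by (intro X_sets) auto
  have "measure M (B \<inter> C) = (\<integral>\<omega>\<in>B. indicator C \<omega> \<partial>M)"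
    using BM C by (simp add: set_lebesgue_integral_def indicator_inter_arith[symmetric])
  also have "\<dots> = (\<integral>\<omega>\<in>B. real_cond_exp M (past M X s) (indicator C) \<omega> \<partial>M)"
    using B C by (intro sub.real_cond_exp_intA) (auto simp: integrable_indicator_iff emeasure_eq_measure)
  also have "\<dots> = (\<integral>\<omega>. indicator B \<omega> * G s t i j \<partial>M)"
    unfolding set_lebesgue_integral_def
  proof (rule integral_cong_AE)
    have [measurable]: "B \<in> sets M" by (rule BM)
    show "(\<lambda>\<omega>. indicator B \<omega> *\<^sub>R real_cond_exp M (past M X s) (indicator C) \<omega>) \<in> borel_measurable M"
      "(\<lambda>\<omega>. indicator B \<omega> * G s t i j) \<in> borel_measurable M"
      by measurable
    have "AE \<omega> in M. real_cond_exp M (past M X s) (indicator C) \<omega>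
        = product_integral (intensity_matrix A) s t $ X s \<omega> $ j"
      using mjp assms unfolding markov_jump_process_def C_def by auto
    then show "AE \<omega> in M. indicator B \<omega> *\<^sub>R real_cond_exp M (past M X s) (indicator C) \<omega>
        = indicator B \<omega> * G s t i j"
      by eventually_elim (auto simp: indicator_def B_def)
  qed
  also have "\<dots> = measure M B * G s t i j" using BM by simp
  also have "B \<inter> C = {\<omega>\<in>space M. X r \<omega> = h \<and> X s \<omega> = i \<and> X t \<omega> = j}"
    by (auto simp: B_def C_def)
  finally show ?thesis by (simp add: qq_def B_def)
qed

lemma qq_refl: "qq s s i i = q s i"
  by (simp add: q_def qq_def)

lemma qq_eq: "0 \<le> s \<Longrightarrow> s \<le> t \<Longrightarrow> qq s t i j = q s i * G s t i j"
  using markov_three_times[of s s t i i j] by (simp add: qq_refl, simp add: qq_def)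

lemma q_bounds: "0 \<le> q s i" "q s i \<le> 1"
  by (simp_all add: q_def)

lemma qq_nonneg: "0 \<le> qq s t i j"
  by (simp add: qq_def)

lemma sum_qq: "0 \<le> s \<Longrightarrow> 0 \<le> t \<Longrightarrow> (\<Sum>i\<in>UNIV. qq s t i j) = q t j"
proof -
  assume st: "0 \<le> s" "0 \<le> t"
  have "{\<omega>\<in>space M. X t \<omega> = j} = (\<Union>i. {\<omega>\<in>space M. X s \<omega> = i \<and> X t \<omega> = j})" by auto
  then show ?thesis
    unfolding q_def qq_def
    by (simp add: finite_measure_finite_Union[symmetric] X_sets2 st disjoint_family_on_def)
      (subst finite_measure_finite_Union[symmetric]; auto simp: X_sets2 st disjoint_family_on_def)
qed

lemma qq_le: "0 \<le> s \<Longrightarrow> 0 \<le> t \<Longrightarrow> qq s t i j \<le> q t j"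
  unfolding q_def qq_def by (intro finite_measure_mono X_sets) auto

lemma qq_le': "0 \<le> s \<Longrightarrow> 0 \<le> t \<Longrightarrow> qq s t i j \<le> q s i"
  unfolding q_def qq_def by (intro finite_measure_mono X_sets) auto

lemma q_0: "q 0 (Some i) = a $ i" and q_0_None: "q 0 None = 0"
  using mjp by (auto simp: q_def markov_jump_process_def)

lemma q_eq: "0 \<le> s \<Longrightarrow> q s (Some i) = (a v* product_integral A 0 s) $ i"
proof -
  assume s: "0 \<le> s"
  have "q s (Some i) = (\<Sum>k\<in>UNIV. q 0 k * G 0 s k (Some i))"
    using sum_qq[of 0 s "Some i"] s by (simp add: qq_eq)
  also have "\<dots> = (\<Sum>k\<in>UNIV. a $ k * product_integral A 0 s $ k $ i)"
    using s by (simp add: sum_UNIV_option q_0 q_0_None G_block with_absorption_def)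
  finally show ?thesis by (simp add: vector_matrix_mult_def mult.commute)
qed

text \<open>
  The forward equation, multiplied by the probability of the starting state.
\<close>

lemma qq_increment:
  assumes "0 \<le> s" "s \<le> r" "r \<le> t"
  shows "set_integrable lborel {r..t} (\<lambda>u. \<Sum>k\<in>UNIV. qq s u i k * L u k j)"
    and "qq s t i j = qq s r i j + (LINT u:{r..t}|lborel. \<Sum>k\<in>UNIV. qq s u i k * L u k j)"
proof -
  have eq: "(\<Sum>k\<in>UNIV. qq s u i k * L u k j) = q s i * (\<Sum>k\<in>UNIV. G s u i k * L u k j)" if "s \<le> u" for u
    using that assms(1) by (simp add: qq_eq sum_distrib_left mult.assoc)
  note inc = solution_increment[OF G_solves[OF assms(1)] assms(2,3), of i j]
  show "set_integrable lborel {r..t} (\<lambda>u. \<Sum>k\<in>UNIV. qq s u i k * L u k j)"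
    using inc(1) assms by (subst set_integrable_cong[OF refl refl eq]) auto
  have "(LINT u:{r..t}|lborel. \<Sum>k\<in>UNIV. qq s u i k * L u k j)
    = (LINT u:{r..t}|lborel. q s i * (\<Sum>k\<in>UNIV. G s u i k * L u k j))"
    using assms by (intro set_lebesgue_integral_cong) (auto simp: eq)
  then show "qq s t i j = qq s r i j + (LINT u:{r..t}|lborel. \<Sum>k\<in>UNIV. qq s u i k * L u k j)"
    using inc(2) assms by (simp add: qq_eq distrib_left)
qed

lemma q_increment:
  assumes "0 \<le> r" "r \<le> t"
  shows "set_integrable lborel {r..t} (\<lambda>u. \<Sum>k\<in>UNIV. q u k * L u k j)"
    and "q t j = q r j + (LINT u:{r..t}|lborel. \<Sum>k\<in>UNIV. q u k * L u k j)"
proof -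
  have eq: "(\<Sum>k\<in>UNIV. q u k * L u k j) = (\<Sum>i\<in>UNIV. \<Sum>k\<in>UNIV. qq 0 u i k * L u k j)" if "0 \<le> u" for u
    by (subst sum.swap) (simp add: sum_distrib_right[symmetric] sum_qq that)
  note inc = qq_increment[OF order_refl assms]
  show "set_integrable lborel {r..t} (\<lambda>u. \<Sum>k\<in>UNIV. q u k * L u k j)"
    using set_integral_sum(1)[OF inc(1)] assms
    by (subst set_integrable_cong[OF refl refl eq]) auto
  have "(LINT u:{r..t}|lborel. \<Sum>k\<in>UNIV. q u k * L u k j)
    = (\<Sum>i\<in>UNIV. LINT u:{r..t}|lborel. \<Sum>k\<in>UNIV. qq 0 u i k * L u k j)"
    unfolding set_integral_sum(2)[OF inc(1), symmetric]
    using assms by (intro set_lebesgue_integral_cong) (auto simp: eq)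
  then show "q t j = q r j + (LINT u:{r..t}|lborel. \<Sum>k\<in>UNIV. q u k * L u k j)"
  proof -
    have "(\<Sum>i\<in>UNIV. qq 0 t i j)
      = (\<Sum>i\<in>UNIV. qq 0 r i j + (LINT u:{r..t}|lborel. \<Sum>k\<in>UNIV. qq 0 u i k * L u k j))"
      by (intro sum.cong refl inc(2))
    also have "\<dots> = q r j + (\<Sum>i\<in>UNIV. LINT u:{r..t}|lborel. \<Sum>k\<in>UNIV. qq 0 u i k * L u k j)"
      using assms by (simp add: sum.distrib sum_qq)
    finally show ?thesis
      using assms \<open>(LINT u:{r..t}|lborel. \<Sum>k\<in>UNIV. q u k * L u k j) = _\<close> by (simp add: sum_qq)
  qed
qed

lemma continuous_qq: "0 \<le> s \<Longrightarrow> continuous_on {s..b} (\<lambda>t. qq s t i j)"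
  by (subst continuous_on_cong[OF refl, of _ _ "\<lambda>t. q s i * G s t i j"])
     (auto intro!: continuous_intros continuous_on_solution G_solves simp: qq_eq)

lemma continuous_q: "continuous_on {0..b} (\<lambda>t. q t j)"
proof -
  have "continuous_on {0..b} (\<lambda>t. \<Sum>i\<in>UNIV. qq 0 t i j)"
    by (intro continuous_intros continuous_qq) auto
  then show ?thesis
    by (subst continuous_on_cong[OF refl, of _ _ "\<lambda>t. \<Sum>i\<in>UNIV. qq 0 t i j"]) (auto simp: sum_qq)
qed

text \<open>
  For two fixed times this is the row of the absorbing state in the transition matrix. Countably many pairs of
  rational times suffice, because the paths are right-continuous.
\<close>

lemma absorbing: "AE \<omega> in M. \<forall>s\<ge>0. \<forall>t\<ge>s. X s \<omega> = None \<longrightarrow> X t \<omega> = None"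
proof -
  have zero: "AE \<omega> in M. X s \<omega> = None \<longrightarrow> X t \<omega> = None" if "0 \<le> s" "s \<le> t" for s t
  proof -
    have "AE \<omega> in M. \<omega> \<notin> {\<omega>\<in>space M. X s \<omega> = None \<and> X t \<omega> = Some i}" for i
    proof -
      have "qq s t None (Some i) = 0" using that by (simp add: qq_eq G_None)
      then show ?thesis
        using that by (subst prob_eq_0[symmetric]) (auto simp: qq_def intro!: X_sets2)
    qed
    then have "AE \<omega> in M. \<forall>i. \<omega> \<notin> {\<omega>\<in>space M. X s \<omega> = None \<and> X t \<omega> = Some i}"
      by (subst AE_all_countable) auto
    then show ?thesis
      using AE_space
    proof eventually_elim
      case (elim \<omega>)
      then show ?case by (cases "X t \<omega>") auto
    qed
  qed
  let ?R = "{p\<in>\<rat> \<times> \<rat>. 0 \<le> fst p \<and> fst p \<le> snd p} :: (real \<times> real) set"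
  have "countable ?R"
    by (rule countable_subset[of _ "\<rat> \<times> \<rat>"]) (auto intro: countable_SIGMA countable_rat)
  then have "AE \<omega> in M. \<forall>p\<in>?R. X (fst p) \<omega> = None \<longrightarrow> X (snd p) \<omega> = None"
    using zero by (subst AE_ball_countable) auto
  then show ?thesis
    using AE_space
  proof eventually_elim
    case (elim \<omega>)
    have right: "\<exists>b>t. \<forall>u. t < u \<longrightarrow> u < b \<longrightarrow> X u \<omega> = X t \<omega>" if "0 \<le> t" for t
      using path[OF elim(2)] that by (auto simp: jump_path_def eventually_at_right_field)
    show ?case
    proof (intro allI impI)
      fix s t :: real assume st: "0 \<le> s" "s \<le> t" "X s \<omega> = None"
      show "X t \<omega> = None"
      proof (cases "s = t")
        case False
        then have "s < t" using st by simp
        obtain b where b: "b > s" "\<And>u. s < u \<Longrightarrow> u < b \<Longrightarrow> X u \<omega> = X s \<omega>"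
          using right[OF st(1)] by auto
        obtain c where c: "c > t" "\<And>u. t < u \<Longrightarrow> u < c \<Longrightarrow> X u \<omega> = X t \<omega>"
          using right[of t] st by auto
        obtain x where x: "x \<in> \<rat>" "s < x" "x < min b t"
          using Rats_dense_in_real[of s "min b t"] b \<open>s < t\<close> by auto
        obtain y where y: "y \<in> \<rat>" "t < y" "y < c"
          using Rats_dense_in_real[of t c] c by auto
        have "X x \<omega> = None" using b(2)[of x] x st by simp
        moreover have "(x, y) \<in> ?R" using x y st by auto
        ultimately have "X y \<omega> = None" using elim(1) by force
        then show ?thesis using c(2)[of y] y by simp
      qed (use st in simp)
    qed
  qed
qed

text \<open>
  The infimum is attained by right continuity, and it is positive because the initial distribution
  does not charge the absorbing state.
\<close>

lemma \<tau>_characterization: "AE \<omega> in M. 0 < \<tau> \<omega> \<and> (\<forall>t\<ge>0. X t \<omega> = None \<longleftrightarrow> \<tau> \<omega> \<le> t)"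
proof -
  have "AE \<omega> in M. \<omega> \<notin> {\<omega>\<in>space M. X 0 \<omega> = None}"
    using q_0_None by (subst prob_eq_0[symmetric]) (auto simp: q_def intro!: X_sets)
  then show ?thesis
    using absorbing absorbed AE_space
  proof eventually_elim
    case (elim \<omega>)
    define S where "S = {t. 0 \<le> t \<and> X t \<omega> = None}"
    have ne: "S \<noteq> {}" using elim(3) by (auto simp: S_def)
    have bd: "bdd_below S" by (auto simp: S_def intro: bdd_belowI)
    have at: "\<tau> \<omega> = Inf S" by (simp add: absorption_time_def S_def)
    have nonneg: "0 \<le> \<tau> \<omega>" unfolding at using ne by (rule cInf_greatest) (auto simp: S_def)
    have le: "\<tau> \<omega> \<le> t" if "0 \<le> t" "X t \<omega> = None" for t
      unfolding at using that bd by (intro cInf_lower) (auto simp: S_def)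
    have after: "X t \<omega> = None" if t: "\<tau> \<omega> < t" for t
    proof -
      obtain s where "s \<in> S" "s < t" using t cInf_lessD[OF ne, of t] unfolding at by auto
      then show ?thesis using elim(2) by (auto simp: S_def)
    qed
    obtain b where b: "b > \<tau> \<omega>" "\<And>u. \<tau> \<omega> < u \<Longrightarrow> u < b \<Longrightarrow> X u \<omega> = X (\<tau> \<omega>) \<omega>"
      using path[OF elim(4)] nonneg by (auto simp: jump_path_def eventually_at_right_field)
    have at_tau: "X (\<tau> \<omega>) \<omega> = None"
      using b(2)[of "(\<tau> \<omega> + b) / 2"] after[of "(\<tau> \<omega> + b) / 2"] b(1) by simp
    have "\<tau> \<omega> \<noteq> 0" using at_tau elim(1,4) by auto
    then show ?case
      using nonneg le after at_tau by (metis less_eq_real_def)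
  qed
qed

subsection \<open>The density of the absorption time\<close>

text \<open>
  Joint density, at \<open>w\<close>, of the event \<open>X s = i\<close> and the time of absorption: the flux into the
  absorbing state from paths that were in \<open>i\<close> at time \<open>s\<close>.
\<close>

definition joint_density :: "real \<Rightarrow> real \<Rightarrow> 'p option \<Rightarrow> real" where
  "joint_density s w i = (\<Sum>k\<in>UNIV. qq s w i k * L w k None)"

definition tau_density :: "real \<Rightarrow> real" where
  "tau_density w = (\<Sum>k\<in>UNIV. q w k * L w k None)"

text \<open>
  Fubini's theorem; measurability in both times comes from the joint measurability of the process.
\<close>

lemma qq_measurable:
  "(\<lambda>x. if 0 \<le> fst x \<and> 0 \<le> snd x then qq (fst x) (snd x) i j else 0) \<in> borel_measurable (borel \<Otimes>\<^sub>M borel)"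
proof -
  have m: "(\<lambda>p. of_bool (0 \<le> fst p \<and> X (fst p) (snd p) = k) :: real) \<in> borel_measurable (borel \<Otimes>\<^sub>M M)" for k
    using measurable_path_indicator[OF X_measurable path, of k] by (simp add: case_prod_unfold)
  have m1: "(\<lambda>p::(real \<times> real) \<times> 'w. of_bool (0 \<le> fst (fst p) \<and> X (fst (fst p)) (snd p) = i) :: real)
      \<in> borel_measurable ((borel \<Otimes>\<^sub>M borel) \<Otimes>\<^sub>M M)"
    using measurable_compose[OF _ m[of i], of "\<lambda>p. (fst (fst p), snd p)" "(borel \<Otimes>\<^sub>M borel) \<Otimes>\<^sub>M M"]
    by simp
  have m2: "(\<lambda>p::(real \<times> real) \<times> 'w. of_bool (0 \<le> snd (fst p) \<and> X (snd (fst p)) (snd p) = j) :: real)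
      \<in> borel_measurable ((borel \<Otimes>\<^sub>M borel) \<Otimes>\<^sub>M M)"
    using measurable_compose[OF _ m[of j], of "\<lambda>p. (snd (fst p), snd p)" "(borel \<Otimes>\<^sub>M borel) \<Otimes>\<^sub>M M"]
    by simp
  have "(\<lambda>x. \<integral>\<omega>. (of_bool (0 \<le> fst x \<and> X (fst x) \<omega> = i) * of_bool (0 \<le> snd x \<and> X (snd x) \<omega> = j) :: real) \<partial>M)
      \<in> borel_measurable (borel \<Otimes>\<^sub>M borel)"
    using borel_measurable_times[OF m1 m2]
    by (intro borel_measurable_lebesgue_integral) (simp add: case_prod_unfold)
  moreover have "(\<integral>\<omega>. (of_bool (0 \<le> fst x \<and> X (fst x) \<omega> = i) * of_bool (0 \<le> snd x \<and> X (snd x) \<omega> = j) :: real) \<partial>M)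
      = (if 0 \<le> fst x \<and> 0 \<le> snd x then qq (fst x) (snd x) i j else 0)" for x :: "real \<times> real"
  proof (cases "0 \<le> fst x \<and> 0 \<le> snd x")
    case True
    have "(\<integral>\<omega>. (of_bool (0 \<le> fst x \<and> X (fst x) \<omega> = i) * of_bool (0 \<le> snd x \<and> X (snd x) \<omega> = j) :: real) \<partial>M)
      = (\<integral>\<omega>. indicator {\<omega>\<in>space M. X (fst x) \<omega> = i \<and> X (snd x) \<omega> = j} \<omega> \<partial>M)"
      using True by (intro Bochner_Integration.integral_cong) (auto simp: indicator_def)
    then show ?thesis using True by (simp add: qq_def X_sets2)
  qed auto
  ultimately show ?thesis by simp
qed

lemma q_measurable: "(\<lambda>w. if 0 \<le> w then q w i else 0) \<in> borel_measurable borel"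
proof -
  have "(\<lambda>w. (w, w)) \<in> measurable borel (borel \<Otimes>\<^sub>M borel :: (real \<times> real) measure)" by simp
  from measurable_compose[OF this qq_measurable[of i i]] show ?thesis
    by (simp add: qq_refl cong: if_cong)
qed

lemma q_nonneg_L: "0 \<le> w \<Longrightarrow> 0 \<le> L w k None"
  by (cases k) (auto intro: L_nonneg)

lemma joint_density_nonneg: "0 \<le> w \<Longrightarrow> 0 \<le> joint_density s w i"
  unfolding joint_density_def by (intro sum_nonneg mult_nonneg_nonneg qq_nonneg q_nonneg_L)

lemma tau_density_nonneg: "0 \<le> w \<Longrightarrow> 0 \<le> tau_density w"
  unfolding tau_density_def by (intro sum_nonneg mult_nonneg_nonneg q_bounds q_nonneg_L)

lemma joint_density_le: "0 \<le> s \<Longrightarrow> 0 \<le> w \<Longrightarrow> joint_density s w i \<le> tau_density w"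
  unfolding joint_density_def tau_density_def by (intro sum_mono mult_right_mono qq_le q_nonneg_L)

lemma tau_density_measurable [measurable]: "(\<lambda>w. indicator {0..} w * tau_density w) \<in> borel_measurable borel"
proof -
  have "indicator {0..} w * tau_density w
      = (\<Sum>k\<in>UNIV. (if 0 \<le> w then q w k else 0) * (indicator {0..} w * L w k None))" for w
    by (simp add: tau_density_def indicator_def)
  then show ?thesis
    by (simp, intro borel_measurable_sum borel_measurable_times q_measurable L_measurable)
qed

lemma joint_density_measurable:
  "(\<lambda>x. if 0 \<le> fst x \<and> 0 \<le> snd x then joint_density (fst x) (snd x) i else 0) \<in> borel_measurable (borel \<Otimes>\<^sub>M borel)"
proof -
  have "(if 0 \<le> fst x \<and> 0 \<le> snd x then joint_density (fst x) (snd x) i else 0)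
    = (\<Sum>k\<in>UNIV. (if 0 \<le> fst x \<and> 0 \<le> snd x then qq (fst x) (snd x) i k else 0)
        * (indicator {0..} (snd x) * L (snd x) k None))" for x
    by (simp add: joint_density_def indicator_def)
  then show ?thesis
    by (simp, intro borel_measurable_sum borel_measurable_times qq_measurable
        measurable_compose[OF measurable_snd L_measurable])
qed

text \<open>
  Absorption before \<open>v\<close> means \<open>X v = None\<close>, whose probability jointly with \<open>X s = i\<close> is given by
  the forward equation at the absorbing state. If \<open>v < s\<close>, a process in a transient state at time
  \<open>s\<close> has not been absorbed by \<open>v\<close>.
\<close>

lemma emeasure_absorbed_by:
  assumes "0 \<le> s" "i \<noteq> None"
  shows "emeasure M {\<omega>\<in>space M. X s \<omega> = i \<and> \<tau> \<omega> \<le> v}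
    = (\<integral>\<^sup>+w. indicator {s..v} w * ennreal (joint_density s w i) \<partial>lborel)"
proof (cases "s \<le> v")
  case True
  have "emeasure M {\<omega>\<in>space M. X s \<omega> = i \<and> \<tau> \<omega> \<le> v} = emeasure M {\<omega>\<in>space M. X s \<omega> = i \<and> X v \<omega> = None}"
  proof (rule emeasure_eq_AE)
    show "AE \<omega> in M. (\<omega> \<in> {\<omega>\<in>space M. X s \<omega> = i \<and> \<tau> \<omega> \<le> v}) = (\<omega> \<in> {\<omega>\<in>space M. X s \<omega> = i \<and> X v \<omega> = None})"
      using \<tau>_characterization by eventually_elim (use assms True in auto)
    have "{\<omega>\<in>space M. X s \<omega> = i \<and> \<tau> \<omega> \<le> v} = {\<omega>\<in>space M. X s \<omega> = i} \<inter> {\<omega>\<in>space M. \<tau> \<omega> \<le> v}" by auto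
    also have "\<dots> \<in> sets M" using X_sets[OF assms(1)] by (intro sets.Int) auto
    finally show "{\<omega>\<in>space M. X s \<omega> = i \<and> \<tau> \<omega> \<le> v} \<in> sets M" .
  qed (use X_sets2 assms True in auto)
  also have "\<dots> = ennreal (qq s v i None)"
    by (simp add: emeasure_eq_measure qq_def)
  also have "qq s v i None = (LINT w:{s..v}|lborel. joint_density s w i)"
    using qq_increment(2)[OF assms(1) order_refl True, of i None] assms
    by (simp add: joint_density_def qq_eq G_refl)
  also have "ennreal \<dots> = (\<integral>\<^sup>+w. indicator {s..v} w * ennreal (joint_density s w i) \<partial>lborel)"
    using qq_increment(1)[OF assms(1) order_refl True, of i None] assms
    by (intro ennreal_set_integral) (auto simp: joint_density_def[symmetric] joint_density_nonneg)
  finally show ?thesis .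
next
  case False
  have "AE \<omega> in M. \<not> (X s \<omega> = i \<and> \<tau> \<omega> \<le> v)"
    using \<tau>_characterization
  proof eventually_elim
    case (elim \<omega>)
    show ?case
    proof
      assume "X s \<omega> = i \<and> \<tau> \<omega> \<le> v"
      moreover from this have "\<tau> \<omega> \<le> s" using False by simp
      then have "X s \<omega> = None" using elim assms(1) by blast
      ultimately show False using assms(2) by simp
    qed
  qed
  then have "emeasure M {\<omega>\<in>space M. X s \<omega> = i \<and> \<tau> \<omega> \<le> v} = 0"
    by (rule emeasure_eq_0_AE)
  then show ?thesis using False by simp
qed

lemma emeasure_\<tau>_le:
  "emeasure M {\<omega>\<in>space M. \<tau> \<omega> \<le> v} = (\<integral>\<^sup>+w. indicator {..v} w * ennreal (indicator {0..} w * tau_density w) \<partial>lborel)"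
proof (cases "0 \<le> v")
  case True
  have "emeasure M {\<omega>\<in>space M. \<tau> \<omega> \<le> v} = emeasure M {\<omega>\<in>space M. X v \<omega> = None}"
  proof (rule emeasure_eq_AE)
    show "AE \<omega> in M. (\<omega> \<in> {\<omega>\<in>space M. \<tau> \<omega> \<le> v}) = (\<omega> \<in> {\<omega>\<in>space M. X v \<omega> = None})"
      using \<tau>_characterization by eventually_elim (use True in auto)
  qed (use X_sets True in auto)
  also have "\<dots> = ennreal (q v None)" by (simp add: emeasure_eq_measure q_def)
  also have "q v None = (LINT w:{0..v}|lborel. tau_density w)"
    using q_increment(2)[OF order_refl True, of None] by (simp add: tau_density_def q_0_None)
  also have "ennreal \<dots> = (\<integral>\<^sup>+w. indicator {0..v} w * ennreal (tau_density w) \<partial>lborel)"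
    using q_increment(1)[OF order_refl True, of None]
    by (intro ennreal_set_integral) (auto simp: tau_density_def[symmetric] tau_density_nonneg)
  also have "\<dots> = (\<integral>\<^sup>+w. indicator {..v} w * ennreal (indicator {0..} w * tau_density w) \<partial>lborel)"
    by (intro nn_integral_cong) (auto simp: indicator_def)
  finally show ?thesis .
next
  case False
  have "AE \<omega> in M. \<not> \<tau> \<omega> \<le> v"
    using \<tau>_characterization by eventually_elim (use False in auto)
  then have "emeasure M {\<omega>\<in>space M. \<tau> \<omega> \<le> v} = 0"
    by (rule emeasure_eq_0_AE)
  moreover have "(\<integral>\<^sup>+w. indicator {..v} w * ennreal (indicator {0..} w * tau_density w) \<partial>lborel) = (\<integral>\<^sup>+w. 0 \<partial>(lborel :: real measure))"
    using False by (intro nn_integral_cong) (auto simp: indicator_def)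
  ultimately show ?thesis by simp
qed

lemma distr_\<tau>: "distr M borel \<tau> = density lborel (\<lambda>w. ennreal (indicator {0..} w * tau_density w))"
proof (rule measure_eqI_atMost)
  have D: "emeasure (distr M borel \<tau>) {..v} = emeasure M {\<omega>\<in>space M. \<tau> \<omega> \<le> v}" for v
    by (subst emeasure_distr) (auto simp: vimage_def Int_def conj_commute)
  show "emeasure (distr M borel \<tau>) {..v} = emeasure (density lborel (\<lambda>w. ennreal (indicator {0..} w * tau_density w))) {..v}" for v
    unfolding D emeasure_\<tau>_le by (subst emeasure_density) (auto simp: mult.commute)
  show "emeasure (distr M borel \<tau>) {..v} < \<infinity>" for v
    unfolding D by (simp add: emeasure_eq_measure)
qed auto

lemma nn_integral_\<tau>:
  assumes [measurable]: "g \<in> borel_measurable borel"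
  shows "(\<integral>\<^sup>+\<omega>. g (\<tau> \<omega>) \<partial>M) = (\<integral>\<^sup>+w. g w * ennreal (indicator {0..} w * tau_density w) \<partial>lborel)"
proof -
  have "(\<integral>\<^sup>+\<omega>. g (\<tau> \<omega>) \<partial>M) = (\<integral>\<^sup>+w. g w \<partial>distr M borel \<tau>)"
    by (subst nn_integral_distr) auto
  also have "\<dots> = (\<integral>\<^sup>+w. ennreal (indicator {0..} w * tau_density w) * g w \<partial>lborel)"
    unfolding distr_\<tau> by (subst nn_integral_density) auto
  finally show ?thesis by (simp add: mult.commute)
qed

text \<open>
  Quotients by the density of \<open>\<tau>\<close> are only ever integrated against the law of \<open>\<tau>\<close>. The default
  value \<open>c / 0 = 0\<close> is harmless as long as the numerator vanishes as well.
\<close>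

lemma divide_times_tau_density:
  assumes "0 \<le> c" "0 \<le> w" "tau_density w = 0 \<Longrightarrow> c = 0"
  shows "ennreal (c / tau_density w) * ennreal (tau_density w) = ennreal c"
  using assms tau_density_nonneg[of w]
  by (cases "tau_density w = 0") (auto simp: ennreal_mult[symmetric])

text \<open>
  Conditional probability of \<open>X s = i\<close> given \<open>\<tau> = w\<close>. The absorbing state is treated separately
  because its occupation given \<open>\<tau> = w\<close> is deterministic.
\<close>

definition occ_density :: "real \<Rightarrow> 'p option \<Rightarrow> real \<Rightarrow> real" where
  "occ_density s i w = (if 0 \<le> s \<and> s < w \<and> i \<noteq> None then joint_density s w i / tau_density w else 0)"

lemma occ_density_nonneg: "0 \<le> occ_density s i w"
  by (auto simp: occ_density_def intro!: divide_nonneg_nonneg joint_density_nonneg tau_density_nonneg)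

lemma occ_density_measurable:
  "(\<lambda>x. occ_density (fst x) i (snd x)) \<in> borel_measurable (borel \<Otimes>\<^sub>M borel)"
proof -
  have [measurable]: "(\<lambda>x. if 0 \<le> fst x \<and> 0 \<le> snd x then joint_density (fst x) (snd x) i else 0)
      \<in> borel_measurable (borel \<Otimes>\<^sub>M borel)"
    by (rule joint_density_measurable)
  have "(\<lambda>x::real \<times> real. if 0 \<le> fst x \<and> fst x < snd x \<and> i \<noteq> None
      then (if 0 \<le> fst x \<and> 0 \<le> snd x then joint_density (fst x) (snd x) i else 0)
        / (indicator {0..} (snd x) * tau_density (snd x)) else 0) \<in> borel_measurable (borel \<Otimes>\<^sub>M borel)"
    by measurable
  also have "(\<lambda>x::real \<times> real. if 0 \<le> fst x \<and> fst x < snd x \<and> i \<noteq> None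
      then (if 0 \<le> fst x \<and> 0 \<le> snd x then joint_density (fst x) (snd x) i else 0)
        / (indicator {0..} (snd x) * tau_density (snd x)) else 0) = (\<lambda>x. occ_density (fst x) i (snd x))"
    by (auto simp: occ_density_def fun_eq_iff)
  finally show ?thesis .
qed

text \<open>
  Bayes' formula: multiplying by the density of \<open>\<tau>\<close> recovers the joint density.
\<close>

lemma occupation_and_absorption:
  assumes "0 \<le> s" "i \<noteq> None"
  shows "emeasure M {\<omega>\<in>space M. X s \<omega> = i \<and> \<tau> \<omega> \<le> v}
    = (\<integral>\<^sup>+\<omega>. ennreal (occ_density s i (\<tau> \<omega>)) * indicator {..v} (\<tau> \<omega>) \<partial>M)"
proof -
  have "(\<lambda>w. (s, w)) \<in> measurable borel (borel \<Otimes>\<^sub>M borel)" by simp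
  from measurable_compose[OF this occ_density_measurable]
  have [measurable]: "(\<lambda>w. occ_density s i w) \<in> borel_measurable borel" by simp
  have "(\<integral>\<^sup>+\<omega>. ennreal (occ_density s i (\<tau> \<omega>)) * indicator {..v} (\<tau> \<omega>) \<partial>M)
    = (\<integral>\<^sup>+w. ennreal (occ_density s i w) * indicator {..v} w * ennreal (indicator {0..} w * tau_density w) \<partial>lborel)"
    by (rule nn_integral_\<tau>) measurable
  also have "\<dots> = (\<integral>\<^sup>+w. indicator {s..v} w * ennreal (joint_density s w i) \<partial>lborel)"
  proof (rule nn_integral_cong_AE)
    show "AE w in lborel. ennreal (occ_density s i w) * indicator {..v} w * ennreal (indicator {0..} w * tau_density w)
      = indicator {s..v} w * ennreal (joint_density s w i)"
      using AE_lborel_singleton[of s]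
    proof eventually_elim
      case (elim w)
      show ?case
      proof (cases "s < w \<and> w \<le> v")
        case True
        have "tau_density w = 0 \<Longrightarrow> joint_density s w i = 0"
          using joint_density_le[of s w i] joint_density_nonneg[of w s i] True assms by auto
        then have "ennreal (joint_density s w i / tau_density w) * ennreal (tau_density w) = ennreal (joint_density s w i)"
          using True assms by (intro divide_times_tau_density joint_density_nonneg) auto
        then show ?thesis using True assms by (auto simp: occ_density_def)
      qed (use elim in \<open>auto simp: occ_density_def indicator_def\<close>)
    qed
  qed
  finally show ?thesis using emeasure_absorbed_by[OF assms] by simp
qed

text \<open>
  The Markov property at time \<open>s\<close> factorizes the joint density into the probability of \<open>X s = i\<close>
  and the density of absorption at \<open>w\<close> for a process started from \<open>i\<close> at time \<open>s\<close>.
\<close>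

lemma joint_density_eq:
  assumes "0 \<le> s" "s \<le> w"
  shows "joint_density s w (Some i) = ((a v* product_integral A 0 s) \<bullet> axis i 1)
    * (axis i 1 \<bullet> (product_integral A s w *v exit_rates A w))"
proof -
  have "joint_density s w (Some i) = q s (Some i) * (\<Sum>k\<in>UNIV. product_integral A s w $ i $ k * exit_rates A w $ k)"
    using assms by (simp add: joint_density_def sum_UNIV_option qq_eq G_block with_absorption_def
        intensity_matrix_def sum_distrib_left mult.assoc)
  then show ?thesis
    using assms by (simp add: q_eq inner_axis inner_axis' matrix_vector_mult_def)
qed

lemma tau_density_eq: "0 \<le> w \<Longrightarrow> tau_density w = absorption_density a A w"
  by (simp add: tau_density_def sum_UNIV_option q_eq absorption_density_def inner_vec_def intensity_matrix_def)

subsection \<open>Behaviour on a time interval with integrable intensities\<close>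

text \<open>
  A common bound for all entries of the intensity matrix; it serves as the dominating function
  in all limits along grids.
\<close>

definition total_intensity :: "real \<Rightarrow> real" where
  "total_intensity u = (\<Sum>k\<in>UNIV. \<Sum>l\<in>UNIV. \<bar>L u k l\<bar>)"

lemma total_intensity_nonneg: "0 \<le> total_intensity u"
  unfolding total_intensity_def by (intro sum_nonneg) auto

lemma ex_total_intensity_integrable:
  assumes "0 \<le> s" "0 < c"
  obtains e where "0 < e" "set_integrable lborel {s..s+e} total_intensity" "(LINT u:{s..s+e}|lborel. total_intensity u) < c"
proof -
  from locally_integrable assms(1) obtain d where d: "d > 0"
    "\<And>i j. set_integrable lborel {s..s+d} (\<lambda>u. L u i j)"
    unfolding locally_integrable_right_def by blast
  have int: "set_integrable lborel {s..s+d} total_intensity"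
    unfolding total_intensity_def by (intro set_integral_sum(1) set_integrable_abs d)
  then obtain e where "0 < e" "e \<le> d" "(LINT u:{s..s+e}|lborel. total_intensity u) < c"
    using ex_small_set_integral[OF int d(1) assms(2)] by blast
  then show ?thesis
    by (intro that[of e] set_integrable_subset[OF int]) auto
qed

lemma weighted_sum_le_total_intensity:
  assumes "\<And>k. \<bar>w k\<bar> \<le> c"
  shows "\<bar>\<Sum>k\<in>UNIV. w k * L u k j\<bar> \<le> c * total_intensity u"
proof -
  have "0 \<le> c" using assms[of None] by simp
  have "\<bar>\<Sum>k\<in>UNIV. w k * L u k j\<bar> \<le> (\<Sum>k\<in>UNIV. \<bar>w k\<bar> * \<bar>L u k j\<bar>)"
    by (rule order_trans[OF sum_abs]) (simp add: abs_mult)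
  also have "\<dots> \<le> (\<Sum>k\<in>UNIV. c * (\<Sum>l\<in>UNIV. \<bar>L u k l\<bar>))"
    using assms \<open>0 \<le> c\<close>
    by (intro sum_mono mult_mono member_le_sum[of j UNIV "\<lambda>l. \<bar>L u _ l\<bar>"]) auto
  finally show ?thesis by (simp add: total_intensity_def sum_distrib_left)
qed

text \<open>
  In a short time the process moves with probability at most the integral of the total intensity.
\<close>

lemma qq_drift:
  assumes st: "0 \<le> s" "s \<le> t" and int: "set_integrable lborel {s..t} total_intensity"
  shows "\<bar>qq s t i j - of_bool (i = j) * q s i\<bar> \<le> q s i * (LINT u:{s..t}|lborel. total_intensity u)"
proof -
  have "qq s t i j - of_bool (i = j) * q s i = (LINT u:{s..t}|lborel. \<Sum>k\<in>UNIV. qq s u i k * L u k j)"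
    using qq_increment(2)[OF st(1) order_refl st(2), of i j] st by (simp add: qq_eq G_refl)
  also have "\<bar>\<dots>\<bar> \<le> (LINT u:{s..t}|lborel. q s i * total_intensity u)"
    using st by (intro abs_set_integral_le qq_increment(1) set_integrable_mult_right int weighted_sum_le_total_intensity)
      (auto simp: qq_nonneg intro: qq_le')
  finally show ?thesis by simp
qed

lemma q_drift:
  assumes st: "0 \<le> s" "s \<le> t" and int: "set_integrable lborel {s..t} total_intensity"
  shows "\<bar>q t j - q s j\<bar> \<le> (LINT u:{s..t}|lborel. total_intensity u)"
proof -
  have "q t j - q s j = (LINT u:{s..t}|lborel. \<Sum>k\<in>UNIV. q u k * L u k j)"
    using q_increment(2)[OF st, of j] by simp
  also have "\<bar>\<dots>\<bar> \<le> (LINT u:{s..t}|lborel. 1 * total_intensity u)"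
    using st int by (intro abs_set_integral_le q_increment(1) weighted_sum_le_total_intensity) (auto simp: q_bounds)
  finally show ?thesis by simp
qed

text \<open>
  On a short interval, a state of positive probability keeps a positive probability, since it is
  left with probability less than one. So if the state has probability zero at some time of the
  interval, it does so from the beginning of the interval up to the last such time \<open>z\<close>. On that part
  the probability of the state is constantly zero, hence the forward equation expresses \<open>0\<close> as an
  integral of the nonnegative rates of influx, which vanish almost everywhere.
\<close>

lemma AE_no_influx_to_null_state:
  assumes "i \<noteq> j"
  shows "AE u in lborel. 0 \<le> u \<and> q u j = 0 \<longrightarrow> q u i * L u i j = 0"
proof -
  let ?Z = "\<lambda>u. q u j = 0 \<longrightarrow> q u i * L u i j = 0"
  have "AE u in lborel. 0 \<le> u \<and> u \<le> t \<longrightarrow> ?Z u" if "0 \<le> t" for t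
    using that
  proof (induction rule: right_induct)
    case base
    then show ?case using AE_lborel_singleton[of 0] by eventually_elim auto
  next
    case (right r)
    obtain d where d: "0 < d" "set_integrable lborel {r..r+d} total_intensity" "(LINT u:{r..r+d}|lborel. total_intensity u) < 1"
      using ex_total_intensity_integrable[OF right(1), of 1] by auto
    have persist: "0 < q t j" if "r \<le> s" "s \<le> t" "t \<le> r + d" "0 < q s j" for s t
    proof -
      have int: "set_integrable lborel {s..t} total_intensity"
        using that by (intro set_integrable_subset[OF d(2)]) auto
      have "(LINT u:{s..t}|lborel. total_intensity u) \<le> (LINT u:{r..r+d}|lborel. total_intensity u)"
      proof -
        have "set_integrable lborel {r..t} total_intensity"
          using that by (intro set_integrable_subset[OF d(2)]) auto
        then show ?thesis
          using set_integral_split[of r t total_intensity s] set_integral_split[OF d(2), of t] that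
            set_integral_nonneg[of "{r..s}" total_intensity lborel] set_integral_nonneg[of "{t..r+d}" total_intensity lborel] total_intensity_nonneg
          by simp
      qed
      then have lt: "q s j * (LINT u:{s..t}|lborel. total_intensity u) < q s j"
        using that d(3) by simp
      have "\<bar>qq s t j j - q s j\<bar> \<le> q s j * (LINT u:{s..t}|lborel. total_intensity u)"
        using qq_drift[OF _ _ int, of j j] that right(1) by simp
      with lt have "0 < qq s t j j" by linarith
      also have "\<dots> \<le> q t j" using that right(1) by (intro qq_le) auto
      finally show ?thesis .
    qed
    define Z where "Z = {u\<in>{r..r+d}. q u j = 0}"
    have "AE u in lborel. u \<in> {r..r+d} \<longrightarrow> ?Z u"
    proof (cases "Z = {}")
      case True
      then show ?thesis by (auto simp: Z_def)
    next
      case False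
      have "compact Z"
      proof -
        have "closed Z"
          unfolding Z_def using right(1)
          by (intro continuous_closed_preimage_constant continuous_on_subset[OF continuous_q[of "r+d" j]]) auto
        moreover have "{r..r+d} \<inter> Z = Z" by (auto simp: Z_def)
        ultimately show ?thesis using compact_Int_closed[OF compact_Icc, of Z r "r + d"] by simp
      qed
      \<comment> \<open>The last time in the interval at which the state has probability zero.\<close>
      then obtain z where z: "z \<in> Z" "\<And>u. u \<in> Z \<Longrightarrow> u \<le> z"
        using compact_attains_sup[OF _ False] by blast
      have null: "q u j = 0" if "r \<le> u" "u \<le> z" for u
        using persist[OF that(1,2)] z(1) q_bounds(1)[of u j] by (force simp: Z_def)
      have rz: "r \<le> z" using z(1) by (simp add: Z_def)
      let ?h = "\<lambda>u. \<Sum>k\<in>UNIV. q u k * L u k j"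
      have nonneg: "0 \<le> q u k * L u k j" if "r \<le> u" "u \<le> z" for u k
        using null[OF that] L_nonneg[of u k j] q_bounds(1)[of u k] that right(1) by (cases "k = j") auto
      have "(LINT u:{r..z}|lborel. ?h u) = 0"
        using q_increment(2)[OF right(1) rz, of j] null[of r] null[of z] rz by simp
      then have "AE u in lborel. indicator {r..z} u *\<^sub>R ?h u = 0"
        unfolding set_lebesgue_integral_def
        by (subst (asm) integral_nonneg_eq_0_iff_AE)
           (use q_increment(1)[OF right(1) rz, of j] nonneg in
             \<open>auto simp: set_integrable_def indicator_def intro!: sum_nonneg\<close>)
      then show ?thesis
      proof eventually_elim
        case (elim u)
        show ?case
        proof (intro impI)
          assume "u \<in> {r..r+d}" "q u j = 0"
          then have "u \<in> Z" by (simp add: Z_def)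
          then have u: "r \<le> u" "u \<le> z" using z(2) by (auto simp: Z_def)
          then have "?h u = 0" using elim by simp
          then show "q u i * L u i j = 0"
            using nonneg[OF u] by (simp add: sum_nonneg_eq_0_iff)
        qed
      qed
    qed
    with right(2) have all: "AE u in lborel. 0 \<le> u \<and> u \<le> r + d \<longrightarrow> ?Z u"
      by eventually_elim auto
    have "AE u in lborel. 0 \<le> u \<and> u \<le> t \<longrightarrow> ?Z u" if "t \<in> {r..r+d}" for t
      using all by eventually_elim (use that in auto)
    then show ?case using d(1) by blast
  next
    case (left r)
    have "AE u in lborel. \<forall>n::nat. 0 \<le> u \<and> u \<le> max 0 (r - 1 / Suc n) \<longrightarrow> ?Z u"
      by (subst AE_all_countable) (intro allI left(2); use left(1) in auto)
    then show ?case
      using AE_lborel_singleton[of r]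
    proof eventually_elim
      case (elim u)
      show ?case
      proof
        assume u: "0 \<le> u \<and> u \<le> r"
        then have "0 < r - u" using elim(2) by simp
        then obtain n where "1 / Suc n < r - u" using nat_approx_posE by blast
        then have "u \<le> max 0 (r - 1 / Suc n)" by simp
        with elim(1) u show "?Z u" by blast
      qed
    qed
  qed
  then have "AE u in lborel. \<forall>n::nat. 0 \<le> u \<and> u \<le> real n \<longrightarrow> ?Z u"
    by (subst AE_all_countable) auto
  then show ?thesis
  proof eventually_elim
    case (elim u)
    then show ?case using real_arch_simple[of u] by blast
  qed
qed

subsection \<open>No jumps at fixed times\<close>

text \<open>
  Let \<open>b n\<close> increase to \<open>s\<close>. The probability that the left limit at \<open>s\<close> is \<open>i\<close> while \<open>X s = j\<close> is the
  limit of \<open>P(X (b n) = i, X s = j)\<close>. Since the transition probabilities are continuous in the later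
  time, \<open>X s = j\<close> may be replaced by the event that the left limit is \<open>j\<close>; but two different left
  limits are impossible.
\<close>

lemma no_fixed_jump:
  assumes s: "0 < s"
  shows "AE \<omega> in M. s \<notin> jump_times (\<lambda>t. X t \<omega>)"
proof -
  define b where "b n = s - s / real (Suc (Suc n))" for n
  have b: "0 < b n" "b n < s" for n
    using s by (auto simp: b_def pos_divide_less_eq)
  have "(\<lambda>n. s / real (Suc (Suc n))) \<longlonglongrightarrow> 0"
    using LIMSEQ_Suc[OF LIMSEQ_Suc[OF lim_const_over_n[of s]]] .
  then have b_lim: "b \<longlonglongrightarrow> s"
    unfolding b_def using tendsto_diff[OF tendsto_const[of s]] by fastforce
  have b_left: "filterlim b (at_left s) sequentially"
    by (intro tendsto_imp_filterlim_at_left b_lim) (simp add: b)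
  define E where "E j = {\<omega>\<in>space M. \<forall>\<^sub>F u in at_left s. X u \<omega> = j}" for j
  have E: "\<forall>\<^sub>F n in sequentially. X (b n) \<omega> = j \<longleftrightarrow> \<omega> \<in> E j" if \<omega>: "\<omega> \<in> space M" for \<omega> j
  proof -
    from path[OF \<omega>] s obtain i where i: "\<forall>\<^sub>F u in at_left s. X u \<omega> = i"
      by (auto simp: jump_path_def)
    have "\<omega> \<in> E j \<longleftrightarrow> i = j"
      using i \<omega> eventually_at_left_unique[OF i, of j] by (auto simp: E_def)
    moreover have "\<forall>\<^sub>F n in sequentially. X (b n) \<omega> = i"
      by (rule eventually_compose_filterlim[OF i b_left])
    ultimately show ?thesis by (auto elim: eventually_mono)
  qed
  have "prob {\<omega>\<in>space M. \<omega> \<in> E i \<and> X s \<omega> = j} = 0 \<and> {\<omega>\<in>space M. \<omega> \<in> E i \<and> X s \<omega> = j} \<in> events"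
    if "i \<noteq> j" for i j
  proof -
    have lim1: "{\<omega>\<in>space M. \<omega> \<in> E i \<and> X s \<omega> = j} \<in> events"
      "(\<lambda>n. qq (b n) s i j) \<longlonglongrightarrow> prob {\<omega>\<in>space M. \<omega> \<in> E i \<and> X s \<omega> = j}"
      unfolding qq_def
    proof -
      have 1: "{\<omega>\<in>space M. X (b n) \<omega> = i \<and> X s \<omega> = j} \<in> events" for n
        using b s by (intro X_sets2) (simp_all add: less_imp_le)
      have 2: "\<forall>\<^sub>F n in sequentially. \<omega> \<in> {\<omega>\<in>space M. X (b n) \<omega> = i \<and> X s \<omega> = j}
          \<longleftrightarrow> \<omega> \<in> {\<omega>\<in>space M. \<omega> \<in> E i \<and> X s \<omega> = j}" if "\<omega> \<in> space M" for \<omega>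
        using E[OF that, of i] by eventually_elim simp
      show "{\<omega>\<in>space M. \<omega> \<in> E i \<and> X s \<omega> = j} \<in> events"
        "(\<lambda>n. prob {\<omega>\<in>space M. X (b n) \<omega> = i \<and> X s \<omega> = j}) \<longlonglongrightarrow> prob {\<omega>\<in>space M. \<omega> \<in> E i \<and> X s \<omega> = j}"
        by (rule prob_tendsto[OF 1 _ 2]; blast)+
    qed
    \<comment> \<open>Continuity of \<open>t \<mapsto> qq (b n) t i j\<close> at \<open>s\<close>: the state
        at time \<open>s\<close> may be replaced by the left limit.\<close>
    have eq: "qq (b n) s i j = prob {\<omega>\<in>space M. \<omega> \<in> E j \<and> X (b n) \<omega> = i}" for n
    proof (rule LIMSEQ_unique)
      have sets: "{\<omega>\<in>space M. X (b n) \<omega> = i \<and> X (b m) \<omega> = j} \<in> events" for m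
        using b by (intro X_sets2) (simp_all add: less_imp_le)
      have ev: "\<forall>\<^sub>F m in sequentially. \<omega> \<in> {\<omega>\<in>space M. X (b n) \<omega> = i \<and> X (b m) \<omega> = j}
          \<longleftrightarrow> \<omega> \<in> {\<omega>\<in>space M. \<omega> \<in> E j \<and> X (b n) \<omega> = i}" if "\<omega> \<in> space M" for \<omega>
        using E[OF that, of j] by eventually_elim auto
      show "(\<lambda>m. qq (b n) (b m) i j) \<longlonglongrightarrow> prob {\<omega>\<in>space M. \<omega> \<in> E j \<and> X (b n) \<omega> = i}"
        unfolding qq_def by (rule prob_tendsto(2)[OF sets _ ev]) blast
      have "\<forall>\<^sub>F m in sequentially. b m \<in> {b n..s}"
        using order_tendstoD(1)[OF b_lim b(2)[of n]]
        by eventually_elim (use b in \<open>auto simp: less_imp_le\<close>)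
      then show "(\<lambda>m. qq (b n) (b m) i j) \<longlonglongrightarrow> qq (b n) s i j"
        using b[of n] by (intro continuous_on_tendsto_compose[OF continuous_qq[of "b n" s] b_lim])
          (auto simp: less_imp_le)
    qed
    have sets: "{\<omega>\<in>space M. \<omega> \<in> E j \<and> X (b n) \<omega> = i} \<in> events" for n
    proof -
      have "E j \<in> events"
      proof (rule prob_tendsto(1))
        show "{\<omega>\<in>space M. X (b n) \<omega> = j} \<in> events" for n
          using b by (intro X_sets) (simp add: less_imp_le)
        show "\<forall>\<^sub>F n in sequentially. \<omega> \<in> {\<omega>\<in>space M. X (b n) \<omega> = j} \<longleftrightarrow> \<omega> \<in> E j"
          if "\<omega> \<in> space M" for \<omega>
          using E[OF that, of j] by eventually_elim (simp add: that)
      qed (simp add: E_def)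
      then have "E j \<inter> {\<omega>\<in>space M. X (b n) \<omega> = i} \<in> events"
        using b[of n] by (intro sets.Int X_sets) (simp_all add: less_imp_le)
      moreover have "E j \<inter> {\<omega>\<in>space M. X (b n) \<omega> = i} = {\<omega>\<in>space M. \<omega> \<in> E j \<and> X (b n) \<omega> = i}"
        by (auto simp: E_def)
      ultimately show ?thesis by simp
    qed
    have ev: "\<forall>\<^sub>F n in sequentially. \<omega> \<in> {\<omega>\<in>space M. \<omega> \<in> E j \<and> X (b n) \<omega> = i}
        \<longleftrightarrow> \<omega> \<in> {\<omega>\<in>space M. \<omega> \<in> E j \<and> \<omega> \<in> E i}" if "\<omega> \<in> space M" for \<omega>
      using E[OF that, of i] by eventually_elim simp
    have "(\<lambda>n. prob {\<omega>\<in>space M. \<omega> \<in> E j \<and> X (b n) \<omega> = i}) \<longlonglongrightarrow> prob {\<omega>\<in>space M. \<omega> \<in> E j \<and> \<omega> \<in> E i}"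
      by (rule prob_tendsto(2)[OF sets _ ev]) blast
    moreover have "{\<omega>\<in>space M. \<omega> \<in> E j \<and> \<omega> \<in> E i} = {}"
    proof -
      have "\<not> (\<omega> \<in> E j \<and> \<omega> \<in> E i)" for \<omega>
        using that eventually_at_left_unique[of "\<lambda>u. X u \<omega>" j s i] by (auto simp: E_def)
      then show ?thesis by blast
    qed
    ultimately have "(\<lambda>n. qq (b n) s i j) \<longlonglongrightarrow> 0" unfolding eq by simp
    then show ?thesis using lim1 LIMSEQ_unique by blast
  qed
  then have "AE \<omega> in M. \<omega> \<notin> {\<omega>\<in>space M. \<omega> \<in> E i \<and> X s \<omega> = j}" if "i \<noteq> j" for i j
    using that prob_eq_0 by blast
  then have "AE \<omega> in M. \<forall>i j. i \<noteq> j \<longrightarrow> \<omega> \<notin> {\<omega>\<in>space M. \<omega> \<in> E i \<and> X s \<omega> = j}"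
    by (subst AE_all_countable, intro allI, subst AE_all_countable) auto
  then show ?thesis
    using AE_space
  proof eventually_elim
    case (elim \<omega>)
    from path[OF elim(2)] s obtain i where i: "\<forall>\<^sub>F u in at_left s. X u \<omega> = i"
      by (auto simp: jump_path_def)
    then have "i = X s \<omega>" using elim by (auto simp: E_def)
    then show ?case using i by (simp add: jump_times_def)
  qed
qed

subsection \<open>The expected number of jumps on an interval with integrable intensities\<close>

text \<open>
  The conditional law of the state at time \<open>v\<close>, given that the process is in \<open>j\<close> at time \<open>u\<close>;
  it is set to zero if the process is almost surely not in \<open>j\<close> at that time.
\<close>

definition H :: "real \<Rightarrow> real \<Rightarrow> 'p option \<Rightarrow> 'p option \<Rightarrow> real" where
  "H u v j k = (if 0 < q u j then qq u v j k / q u j else 0)"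

lemma H_bounds: "0 \<le> u \<Longrightarrow> 0 \<le> v \<Longrightarrow> 0 \<le> H u v j k" "0 \<le> u \<Longrightarrow> 0 \<le> v \<Longrightarrow> H u v j k \<le> 1"
  by (auto simp: H_def qq_nonneg qq_le' divide_le_eq_1)

text \<open>
  In the earlier time the joint probabilities are only right-continuous a priori, by right
  continuity of the paths.
\<close>

lemma qq_right_continuous:
  assumes "0 \<le> u" "0 \<le> v" and d: "\<And>n::nat. u < d n" "d \<longlonglongrightarrow> u"
  shows "(\<lambda>n. qq (d n) v j k) \<longlonglongrightarrow> qq u v j k"
  unfolding qq_def
proof (rule prob_tendsto(2))
  have right: "filterlim d (at_right u) sequentially"
    by (intro tendsto_imp_filterlim_at_right d) (simp add: d)
  show "{\<omega>\<in>space M. X (d n) \<omega> = j \<and> X v \<omega> = k} \<in> events" for n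
    using assms(1,2) d(1)[of n] by (intro X_sets2) auto
  show "\<forall>\<^sub>F n in sequentially. \<omega> \<in> {\<omega>\<in>space M. X (d n) \<omega> = j \<and> X v \<omega> = k}
      \<longleftrightarrow> \<omega> \<in> {\<omega>\<in>space M. X u \<omega> = j \<and> X v \<omega> = k}" if "\<omega> \<in> space M" for \<omega>
  proof -
    have "\<forall>\<^sub>F s in at_right u. X s \<omega> = X u \<omega>"
      using path[OF that] assms(1) by (auto simp: jump_path_def)
    from eventually_compose_filterlim[OF this right] show ?thesis
      by eventually_elim simp
  qed
qed auto

text \<open>
  If \<open>X d = j\<close> has probability zero, both sides vanish, so that the default value in \<open>H\<close> is
  immaterial.
\<close>

lemma cell_probability:
  assumes "0 \<le> c" "c \<le> d" "d \<le> v" "i \<noteq> j"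
  shows "measure M {\<omega>\<in>space M. X c \<omega> = i \<and> X d \<omega> = j \<and> X v \<omega> = k}
    = (LINT u:{c..d}|lborel. (\<Sum>l\<in>UNIV. qq c u i l * L u l j) * H d v j k)"
proof -
  have "qq c d i j * G d v j k = qq c d i j * H d v j k"
  proof (cases "q d j = 0")
    case True
    then have "qq c d i j = 0"
      using qq_le[of c d i j] qq_nonneg[of c d i j] assms by simp
    then show ?thesis by simp
  next
    case False
    then have "0 < q d j" using q_bounds(1)[of d j] by simp
    then show ?thesis using assms by (simp add: H_def qq_eq)
  qed
  moreover have "qq c d i j = (LINT u:{c..d}|lborel. \<Sum>l\<in>UNIV. qq c u i l * L u l j)"
    using qq_increment(2)[OF assms(1) order_refl assms(2), of i j] assms by (simp add: qq_eq G_refl)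
  ultimately show ?thesis
    using markov_three_times[of c d v i j k] assms by simp
qed

definition njumps :: "'p option \<Rightarrow> 'p option \<Rightarrow> real \<Rightarrow> real \<Rightarrow> 'w \<Rightarrow> real" where
  "njumps i j \<alpha> \<beta> \<omega> = real (card (jumps (\<lambda>t. X t \<omega>) i j \<inter> {\<alpha><..\<beta>}))"

lemma njumps_measurable: "0 \<le> \<alpha> \<Longrightarrow> \<alpha> \<le> \<beta> \<Longrightarrow> i \<noteq> j \<Longrightarrow> njumps i j \<alpha> \<beta> \<in> borel_measurable M"
  using measurable_card_jumps[of X M \<alpha> \<beta> i j] X_measurable path by (simp add: njumps_def[abs_def])

definition ncells :: "'p option \<Rightarrow> 'p option \<Rightarrow> real \<Rightarrow> real \<Rightarrow> nat \<Rightarrow> 'w \<Rightarrow> real" where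
  "ncells i j \<alpha> \<beta> n \<omega> = real (cell_count (\<lambda>t. X t \<omega>) i j \<alpha> \<beta> n)"

lemma ncells_eq:
  assumes "\<omega> \<in> space M"
  shows "ncells i j \<alpha> \<beta> n \<omega>
    = (\<Sum>k<n. indicator {\<omega>\<in>space M. X (grid \<alpha> \<beta> n k) \<omega> = i \<and> X (grid \<alpha> \<beta> n (Suc k)) \<omega> = j} \<omega>)"
  unfolding ncells_def cell_count_def of_nat_sum
  using assms by (intro sum.cong) (auto simp: indicator_def)

lemma ncells_measurable: "0 \<le> \<alpha> \<Longrightarrow> \<alpha> \<le> \<beta> \<Longrightarrow> ncells i j \<alpha> \<beta> n \<in> borel_measurable M"
proof -
  assume ab: "0 \<le> \<alpha>" "\<alpha> \<le> \<beta>"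
  have "(\<lambda>\<omega>. \<Sum>k<n. indicator {\<omega>\<in>space M. X (grid \<alpha> \<beta> n k) \<omega> = i \<and> X (grid \<alpha> \<beta> n (Suc k)) \<omega> = j} \<omega> :: real)
      \<in> borel_measurable M"
    using ab by (intro borel_measurable_sum borel_measurable_indicator X_sets2) (auto intro: order_trans[OF _ grid_ge])
  then show ?thesis by (subst measurable_cong[OF ncells_eq])
qed

lemma ncells_tendsto:
  assumes "\<omega> \<in> space M" "0 \<le> \<alpha>" "\<alpha> \<le> \<beta>" "i \<noteq> j"
  shows "(\<lambda>n. ncells i j \<alpha> \<beta> n \<omega>) \<longlonglongrightarrow> njumps i j \<alpha> \<beta> \<omega>"
  using eventually_cell_count_eq[OF path[OF assms(1)] assms(2-)]
  by (intro tendsto_eventually) (auto elim!: eventually_mono simp: ncells_def njumps_def)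

text \<open>
  Fatou's lemma: the expected counts along grids are bounded by the integral of the total
  intensity.
\<close>

lemma integrable_njumps:
  assumes ab: "0 \<le> \<alpha>" "\<alpha> \<le> \<beta>" and int: "set_integrable lborel {\<alpha>..\<beta>} total_intensity" and "i \<noteq> j"
  shows "integrable M (njumps i j \<alpha> \<beta>)"
proof -
  have grid0: "0 \<le> grid \<alpha> \<beta> n k" for n k using ab(1) grid_ge[OF ab(2), of n k] by linarith
  have cells: "(\<integral>\<^sup>+\<omega>. ennreal (ncells i j \<alpha> \<beta> n \<omega>) \<partial>M) \<le> ennreal (LINT u:{\<alpha>..\<beta>}|lborel. total_intensity u)" for n
  proof (cases "n = 0")
    case False
    let ?g = "grid \<alpha> \<beta> n"
    have mono: "?g k \<le> ?g l" if "k \<le> l" for k l using that ab by (intro grid_mono)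
    have sub: "set_integrable lborel {?g k..?g (Suc k)} total_intensity" if "k < n" for k
      using grid_ge[OF ab(2), of n k] grid_le[OF ab(2), of "Suc k" n] that
      by (intro set_integrable_subset[OF int]) auto
    have int': "set_integrable lborel {?g 0..?g n} total_intensity" using False int by simp
    have "(\<integral>\<^sup>+\<omega>. ennreal (ncells i j \<alpha> \<beta> n \<omega>) \<partial>M)
      = (\<integral>\<^sup>+\<omega>. (\<Sum>k<n. indicator {\<omega>\<in>space M. X (?g k) \<omega> = i \<and> X (?g (Suc k)) \<omega> = j} \<omega>) \<partial>M)"
      by (intro nn_integral_cong) (simp add: ncells_eq sum_ennreal[symmetric] ennreal_indicator)
    also have "\<dots> = (\<Sum>k<n. ennreal (qq (?g k) (?g (Suc k)) i j))"
      using grid0 X_sets2 by (subst nn_integral_sum) (auto simp: emeasure_eq_measure qq_def)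
    also have "\<dots> \<le> (\<Sum>k<n. ennreal (LINT u:{?g k..?g (Suc k)}|lborel. total_intensity u))"
    proof (intro sum_mono ennreal_leI)
      fix k assume "k \<in> {..<n}"
      then have int: "set_integrable lborel {?g k..?g (Suc k)} total_intensity" using sub by simp
      have I: "0 \<le> (LINT u:{?g k..?g (Suc k)}|lborel. total_intensity u)"
        by (intro set_integral_nonneg total_intensity_nonneg)
      have "qq (?g k) (?g (Suc k)) i j \<le> q (?g k) i * (LINT u:{?g k..?g (Suc k)}|lborel. total_intensity u)"
        using qq_drift[OF grid0 mono int, of i j] \<open>i \<noteq> j\<close> by simp
      also have "\<dots> \<le> 1 * (LINT u:{?g k..?g (Suc k)}|lborel. total_intensity u)"
        by (intro mult_right_mono q_bounds I)
      finally show "qq (?g k) (?g (Suc k)) i j \<le> (LINT u:{?g k..?g (Suc k)}|lborel. total_intensity u)" by simp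
    qed
    also have "\<dots> = ennreal (\<Sum>k<n. LINT u:{?g k..?g (Suc k)}|lborel. total_intensity u)"
      by (intro sum_ennreal set_integral_nonneg total_intensity_nonneg)
    also have "\<dots> = ennreal (LINT u:{\<alpha>..\<beta>}|lborel. total_intensity u)"
      using sum_integral_cells[of ?g n total_intensity, OF mono int'] False by simp
    finally show ?thesis .
  qed (simp add: ncells_def cell_count_def)
  have "(\<integral>\<^sup>+\<omega>. ennreal (njumps i j \<alpha> \<beta> \<omega>) \<partial>M) = (\<integral>\<^sup>+\<omega>. liminf (\<lambda>n. ennreal (ncells i j \<alpha> \<beta> n \<omega>)) \<partial>M)"
    by (intro nn_integral_cong lim_imp_Liminf[symmetric] tendsto_ennrealI ncells_tendsto ab \<open>i \<noteq> j\<close>) auto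
  also have "\<dots> \<le> liminf (\<lambda>n. \<integral>\<^sup>+\<omega>. ennreal (ncells i j \<alpha> \<beta> n \<omega>) \<partial>M)"
    using ncells_measurable[OF ab] by (intro nn_integral_liminf) auto
  also have "\<dots> \<le> ennreal (LINT u:{\<alpha>..\<beta>}|lborel. total_intensity u)"
    using cells by (intro Liminf_le) auto
  finally have "(\<integral>\<^sup>+\<omega>. ennreal (njumps i j \<alpha> \<beta> \<omega>) \<partial>M) < \<infinity>"
    by (rule le_less_trans) simp
  then show ?thesis
    using njumps_measurable[OF ab \<open>i \<noteq> j\<close>] by (intro integrableI_nonneg) (auto simp: njumps_def)
qed

text \<open>
  Every cell counted contains a jump, though possibly between other states than \<open>i\<close> and \<open>j\<close>. This
  gives an integrable bound on the counts that does not depend on the grid.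
\<close>

lemma ncells_le_total:
  assumes "\<omega> \<in> space M" "0 \<le> \<alpha>" "\<alpha> \<le> \<beta>" "i \<noteq> j"
  shows "ncells i j \<alpha> \<beta> n \<omega> \<le> (\<Sum>(k, l)\<in>{(k, l). k \<noteq> l}. njumps k l \<alpha> \<beta> \<omega>)"
proof -
  let ?x = "\<lambda>t. X t \<omega>"
  have p: "jump_path ?x" by (rule path[OF assms(1)])
  have "jump_times ?x \<inter> {\<alpha><..\<beta>} \<subseteq> (\<Union>(k, l)\<in>{(k, l). k \<noteq> l}. jumps ?x k l \<inter> {\<alpha><..\<beta>})"
  proof
    fix s assume s: "s \<in> jump_times ?x \<inter> {\<alpha><..\<beta>}"
    then have "0 < s" by (simp add: jump_times_def)
    with p obtain k where k: "\<forall>\<^sub>F u in at_left s. ?x u = k" by (auto simp: jump_path_def)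
    then have "s \<in> jumps ?x k (?x s)" using \<open>0 < s\<close> by (simp add: jumps_def)
    moreover have "k \<noteq> ?x s" using k s by (auto simp: jump_times_def)
    ultimately show "s \<in> (\<Union>(k, l)\<in>{(k, l). k \<noteq> l}. jumps ?x k l \<inter> {\<alpha><..\<beta>})" using s by auto
  qed
  then have "card (jump_times ?x \<inter> {\<alpha><..\<beta>}) \<le> card (\<Union>(k, l)\<in>{(k, l). k \<noteq> l}. jumps ?x k l \<inter> {\<alpha><..\<beta>})"
    by (intro card_mono) (auto intro!: finite_jumps[OF p])
  also have "\<dots> \<le> (\<Sum>(k, l)\<in>{(k, l). k \<noteq> l}. card (jumps ?x k l \<inter> {\<alpha><..\<beta>}))"
    by (rule order_trans[OF card_UN_le]) (auto simp: case_prod_unfold)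
  finally have "card (jump_times ?x \<inter> {\<alpha><..\<beta>}) \<le> (\<Sum>(k, l)\<in>{(k, l). k \<noteq> l}. card (jumps ?x k l \<inter> {\<alpha><..\<beta>}))" .
  with cell_count_le[OF p assms(2-), of n]
  have "cell_count ?x i j \<alpha> \<beta> n \<le> (\<Sum>(k, l)\<in>{(k, l). k \<noteq> l}. card (jumps ?x k l \<inter> {\<alpha><..\<beta>}))" by linarith
  then have "real (cell_count ?x i j \<alpha> \<beta> n) \<le> real (\<Sum>(k, l)\<in>{(k, l). k \<noteq> l}. card (jumps ?x k l \<inter> {\<alpha><..\<beta>}))"
    by (simp only: of_nat_le_iff)
  then show ?thesis
    by (simp add: ncells_def njumps_def case_prod_unfold)
qed

text \<open>
  By \<open>cell_probability\<close>, the expected count along a grid, on the event \<open>X v = k\<close>, is the integral of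
  the function \<open>\<Psi> n\<close>, whose value at \<open>u\<close> is determined by the cell \<open>[c, d)\<close> that contains \<open>u\<close>:
  \<open>(\<Sum>l. P(X c = i, X u = l) L u l j) P(X v = k | X d = j)\<close>. As the grid is refined, \<open>c\<close> and \<open>d\<close> tend
  to \<open>u\<close> from the left and from the right. The first factor tends to \<open>P(X u = i) L u i j\<close> by
  \<open>qq_drift\<close>, the second one by right continuity, provided that \<open>X u = j\<close> has positive probability; at
  the other times the first factor tends to zero by \<open>AE_no_influx_to_null_state\<close> and the second one is
  bounded. The total intensity dominates the integrands, the total number of jumps dominates the
  counts.
\<close>

lemma expected_jumps_local:
  assumes ab: "0 \<le> \<alpha>" "\<alpha> \<le> \<beta>" "\<beta> \<le> v" and int: "set_integrable lborel {\<alpha>..\<beta>} total_intensity" and "i \<noteq> j"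
  shows "set_integrable lborel {\<alpha>..\<beta>} (\<lambda>u. q u i * L u i j * H u v j k)"
    and "(\<integral>\<omega>. njumps i j \<alpha> \<beta> \<omega> * indicator {\<omega>\<in>space M. X v \<omega> = k} \<omega> \<partial>M)
      = (LINT u:{\<alpha>..\<beta>}|lborel. q u i * L u i j * H u v j k)"
proof -
  let ?V = "{\<omega>\<in>space M. X v \<omega> = k}"
  let ?limit = "\<lambda>u. indicator {\<alpha>..\<beta>} u *\<^sub>R (q u i * L u i j * H u v j k)"
  have V: "?V \<in> events" using ab by (intro X_sets) auto
  have grid0: "0 \<le> grid \<alpha> \<beta> n m" for n m using ab(1) grid_ge[OF ab(2), of n m] by linarith
  have mono: "grid \<alpha> \<beta> n m \<le> grid \<alpha> \<beta> n m'" if "m \<le> m'" for n m m' using that ab by (intro grid_mono)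
  define \<Phi> where "\<Phi> c d u = (\<Sum>l\<in>UNIV. qq c u i l * L u l j) * H d v j k" for c d u
  define \<Psi> where "\<Psi> n u = (\<Sum>m<Suc n. indicator {grid \<alpha> \<beta> (Suc n) m..<grid \<alpha> \<beta> (Suc n) (Suc m)} u
      * \<Phi> (grid \<alpha> \<beta> (Suc n) m) (grid \<alpha> \<beta> (Suc n) (Suc m)) u)" for n u
  have \<Phi>_int: "set_integrable lborel {c..d} (\<Phi> c d)" if "0 \<le> c" "c \<le> d" for c d
    unfolding \<Phi>_def using that by (intro set_integrable_mult_left qq_increment(1)) auto
  have \<Phi>_int': "integrable lborel (\<lambda>u. indicator {c..<d} u * \<Phi> c d u)"
    "(\<integral>u. indicator {c..<d} u * \<Phi> c d u \<partial>lborel) = (LINT u:{c..d}|lborel. \<Phi> c d u)" if "0 \<le> c" "c \<le> d" for c d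
  proof -
    have 1: "set_integrable lborel {c..<d} (\<Phi> c d)"
      by (rule set_integrable_subset[OF \<Phi>_int[OF that]]) auto
    then show "integrable lborel (\<lambda>u. indicator {c..<d} u * \<Phi> c d u)" by (simp add: set_integrable_def)
    have "(LINT u:{c..<d}|lborel. \<Phi> c d u) = (LINT u:{c..d}|lborel. \<Phi> c d u)"
      unfolding set_lebesgue_integral_def
    proof (rule integral_cong_AE)
      show "AE u in lborel. indicator {c..<d} u *\<^sub>R \<Phi> c d u = indicator {c..d} u *\<^sub>R \<Phi> c d u"
        using AE_lborel_singleton[of d] by eventually_elim (auto simp: indicator_def)
    qed (use 1 \<Phi>_int[OF that] in \<open>auto simp: set_integrable_def\<close>)
    then show "(\<integral>u. indicator {c..<d} u * \<Phi> c d u \<partial>lborel) = (LINT u:{c..d}|lborel. \<Phi> c d u)"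
      by (simp add: set_lebesgue_integral_def)
  qed
  have \<Psi>_int: "integrable lborel (\<Psi> n)" for n
    unfolding \<Psi>_def by (intro Bochner_Integration.integrable_sum \<Phi>_int' grid0 mono) auto
  have bound_sum: "\<bar>\<Sum>l\<in>UNIV. qq c u i l * L u l j\<bar> \<le> total_intensity u" if "0 \<le> c" "c \<le> u" for c u
    using weighted_sum_le_total_intensity[of "\<lambda>l. qq c u i l" 1 u j] that
    by (simp add: qq_nonneg order_trans[OF qq_le' q_bounds(2)])
  have cells: "(\<integral>\<omega>. ncells i j \<alpha> \<beta> (Suc n) \<omega> * indicator ?V \<omega> \<partial>M) = (\<integral>u. \<Psi> n u \<partial>lborel)" for n
  proof -
    let ?g = "grid \<alpha> \<beta> (Suc n)"
    let ?C = "\<lambda>m. {\<omega>\<in>space M. X (?g m) \<omega> = i \<and> X (?g (Suc m)) \<omega> = j}"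
    have C: "?C m \<inter> ?V \<in> events" for m using X_sets2[OF grid0 grid0] V by (intro sets.Int)
    have "(\<integral>\<omega>. ncells i j \<alpha> \<beta> (Suc n) \<omega> * indicator ?V \<omega> \<partial>M)
      = (\<integral>\<omega>. (\<Sum>m<Suc n. indicator (?C m \<inter> ?V) \<omega>) \<partial>M)"
      by (intro Bochner_Integration.integral_cong refl)
        (simp add: ncells_eq sum_distrib_right indicator_inter_arith del: sum.lessThan_Suc)
    also have "\<dots> = (\<Sum>m<Suc n. prob (?C m \<inter> ?V))"
      using C by (subst Bochner_Integration.integral_sum) (auto simp: integrable_indicator_iff emeasure_eq_measure)
    also have "\<dots> = (\<Sum>m<Suc n. LINT u:{?g m..?g (Suc m)}|lborel. \<Phi> (?g m) (?g (Suc m)) u)"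
    proof (intro sum.cong refl)
      fix m assume "m \<in> {..<Suc n}"
      then have "?g (Suc m) \<le> v" using grid_le[OF ab(2), of "Suc m" "Suc n"] ab(3) by simp
      moreover have "?C m \<inter> ?V = {\<omega>\<in>space M. X (?g m) \<omega> = i \<and> X (?g (Suc m)) \<omega> = j \<and> X v \<omega> = k}" by auto
      ultimately show "prob (?C m \<inter> ?V) = (LINT u:{?g m..?g (Suc m)}|lborel. \<Phi> (?g m) (?g (Suc m)) u)"
        unfolding \<Phi>_def using cell_probability[OF grid0 mono _ \<open>i \<noteq> j\<close>, of m "Suc m" "Suc n" v k] by simp
    qed
    also have "\<dots> = (\<integral>u. \<Psi> n u \<partial>lborel)"
      unfolding \<Psi>_def
      by (subst Bochner_Integration.integral_sum) (simp_all add: \<Phi>_int' grid0 mono del: sum.lessThan_Suc)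
    finally show ?thesis .
  qed
  \<comment> \<open>The value of \<open>\<Psi> n\<close> at \<open>u\<close> involves only the cell that
      contains \<open>u\<close>.\<close>
  have cell_of: "\<exists>c d. \<alpha> \<le> c \<and> c \<le> u \<and> u < d \<and> d \<le> \<beta> \<and> d - c = (\<beta> - \<alpha>) / real (Suc n) \<and> \<Psi> n u = \<Phi> c d u"
    if u: "\<alpha> \<le> u" "u < \<beta>" for u n
  proof -
    let ?g = "grid \<alpha> \<beta> (Suc n)"
    obtain m where m: "m < Suc n" "\<And>l. l < Suc n \<Longrightarrow> (?g l \<le> u \<and> u < ?g (Suc l)) \<longleftrightarrow> l = m"
      using grid_cell[of \<alpha> \<beta> "Suc n" u] u by auto
    have "\<Psi> n u = (\<Sum>l<Suc n. if l = m then \<Phi> (?g l) (?g (Suc l)) u else 0)"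
      unfolding \<Psi>_def using m(2) by (intro sum.cong) (auto simp: indicator_def)
    also have "\<dots> = \<Phi> (?g m) (?g (Suc m)) u" using m(1) by (simp add: sum.delta del: sum.lessThan_Suc)
    finally have "\<Psi> n u = \<Phi> (?g m) (?g (Suc m)) u" .
    moreover have "?g m \<le> u \<and> u < ?g (Suc m)" using m by blast
    ultimately show ?thesis
      using grid_ge[OF ab(2), of "Suc n" m] grid_le[OF ab(2), of "Suc m" "Suc n"] m(1)
      by (intro exI[of _ "?g m"] exI[of _ "?g (Suc m)"]) (auto simp: grid_Suc)
  qed
  have \<Psi>_outside: "\<Psi> n u = 0" if "\<not> (\<alpha> \<le> u \<and> u < \<beta>)" for n u
    unfolding \<Psi>_def
  proof (intro sum.neutral ballI)
    fix m assume "m \<in> {..<Suc n}"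
    then have "\<alpha> \<le> grid \<alpha> \<beta> (Suc n) m" "grid \<alpha> \<beta> (Suc n) (Suc m) \<le> \<beta>"
      using grid_ge[OF ab(2)] grid_le[OF ab(2), of "Suc m" "Suc n"] by auto
    then show "indicator {grid \<alpha> \<beta> (Suc n) m..<grid \<alpha> \<beta> (Suc n) (Suc m)} u
      * \<Phi> (grid \<alpha> \<beta> (Suc n) m) (grid \<alpha> \<beta> (Suc n) (Suc m)) u = 0"
      using that by (auto simp: indicator_def)
  qed
  have \<Psi>_bound: "\<bar>\<Psi> n u\<bar> \<le> indicator {\<alpha>..\<beta>} u * total_intensity u" for n u
  proof (cases "\<alpha> \<le> u \<and> u < \<beta>")
    case True
    then obtain c d where cd: "\<alpha> \<le> c" "c \<le> u" "u < d" "d \<le> \<beta>" "\<Psi> n u = \<Phi> c d u"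
      using cell_of[of u n] by auto
    have "\<bar>\<Phi> c d u\<bar> \<le> total_intensity u * 1"
      unfolding \<Phi>_def abs_mult using cd ab True total_intensity_nonneg[of u] H_bounds[of d v j k]
      by (intro mult_mono bound_sum) auto
    then show ?thesis using cd True by simp
  qed (simp add: \<Psi>_outside total_intensity_nonneg)
  have lim: "AE u in lborel. (\<lambda>n. \<Psi> n u) \<longlonglongrightarrow> ?limit u"
    using AE_no_influx_to_null_state[OF \<open>i \<noteq> j\<close>] AE_lborel_singleton[of \<beta>]
  proof eventually_elim
    case (elim u)
    show ?case
    proof (cases "\<alpha> \<le> u \<and> u < \<beta>")
      case True
      then obtain c d where cd: "\<And>n. \<alpha> \<le> c n" "\<And>n. c n \<le> u" "\<And>n. u < d n" "\<And>n. d n \<le> \<beta>"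
        "\<And>n. d n - c n = (\<beta> - \<alpha>) / real (Suc n)" "\<And>n. \<Psi> n u = \<Phi> (c n) (d n) u"
        using cell_of[of u] by metis
      have mesh: "(\<lambda>n. (\<beta> - \<alpha>) / real (Suc n)) \<longlonglongrightarrow> 0"
        by (rule LIMSEQ_Suc[OF lim_const_over_n])
      have u0: "0 \<le> u" "0 \<le> v" using True ab by auto
      have c_lim: "c \<longlonglongrightarrow> u"
      proof (rule real_tendsto_sandwich[OF _ _ _ tendsto_const])
        show "\<forall>\<^sub>F n in sequentially. u - (\<beta> - \<alpha>) / real (Suc n) \<le> c n"
        proof (rule always_eventually, rule allI)
          fix n show "u - (\<beta> - \<alpha>) / real (Suc n) \<le> c n" using cd(3)[of n] cd(5)[of n] by linarith
        qed
        show "(\<lambda>n. u - (\<beta> - \<alpha>) / real (Suc n)) \<longlonglongrightarrow> u"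
          using tendsto_diff[OF tendsto_const[of u] mesh] by simp
      qed (simp add: cd)
      have d_lim: "d \<longlonglongrightarrow> u"
      proof (rule real_tendsto_sandwich[OF _ _ tendsto_const])
        show "\<forall>\<^sub>F n in sequentially. d n \<le> u + (\<beta> - \<alpha>) / real (Suc n)"
        proof (rule always_eventually, rule allI)
          fix n show "d n \<le> u + (\<beta> - \<alpha>) / real (Suc n)" using cd(2)[of n] cd(5)[of n] by linarith
        qed
        show "(\<lambda>n. u + (\<beta> - \<alpha>) / real (Suc n)) \<longlonglongrightarrow> u"
          using tendsto_add[OF tendsto_const[of u] mesh] by simp
      qed (simp add: cd less_imp_le)
      have int_u: "set_integrable lborel {\<alpha>..u} total_intensity"
        using True by (intro set_integrable_subset[OF int]) auto
      have I_lim: "(\<lambda>n. LINT w:{c n..u}|lborel. total_intensity w) \<longlonglongrightarrow> 0"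
      proof -
        have "(\<lambda>n. LINT w:{\<alpha>..c n}|lborel. total_intensity w) \<longlonglongrightarrow> (LINT w:{\<alpha>..u}|lborel. total_intensity w)"
          using True cd by (intro continuous_on_tendsto_compose[OF continuous_on_indefinite_set_integral[OF int_u] c_lim]) auto
        then have "(\<lambda>n. (LINT w:{\<alpha>..u}|lborel. total_intensity w) - (LINT w:{\<alpha>..c n}|lborel. total_intensity w)) \<longlonglongrightarrow> 0"
          using tendsto_diff[OF tendsto_const, of _ _ _ "LINT w:{\<alpha>..u}|lborel. total_intensity w"] by fastforce
        moreover have "(LINT w:{c n..u}|lborel. total_intensity w)
            = (LINT w:{\<alpha>..u}|lborel. total_intensity w) - (LINT w:{\<alpha>..c n}|lborel. total_intensity w)" for n
          using set_integral_split[OF int_u cd(1,2)[of n]] by simp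
        ultimately show ?thesis by simp
      qed
      have qq_lim: "(\<lambda>n. qq (c n) u i l) \<longlonglongrightarrow> of_bool (i = l) * q u i" for l
      proof (rule Lim_transform)
        show "(\<lambda>n. of_bool (i = l) * q u i) \<longlonglongrightarrow> of_bool (i = l) * q u i" by simp
        show "(\<lambda>n. qq (c n) u i l - of_bool (i = l) * q u i) \<longlonglongrightarrow> 0"
        proof (rule Lim_null_comparison)
          show "(\<lambda>n. 2 * (LINT w:{c n..u}|lborel. total_intensity w)) \<longlonglongrightarrow> 0"
            using tendsto_mult[OF tendsto_const I_lim, of 2] by simp
          show "\<forall>\<^sub>F n in sequentially. norm (qq (c n) u i l - of_bool (i = l) * q u i) \<le> 2 * (LINT w:{c n..u}|lborel. total_intensity w)"
          proof (rule always_eventually, rule allI)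
            fix n
            have c0: "0 \<le> c n" using cd(1)[of n] ab by simp
            have int_c: "set_integrable lborel {c n..u} total_intensity"
              using cd(1)[of n] by (intro set_integrable_subset[OF int_u]) auto
            have I0: "0 \<le> (LINT w:{c n..u}|lborel. total_intensity w)" by (intro set_integral_nonneg total_intensity_nonneg)
            have "\<bar>qq (c n) u i l - of_bool (i = l) * q (c n) i\<bar> \<le> 1 * (LINT w:{c n..u}|lborel. total_intensity w)"
              using qq_drift[OF c0 cd(2) int_c, of i l] mult_right_mono[OF q_bounds(2) I0, of "c n" i] by linarith
            moreover have "\<bar>of_bool (i = l) * q u i - of_bool (i = l) * q (c n) i\<bar> \<le> (LINT w:{c n..u}|lborel. total_intensity w)"
              using q_drift[OF c0 cd(2) int_c, of i] I0 by (cases "i = l") auto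
            ultimately show "norm (qq (c n) u i l - of_bool (i = l) * q u i) \<le> 2 * (LINT w:{c n..u}|lborel. total_intensity w)"
              unfolding real_norm_def by linarith
          qed
        qed
      qed
      have "(\<lambda>n. \<Sum>l\<in>UNIV. qq (c n) u i l * L u l j) \<longlonglongrightarrow> (\<Sum>l\<in>UNIV. of_bool (i = l) * q u i * L u l j)"
        by (intro tendsto_intros qq_lim)
      also have "(\<Sum>l\<in>UNIV. of_bool (i = l) * q u i * L u l j) = q u i * L u i j"
      proof -
        have "(\<Sum>l\<in>UNIV. of_bool (i = l) * q u i * L u l j) = (\<Sum>l\<in>UNIV. if i = l then q u i * L u l j else 0)"
          by (intro sum.cong) auto
        then show ?thesis by simp
      qed
      finally have S: "(\<lambda>n. \<Sum>l\<in>UNIV. qq (c n) u i l * L u l j) \<longlonglongrightarrow> q u i * L u i j" .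
      have "(\<lambda>n. \<Phi> (c n) (d n) u) \<longlonglongrightarrow> q u i * L u i j * H u v j k"
      proof (cases "q u j = 0")
        case True
        then have zero: "q u i * L u i j = 0" using elim(1) u0 by simp
        have "(\<lambda>n. \<Phi> (c n) (d n) u) \<longlonglongrightarrow> 0"
        proof (rule Lim_null_comparison)
          show "(\<lambda>n. \<bar>\<Sum>l\<in>UNIV. qq (c n) u i l * L u l j\<bar>) \<longlonglongrightarrow> 0"
            using tendsto_rabs[OF S] zero by simp
          show "\<forall>\<^sub>F n in sequentially. norm (\<Phi> (c n) (d n) u) \<le> \<bar>\<Sum>l\<in>UNIV. qq (c n) u i l * L u l j\<bar>"
          proof (rule always_eventually, rule allI)
            fix n
            have "0 \<le> d n" using cd(3)[of n] u0 by linarith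
            then show "norm (\<Phi> (c n) (d n) u) \<le> \<bar>\<Sum>l\<in>UNIV. qq (c n) u i l * L u l j\<bar>"
              using H_bounds[of "d n" v j k] u0 by (simp add: \<Phi>_def abs_mult mult_left_le)
          qed
        qed
        then show ?thesis unfolding zero by simp
      next
        case False
        then have pos: "0 < q u j" using q_bounds(1)[of u j] by simp
        have "(\<lambda>n. q (d n) j) \<longlonglongrightarrow> q u j"
          using u0 cd(3,4) True
          by (intro continuous_on_tendsto_compose[OF continuous_q[of \<beta>] d_lim])
             (auto intro!: always_eventually intro: order_trans[OF _ less_imp_le])
        moreover have "(\<lambda>n. qq (d n) v j k) \<longlonglongrightarrow> qq u v j k"
          by (intro qq_right_continuous u0 cd d_lim)
        ultimately have "(\<lambda>n. qq (d n) v j k / q (d n) j) \<longlonglongrightarrow> qq u v j k / q u j"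
          using pos by (intro tendsto_divide) auto
        moreover have "\<forall>\<^sub>F n in sequentially. qq (d n) v j k / q (d n) j = H (d n) v j k"
          using order_tendstoD(1)[OF \<open>(\<lambda>n. q (d n) j) \<longlonglongrightarrow> q u j\<close> pos] by eventually_elim (simp add: H_def)
        ultimately have "(\<lambda>n. H (d n) v j k) \<longlonglongrightarrow> H u v j k"
          using pos by (simp add: H_def[of u] tendsto_cong)
        then show ?thesis unfolding \<Phi>_def by (intro tendsto_mult S)
      qed
      then show ?thesis using True cd(6) by simp
    next
      case False
      then show ?thesis using \<Psi>_outside[OF False] elim(2) by (auto simp: indicator_def)
    qed
  qed
  have total_intensity_int: "integrable lborel (\<lambda>u. indicator {\<alpha>..\<beta>} u * total_intensity u)"
    using int by (simp add: set_integrable_def)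
  have limit_meas: "?limit \<in> borel_measurable lborel"
  proof -
    have [measurable]: "(\<lambda>u. if 0 \<le> u then q u x else 0) \<in> borel_measurable borel" for x by (rule q_measurable)
    have [measurable]: "(\<lambda>u. indicator {0..} u * L u i j) \<in> borel_measurable borel" by (rule L_measurable)
    have [measurable]: "(\<lambda>u. if 0 \<le> u then qq u v j k else 0) \<in> borel_measurable borel"
    proof -
      have "(\<lambda>u. (u, v)) \<in> measurable borel (borel \<Otimes>\<^sub>M borel)" by simp
      from measurable_compose[OF this qq_measurable[of j k]] ab show ?thesis
        by (simp cong: if_cong)
    qed
    have "(\<lambda>u. indicator {\<alpha>..\<beta>} u * ((if 0 \<le> u then q u i else 0) * (indicator {0..} u * L u i j) *
       (if 0 < (if 0 \<le> u then q u j else 0) then (if 0 \<le> u then qq u v j k else 0) / (if 0 \<le> u then q u j else 0) else 0)))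
       \<in> borel_measurable lborel" by measurable
    also have "(\<lambda>u. indicator {\<alpha>..\<beta>} u * ((if 0 \<le> u then q u i else 0) * (indicator {0..} u * L u i j) *
       (if 0 < (if 0 \<le> u then q u j else 0) then (if 0 \<le> u then qq u v j k else 0) / (if 0 \<le> u then q u j else 0) else 0)))
       = ?limit"
      using ab by (auto simp: fun_eq_iff indicator_def H_def)
    finally show ?thesis .
  qed
  have bound: "AE u in lborel. norm (\<Psi> n u) \<le> indicator {\<alpha>..\<beta>} u * total_intensity u" for n
    using \<Psi>_bound by simp
  note dct = integrable_dominated_convergence[OF limit_meas borel_measurable_integrable[OF \<Psi>_int] total_intensity_int lim bound]
    integral_dominated_convergence[OF limit_meas borel_measurable_integrable[OF \<Psi>_int] total_intensity_int lim bound]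
  show "set_integrable lborel {\<alpha>..\<beta>} (\<lambda>u. q u i * L u i j * H u v j k)"
    using dct(1) by (simp add: set_integrable_def)
  have "(\<lambda>n. \<integral>\<omega>. ncells i j \<alpha> \<beta> (Suc n) \<omega> * indicator ?V \<omega> \<partial>M)
      \<longlonglongrightarrow> (\<integral>\<omega>. njumps i j \<alpha> \<beta> \<omega> * indicator ?V \<omega> \<partial>M)"
  proof (rule integral_dominated_convergence[where w = "\<lambda>\<omega>. \<Sum>(k, l)\<in>{(k, l). k \<noteq> l}. njumps k l \<alpha> \<beta> \<omega>"])
    show "(\<lambda>\<omega>. njumps i j \<alpha> \<beta> \<omega> * indicator ?V \<omega>) \<in> borel_measurable M"
      by (intro borel_measurable_times borel_measurable_indicator njumps_measurable ab \<open>i \<noteq> j\<close> V)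
    show "(\<lambda>\<omega>. ncells i j \<alpha> \<beta> (Suc n) \<omega> * indicator ?V \<omega>) \<in> borel_measurable M" for n
      by (intro borel_measurable_times borel_measurable_indicator ncells_measurable ab V)
    show "integrable M (\<lambda>\<omega>. \<Sum>(k, l)\<in>{(k, l). k \<noteq> l}. njumps k l \<alpha> \<beta> \<omega>)"
      unfolding case_prod_unfold
      by (intro Bochner_Integration.integrable_sum integrable_njumps ab int) auto
    show "AE \<omega> in M. (\<lambda>n. ncells i j \<alpha> \<beta> (Suc n) \<omega> * indicator ?V \<omega>) \<longlonglongrightarrow> njumps i j \<alpha> \<beta> \<omega> * indicator ?V \<omega>"
      by (rule AE_I2) (intro tendsto_intros LIMSEQ_Suc[OF ncells_tendsto] ab \<open>i \<noteq> j\<close>)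
    show "AE \<omega> in M. norm (ncells i j \<alpha> \<beta> (Suc n) \<omega> * indicator ?V \<omega>)
        \<le> (\<Sum>(k, l)\<in>{(k, l). k \<noteq> l}. njumps k l \<alpha> \<beta> \<omega>)" for n
    proof (rule AE_I2)
      fix \<omega> assume "\<omega> \<in> space M"
      from ncells_le_total[OF this ab(1,2) \<open>i \<noteq> j\<close>, of "Suc n"]
      have "\<bar>ncells i j \<alpha> \<beta> (Suc n) \<omega>\<bar> \<le> (\<Sum>(k, l)\<in>{(k, l). k \<noteq> l}. njumps k l \<alpha> \<beta> \<omega>)"
        by (simp add: ncells_def)
      then show "norm (ncells i j \<alpha> \<beta> (Suc n) \<omega> * indicator ?V \<omega>) \<le> (\<Sum>(k, l)\<in>{(k, l). k \<noteq> l}. njumps k l \<alpha> \<beta> \<omega>)"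
        by (auto simp: indicator_def)
    qed
  qed
  then have "(\<lambda>n. \<integral>u. \<Psi> n u \<partial>lborel) \<longlonglongrightarrow> (\<integral>\<omega>. njumps i j \<alpha> \<beta> \<omega> * indicator ?V \<omega> \<partial>M)"
    by (simp add: cells)
  with dct(2) show "(\<integral>\<omega>. njumps i j \<alpha> \<beta> \<omega> * indicator ?V \<omega> \<partial>M)
      = (LINT u:{\<alpha>..\<beta>}|lborel. q u i * L u i j * H u v j k)"
    unfolding set_lebesgue_integral_def by (intro LIMSEQ_unique)
qed

subsection \<open>The kernel of conditionally expected jumps\<close>

text \<open>
  Conditional density of \<open>\<tau>\<close> given that the process is in \<open>j\<close> at time \<open>u\<close>.
\<close>

definition R :: "real \<Rightarrow> real \<Rightarrow> 'p option \<Rightarrow> real" where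
  "R u w j = (if 0 < q u j then joint_density u w j / q u j else 0)"

lemma R_nonneg: "0 \<le> w \<Longrightarrow> 0 \<le> R u w j"
  by (auto simp: R_def intro!: divide_nonneg_nonneg joint_density_nonneg)

lemma R_zero: "0 \<le> u \<Longrightarrow> 0 \<le> w \<Longrightarrow> tau_density w = 0 \<Longrightarrow> R u w j = 0"
  using joint_density_le[of u w j] joint_density_nonneg[of w u j] by (simp add: R_def)

lemma H_None_eq_integral:
  assumes "0 \<le> u" "u \<le> v" "j \<noteq> None"
  shows "ennreal (H u v j None) = (\<integral>\<^sup>+w. indicator {u..v} w * ennreal (R u w j) \<partial>lborel)"
proof (cases "0 < q u j")
  case True
  have int: "set_integrable lborel {u..v} (\<lambda>w. joint_density u w j)"
    using qq_increment(1)[OF assms(1) order_refl assms(2), of j None] by (simp add: joint_density_def[symmetric])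
  have "qq u v j None = (LINT w:{u..v}|lborel. joint_density u w j)"
    using qq_increment(2)[OF assms(1) order_refl assms(2), of j None] assms
    by (simp add: joint_density_def qq_eq G_refl)
  then have "H u v j None = (LINT w:{u..v}|lborel. R u w j)"
    using True by (simp add: H_def R_def)
  moreover have "set_integrable lborel {u..v} (\<lambda>w. R u w j)"
    using int True by (simp add: R_def)
  ultimately show ?thesis
    using assms by (simp only:) (rule ennreal_set_integral; simp add: R_nonneg)
next
  case False
  then show ?thesis by (simp add: H_def R_def)
qed

definition jump_rate :: "'p option \<Rightarrow> 'p option \<Rightarrow> real \<Rightarrow> real" where
  "jump_rate i j u = q u i * L u i j"

lemma jump_rate_nonneg: "0 \<le> u \<Longrightarrow> i \<noteq> j \<Longrightarrow> 0 \<le> jump_rate i j u"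
  unfolding jump_rate_def by (intro mult_nonneg_nonneg q_bounds L_nonneg)

lemma jump_rate_measurable: "(\<lambda>u. indicator {0..} u * jump_rate i j u) \<in> borel_measurable borel"
proof -
  have "(\<lambda>u. (if 0 \<le> u then q u i else 0) * (indicator {0..} u * L u i j)) \<in> borel_measurable borel"
    by (intro borel_measurable_times q_measurable L_measurable)
  also have "(\<lambda>u. (if 0 \<le> u then q u i else 0) * (indicator {0..} u * L u i j))
      = (\<lambda>u. indicator {0..} u * jump_rate i j u)"
    by (auto simp: fun_eq_iff jump_rate_def indicator_def)
  finally show ?thesis .
qed

text \<open>
  Bayes' formula for jumps: intensity of a jump from \<open>i\<close> to \<open>j\<close> at time \<open>u\<close>, given absorption at
  time \<open>w\<close>.
\<close>

definition jump_density :: "'p option \<Rightarrow> 'p option \<Rightarrow> real \<Rightarrow> real \<Rightarrow> real" where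
  "jump_density i j u w = (if 0 < u \<and> u < w then jump_rate i j u * R u w j / tau_density w else 0)"

lemma jump_density_measurable:
  "(\<lambda>x. jump_density i j (fst x) (snd x)) \<in> borel_measurable (borel \<Otimes>\<^sub>M borel)"
proof -
  have [measurable]: "(\<lambda>x. if 0 \<le> fst x \<and> 0 \<le> snd x then joint_density (fst x) (snd x) j else 0)
      \<in> borel_measurable (borel \<Otimes>\<^sub>M borel)"
    by (rule joint_density_measurable)
  have [measurable]: "(\<lambda>u. if 0 \<le> u then q u j else 0) \<in> borel_measurable borel" by (rule q_measurable)
  have [measurable]: "(\<lambda>u. indicator {0..} u * jump_rate i j u) \<in> borel_measurable borel"
    by (rule jump_rate_measurable)
  have "(\<lambda>x::real \<times> real. if 0 < fst x \<and> fst x < snd x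
      then (indicator {0..} (fst x) * jump_rate i j (fst x)) *
        (if 0 < (if 0 \<le> fst x then q (fst x) j else 0)
         then (if 0 \<le> fst x \<and> 0 \<le> snd x then joint_density (fst x) (snd x) j else 0) / (if 0 \<le> fst x then q (fst x) j else 0)
         else 0)
        / (indicator {0..} (snd x) * tau_density (snd x)) else 0) \<in> borel_measurable (borel \<Otimes>\<^sub>M borel)"
    by measurable
  also have "(\<lambda>x::real \<times> real. if 0 < fst x \<and> fst x < snd x
      then (indicator {0..} (fst x) * jump_rate i j (fst x)) *
        (if 0 < (if 0 \<le> fst x then q (fst x) j else 0)
         then (if 0 \<le> fst x \<and> 0 \<le> snd x then joint_density (fst x) (snd x) j else 0) / (if 0 \<le> fst x then q (fst x) j else 0)
         else 0)
        / (indicator {0..} (snd x) * tau_density (snd x)) else 0) = (\<lambda>x. jump_density i j (fst x) (snd x))"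
    by (auto simp: jump_density_def R_def fun_eq_iff)
  finally show ?thesis .
qed

text \<open>
  Probability that the process leaves through the state \<open>i\<close>, given that it is absorbed at time \<open>w\<close>.
\<close>

definition exit_weight :: "'p option \<Rightarrow> real \<Rightarrow> real" where
  "exit_weight i w = (if 0 < w then jump_rate i None w / tau_density w else 0)"

lemma exit_weight_measurable [measurable]: "exit_weight i \<in> borel_measurable borel"
proof -
  have [measurable]: "(\<lambda>u. indicator {0..} u * jump_rate i None u) \<in> borel_measurable borel"
    by (rule jump_rate_measurable)
  have "(\<lambda>w. if 0 < w then (indicator {0..} w * jump_rate i None w) / (indicator {0..} w * tau_density w) else 0)
      \<in> borel_measurable borel" by measurable
  also have "(\<lambda>w. if 0 < w then (indicator {0..} w * jump_rate i None w) / (indicator {0..} w * tau_density w) else 0)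
      = exit_weight i"
    by (auto simp: exit_weight_def fun_eq_iff)
  finally show ?thesis .
qed

text \<open>
  Given absorption at time \<open>w\<close>, jumps between transient states have an intensity, whereas
  the only jump into the absorbing state takes place at time \<open>w\<close>.
\<close>

definition jump_kernel :: "'p option \<Rightarrow> 'p option \<Rightarrow> real \<Rightarrow> real measure" where
  "jump_kernel i j w = (if j = None then density (return borel w) (\<lambda>_. ennreal (exit_weight i w))
     else density lborel (\<lambda>u. ennreal (jump_density i j u w)))"

lemma sets_jump_kernel [simp]: "sets (jump_kernel i j w) = sets borel"
  and space_jump_kernel [simp]: "space (jump_kernel i j w) = UNIV"
  by (simp_all add: jump_kernel_def)

lemma emeasure_jump_kernel_Some:
  assumes "B \<in> sets borel" "j \<noteq> None"
  shows "emeasure (jump_kernel i j w) B = (\<integral>\<^sup>+u. ennreal (jump_density i j u w) * indicator B u \<partial>lborel)"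
proof -
  have "(\<lambda>u. (u, w)) \<in> measurable borel (borel \<Otimes>\<^sub>M borel)" by simp
  from measurable_compose[OF this jump_density_measurable]
  have [measurable]: "(\<lambda>u. jump_density i j u w) \<in> borel_measurable borel" by simp
  have [measurable]: "B \<in> sets borel" by fact
  show ?thesis unfolding jump_kernel_def if_not_P[OF assms(2)] by (simp add: emeasure_density)
qed

lemma emeasure_jump_kernel_None:
  assumes "B \<in> sets borel"
  shows "emeasure (jump_kernel i None w) B = ennreal (exit_weight i w) * indicator B w"
proof -
  have [measurable]: "B \<in> sets borel" by fact
  show ?thesis by (simp add: jump_kernel_def emeasure_density nn_integral_return nn_integral_cmult_indicator)
qed

lemma emeasure_jump_kernel_measurable:
  assumes B: "B \<in> sets borel"
  shows "(\<lambda>w. emeasure (jump_kernel i j w) B) \<in> borel_measurable borel"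
proof (cases j)
  case None
  have [measurable]: "B \<in> sets borel" by fact
  show ?thesis unfolding None emeasure_jump_kernel_None[OF B] by measurable
next
  case (Some l)
  have [measurable]: "B \<in> sets borel" by fact
  have [measurable]: "(\<lambda>x. jump_density i j (snd x) (fst x)) \<in> borel_measurable (borel \<Otimes>\<^sub>M borel)"
    using measurable_compose[OF measurable_pair_swap' jump_density_measurable[of i j]]
    by (simp add: case_prod_unfold)
  have "(\<lambda>x. ennreal (jump_density i j (snd x) (fst x)) * indicator B (snd x)) \<in> borel_measurable (borel \<Otimes>\<^sub>M lborel)"
    by measurable
  then have "(\<lambda>w. \<integral>\<^sup>+u. ennreal (jump_density i j u w) * indicator B u \<partial>lborel) \<in> borel_measurable borel"
    by (intro lborel.borel_measurable_nn_integral) (simp add: case_prod_unfold)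
  then show ?thesis
    by (subst emeasure_jump_kernel_Some[OF B]) (simp_all add: Some)
qed

lemma jump_kernel_outside:
  assumes "B \<in> sets borel" "B \<inter> {0<..w} = {}"
  shows "emeasure (jump_kernel i j w) B = 0"
proof (cases j)
  case None
  have "exit_weight i w = 0 \<or> w \<notin> B" using assms(2) by (auto simp: exit_weight_def)
  then show ?thesis using assms(1) by (auto simp: None emeasure_jump_kernel_None)
next
  case (Some l)
  have zero: "ennreal (jump_density i j u w) * indicator B u = 0" for u
    using assms(2) by (cases "u \<in> B") (auto simp: jump_density_def)
  show ?thesis
    by (subst emeasure_jump_kernel_Some) (simp_all only: assms(1) Some zero[unfolded Some] nn_integral_const, simp_all)
qed

lemma jump_kernel_from_None: "emeasure (jump_kernel None j w) B = 0"
proof (cases "B \<in> sets borel")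
  case True
  then show ?thesis
  proof (cases j)
    case (Some l)
    have "jump_density None j u w = 0" for u by (simp add: jump_density_def jump_rate_def)
    then show ?thesis using True Some by (subst emeasure_jump_kernel_Some) simp_all
  qed (simp add: emeasure_jump_kernel_None exit_weight_def jump_rate_def)
qed (simp add: emeasure_notin_sets)

subsection \<open>Jumps and absorption\<close>

lemma no_jumps_after_\<tau>:
  "AE \<omega> in M. \<forall>i j. i \<noteq> j \<longrightarrow> jumps (\<lambda>t. X t \<omega>) i j \<subseteq> {0<..\<tau> \<omega>} \<and> (i = None \<longrightarrow> jumps (\<lambda>t. X t \<omega>) i j = {})"
  using \<tau>_characterization
proof eventually_elim
  case (elim \<omega>)
  let ?x = "\<lambda>t. X t \<omega>"
  have no: "s \<notin> jumps ?x i j" if "i \<noteq> j" and late: "\<tau> \<omega> < s \<or> i = None" for i j s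
  proof
    assume s: "s \<in> jumps ?x i j"
    then have s0: "0 < s" "X s \<omega> = j" and i: "\<forall>\<^sub>F u in at_left s. ?x u = i" by (auto simp: jumps_def)
    obtain u where u: "0 < u" "u < s" "?x u = None"
    proof (cases "i = None")
      case True
      have "\<forall>\<^sub>F u in at_left s. 0 < u \<and> u < s \<and> ?x u = None"
        using i eventually_at_left_real[OF s0(1)] by eventually_elim (use True in auto)
      then obtain u where "0 < u \<and> u < s \<and> ?x u = None"
        using eventually_happens'[OF trivial_limit_at_left_real] by blast
      then show ?thesis using that by blast
    next
      case False
      then have "\<tau> \<omega> < s" using late by blast
      then show ?thesis using elim by (intro that[of "(\<tau> \<omega> + s) / 2"]) auto
    qed
    then have "\<tau> \<omega> \<le> u" using elim by (meson less_imp_le)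
    have "\<forall>\<^sub>F v in at_left s. ?x v = None"
      using eventually_at_left_real[OF u(2)]
      by eventually_elim (use elim u \<open>\<tau> \<omega> \<le> u\<close> in auto)
    then have "i = None" using eventually_at_left_unique[OF i] by simp
    moreover have "X s \<omega> = None" using elim s0(1) u \<open>\<tau> \<omega> \<le> u\<close> by auto
    ultimately show False using s0(2) \<open>i \<noteq> j\<close> by simp
  qed
  show ?case
  proof (intro allI impI conjI subsetI)
    fix i j :: "'p option" and s assume ij: "i \<noteq> j" and s: "s \<in> jumps ?x i j"
    then have "0 < s" by (simp add: jumps_def)
    moreover have "\<not> \<tau> \<omega> < s" using no[OF ij] s by blast
    ultimately show "s \<in> {0<..\<tau> \<omega>}" by simp
  next
    fix i j :: "'p option" assume "i \<noteq> j" "i = None"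
    then show "jumps ?x i j = {}" using no by blast
  qed
qed

text \<open>
  Jumps end with absorption, so \<open>\<beta>\<close> may be replaced by its minimum with \<open>v\<close>, and the event of
  absorption before \<open>v\<close> is an event about the state at time \<open>v\<close>.
\<close>

lemma expected_jumps_before:
  assumes ab: "0 \<le> \<alpha>" "\<alpha> \<le> \<beta>" and int: "set_integrable lborel {\<alpha>..\<beta>} total_intensity" and "i \<noteq> j"
  shows "(\<integral>\<^sup>+\<omega>. ennreal (njumps i j \<alpha> \<beta> \<omega>) * indicator {..v} (\<tau> \<omega>) \<partial>M)
    = (\<integral>\<^sup>+u. indicator {\<alpha>..\<beta>} u * indicator {..v} u * ennreal (jump_rate i j u * H u v j None) \<partial>lborel)"
proof (cases "\<alpha> \<le> v")
  case True
  define \<beta>' where "\<beta>' = min \<beta> v"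
  have \<beta>': "0 \<le> \<alpha>" "\<alpha> \<le> \<beta>'" "\<beta>' \<le> v" using ab True by (auto simp: \<beta>'_def)
  have int': "set_integrable lborel {\<alpha>..\<beta>'} total_intensity"
    by (rule set_integrable_subset[OF int]) (auto simp: \<beta>'_def)
  let ?V = "{\<omega>\<in>space M. X v \<omega> = None}"
  have V: "?V \<in> events" using \<beta>' by (intro X_sets) auto
  have "(\<integral>\<^sup>+\<omega>. ennreal (njumps i j \<alpha> \<beta> \<omega>) * indicator {..v} (\<tau> \<omega>) \<partial>M)
    = (\<integral>\<^sup>+\<omega>. ennreal (njumps i j \<alpha> \<beta>' \<omega> * indicator ?V \<omega>) \<partial>M)"
  proof (rule nn_integral_cong_AE)
    show "AE \<omega> in M. ennreal (njumps i j \<alpha> \<beta> \<omega>) * indicator {..v} (\<tau> \<omega>)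
      = ennreal (njumps i j \<alpha> \<beta>' \<omega> * indicator ?V \<omega>)"
      using \<tau>_characterization no_jumps_after_\<tau> AE_space
    proof eventually_elim
      case (elim \<omega>)
      have V_iff: "\<omega> \<in> ?V \<longleftrightarrow> \<tau> \<omega> \<le> v" using elim \<beta>' by auto
      have "njumps i j \<alpha> \<beta> \<omega> = njumps i j \<alpha> \<beta>' \<omega>" if "\<tau> \<omega> \<le> v"
      proof -
        have "jumps (\<lambda>t. X t \<omega>) i j \<inter> {\<alpha><..\<beta>} = jumps (\<lambda>t. X t \<omega>) i j \<inter> {\<alpha><..\<beta>'}"
          using elim(2) \<open>i \<noteq> j\<close> that by (fastforce simp: \<beta>'_def)
        then show ?thesis by (simp add: njumps_def)
      qed
      then show ?case using V_iff by (cases "\<tau> \<omega> \<le> v") auto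
    qed
  qed
  also have "\<dots> = ennreal (\<integral>\<omega>. njumps i j \<alpha> \<beta>' \<omega> * indicator ?V \<omega> \<partial>M)"
    by (intro nn_integral_eq_integral integrable_real_mult_indicator integrable_njumps \<beta>' int' \<open>i \<noteq> j\<close> V)
       (auto simp: njumps_def)
  also have "\<dots> = ennreal (LINT u:{\<alpha>..\<beta>'}|lborel. jump_rate i j u * H u v j None)"
    using expected_jumps_local(2)[OF \<beta>' int' \<open>i \<noteq> j\<close>] by (simp add: jump_rate_def)
  also have "\<dots> = (\<integral>\<^sup>+u. indicator {\<alpha>..\<beta>'} u * ennreal (jump_rate i j u * H u v j None) \<partial>lborel)"
    using expected_jumps_local(1)[OF \<beta>' int' \<open>i \<noteq> j\<close>, of None] \<beta>' \<open>i \<noteq> j\<close>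
    by (intro ennreal_set_integral) (auto simp: jump_rate_def[symmetric] intro!: mult_nonneg_nonneg jump_rate_nonneg H_bounds)
  also have "\<dots> = (\<integral>\<^sup>+u. indicator {\<alpha>..\<beta>} u * indicator {..v} u * ennreal (jump_rate i j u * H u v j None) \<partial>lborel)"
    by (intro nn_integral_cong) (auto simp: indicator_def \<beta>'_def)
  finally show ?thesis .
next
  case False
  have "AE \<omega> in M. ennreal (njumps i j \<alpha> \<beta> \<omega>) * indicator {..v} (\<tau> \<omega>) = 0"
    using no_jumps_after_\<tau>
  proof eventually_elim
    case (elim \<omega>)
    have "jumps (\<lambda>t. X t \<omega>) i j \<inter> {\<alpha><..\<beta>} = {}" if "\<tau> \<omega> \<le> v"
      using elim \<open>i \<noteq> j\<close> that False by fastforce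
    then show ?case by (auto simp: njumps_def indicator_def)
  qed
  then have "(\<integral>\<^sup>+\<omega>. ennreal (njumps i j \<alpha> \<beta> \<omega>) * indicator {..v} (\<tau> \<omega>) \<partial>M) = (\<integral>\<^sup>+\<omega>. 0 \<partial>M)"
    by (rule nn_integral_cong_AE)
  moreover have "(\<integral>\<^sup>+u. indicator {\<alpha>..\<beta>} u * indicator {..v} u * ennreal (jump_rate i j u * H u v j None) \<partial>lborel)
      = (\<integral>\<^sup>+u. 0 \<partial>(lborel :: real measure))"
    using False by (intro nn_integral_cong) (auto simp: indicator_def)
  ultimately show ?thesis by simp
qed

lemma jump_density_times_tau_density:
  assumes "i \<noteq> j" "0 < u" "u < w"
  shows "ennreal (jump_density i j u w) * ennreal (tau_density w) = ennreal (jump_rate i j u) * ennreal (R u w j)"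
  using assms R_nonneg[of w u j] jump_rate_nonneg[of u i j] R_zero[of u w j]
  by (simp add: jump_density_def divide_times_tau_density ennreal_mult[symmetric])

lemma exit_weight_times_tau_density:
  assumes "i \<noteq> None" "0 < w"
  shows "ennreal (exit_weight i w) * ennreal (tau_density w) = ennreal (jump_rate i None w)"
proof -
  have "jump_rate i None w \<le> tau_density w"
    unfolding jump_rate_def tau_density_def using assms
    by (intro member_le_sum[of i UNIV "\<lambda>k. q w k * L w k None"] mult_nonneg_nonneg q_bounds q_nonneg_L) auto
  then have "tau_density w = 0 \<Longrightarrow> jump_rate i None w = 0"
    using jump_rate_nonneg[of w i None] assms by simp
  then show ?thesis
    using assms jump_rate_nonneg[of w i None] by (simp add: exit_weight_def divide_times_tau_density)
qed

text \<open>
  For \<open>j\<close> transient, Fubini's theorem: integrating the conditional density \<open>R u w j\<close> of \<open>\<tau>\<close> over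
  \<open>w \<le> v\<close> gives the conditional probability \<open>H u v j None\<close> of absorption before \<open>v\<close>. For \<open>j = None\<close>, the
  kernel is concentrated in \<open>w\<close>, and \<open>H w v None None = 1\<close> whenever the absorbing state has positive
  probability; otherwise there is no influx into it.
\<close>

lemma expected_kernel_before:
  assumes ab: "0 \<le> \<alpha>" "\<alpha> \<le> \<beta>" and "i \<noteq> j"
  shows "(\<integral>\<^sup>+\<omega>. emeasure (jump_kernel i j (\<tau> \<omega>)) {\<alpha><..\<beta>} * indicator {..v} (\<tau> \<omega>) \<partial>M)
    = (\<integral>\<^sup>+u. indicator {\<alpha>..\<beta>} u * indicator {..v} u * ennreal (jump_rate i j u * H u v j None) \<partial>lborel)"
proof -
  have [measurable]: "(\<lambda>w. emeasure (jump_kernel i j w) {\<alpha><..\<beta>}) \<in> borel_measurable borel"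
    by (rule emeasure_jump_kernel_measurable) simp
  have "(\<integral>\<^sup>+\<omega>. emeasure (jump_kernel i j (\<tau> \<omega>)) {\<alpha><..\<beta>} * indicator {..v} (\<tau> \<omega>) \<partial>M)
    = (\<integral>\<^sup>+w. emeasure (jump_kernel i j w) {\<alpha><..\<beta>} * indicator {..v} w * ennreal (indicator {0..} w * tau_density w) \<partial>lborel)"
    by (rule nn_integral_\<tau>) measurable
  also have "\<dots> = (\<integral>\<^sup>+u. indicator {\<alpha>..\<beta>} u * indicator {..v} u * ennreal (jump_rate i j u * H u v j None) \<partial>lborel)"
  proof (cases j)
    case None
    show ?thesis
    proof (rule nn_integral_cong_AE)
      show "AE w in lborel. emeasure (jump_kernel i j w) {\<alpha><..\<beta>} * indicator {..v} w * ennreal (indicator {0..} w * tau_density w)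
        = indicator {\<alpha>..\<beta>} w * indicator {..v} w * ennreal (jump_rate i j w * H w v j None)"
        using AE_no_influx_to_null_state[OF \<open>i \<noteq> j\<close>] AE_lborel_singleton[of \<alpha>]
      proof eventually_elim
        case (elim w)
        show ?case
        proof (cases "\<alpha> < w \<and> w \<le> \<beta> \<and> w \<le> v")
          case True
          have rate: "jump_rate i None w * H w v None None = jump_rate i None w"
          proof (cases "q w None = 0")
            case True
            then show ?thesis using elim(1) ab \<open>\<alpha> < w \<and> w \<le> \<beta> \<and> w \<le> v\<close> by (simp add: jump_rate_def None)
          next
            case False
            then have "0 < q w None" using q_bounds(1)[of w None] by simp
            then show ?thesis using True ab by (simp add: H_def qq_eq G_None)
          qed
          show ?thesis
            unfolding None rate using True ab None \<open>i \<noteq> j\<close> exit_weight_times_tau_density[of i w]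
            by (simp add: emeasure_jump_kernel_None)
        qed (use elim(2) None in \<open>auto simp: emeasure_jump_kernel_None indicator_def\<close>)
      qed
    qed
  next
    case (Some l)
    have [measurable]: "(\<lambda>x. jump_density i j (snd x) (fst x)) \<in> borel_measurable (borel \<Otimes>\<^sub>M borel)"
      using measurable_compose[OF measurable_pair_swap' jump_density_measurable[of i j]]
      by (simp add: case_prod_unfold)
    let ?h = "\<lambda>w u. ennreal (jump_density i j u w) * indicator {\<alpha><..\<beta>} u * indicator {..v} w * ennreal (indicator {0..} w * tau_density w)"
    have m: "case_prod ?h \<in> borel_measurable (lborel \<Otimes>\<^sub>M lborel)"
      unfolding case_prod_unfold by measurable
    have m1: "(\<lambda>u. ennreal (jump_density i j u w) * indicator {\<alpha><..\<beta>} u) \<in> borel_measurable lborel" for w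
    proof -
      have "(\<lambda>u. (u, w)) \<in> measurable borel (borel \<Otimes>\<^sub>M borel)" by simp
      from measurable_compose[OF this jump_density_measurable]
      have [measurable]: "(\<lambda>u. jump_density i j u w) \<in> borel_measurable borel" by simp
      show ?thesis by measurable
    qed
    have mR: "(\<lambda>w. indicator {u..v} w * ennreal (R u w j)) \<in> borel_measurable lborel" if "0 < u" for u
    proof -
      have "(\<lambda>w. (u, w)) \<in> measurable borel (borel \<Otimes>\<^sub>M borel)" by simp
      from measurable_compose[OF this joint_density_measurable[of j]] that
      have [measurable]: "(\<lambda>w. if 0 \<le> w then joint_density u w j else 0) \<in> borel_measurable borel" by (simp cong: if_cong)
      have "(\<lambda>w. indicator {u..v} w * ennreal (if 0 < q u j then (if 0 \<le> w then joint_density u w j else 0) / q u j else 0))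
          \<in> borel_measurable borel" by measurable
      also have "(\<lambda>w. indicator {u..v} w * ennreal (if 0 < q u j then (if 0 \<le> w then joint_density u w j else 0) / q u j else 0))
          = (\<lambda>w. indicator {u..v} w * ennreal (R u w j))"
        using that by (auto simp: R_def indicator_def fun_eq_iff)
      finally show ?thesis by simp
    qed
    have "(\<integral>\<^sup>+w. emeasure (jump_kernel i j w) {\<alpha><..\<beta>} * indicator {..v} w * ennreal (indicator {0..} w * tau_density w) \<partial>lborel)
      = (\<integral>\<^sup>+w. \<integral>\<^sup>+u. ?h w u \<partial>lborel \<partial>lborel)"
    proof (rule nn_integral_cong)
      fix w :: real
      have "(\<integral>\<^sup>+u. ?h w u \<partial>lborel) = (\<integral>\<^sup>+u. ennreal (jump_density i j u w) * indicator {\<alpha><..\<beta>} u \<partial>lborel)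
          * (indicator {..v} w * ennreal (indicator {0..} w * tau_density w))"
        using nn_integral_multc[OF m1[of w], of "indicator {..v} w * ennreal (indicator {0..} w * tau_density w)"]
        by (simp only: mult.assoc)
      then show "emeasure (jump_kernel i j w) {\<alpha><..\<beta>} * indicator {..v} w * ennreal (indicator {0..} w * tau_density w)
          = (\<integral>\<^sup>+u. ?h w u \<partial>lborel)"
        by (subst emeasure_jump_kernel_Some) (simp_all only: Some mult.assoc, simp_all)
    qed
    also have "\<dots> = (\<integral>\<^sup>+u. \<integral>\<^sup>+w. ?h w u \<partial>lborel \<partial>lborel)"
      by (rule lborel_pair.Fubini'[OF m, symmetric])
    also have "\<dots> = (\<integral>\<^sup>+u. indicator {\<alpha>..\<beta>} u * indicator {..v} u * ennreal (jump_rate i j u * H u v j None) \<partial>lborel)"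
    proof (rule nn_integral_cong_AE)
      show "AE u in lborel. (\<integral>\<^sup>+w. ?h w u \<partial>lborel)
          = indicator {\<alpha>..\<beta>} u * indicator {..v} u * ennreal (jump_rate i j u * H u v j None)"
        using AE_lborel_singleton[of \<alpha>]
      proof eventually_elim
        case (elim u)
        show ?case
        proof (cases "\<alpha> < u \<and> u \<le> \<beta> \<and> u \<le> v")
          case True
          then have u: "0 < u" "0 \<le> u" "u \<le> v" "0 \<le> v" using ab by auto
          have "(\<integral>\<^sup>+w. ?h w u \<partial>lborel) = (\<integral>\<^sup>+w. ennreal (jump_rate i j u) * (indicator {u..v} w * ennreal (R u w j)) \<partial>lborel)"
          proof (rule nn_integral_cong_AE)
            show "AE w in lborel. ?h w u = ennreal (jump_rate i j u) * (indicator {u..v} w * ennreal (R u w j))"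
              using AE_lborel_singleton[of u]
            proof eventually_elim
              case (elim w)
              show ?case
              proof (cases "u < w \<and> w \<le> v")
                case True
                then show ?thesis
                  using jump_density_times_tau_density[OF \<open>i \<noteq> j\<close> u(1), of w] u \<open>\<alpha> < u \<and> u \<le> \<beta> \<and> u \<le> v\<close> by simp
              qed (use elim in \<open>auto simp: jump_density_def indicator_def\<close>)
            qed
          qed
          also have "\<dots> = ennreal (jump_rate i j u) * (\<integral>\<^sup>+w. indicator {u..v} w * ennreal (R u w j) \<partial>lborel)"
            by (rule nn_integral_cmult[OF mR[OF u(1)]])
          also have "\<dots> = ennreal (jump_rate i j u) * ennreal (H u v j None)"
            using H_None_eq_integral[OF u(2,3), of j] Some by simp
          also have "\<dots> = ennreal (jump_rate i j u * H u v j None)"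
            using jump_rate_nonneg[OF u(2) \<open>i \<noteq> j\<close>] H_bounds[OF u(2,4)] by (simp add: ennreal_mult)
          finally show ?thesis using True by simp
        next
          case False
          have "(\<integral>\<^sup>+w. ?h w u \<partial>lborel) = (\<integral>\<^sup>+w. 0 \<partial>(lborel :: real measure))"
            using False elim by (intro nn_integral_cong) (auto simp: jump_density_def indicator_def)
          then show ?thesis using False elim by (simp only: nn_integral_const) (auto simp: indicator_def)
        qed
      qed
    qed
    finally show ?thesis .
  qed
  finally show ?thesis .
qed

lemma jumps_and_absorption:
  assumes "0 \<le> \<alpha>" "\<alpha> \<le> \<beta>" "set_integrable lborel {\<alpha>..\<beta>} total_intensity" "i \<noteq> j"
  shows "(\<integral>\<^sup>+\<omega>. ennreal (njumps i j \<alpha> \<beta> \<omega>) * indicator {..v} (\<tau> \<omega>) \<partial>M)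
    = (\<integral>\<^sup>+\<omega>. emeasure (jump_kernel i j (\<tau> \<omega>)) {\<alpha><..\<beta>} * indicator {..v} (\<tau> \<omega>) \<partial>M)"
    and "(\<integral>\<^sup>+\<omega>. ennreal (njumps i j \<alpha> \<beta> \<omega>) \<partial>M) < \<infinity>"
proof -
  show "(\<integral>\<^sup>+\<omega>. ennreal (njumps i j \<alpha> \<beta> \<omega>) * indicator {..v} (\<tau> \<omega>) \<partial>M)
    = (\<integral>\<^sup>+\<omega>. emeasure (jump_kernel i j (\<tau> \<omega>)) {\<alpha><..\<beta>} * indicator {..v} (\<tau> \<omega>) \<partial>M)"
    using assms by (simp add: expected_jumps_before expected_kernel_before)
  show "(\<integral>\<^sup>+\<omega>. ennreal (njumps i j \<alpha> \<beta> \<omega>) \<partial>M) < \<infinity>"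
    using integrable_njumps[OF assms] by (subst nn_integral_eq_integral) (auto simp: njumps_def)
qed

lemma jump_kernel_atom:
  assumes "r \<noteq> w"
  shows "emeasure (jump_kernel i j w) {r} = 0"
proof (cases j)
  case None
  then show ?thesis using assms by (simp add: emeasure_jump_kernel_None)
next
  case (Some l)
  have "(\<integral>\<^sup>+u. ennreal (jump_density i j u w) * indicator {r} u \<partial>lborel) = (\<integral>\<^sup>+u. 0 \<partial>(lborel :: real measure))"
    using AE_lborel_singleton[of r] by (intro nn_integral_cong_AE) (auto elim!: eventually_mono)
  then show ?thesis using Some by (subst emeasure_jump_kernel_Some) auto
qed

text \<open>
  The law of \<open>\<tau>\<close> has a density.
\<close>

lemma AE_\<tau>_neq: "AE \<omega> in M. \<tau> \<omega> \<noteq> r"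
proof -
  have "(\<integral>\<^sup>+\<omega>. indicator {r} (\<tau> \<omega>) \<partial>M) = (\<integral>\<^sup>+w. indicator {r} w * ennreal (indicator {0..} w * tau_density w) \<partial>lborel)"
    by (rule nn_integral_\<tau>) simp
  also have "\<dots> = (\<integral>\<^sup>+w. 0 \<partial>(lborel :: real measure))"
    using AE_lborel_singleton[of r] by (intro nn_integral_cong_AE) (auto elim!: eventually_mono)
  finally have "(\<integral>\<^sup>+\<omega>. indicator {r} (\<tau> \<omega>) \<partial>M) = 0" by simp
  then have "AE \<omega> in M. indicator {r} (\<tau> \<omega>) = (0 :: ennreal)"
    by (subst (asm) nn_integral_0_iff_AE) auto
  then show ?thesis by eventually_elim (auto simp: indicator_def)
qed

end

section \<open>Versions of conditional expectations\<close>

text \<open>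
  States that \<open>g\<close> is a version of the conditional expectation of \<open>f\<close> without reference to integrability,
  so that it remains applicable to jump counts with infinite expectation.
\<close>

definition is_cond_exp :: "'a measure \<Rightarrow> 'a measure \<Rightarrow> ('a \<Rightarrow> ennreal) \<Rightarrow> ('a \<Rightarrow> ennreal) \<Rightarrow> bool" where
  "is_cond_exp M F f g \<longleftrightarrow> f \<in> borel_measurable M \<and> g \<in> borel_measurable F \<and>
     (\<forall>A\<in>sets F. (\<integral>\<^sup>+x\<in>A. f x \<partial>M) = (\<integral>\<^sup>+x\<in>A. g x \<partial>M))"

context sigma_finite_subalgebra
begin

lemma F_sets: "A \<in> sets F \<Longrightarrow> A \<in> sets M"
  using subalg by (auto simp: subalgebra_def)

lemma F_measurable: "g \<in> borel_measurable F \<Longrightarrow> g \<in> borel_measurable M"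
  by (rule measurable_from_subalg[OF subalg])

lemma is_cond_expD: "is_cond_exp M F f g \<Longrightarrow> AE x in M. nn_cond_exp M F f x = g x"
  using nn_cond_exp_charact[of f g] by (auto simp: is_cond_exp_def elim: eventually_mono)

lemma is_cond_exp_nn_cond_exp:
  assumes f: "f \<in> borel_measurable M"
  shows "is_cond_exp M F f (nn_cond_exp M F f)"
  unfolding is_cond_exp_def
proof (intro conjI ballI f)
  fix A assume "A \<in> sets F"
  then show "(\<integral>\<^sup>+x\<in>A. f x \<partial>M) = (\<integral>\<^sup>+x\<in>A. nn_cond_exp M F f x \<partial>M)"
    using nn_cond_exp_intg[of "indicator A" f] f by (simp add: mult.commute)
qed simp

lemma is_cond_exp_AE:
  assumes "is_cond_exp M F f g" "f' \<in> borel_measurable M" "g' \<in> borel_measurable F"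
    and "AE x in M. f x = f' x" "AE x in M. g x = g' x"
  shows "is_cond_exp M F f' g'"
  unfolding is_cond_exp_def
proof (intro conjI ballI assms(2,3))
  fix A assume A: "A \<in> sets F"
  have "(\<integral>\<^sup>+x\<in>A. f' x \<partial>M) = (\<integral>\<^sup>+x\<in>A. f x \<partial>M)"
    using assms(4) by (intro nn_integral_cong_AE) (auto elim: eventually_mono)
  also have "\<dots> = (\<integral>\<^sup>+x\<in>A. g x \<partial>M)" using assms(1) A by (simp add: is_cond_exp_def)
  also have "\<dots> = (\<integral>\<^sup>+x\<in>A. g' x \<partial>M)"
    using assms(5) by (intro nn_integral_cong_AE) (auto elim: eventually_mono)
  finally show "(\<integral>\<^sup>+x\<in>A. f' x \<partial>M) = (\<integral>\<^sup>+x\<in>A. g' x \<partial>M)" .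
qed

lemma is_cond_expI_AE:
  assumes "f \<in> borel_measurable M" "g \<in> borel_measurable F" "AE x in M. nn_cond_exp M F f x = g x"
  shows "is_cond_exp M F f g"
  using is_cond_exp_AE[OF is_cond_exp_nn_cond_exp[OF assms(1)] assms(1,2)] assms(3) by simp

lemma is_cond_exp_add:
  assumes "is_cond_exp M F f g" "is_cond_exp M F f' g'"
  shows "is_cond_exp M F (\<lambda>x. f x + f' x) (\<lambda>x. g x + g' x)"
  unfolding is_cond_exp_def
proof (intro conjI ballI)
  have f [measurable]: "f \<in> borel_measurable M" "f' \<in> borel_measurable M"
    and g: "g \<in> borel_measurable F" "g' \<in> borel_measurable F"
    using assms by (auto simp: is_cond_exp_def)
  have [measurable]: "g \<in> borel_measurable M" "g' \<in> borel_measurable M"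
    by (auto intro: F_measurable g)
  show "(\<lambda>x. f x + f' x) \<in> borel_measurable M" by measurable
  show "(\<lambda>x. g x + g' x) \<in> borel_measurable F" using g by measurable
  fix A assume A: "A \<in> sets F"
  then have [measurable]: "A \<in> sets M" by (rule F_sets)
  have "(\<integral>\<^sup>+x\<in>A. f x \<partial>M) = (\<integral>\<^sup>+x\<in>A. g x \<partial>M)" "(\<integral>\<^sup>+x\<in>A. f' x \<partial>M) = (\<integral>\<^sup>+x\<in>A. g' x \<partial>M)"
    using assms A by (auto simp: is_cond_exp_def)
  then show "(\<integral>\<^sup>+x\<in>A. (f x + f' x) \<partial>M) = (\<integral>\<^sup>+x\<in>A. (g x + g' x) \<partial>M)"
    by (simp add: distrib_right nn_integral_add)
qed

lemma is_cond_exp_zero: "is_cond_exp M F (\<lambda>_. 0) (\<lambda>_. 0)"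
  by (simp add: is_cond_exp_def)

lemma is_cond_exp_sum:
  assumes "\<And>i. i \<in> I \<Longrightarrow> is_cond_exp M F (f i) (g i)"
  shows "is_cond_exp M F (\<lambda>x. \<Sum>i\<in>I. f i x) (\<lambda>x. \<Sum>i\<in>I. g i x)"
  using assms by (induction I rule: infinite_finite_induct) (auto intro: is_cond_exp_zero is_cond_exp_add)

lemma is_cond_exp_cmult:
  assumes "is_cond_exp M F f g"
  shows "is_cond_exp M F (\<lambda>x. c * f x) (\<lambda>x. c * g x)"
  unfolding is_cond_exp_def
proof (intro conjI ballI)
  have f [measurable]: "f \<in> borel_measurable M" and g: "g \<in> borel_measurable F"
    using assms by (auto simp: is_cond_exp_def)
  have [measurable]: "g \<in> borel_measurable M" by (rule F_measurable[OF g])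
  show "(\<lambda>x. c * f x) \<in> borel_measurable M" by measurable
  show "(\<lambda>x. c * g x) \<in> borel_measurable F" using g by measurable
  fix A assume A: "A \<in> sets F"
  then have [measurable]: "A \<in> sets M" by (rule F_sets)
  show "(\<integral>\<^sup>+x\<in>A. c * f x \<partial>M) = (\<integral>\<^sup>+x\<in>A. c * g x \<partial>M)"
    using assms A by (simp add: is_cond_exp_def mult.assoc nn_integral_cmult)
qed

lemma is_cond_exp_SUP:
  fixes f g :: "nat \<Rightarrow> 'a \<Rightarrow> ennreal"
  assumes "\<And>n. is_cond_exp M F (f n) (g n)" "incseq f" "incseq g"
  shows "is_cond_exp M F (\<lambda>x. SUP n. f n x) (\<lambda>x. SUP n. g n x)"
proof -
  have f: "f n \<in> borel_measurable M" and g: "g n \<in> borel_measurable F" for n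
    using assms(1) by (auto simp: is_cond_exp_def)
  have sup: "(\<integral>\<^sup>+x\<in>A. (SUP n. h n x) \<partial>M) = (SUP n. \<integral>\<^sup>+x\<in>A. h n x \<partial>M)"
    if "incseq h" "\<And>n. h n \<in> borel_measurable M" "A \<in> sets F" for h :: "nat \<Rightarrow> 'a \<Rightarrow> ennreal" and A
  proof -
    have "(\<integral>\<^sup>+x\<in>A. (SUP n. h n x) \<partial>M) = (\<integral>\<^sup>+x. (SUP n. h n x * indicator A x) \<partial>M)"
    proof (rule nn_integral_cong)
      show "(SUP n. h n x) * indicator A x = (SUP n. h n x * indicator A x)" for x
        by (cases "x \<in> A") simp_all
    qed
    also have "\<dots> = (SUP n. \<integral>\<^sup>+x\<in>A. h n x \<partial>M)"
    proof (rule nn_integral_monotone_convergence_SUP)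
      show "incseq (\<lambda>n x. h n x * indicator A x)"
      proof (intro monoI le_funI mult_right_mono)
        show "h m x \<le> h n x" if "m \<le> n" for m n x
          using \<open>incseq h\<close> that by (simp add: mono_def le_fun_def)
      qed simp
      show "(\<lambda>x. h n x * indicator A x) \<in> borel_measurable M" for n
        using that(2)[of n] F_sets[OF that(3)] by simp
    qed
    finally show ?thesis .
  qed
  show ?thesis
    unfolding is_cond_exp_def
  proof (intro conjI ballI)
    show "(\<lambda>x. SUP n. f n x) \<in> borel_measurable M" using f by (intro borel_measurable_SUP) auto
    show "(\<lambda>x. SUP n. g n x) \<in> borel_measurable F" using g by (intro borel_measurable_SUP) auto
    fix A assume A: "A \<in> sets F"
    have "(\<integral>\<^sup>+x\<in>A. f n x \<partial>M) = (\<integral>\<^sup>+x\<in>A. g n x \<partial>M)" for n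
      using assms(1) A by (simp add: is_cond_exp_def)
    then show "(\<integral>\<^sup>+x\<in>A. (SUP n. f n x) \<partial>M) = (\<integral>\<^sup>+x\<in>A. (SUP n. g n x) \<partial>M)"
      by (simp only: sup[OF assms(2) f A] sup[OF assms(3) F_measurable[OF g] A])
  qed
qed

lemma is_cond_exp_suminf:
  fixes f g :: "nat \<Rightarrow> 'a \<Rightarrow> ennreal"
  assumes "\<And>n. is_cond_exp M F (f n) (g n)"
  shows "is_cond_exp M F (\<lambda>x. \<Sum>n. f n x) (\<lambda>x. \<Sum>n. g n x)"
proof -
  have sup: "is_cond_exp M F (\<lambda>x. SUP n. \<Sum>i<n. f i x) (\<lambda>x. SUP n. \<Sum>i<n. g i x)"
  proof (rule is_cond_exp_SUP)
    show "is_cond_exp M F (\<lambda>x. \<Sum>i<n. f i x) (\<lambda>x. \<Sum>i<n. g i x)" for n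
      by (rule is_cond_exp_sum) (rule assms)
    show "incseq (\<lambda>n x. \<Sum>i<n. f i x)" "incseq (\<lambda>n x. \<Sum>i<n. g i x)"
      by (rule monoI, rule le_funI, rule sum_mono2; simp)+
  qed
  have 1: "(\<lambda>x. \<Sum>n. f n x) = (\<lambda>x. SUP n. \<Sum>i<n. f i x)" and 2: "(\<lambda>x. \<Sum>n. g n x) = (\<lambda>x. SUP n. \<Sum>i<n. g i x)"
    by (rule ext, rule suminf_eq_SUP)+
  show ?thesis by (subst 1, subst 2, rule sup)
qed

text \<open>
  Subtraction is possible as soon as the conditional expectation subtracted is finite almost
  surely.
\<close>

lemma is_cond_exp_diff:
  assumes sum: "is_cond_exp M F (\<lambda>x. f x + f' x) (\<lambda>x. g x + g' x)" and "is_cond_exp M F f g"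
    and fin: "AE x in M. g x < \<infinity>" and f': "f' \<in> borel_measurable M" and g': "g' \<in> borel_measurable F"
  shows "is_cond_exp M F f' g'"
proof (rule is_cond_expI_AE[OF f' g'])
  have f: "f \<in> borel_measurable M" using assms(2) by (simp add: is_cond_exp_def)
  show "AE x in M. nn_cond_exp M F f' x = g' x"
    using is_cond_expD[OF sum] is_cond_expD[OF assms(2)] fin nn_cond_exp_sum[OF f f']
  proof eventually_elim
    case (elim x)
    then have "g x + nn_cond_exp M F f' x = g x + g' x" by simp
    then show ?case using elim(3) by (auto simp: ennreal_add_left_cancel)
  qed
qed

lemma is_cond_exp_cong:
  assumes "is_cond_exp M F f g" "\<And>x. x \<in> space M \<Longrightarrow> f x = f' x" "\<And>x. x \<in> space M \<Longrightarrow> g x = g' x"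
  shows "is_cond_exp M F f' g'"
proof -
  have f': "f' \<in> borel_measurable M"
    using assms(1,2) measurable_cong[of M f f'] by (simp add: is_cond_exp_def)
  have "space F = space M" using subalg by (simp add: subalgebra_def)
  then have g': "g' \<in> borel_measurable F"
    using assms(1,3) measurable_cong[of F g g'] by (simp add: is_cond_exp_def)
  show ?thesis
    by (rule is_cond_exp_AE[OF assms(1) f' g']) (use assms(2,3) in \<open>auto intro: AE_I2\<close>)
qed

lemma is_cond_exp_self: "g \<in> borel_measurable F \<Longrightarrow> is_cond_exp M F g g"
  by (simp add: is_cond_exp_def F_measurable)

text \<open>
  Suppose that the kernel \<open>L\<close> is a conditional expectation of the random measure \<open>K\<close> on all
  intervals \<open>(0, t]\<close>. On a bounded interval the Borel sets with this property form a Dynkin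
  system, because conditional expectations that are almost surely finite can be subtracted;
  they need not be integrable. From sets the property passes to nonnegative functions.
\<close>

lemma is_cond_exp_random_measure:
  fixes K L :: "'a \<Rightarrow> real measure"
  assumes K: "\<And>\<omega>. \<omega> \<in> space M \<Longrightarrow> sets (K \<omega>) = sets borel" "\<And>\<omega>. \<omega> \<in> space M \<Longrightarrow> emeasure (K \<omega>) {..0} = 0"
      "\<And>\<omega> t. \<omega> \<in> space M \<Longrightarrow> emeasure (K \<omega>) {0<..t} < \<infinity>"
    and L: "\<And>\<omega>. sets (L \<omega>) = sets borel" "\<And>\<omega>. emeasure (L \<omega>) {..0} = 0"
      "\<And>B. B \<in> sets borel \<Longrightarrow> (\<lambda>\<omega>. emeasure (L \<omega>) B) \<in> borel_measurable F"
    and base: "\<And>t. 0 \<le> t \<Longrightarrow> is_cond_exp M F (\<lambda>\<omega>. emeasure (K \<omega>) {0<..t}) (\<lambda>\<omega>. emeasure (L \<omega>) {0<..t})"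
    and fin: "\<And>t. 0 \<le> t \<Longrightarrow> AE \<omega> in M. emeasure (L \<omega>) {0<..t} < \<infinity>"
    and g: "g \<in> borel_measurable borel"
  shows "is_cond_exp M F (\<lambda>\<omega>. \<integral>\<^sup>+s. g s \<partial>K \<omega>) (\<lambda>\<omega>. \<integral>\<^sup>+s. g s \<partial>L \<omega>)"
proof -
  have bounded: "is_cond_exp M F (\<lambda>\<omega>. emeasure (K \<omega>) (B \<inter> {0<..real k})) (\<lambda>\<omega>. emeasure (L \<omega>) (B \<inter> {0<..real k}))"
    if B: "B \<in> sets borel" for B and k :: nat
  proof -
    let ?I = "{0<..real k}"
    have "Int_stable (range (atMost :: real \<Rightarrow> real set))"
    proof (rule Int_stableI)
      fix A B :: "real set" assume "A \<in> range atMost" "B \<in> range atMost"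
      then obtain a b where "A = {..a}" "B = {..b}" by auto
      then have "A \<inter> B = {..min a b}" by auto
      then show "A \<inter> B \<in> range atMost" by simp
    qed
    moreover have "range (atMost :: real \<Rightarrow> real set) \<subseteq> Pow UNIV" by simp
    moreover have "B \<in> sigma_sets UNIV (range (atMost :: real \<Rightarrow> real set))"
      using B by (simp add: borel_eq_atMost)
    ultimately show ?thesis
    proof (induction rule: sigma_sets_induct_disjoint)
      case (basic B)
      then obtain b where "B = {..b}" by auto
      then have "B \<inter> ?I = {0<..max 0 (min b (real k))}" by auto
      then show ?case using base[of "max 0 (min b (real k))"] by simp
    next
      case empty
      then show ?case by (simp add: is_cond_exp_zero)
    next
      \<comment> \<open>Complements within the bounded interval: here almost sure finiteness is used.\<close>
      case (compl B)
      then have B: "B \<in> sets borel" by (simp add: borel_eq_atMost)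
      have split: "emeasure \<mu> (B \<inter> ?I) + emeasure \<mu> ((UNIV - B) \<inter> ?I) = emeasure \<mu> ?I"
        if "sets \<mu> = sets borel" for \<mu> :: "real measure"
      proof -
        have "emeasure \<mu> (B \<inter> ?I) + emeasure \<mu> ((UNIV - B) \<inter> ?I)
            = emeasure \<mu> ((B \<inter> ?I) \<union> ((UNIV - B) \<inter> ?I))"
          using B that by (intro plus_emeasure) (auto intro!: sets.Int sets.Diff)
        also have "(B \<inter> ?I) \<union> ((UNIV - B) \<inter> ?I) = ?I" by auto
        finally show ?thesis .
      qed
      show ?case
      proof (rule is_cond_exp_diff[OF _ compl.IH])
        show "is_cond_exp M F (\<lambda>\<omega>. emeasure (K \<omega>) (B \<inter> ?I) + emeasure (K \<omega>) ((UNIV - B) \<inter> ?I))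
            (\<lambda>\<omega>. emeasure (L \<omega>) (B \<inter> ?I) + emeasure (L \<omega>) ((UNIV - B) \<inter> ?I))"
          by (rule is_cond_exp_cong[OF base[of "real k"]]) (simp_all add: split K L)
        show "AE \<omega> in M. emeasure (L \<omega>) (B \<inter> ?I) < \<infinity>"
          using fin[OF of_nat_0_le_iff, of k]
        proof eventually_elim
          case (elim \<omega>)
          have "emeasure (L \<omega>) (B \<inter> ?I) \<le> emeasure (L \<omega>) ?I"
            by (intro emeasure_mono) (auto simp: L)
          then show ?case using elim by (rule le_less_trans)
        qed
        show "(\<lambda>\<omega>. emeasure (L \<omega>) ((UNIV - B) \<inter> ?I)) \<in> borel_measurable F"
          using B by (intro L(3)) auto
        have KB: "(\<lambda>\<omega>. emeasure (K \<omega>) (B \<inter> ?I)) \<in> borel_measurable M"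
          and KI: "(\<lambda>\<omega>. emeasure (K \<omega>) ?I) \<in> borel_measurable M"
          using compl.IH base[of "real k"] by (auto simp: is_cond_exp_def)
        have "emeasure (K \<omega>) ?I - emeasure (K \<omega>) (B \<inter> ?I) = emeasure (K \<omega>) ((UNIV - B) \<inter> ?I)"
          if \<omega>: "\<omega> \<in> space M" for \<omega>
        proof -
          have "emeasure (K \<omega>) (B \<inter> ?I) \<le> emeasure (K \<omega>) ?I"
            by (intro emeasure_mono) (auto simp: K \<omega>)
          then have "emeasure (K \<omega>) (B \<inter> ?I) \<noteq> \<top>" using K(3)[OF \<omega>, of "real k"] by (auto simp: top_unique)
          then show ?thesis
            using split[OF K(1)[OF \<omega>]] by (metis ennreal_add_diff_cancel_left)
        qed
        then show "(\<lambda>\<omega>. emeasure (K \<omega>) ((UNIV - B) \<inter> ?I)) \<in> borel_measurable M"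
          using borel_measurable_minus_ennreal[OF KI KB] by (subst (asm) measurable_cong) auto
      qed
    next
      case (union C)
      have C: "C i \<in> sets borel" for i using union(2) unfolding borel_eq_atMost by auto
      have sum: "(\<Sum>i. emeasure \<mu> (C i \<inter> ?I)) = emeasure \<mu> (\<Union> (range C) \<inter> ?I)"
        if "sets \<mu> = sets borel" for \<mu> :: "real measure"
      proof -
        have "(\<Sum>i. emeasure \<mu> (C i \<inter> ?I)) = emeasure \<mu> (\<Union>i. C i \<inter> ?I)"
        proof (rule suminf_emeasure)
          show "range (\<lambda>i. C i \<inter> ?I) \<subseteq> sets \<mu>" using C that by auto
          show "disjoint_family (\<lambda>i. C i \<inter> ?I)"
            using union(1) by (rule disjoint_family_on_bisimulation) auto
        qed
        also have "(\<Union>i. C i \<inter> ?I) = \<Union> (range C) \<inter> ?I" by auto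
        finally show ?thesis .
      qed
      show ?case
        using is_cond_exp_suminf[of "\<lambda>i \<omega>. emeasure (K \<omega>) (C i \<inter> ?I)" "\<lambda>i \<omega>. emeasure (L \<omega>) (C i \<inter> ?I)", OF union(3)]
        by (rule is_cond_exp_cong) (simp_all only: sum K L)
    qed
  qed
  have set: "is_cond_exp M F (\<lambda>\<omega>. emeasure (K \<omega>) B) (\<lambda>\<omega>. emeasure (L \<omega>) B)" if B: "B \<in> sets borel" for B
  proof -
    have mono: "emeasure \<mu> (B \<inter> {0<..real m}) \<le> emeasure \<mu> (B \<inter> {0<..real n})"
      if "m \<le> n" "sets \<mu> = sets borel" for m n and \<mu> :: "real measure"
      using that B by (intro emeasure_mono) auto
    have sup: "(SUP k. emeasure \<mu> (B \<inter> {0<..real k})) = emeasure \<mu> B"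
      if s: "sets \<mu> = sets borel" and z: "emeasure \<mu> {..0} = 0" for \<mu> :: "real measure"
    proof -
      have "(SUP k. emeasure \<mu> (B \<inter> {0<..real k})) = emeasure \<mu> (\<Union>k. B \<inter> {0<..real k})"
        using B s by (intro SUP_emeasure_incseq) (force simp: incseq_def)+
      also have "(\<Union>k. B \<inter> {0<..real k}) = B - {..0}"
        using real_arch_simple by force
      also have "emeasure \<mu> (B - {..0}) = emeasure \<mu> B"
        using B s z by (intro emeasure_Diff_null_set) (auto simp: null_sets_def)
      finally show ?thesis .
    qed
    let ?K = "\<lambda>k \<omega>. if \<omega> \<in> space M then emeasure (K \<omega>) (B \<inter> {0<..real k}) else 0"
    have "is_cond_exp M F (\<lambda>\<omega>. SUP k. ?K k \<omega>) (\<lambda>\<omega>. SUP k. emeasure (L \<omega>) (B \<inter> {0<..real k}))"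
    proof (rule is_cond_exp_SUP)
      show "is_cond_exp M F (?K k) (\<lambda>\<omega>. emeasure (L \<omega>) (B \<inter> {0<..real k}))" for k
        by (rule is_cond_exp_cong[OF bounded[OF B]]) simp_all
      show "incseq ?K"
        by (intro monoI le_funI) (simp add: mono K)
      show "incseq (\<lambda>k \<omega>. emeasure (L \<omega>) (B \<inter> {0<..real k}))"
        by (intro monoI le_funI) (simp add: mono L)
    qed
    then show ?thesis
      by (rule is_cond_exp_cong) (simp_all add: sup K L)
  qed
  show ?thesis
    using g
  proof (induction rule: borel_measurable_induct)
    case (cong f h)
    show ?case
      by (rule is_cond_exp_cong[OF cong(4)]) (auto intro!: nn_integral_cong simp: cong(3))
  next
    case (set B)
    show ?case
      by (rule is_cond_exp_cong[OF \<open>B \<in> sets borel \<Longrightarrow> is_cond_exp M F (\<lambda>\<omega>. emeasure (K \<omega>) B) (\<lambda>\<omega>. emeasure (L \<omega>) B)\<close>])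
        (use set K L in auto)
  next
    case (mult u c)
    show ?case
    proof (rule is_cond_exp_cong[OF is_cond_exp_cmult[OF mult(4), of c]])
      fix \<omega> assume \<omega>: "\<omega> \<in> space M"
      have "u \<in> borel_measurable (K \<omega>)" "u \<in> borel_measurable (L \<omega>)"
        using mult(2) by (simp_all cong: measurable_cong_sets add: measurable_cong_sets[OF K(1)[OF \<omega>] refl] measurable_cong_sets[OF L(1) refl])
      then show "c * (\<integral>\<^sup>+s. u s \<partial>K \<omega>) = (\<integral>\<^sup>+s. c * u s \<partial>K \<omega>)" "c * (\<integral>\<^sup>+s. u s \<partial>L \<omega>) = (\<integral>\<^sup>+s. c * u s \<partial>L \<omega>)"
        by (simp_all add: nn_integral_cmult)
    qed
  next
    case (add u v)
    show ?case
    proof (rule is_cond_exp_cong[OF is_cond_exp_add[OF add(6,7)]])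
      fix \<omega> assume \<omega>: "\<omega> \<in> space M"
      have "u \<in> borel_measurable (K \<omega>)" "u \<in> borel_measurable (L \<omega>)" "v \<in> borel_measurable (K \<omega>)" "v \<in> borel_measurable (L \<omega>)"
        using add(1,3) by (simp_all add: measurable_cong_sets[OF K(1)[OF \<omega>] refl] measurable_cong_sets[OF L(1) refl])
      then show "(\<integral>\<^sup>+s. u s \<partial>K \<omega>) + (\<integral>\<^sup>+s. v s \<partial>K \<omega>) = (\<integral>\<^sup>+s. v s + u s \<partial>K \<omega>)"
        "(\<integral>\<^sup>+s. u s \<partial>L \<omega>) + (\<integral>\<^sup>+s. v s \<partial>L \<omega>) = (\<integral>\<^sup>+s. v s + u s \<partial>L \<omega>)"
        by (simp_all add: nn_integral_add add.commute)
    qed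
  next
    case (seq U)
    have U: "U i \<in> borel_measurable \<mu>" if "sets \<mu> = sets borel" for i and \<mu> :: "real measure"
      using seq(1)[of i] by (simp add: measurable_cong_sets[OF that refl])
    have mono: "U m s \<le> U n s" if "m \<le> n" for m n s
      using seq(3) that by (simp add: mono_def le_fun_def)
    have sup: "(\<integral>\<^sup>+s. (SUP i. U i) s \<partial>\<mu>) = (SUP i. \<integral>\<^sup>+s. U i s \<partial>\<mu>)" if "sets \<mu> = sets borel" for \<mu> :: "real measure"
      unfolding SUP_apply by (rule nn_integral_monotone_convergence_SUP[OF seq(3) U[OF that]])
    let ?K = "\<lambda>i \<omega>. if \<omega> \<in> space M then \<integral>\<^sup>+s. U i s \<partial>K \<omega> else 0"
    have "is_cond_exp M F (\<lambda>\<omega>. SUP i. ?K i \<omega>) (\<lambda>\<omega>. SUP i. \<integral>\<^sup>+s. U i s \<partial>L \<omega>)"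
    proof (rule is_cond_exp_SUP)
      show "is_cond_exp M F (?K i) (\<lambda>\<omega>. \<integral>\<^sup>+s. U i s \<partial>L \<omega>)" for i
        by (rule is_cond_exp_cong[OF seq(5)]) simp_all
      show "incseq ?K"
        by (intro monoI le_funI) (auto intro!: nn_integral_mono mono)
      show "incseq (\<lambda>i \<omega>. \<integral>\<^sup>+s. U i s \<partial>L \<omega>)"
        by (intro monoI le_funI nn_integral_mono mono)
    qed
    then show ?case
      by (rule is_cond_exp_cong) (simp_all only: sup K L if_True)
  qed
qed

lemma real_cond_exp_eq:
  assumes f: "f \<in> borel_measurable M" "\<And>x. 0 \<le> f x"
    and ce: "is_cond_exp M F (\<lambda>x. ennreal (f x)) g"
  shows "AE x in M. real_cond_exp M F f x = enn2real (g x)"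
proof -
  have "(\<lambda>x. ennreal (- f x)) = (\<lambda>_. 0)" using f(2) by (simp add: ennreal_neg fun_eq_iff)
  then have "AE x in M. nn_cond_exp M F (\<lambda>x. ennreal (- f x)) x = 0"
    using is_cond_expD[OF is_cond_exp_zero] by simp
  then show ?thesis
    using is_cond_expD[OF ce] by eventually_elim (simp add: real_cond_exp_def)
qed

end

section \<open>Independent copies\<close>

locale iid_absorbed_processes =
  fixes M :: "'w measure" and N :: nat and X :: "nat \<Rightarrow> real \<Rightarrow> 'w \<Rightarrow> 'p::finite option"
    and a :: "real^'p" and A :: "real \<Rightarrow> real^'p^'p"
  assumes iid: "iid_markov_jump_processes M N X a A"
    and sub: "sub_intensity A" and prod: "product_integrable A"
    and absorbed: "\<And>n. n \<in> {1..N} \<Longrightarrow> AE \<omega> in M. \<exists>s\<ge>0. X n s \<omega> = None"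

sublocale iid_absorbed_processes \<subseteq> prob_space M
  using iid by (simp add: iid_markov_jump_processes_def)

context iid_absorbed_processes
begin

abbreviation "F \<equiv> absorption_algebra M N X"
abbreviation "tau n \<equiv> absorption_time (X n)"

lemma process: "n \<in> {1..N} \<Longrightarrow> absorbed_markov_process M (X n) a A"
  using iid sub prod absorbed by unfold_locales (auto simp: iid_markov_jump_processes_def)

text \<open>
  All functionals of the \<open>n\<close>-th path are measurable with respect to this sigma-algebra, and the
  sigma-algebras for different \<open>n\<close> are independent.
\<close>

definition path_algebra :: "nat \<Rightarrow> 'w measure" where
  "path_algebra n = vimage_algebra (space M) (\<lambda>\<omega>. \<lambda>t\<in>{0..}. X n t \<omega>) (PiM {0..} (\<lambda>_. count_space UNIV))"

lemma space_path_algebra [simp]: "space (path_algebra n) = space M"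
  by (simp add: path_algebra_def)

lemma path_algebra_X: "0 \<le> t \<Longrightarrow> X n t \<in> measurable (path_algebra n) (count_space UNIV)"
proof -
  assume t: "0 \<le> t"
  have "(\<lambda>\<omega>. \<lambda>t\<in>{0..}. X n t \<omega>) \<in> measurable (path_algebra n) (PiM {0..} (\<lambda>_. count_space UNIV))"
    unfolding path_algebra_def by (rule measurable_vimage_algebra1) (auto simp: space_PiM)
  from measurable_compose[OF this measurable_component_singleton[of t]] t show ?thesis by simp
qed

lemma path_algebra_tau: "n \<in> {1..N} \<Longrightarrow> tau n \<in> borel_measurable (path_algebra n)"
proof -
  assume n: "n \<in> {1..N}"
  interpret absorbed_markov_process M "X n" a A by (rule process[OF n])
  show ?thesis by (rule measurable_absorption_time[OF path_algebra_X]) (auto intro: path)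
qed

lemma tau_M: "n \<in> {1..N} \<Longrightarrow> tau n \<in> borel_measurable M"
proof -
  assume n: "n \<in> {1..N}"
  interpret absorbed_markov_process M "X n" a A by (rule process[OF n])
  show ?thesis by (rule \<tau>_measurable)
qed

abbreviation "T \<omega> \<equiv> (\<lambda>n\<in>{1..N}. tau n \<omega>)"

lemma T_measurable: "T \<in> measurable M (PiM {1..N} (\<lambda>_. borel))"
  by (intro measurable_restrict tau_M)

lemma sets_F: "sets F = {T -` C \<inter> space M |C. C \<in> sets (PiM {1..N} (\<lambda>_. borel))}"
  unfolding absorption_algebra_def by (rule sets_vimage_algebra2) (auto simp: space_PiM)

lemma F_subalgebra: "subalgebra M F"
  unfolding subalgebra_def
proof
  show "space F = space M" by (simp add: absorption_algebra_def)
  show "sets F \<subseteq> sets M" unfolding sets_F using measurable_sets[OF T_measurable] by blast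
qed

lemma T_F: "T \<in> measurable F (PiM {1..N} (\<lambda>_. borel))"
  unfolding absorption_algebra_def by (rule measurable_vimage_algebra1) (auto simp: space_PiM)

lemma tau_F: "n \<in> {1..N} \<Longrightarrow> tau n \<in> borel_measurable F"
  using measurable_compose[OF T_F measurable_component_singleton[of n]] by simp

sublocale finite_measure_subalgebra M F
  by unfold_locales (rule F_subalgebra)

lemma nn_integral_prod_paths:
  fixes Y :: "nat \<Rightarrow> 'w \<Rightarrow> ennreal"
  assumes Y: "\<And>k. k \<in> {1..N} \<Longrightarrow> Y k \<in> borel_measurable (path_algebra k)"
  shows "(\<integral>\<^sup>+\<omega>. (\<Prod>k\<in>{1..N}. Y k \<omega>) \<partial>M) = (\<Prod>k\<in>{1..N}. \<integral>\<^sup>+\<omega>. Y k \<omega> \<partial>M)"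
proof (rule indep_vars_nn_integral)
  have iv: "indep_vars (\<lambda>_. PiM {0..} (\<lambda>_. count_space UNIV)) (\<lambda>n \<omega>. \<lambda>t\<in>{0..}. X n t \<omega>) {1..N}"
    using iid by (simp add: iid_markov_jump_processes_def)
  have sets: "sets (path_algebra k) = {(\<lambda>\<omega>. \<lambda>t\<in>{0..}. X k t \<omega>) -` B \<inter> space M |B.
      B \<in> sets (PiM {0..} (\<lambda>_. count_space UNIV))}" for k
    unfolding path_algebra_def by (rule sets_vimage_algebra2) (auto simp: space_PiM)
  have sub: "sets (path_algebra k) \<subseteq> events" if "k \<in> {1..N}" for k
    using iv that unfolding sets indep_vars_def2 by (auto intro: measurable_sets)
  have ind: "indep_sets (\<lambda>k. sets (path_algebra k)) {1..N}"
    using iv unfolding indep_vars_def2 sets by auto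
  show "indep_vars (\<lambda>_. borel) Y {1..N}"
    unfolding indep_vars_def2
  proof (intro conjI ballI)
    fix k assume k: "k \<in> {1..N}"
    show "random_variable borel (Y k)"
      using Y[OF k] sub[OF k] by (auto simp: measurable_def)
  next
    show "indep_sets (\<lambda>k. {Y k -` B \<inter> space M |B. B \<in> sets borel}) {1..N}"
    proof (rule indep_sets_mono_sets[OF ind])
      fix k assume k: "k \<in> {1..N}"
      show "{Y k -` B \<inter> space M |B. B \<in> sets borel} \<subseteq> sets (path_algebra k)"
        using measurable_sets[OF Y[OF k]] by auto
    qed
  qed
qed auto

lemma path_algebra_M: "n \<in> {1..N} \<Longrightarrow> Z \<in> borel_measurable (path_algebra n) \<Longrightarrow> Z \<in> borel_measurable M"
proof -
  assume n: "n \<in> {1..N}" and Z: "Z \<in> borel_measurable (path_algebra n)"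
  have "sets (path_algebra n) \<subseteq> events"
    unfolding path_algebra_def
    by (rule sets_image_in_sets) (auto intro!: measurable_restrict absorbed_markov_process.X_measurable[OF process[OF n]])
  then show ?thesis using Z by (auto simp: measurable_def)
qed

text \<open>
  A functional of the \<open>n\<close>-th path has the same conditional expectation given all absorption
  times as given the \<open>n\<close>-th one, and the latter is determined by integration over the events
  that absorption takes place before some time.
\<close>

lemma is_cond_exp_path_functional:
  fixes Z :: "'w \<Rightarrow> ennreal" and g :: "real \<Rightarrow> ennreal"
  assumes n: "n \<in> {1..N}" and Z: "Z \<in> borel_measurable (path_algebra n)"
    and g: "g \<in> borel_measurable borel"
    and eq: "\<And>v. (\<integral>\<^sup>+\<omega>. Z \<omega> * indicator {..v} (tau n \<omega>) \<partial>M) = (\<integral>\<^sup>+\<omega>. g (tau n \<omega>) * indicator {..v} (tau n \<omega>) \<partial>M)"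
    and fin: "(\<integral>\<^sup>+\<omega>. Z \<omega> \<partial>M) < \<infinity>"
  shows "is_cond_exp M F Z (\<lambda>\<omega>. g (tau n \<omega>))"
proof -
  have ZM [measurable]: "Z \<in> borel_measurable M" by (rule path_algebra_M[OF n Z])
  have [measurable]: "tau n \<in> borel_measurable M" by (rule tau_M[OF n])
  have [measurable]: "g \<in> borel_measurable borel" by (rule g)
  \<comment> \<open>From half-lines to Borel sets, comparing two finite measures on the real line.\<close>
  have one: "(\<integral>\<^sup>+\<omega>. Z \<omega> * indicator C (tau n \<omega>) \<partial>M) = (\<integral>\<^sup>+\<omega>. g (tau n \<omega>) * indicator C (tau n \<omega>) \<partial>M)"
    if [measurable]: "C \<in> sets borel" for C
  proof -
    have D: "emeasure (distr (density M h) borel (tau n)) B = (\<integral>\<^sup>+\<omega>. h \<omega> * indicator B (tau n \<omega>) \<partial>M)"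
      if [measurable]: "h \<in> borel_measurable M" "B \<in> sets borel" for h B
    proof -
      have "tau n -` B \<inter> space M \<in> events" by measurable
      then show ?thesis
        by (subst emeasure_distr)
          (auto simp: emeasure_density intro!: nn_integral_cong split: split_indicator)
    qed
    have "distr (density M Z) borel (tau n) = distr (density M (\<lambda>\<omega>. g (tau n \<omega>))) borel (tau n)"
    proof (rule measure_eqI_atMost)
      show "emeasure (distr (density M Z) borel (tau n)) {..v}
          = emeasure (distr (density M (\<lambda>\<omega>. g (tau n \<omega>))) borel (tau n)) {..v}" for v
        by (simp add: D eq)
      have "(\<integral>\<^sup>+\<omega>. Z \<omega> * indicator {..v} (tau n \<omega>) \<partial>M) \<le> (\<integral>\<^sup>+\<omega>. Z \<omega> \<partial>M)" for v
        by (intro nn_integral_mono) (auto simp: indicator_def)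
      from le_less_trans[OF this fin] show "emeasure (distr (density M Z) borel (tau n)) {..v} < \<infinity>" for v
        by (subst D) auto
    qed auto
    then show ?thesis using D[OF ZM that] D[of "\<lambda>\<omega>. g (tau n \<omega>)", OF _ that] by simp
  qed
  let ?P = "PiM {1..N} (\<lambda>_. borel :: real measure)"
  have D: "emeasure (distr (density M h) ?P T) C = (\<integral>\<^sup>+\<omega>. h \<omega> * indicator C (T \<omega>) \<partial>M)"
    if [measurable]: "h \<in> borel_measurable M" "C \<in> sets ?P" for h C
  proof -
    have "T -` C \<inter> space M \<in> events" using measurable_sets[OF T_measurable that(2)] .
    then show ?thesis
      using T_measurable that(2) by (subst emeasure_distr)
        (auto simp: emeasure_density intro!: nn_integral_cong split: split_indicator)
  qed
  \<comment> \<open>On boxes both integrals factorize by independence, and only the \<open>n\<close>-th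
      factors differ in form; boxes generate the product sigma-algebra.\<close>
  have "distr (density M Z) ?P T = distr (density M (\<lambda>\<omega>. g (tau n \<omega>))) ?P T"
  proof (rule measure_eqI_PiM_finite)
    fix C :: "nat \<Rightarrow> real set" assume C: "\<And>k. k \<in> {1..N} \<Longrightarrow> C k \<in> sets borel"
    have box: "Pi\<^sub>E {1..N} C \<in> sets ?P" using C by (intro sets_PiM_I_finite) auto
    have factor: "(\<integral>\<^sup>+\<omega>. h \<omega> * indicator (Pi\<^sub>E {1..N} C) (T \<omega>) \<partial>M)
      = (\<Prod>k\<in>{1..N}. \<integral>\<^sup>+\<omega>. (if k = n then h \<omega> else 1) * indicator (C k) (tau k \<omega>) \<partial>M)"
      if h: "h \<in> borel_measurable (path_algebra n)" for h
    proof -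
      have ind: "indicator (Pi\<^sub>E {1..N} C) (T \<omega>) = (\<Prod>k\<in>{1..N}. indicator (C k) (tau k \<omega>) :: ennreal)" for \<omega>
      proof (cases "\<forall>k\<in>{1..N}. tau k \<omega> \<in> C k")
        case True
        then have "T \<omega> \<in> Pi\<^sub>E {1..N} C" by auto
        then show ?thesis using True by simp
      next
        case False
        then obtain k where "k \<in> {1..N}" "tau k \<omega> \<notin> C k" by auto
        then have "(\<Prod>k\<in>{1..N}. indicator (C k) (tau k \<omega>) :: ennreal) = 0"
          by (intro prod_zero bexI[of _ k]) auto
        moreover have "T \<omega> \<notin> Pi\<^sub>E {1..N} C" using False by (auto simp: PiE_iff)
        ultimately show ?thesis by simp
      qed
      have "h \<omega> * indicator (Pi\<^sub>E {1..N} C) (T \<omega>)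
          = (\<Prod>k\<in>{1..N}. (if k = n then h \<omega> else 1) * indicator (C k) (tau k \<omega>))" for \<omega>
        unfolding ind prod.distrib using n by (subst prod.delta) auto
      moreover have "(\<lambda>\<omega>. (if k = n then h \<omega> else 1) * indicator (C k) (tau k \<omega>)) \<in> borel_measurable (path_algebra k)"
        if k: "k \<in> {1..N}" for k
        using h measurable_compose[OF path_algebra_tau[OF k] borel_measurable_indicator[OF C[OF k]]]
        by (cases "k = n") simp_all
      ultimately show ?thesis
        using nn_integral_prod_paths[of "\<lambda>k \<omega>. (if k = n then h \<omega> else 1) * indicator (C k) (tau k \<omega>)"]
        by simp
    qed
    have gm: "(\<lambda>\<omega>. g (tau n \<omega>)) \<in> borel_measurable (path_algebra n)"
      by (rule measurable_compose[OF path_algebra_tau[OF n] g])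
    have gM: "(\<lambda>\<omega>. g (tau n \<omega>)) \<in> borel_measurable M" by measurable
    have "(\<integral>\<^sup>+\<omega>. (if k = n then Z \<omega> else 1) * indicator (C k) (tau k \<omega>) \<partial>M)
        = (\<integral>\<^sup>+\<omega>. (if k = n then g (tau n \<omega>) else 1) * indicator (C k) (tau k \<omega>) \<partial>M)" if "k \<in> {1..N}" for k
      using one[OF C[OF that]] by (cases "k = n") auto
    then show "emeasure (distr (density M Z) ?P T) (Pi\<^sub>E {1..N} C)
        = emeasure (distr (density M (\<lambda>\<omega>. g (tau n \<omega>))) ?P T) (Pi\<^sub>E {1..N} C)"
      unfolding D[OF ZM box] D[OF gM box] factor[OF Z] factor[OF gm] by (rule prod.cong[OF refl])
  next
    show "range (\<lambda>_::nat. space ?P) \<subseteq> prod_algebra {1..N} (\<lambda>_. borel)"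
      using space_in_prod_algebra[of "{1..N}" "\<lambda>_. borel :: real measure"] by (auto simp: space_PiM)
    have "(\<integral>\<^sup>+\<omega>. Z \<omega> * indicator (space ?P) (T \<omega>) \<partial>M) \<le> (\<integral>\<^sup>+\<omega>. Z \<omega> \<partial>M)"
      by (intro nn_integral_mono) (auto simp: indicator_def)
    then have "(\<integral>\<^sup>+\<omega>. Z \<omega> * indicator (space ?P) (T \<omega>) \<partial>M) < \<infinity>"
      using fin by (rule le_less_trans)
    then show "emeasure (distr (density M Z) ?P T) (space ?P) \<noteq> \<infinity>" for i :: nat
      by (subst D) auto
  qed auto
  then have all: "(\<integral>\<^sup>+\<omega>. Z \<omega> * indicator C (T \<omega>) \<partial>M) = (\<integral>\<^sup>+\<omega>. g (tau n \<omega>) * indicator C (T \<omega>) \<partial>M)"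
    if "C \<in> sets ?P" for C
    using D[OF ZM that] D[of "\<lambda>\<omega>. g (tau n \<omega>)", OF _ that] by simp
  show ?thesis
    unfolding is_cond_exp_def
  proof (intro conjI ballI)
    show "(\<lambda>\<omega>. g (tau n \<omega>)) \<in> borel_measurable F" by (rule measurable_compose[OF tau_F[OF n] g])
    fix B assume "B \<in> sets F"
    then obtain C where C: "C \<in> sets ?P" and B: "B = T -` C \<inter> space M" unfolding sets_F by blast
    have restrict: "(\<integral>\<^sup>+\<omega>\<in>B. h \<omega> \<partial>M) = (\<integral>\<^sup>+\<omega>. h \<omega> * indicator C (T \<omega>) \<partial>M)" for h
    proof (rule nn_integral_cong)
      fix \<omega> assume "\<omega> \<in> space M"
      then have "\<omega> \<in> B \<longleftrightarrow> T \<omega> \<in> C" by (simp add: B)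
      then show "h \<omega> * indicator B \<omega> = h \<omega> * indicator C (T \<omega>)"
        by (simp only: indicator_def)
    qed
    show "(\<integral>\<^sup>+\<omega>\<in>B. Z \<omega> \<partial>M) = (\<integral>\<^sup>+\<omega>\<in>B. g (tau n \<omega>) \<partial>M)"
      unfolding restrict by (rule all[OF C])
  qed (rule ZM)
qed

abbreviation "occ_density n \<equiv> absorbed_markov_process.occ_density M (X n) A"
abbreviation "jkernel n \<equiv> absorbed_markov_process.jump_kernel M (X n) A"
abbreviation "J n i j \<omega> \<equiv> interval_measure (\<lambda>t. jump_count (X n) i j t \<omega>)"

lemma occ_measurable: "0 \<le> s \<Longrightarrow> (\<lambda>\<omega>. ennreal (occ (X n) i s \<omega>)) \<in> borel_measurable (path_algebra n)"
  using measurable_compose[OF path_algebra_X[of s n], of "\<lambda>x. ennreal (if x = i then 1 else 0)" borel]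
  by (simp add: occ_def)

lemma is_cond_exp_occ:
  assumes n: "n \<in> {1..N}" and s: "0 \<le> s"
  shows "is_cond_exp M F (\<lambda>\<omega>. ennreal (occ (X n) (Some i) s \<omega>)) (\<lambda>\<omega>. ennreal (occ_density n s (Some i) (tau n \<omega>)))"
proof -
  interpret P: absorbed_markov_process M "X n" a A by (rule process[OF n])
  have "(\<lambda>w. (s, w)) \<in> measurable borel (borel \<Otimes>\<^sub>M borel)" by simp
  from measurable_compose[OF this P.occ_density_measurable]
  have m: "(\<lambda>w. ennreal (P.occ_density s (Some i) w)) \<in> borel_measurable borel" by simp
  show ?thesis
  proof (rule is_cond_exp_path_functional[OF n occ_measurable[OF s] m])
    fix v
    have sets: "{\<omega>\<in>space M. X n s \<omega> = Some i \<and> tau n \<omega> \<le> v} \<in> sets M"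
      using sets.Int[OF P.X_sets[OF s, of "Some i"], of "{\<omega>\<in>space M. tau n \<omega> \<le> v}"] tau_M[OF n]
      by (simp add: Int_def conj_ac)
    have "(\<integral>\<^sup>+\<omega>. ennreal (occ (X n) (Some i) s \<omega>) * indicator {..v} (tau n \<omega>) \<partial>M)
      = (\<integral>\<^sup>+\<omega>. indicator {\<omega>\<in>space M. X n s \<omega> = Some i \<and> tau n \<omega> \<le> v} \<omega> \<partial>M)"
      by (intro nn_integral_cong) (auto simp: occ_def indicator_def)
    also have "\<dots> = emeasure M {\<omega>\<in>space M. X n s \<omega> = Some i \<and> tau n \<omega> \<le> v}"
      by (rule nn_integral_indicator[OF sets])
    finally show "(\<integral>\<^sup>+\<omega>. ennreal (occ (X n) (Some i) s \<omega>) * indicator {..v} (tau n \<omega>) \<partial>M)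
      = (\<integral>\<^sup>+\<omega>. ennreal (P.occ_density s (Some i) (tau n \<omega>)) * indicator {..v} (tau n \<omega>) \<partial>M)"
      using P.occupation_and_absorption[OF s, of "Some i" v] by simp
  next
    have "(\<integral>\<^sup>+\<omega>. ennreal (occ (X n) (Some i) s \<omega>) \<partial>M) \<le> (\<integral>\<^sup>+\<omega>. 1 \<partial>M)"
      by (intro nn_integral_mono) (simp add: occ_def)
    then show "(\<integral>\<^sup>+\<omega>. ennreal (occ (X n) (Some i) s \<omega>) \<partial>M) < \<infinity>"
      by (rule le_less_trans) (simp add: emeasure_space_1)
  qed
qed

lemma is_cond_exp_occ_None:
  assumes n: "n \<in> {1..N}" and s: "0 \<le> s"
  shows "is_cond_exp M F (\<lambda>\<omega>. ennreal (occ (X n) None s \<omega>)) (\<lambda>\<omega>. ennreal (indicator {..s} (tau n \<omega>)))"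
proof -
  interpret P: absorbed_markov_process M "X n" a A by (rule process[OF n])
  have m: "(\<lambda>\<omega>. ennreal (indicator {..s} (tau n \<omega>))) \<in> borel_measurable F"
    by (rule measurable_compose[OF tau_F[OF n]]) simp
  have "AE \<omega> in M. ennreal (indicator {..s} (tau n \<omega>)) = ennreal (occ (X n) None s \<omega>)"
    using P.\<tau>_characterization
  proof eventually_elim
    case (elim \<omega>)
    then have "X n s \<omega> = None \<longleftrightarrow> tau n \<omega> \<le> s" using s by blast
    then show ?case by (simp add: occ_def indicator_def)
  qed
  then show ?thesis
    by (intro is_cond_exp_AE[OF is_cond_exp_self[OF m] path_algebra_M[OF n occ_measurable[OF s]] m]) simp_all
qed

lemma sets_J [simp]: "sets (J n i j \<omega>) = sets borel"
  by simp

lemma emeasure_J: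
  assumes n: "n \<in> {1..N}" and \<omega>: "\<omega> \<in> space M" and "i \<noteq> j" and B: "B \<in> sets borel"
  shows "emeasure (J n i j \<omega>) B = emeasure (count_space UNIV) (jumps (\<lambda>t. X n t \<omega>) i j \<inter> B)"
proof -
  interpret P: absorbed_markov_process M "X n" a A by (rule process[OF n])
  show ?thesis
    unfolding interval_measure_jump_count[of "X n", OF P.path[OF \<omega>] \<open>i \<noteq> j\<close>]
    using B by (subst emeasure_distr) (auto simp: emeasure_count_space Int_commute)
qed

lemma emeasure_J_Ioc:
  assumes n: "n \<in> {1..N}" and \<omega>: "\<omega> \<in> space M" and "i \<noteq> j"
  shows "emeasure (J n i j \<omega>) {0<..t} = ennreal (jump_count (X n) i j t \<omega>)"
proof -
  interpret P: absorbed_markov_process M "X n" a A by (rule process[OF n])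
  show ?thesis
    using finite_jumps[OF P.path[OF \<omega>] \<open>i \<noteq> j\<close>, of 0 t]
    by (subst emeasure_J[OF assms]) (auto simp: jump_count_eq ennreal_of_nat_eq_real_of_nat)
qed

text \<open>
  Unconditionally, the expected number of jumps may be infinite. On short intervals
  to the right of any given time it is finite, which gives the conditional expectation on such
  intervals; these are put together by induction along the time axis.
\<close>

lemma is_cond_exp_jumps:
  assumes n: "n \<in> {1..N}" and "i \<noteq> j" and t: "0 \<le> t"
  shows "is_cond_exp M F (\<lambda>\<omega>. emeasure (J n i j \<omega>) {0<..t}) (\<lambda>\<omega>. emeasure (jkernel n i j (tau n \<omega>)) {0<..t})"
proof -
  interpret P: absorbed_markov_process M "X n" a A by (rule process[OF n])
  have kernel_meas: "(\<lambda>\<omega>. emeasure (P.jump_kernel i j (tau n \<omega>)) B) \<in> borel_measurable F" if "B \<in> sets borel" for B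
    by (rule measurable_compose[OF tau_F[OF n] P.emeasure_jump_kernel_measurable[OF that]])
  \<comment> \<open>On an interval with integrable intensities, the formula for one process applies.\<close>
  have local: "is_cond_exp M F (\<lambda>\<omega>. ennreal (P.njumps i j r u \<omega>)) (\<lambda>\<omega>. emeasure (P.jump_kernel i j (tau n \<omega>)) {r<..u})"
    if "0 \<le> r" "r \<le> u" "set_integrable lborel {r..u} P.total_intensity" for r u
  proof (rule is_cond_exp_path_functional[OF n])
    show "(\<lambda>\<omega>. ennreal (P.njumps i j r u \<omega>)) \<in> borel_measurable (path_algebra n)"
      using measurable_card_jumps[of "X n" "path_algebra n" r u i j] path_algebra_X P.path that \<open>i \<noteq> j\<close>
      by (simp add: P.njumps_def)
    show "(\<lambda>w. emeasure (P.jump_kernel i j w) {r<..u}) \<in> borel_measurable borel"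
      by (rule P.emeasure_jump_kernel_measurable) simp
  qed (use P.jumps_and_absorption[OF that \<open>i \<noteq> j\<close>] in auto)
  show ?thesis using t
  proof (induction rule: right_induct)
    case base
    then show ?case by (simp add: is_cond_exp_zero)
  next
    case (right r)
    obtain e where e: "0 < e" "set_integrable lborel {r..r+e} P.total_intensity"
      using P.ex_total_intensity_integrable[OF right(1), of 1] by auto
    have "is_cond_exp M F (\<lambda>\<omega>. emeasure (J n i j \<omega>) {0<..u}) (\<lambda>\<omega>. emeasure (P.jump_kernel i j (tau n \<omega>)) {0<..u})"
      if u: "u \<in> {r..r+e}" for u
    proof (rule is_cond_exp_cong[OF is_cond_exp_add[OF right(2) local[of r u]]])
      show "set_integrable lborel {r..u} P.total_intensity" using u by (intro set_integrable_subset[OF e(2)]) auto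
      have split: "{0<..u} = {0<..r} \<union> {r<..u}" "{0<..r} \<inter> {r<..u} = {}" using u right(1) by auto
      fix \<omega> assume \<omega>: "\<omega> \<in> space M"
      show "emeasure (P.jump_kernel i j (tau n \<omega>)) {0<..r} + emeasure (P.jump_kernel i j (tau n \<omega>)) {r<..u}
          = emeasure (P.jump_kernel i j (tau n \<omega>)) {0<..u}"
        unfolding split(1) by (rule plus_emeasure) (use split in auto)
      have "ennreal (P.njumps i j r u \<omega>) = emeasure (J n i j \<omega>) {r<..u}"
        using finite_jumps[OF P.path[OF \<omega>] \<open>i \<noteq> j\<close>, of r u]
        by (subst emeasure_J[OF n \<omega> \<open>i \<noteq> j\<close>]) (auto simp: P.njumps_def ennreal_of_nat_eq_real_of_nat)
      then show "emeasure (J n i j \<omega>) {0<..r} + ennreal (P.njumps i j r u \<omega>) = emeasure (J n i j \<omega>) {0<..u}"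
        unfolding split(1) by (simp only:) (rule plus_emeasure; use split in auto)
    qed (use u right(1) in auto)
    then show ?case using e(1) by blast
  next
    case (left r)
    \<comment> \<open>Approach \<open>r\<close> from the left by monotone convergence. The end point
        \<open>r\<close> itself can be added, since it is neither a jump time nor an atom of the
        kernel.\<close>
    define s where "s m = max 0 (r - 1 / real (Suc m))" for m
    have s: "0 \<le> s m" "s m < r" for m using left(1) by (auto simp: s_def)
    have s_mono: "s m \<le> s m'" if "m \<le> m'" for m m'
      unfolding s_def using that by (intro max.mono diff_left_mono divide_left_mono) auto
    have UN: "(\<Union>m. {0<..s m}) = {0<..<r}"
    proof (intro equalityI subsetI)
      fix x assume x: "x \<in> {0<..<r}"
      then obtain m where "1 / Suc m < r - x" using nat_approx_posE[of "r - x"] by auto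
      then have "x \<le> s m" by (simp add: s_def)
      then show "x \<in> (\<Union>m. {0<..s m})" using x by auto
    qed (use s in \<open>auto intro: le_less_trans\<close>)
    have sup: "(SUP m. emeasure \<mu> {0<..s m}) = emeasure \<mu> {0<..<r}" if "sets \<mu> = sets borel" for \<mu> :: "real measure"
    proof -
      have "(SUP m. emeasure \<mu> {0<..s m}) = emeasure \<mu> (\<Union>m. {0<..s m})"
        using that s_mono by (intro SUP_emeasure_incseq) (auto simp: incseq_def intro: order_trans[OF _ s_mono])
      then show ?thesis by (simp only: UN)
    qed
    have inc: "emeasure \<mu> {0<..s m} \<le> emeasure \<mu> {0<..s m'}" if "m \<le> m'" "sets \<mu> = sets borel"
      for m m' and \<mu> :: "real measure"
      using s_mono[OF that(1)] that(2) by (intro emeasure_mono) auto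
    have "is_cond_exp M F (\<lambda>\<omega>. SUP m. emeasure (J n i j \<omega>) {0<..s m})
        (\<lambda>\<omega>. SUP m. emeasure (P.jump_kernel i j (tau n \<omega>)) {0<..s m})"
    proof (rule is_cond_exp_SUP)
      show "is_cond_exp M F (\<lambda>\<omega>. emeasure (J n i j \<omega>) {0<..s m}) (\<lambda>\<omega>. emeasure (P.jump_kernel i j (tau n \<omega>)) {0<..s m})" for m
        by (rule left(2)[OF s])
      show "incseq (\<lambda>m \<omega>. emeasure (J n i j \<omega>) {0<..s m})"
        by (intro monoI le_funI inc) simp_all
      show "incseq (\<lambda>m \<omega>. emeasure (P.jump_kernel i j (tau n \<omega>)) {0<..s m})"
        by (intro monoI le_funI inc) simp_all
    qed
    then have open_end: "is_cond_exp M F (\<lambda>\<omega>. emeasure (J n i j \<omega>) {0<..<r})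
        (\<lambda>\<omega>. emeasure (P.jump_kernel i j (tau n \<omega>)) {0<..<r})"
      by (rule is_cond_exp_cong) (simp_all only: sup sets_J P.sets_jump_kernel)
    have meas: "(\<lambda>\<omega>. emeasure (J n i j \<omega>) {0<..r}) \<in> borel_measurable M"
    proof -
      have "(\<lambda>\<omega>. ennreal (P.njumps i j 0 r \<omega>)) \<in> borel_measurable M"
        using P.njumps_measurable[of 0 r i j] left(1) \<open>i \<noteq> j\<close> by simp
      then show ?thesis
      proof (rule measurable_cong[THEN iffD1, rotated])
        fix \<omega> assume "\<omega> \<in> space M"
        have "ennreal (P.njumps i j 0 r \<omega>) = ennreal (jump_count (X n) i j r \<omega>)"
          by (simp add: jump_count_eq P.njumps_def)
        also have "\<dots> = emeasure (J n i j \<omega>) {0<..r}"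
          by (rule emeasure_J_Ioc[OF n \<open>\<omega> \<in> space M\<close> \<open>i \<noteq> j\<close>, symmetric])
        finally show "ennreal (P.njumps i j 0 r \<omega>) = emeasure (J n i j \<omega>) {0<..r}" .
      qed
    qed
    have ends: "{0<..r} = {0<..<r} \<union> {r}" using left(1) by auto
    show ?case
    proof (rule is_cond_exp_AE[OF open_end meas kernel_meas])
      show "AE \<omega> in M. emeasure (J n i j \<omega>) {0<..<r} = emeasure (J n i j \<omega>) {0<..r}"
        using P.no_fixed_jump[OF left(1)] AE_space
      proof eventually_elim
        case (elim \<omega>)
        have "r \<notin> jumps (\<lambda>t. X n t \<omega>) i j" using elim(1) jumps_subset_jump_times[OF \<open>i \<noteq> j\<close>] by blast
        then have "jumps (\<lambda>t. X n t \<omega>) i j \<inter> {0<..<r} = jumps (\<lambda>t. X n t \<omega>) i j \<inter> {0<..r}"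
          unfolding ends by blast
        then show ?case by (simp add: emeasure_J[OF n elim(2) \<open>i \<noteq> j\<close>])
      qed
      show "AE \<omega> in M. emeasure (P.jump_kernel i j (tau n \<omega>)) {0<..<r} = emeasure (P.jump_kernel i j (tau n \<omega>)) {0<..r}"
        using P.AE_\<tau>_neq[of r]
      proof eventually_elim
        case (elim \<omega>)
        have "emeasure (P.jump_kernel i j (tau n \<omega>)) ({0<..<r} \<union> {r})
            = emeasure (P.jump_kernel i j (tau n \<omega>)) {0<..<r} + emeasure (P.jump_kernel i j (tau n \<omega>)) {r}"
          by (rule plus_emeasure[symmetric]) auto
        then show ?case using P.jump_kernel_atom[of r "tau n \<omega>" i j] elim by (simp add: ends)
      qed
    qed simp
  qed
qed

end

section \<open>Versions of the conditional expected statistics\<close>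

text \<open>
  Versions are compared at rational times, where countably many null sets can be discarded;
  right continuity takes care of the other times.
\<close>

lemma right_continuous_eq_on_rationals:
  fixes f g :: "real \<Rightarrow> real"
  assumes "\<And>s. continuous (at_right s) f" "\<And>s. continuous (at_right s) g"
    and eq: "\<And>r. r \<in> \<rat> \<Longrightarrow> 0 \<le> r \<Longrightarrow> f r = g r" and "0 \<le> s"
  shows "f s = g s"
proof (rule ccontr)
  assume "f s \<noteq> g s"
  have "((\<lambda>u. f u - g u) \<longlongrightarrow> f s - g s) (at_right s)"
    using assms(1,2)[of s] by (intro tendsto_diff) (simp_all add: continuous_within)
  then have "\<forall>\<^sub>F u in at_right s. dist (f u - g u) (f s - g s) < \<bar>f s - g s\<bar>"
    using \<open>f s \<noteq> g s\<close> by (intro tendstoD) auto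
  then obtain b where b: "b > s" "\<And>u. u > s \<Longrightarrow> u < b \<Longrightarrow> dist (f u - g u) (f s - g s) < \<bar>f s - g s\<bar>"
    by (auto simp: eventually_at_right_field)
  obtain r where "r \<in> \<rat>" "s < r" "r < b" using Rats_dense_in_real[OF b(1)] by auto
  then show False using b(2)[of r] eq[of r] \<open>0 \<le> s\<close> by (simp add: dist_real_def)
qed

locale finite_cond_jumps = iid_absorbed_processes +
  assumes finite_cond_jump_count: "\<And>n i j s. n \<in> {1..N} \<Longrightarrow> i \<noteq> j \<Longrightarrow> 0 \<le> s \<Longrightarrow>
    AE \<omega> in M. nn_cond_exp M F (\<lambda>\<omega>. ennreal (jump_count (X n) i j s \<omega>)) \<omega> < \<infinity>"
begin

lemma is_cond_exp_jump_count:
  assumes n: "n \<in> {1..N}" and "i \<noteq> j" "0 \<le> t"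
  shows "is_cond_exp M F (\<lambda>\<omega>. ennreal (jump_count (X n) i j t \<omega>)) (\<lambda>\<omega>. emeasure (jkernel n i j (tau n \<omega>)) {0<..t})"
  by (rule is_cond_exp_cong[OF is_cond_exp_jumps[OF assms]]) (simp_all add: emeasure_J_Ioc[OF n _ \<open>i \<noteq> j\<close>])

lemma sets_jkernel: "n \<in> {1..N} \<Longrightarrow> sets (jkernel n i j w) = sets borel"
  by (rule absorbed_markov_process.sets_jump_kernel[OF process])

lemma jkernel_neg: "n \<in> {1..N} \<Longrightarrow> emeasure (jkernel n i j w) {..0} = 0"
  by (rule absorbed_markov_process.jump_kernel_outside[OF process]) auto

lemma jkernel_finite:
  assumes n: "n \<in> {1..N}" and "i \<noteq> j"
  shows "AE \<omega> in M. \<forall>t. emeasure (jkernel n i j (tau n \<omega>)) {0<..t} < \<infinity>"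
proof -
  have "AE \<omega> in M. emeasure (jkernel n i j (tau n \<omega>)) {0<..real k} < \<infinity>" for k :: nat
    using finite_cond_jump_count[OF assms, of "real k"] is_cond_expD[OF is_cond_exp_jump_count[OF assms, of "real k"]]
    by (auto elim: eventually_elim2)
  then have "AE \<omega> in M. \<forall>k::nat. emeasure (jkernel n i j (tau n \<omega>)) {0<..real k} < \<infinity>"
    by (subst AE_all_countable) auto
  then show ?thesis
  proof eventually_elim
    case (elim \<omega>)
    show ?case
    proof
      fix t
      obtain k :: nat where k: "t \<le> real k" using real_arch_simple by blast
      have "emeasure (jkernel n i j (tau n \<omega>)) {0<..t} \<le> emeasure (jkernel n i j (tau n \<omega>)) {0<..real k}"
        using k by (intro emeasure_mono) (auto simp: sets_jkernel[OF n])
      then show "emeasure (jkernel n i j (tau n \<omega>)) {0<..t} < \<infinity>" using elim by (meson le_less_trans)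
    qed
  qed
qed

lemma jump_count_measurable:
  assumes n: "n \<in> {1..N}" and "i \<noteq> j" "0 \<le> t"
  shows "jump_count (X n) i j t \<in> borel_measurable M"
proof -
  interpret P: absorbed_markov_process M "X n" a A by (rule process[OF n])
  have "jump_count (X n) i j t = P.njumps i j 0 t"
    by (simp add: fun_eq_iff jump_count_eq P.njumps_def)
  then show ?thesis using P.njumps_measurable[of 0 t i j] assms by simp
qed

lemma real_cond_exp_jump_count:
  assumes n: "n \<in> {1..N}" and "i \<noteq> j" "0 \<le> t"
  shows "AE \<omega> in M. real_cond_exp M F (jump_count (X n) i j t) \<omega> = enn2real (emeasure (jkernel n i j (tau n \<omega>)) {0<..t})"
  by (intro real_cond_exp_eq jump_count_measurable is_cond_exp_jump_count assms) (simp add: jump_count_def)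

definition Nbar0 :: "nat \<Rightarrow> 'b option \<Rightarrow> 'b option \<Rightarrow> real \<Rightarrow> 'a \<Rightarrow> real" where
  "Nbar0 n i j t \<omega> = enn2real (emeasure (jkernel n i j (tau n \<omega>)) {0<..t})"

lemma cond_jump_count_version_Nbar0: "cond_jump_count_version M N X Nbar0"
  unfolding cond_jump_count_version_def
proof (intro ballI allI impI conjI)
  fix n i j assume n: "n \<in> {1..N}" and ij: "i \<noteq> (j :: 'b option)"
  show "AE \<omega> in M. mono (\<lambda>s. Nbar0 n i j s \<omega>) \<and> (\<forall>s. continuous (at_right s) (\<lambda>s. Nbar0 n i j s \<omega>))
      \<and> (\<forall>s\<le>0. Nbar0 n i j s \<omega> = 0)"
    using jkernel_finite[OF n ij]
  proof eventually_elim
    case (elim \<omega>)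
    note im = interval_measure_of_measure[OF sets_jkernel[OF n] jkernel_neg[OF n], of i j "tau n \<omega>"]
    show ?case unfolding Nbar0_def using im(1-3) elim by blast
  qed
  show "AE \<omega> in M. Nbar0 n i j s \<omega> = real_cond_exp M F (jump_count (X n) i j s) \<omega>" if "0 \<le> s" for s
    using real_cond_exp_jump_count[OF n ij that] by (auto simp: Nbar0_def elim: eventually_mono)
qed

text \<open>
  Any version of the conditional jump counts has right-continuous paths and agrees with the
  explicit one at rational times, so both generate the same measure, almost surely.
\<close>

lemma interval_measure_version:
  assumes Nbar: "cond_jump_count_version M N X Nbar" and n: "n \<in> {1..N}" and ij: "i \<noteq> j"
  shows "AE \<omega> in M. interval_measure (\<lambda>s. Nbar n i j s \<omega>) = jkernel n i j (tau n \<omega>)"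
proof -
  have path: "AE \<omega> in M. mono (\<lambda>s. Nbar n i j s \<omega>) \<and> (\<forall>s. continuous (at_right s) (\<lambda>s. Nbar n i j s \<omega>))
      \<and> (\<forall>s\<le>0. Nbar n i j s \<omega> = 0)"
    and val: "\<And>s. 0 \<le> s \<Longrightarrow> AE \<omega> in M. Nbar n i j s \<omega> = real_cond_exp M F (jump_count (X n) i j s) \<omega>"
    using Nbar n ij unfolding cond_jump_count_version_def by blast+
  have "AE \<omega> in M. \<forall>r\<in>{r\<in>\<rat>. 0 \<le> r}. Nbar n i j r \<omega> = Nbar0 n i j r \<omega>"
  proof (subst AE_ball_countable)
    show "countable {r\<in>\<rat>. 0 \<le> (r :: real)}" by (rule countable_subset[OF _ countable_rat]) auto
    show "\<forall>r\<in>{r\<in>\<rat>. 0 \<le> r}. AE \<omega> in M. Nbar n i j r \<omega> = Nbar0 n i j r \<omega>"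
    proof
      fix r :: real assume "r \<in> {r\<in>\<rat>. 0 \<le> r}"
      then have r: "0 \<le> r" by simp
      show "AE \<omega> in M. Nbar n i j r \<omega> = Nbar0 n i j r \<omega>"
        using val[OF r] real_cond_exp_jump_count[OF n ij r] by eventually_elim (simp add: Nbar0_def)
    qed
  qed
  then show ?thesis
    using path jkernel_finite[OF n ij]
  proof eventually_elim
    case (elim \<omega>)
    note im = interval_measure_of_measure[OF sets_jkernel[OF n] jkernel_neg[OF n], of i j "tau n \<omega>"]
    have fin: "emeasure (jkernel n i j (tau n \<omega>)) {0<..t} < \<infinity>" for t using elim(3) by blast
    have "Nbar n i j s \<omega> = Nbar0 n i j s \<omega>" for s
    proof (cases "0 \<le> s")
      case True
      show ?thesis
      proof (rule right_continuous_eq_on_rationals[OF _ _ _ True, where f = "\<lambda>s. Nbar n i j s \<omega>" and g = "\<lambda>s. Nbar0 n i j s \<omega>"])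
        show "continuous (at_right s) (\<lambda>s. Nbar n i j s \<omega>)" for s using elim(2) by blast
        show "continuous (at_right s) (\<lambda>s. Nbar0 n i j s \<omega>)" for s
          unfolding Nbar0_def by (rule im(2)[OF fin])
        show "Nbar n i j r \<omega> = Nbar0 n i j r \<omega>" if "r \<in> \<rat>" "0 \<le> r" for r using elim(1) that by blast
      qed
    next
      case False
      then show ?thesis using elim(2) by (simp add: Nbar0_def)
    qed
    then have "(\<lambda>s. Nbar n i j s \<omega>) = (\<lambda>t. enn2real (emeasure (jkernel n i j (tau n \<omega>)) {0<..t}))"
      by (simp add: Nbar0_def fun_eq_iff)
    then show ?case using im(4)[OF fin] by simp
  qed
qed

text \<open>
  The absorbing state is occupied exactly from time \<open>tau n\<close> on.
\<close>

definition Ibar0 :: "nat \<Rightarrow> 'b option \<Rightarrow> real \<Rightarrow> 'a \<Rightarrow> real" where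
  "Ibar0 n i s \<omega> = (if i = None then indicator {..s} (tau n \<omega>) else occ_density n s i (tau n \<omega>))"

lemma Ibar0_nonneg: "n \<in> {1..N} \<Longrightarrow> 0 \<le> Ibar0 n i s \<omega>"
  by (auto simp: Ibar0_def intro: absorbed_markov_process.occ_density_nonneg[OF process])

lemma is_cond_exp_occ_Ibar0:
  assumes "n \<in> {1..N}" "0 \<le> s"
  shows "is_cond_exp M F (\<lambda>\<omega>. ennreal (occ (X n) i s \<omega>)) (\<lambda>\<omega>. ennreal (Ibar0 n i s \<omega>))"
  using is_cond_exp_occ[OF assms] is_cond_exp_occ_None[OF assms] by (cases i) (simp_all add: Ibar0_def)

lemma Ibar0_measurable:
  assumes n: "n \<in> {1..N}" and tau: "tau n \<in> borel_measurable K"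
  shows "(\<lambda>x. Ibar0 n i (fst x) (snd x)) \<in> borel_measurable (borel \<Otimes>\<^sub>M K)"
proof -
  interpret P: absorbed_markov_process M "X n" a A by (rule process[OF n])
  have "(\<lambda>x. (fst x, tau n (snd x))) \<in> measurable (borel \<Otimes>\<^sub>M K) (borel \<Otimes>\<^sub>M borel)"
    by (intro measurable_Pair measurable_fst measurable_compose[OF measurable_snd tau])
  from measurable_compose[OF this P.occ_density_measurable[of i]]
  have 1: "(\<lambda>x. P.occ_density (fst x) i (tau n (snd x))) \<in> borel_measurable (borel \<Otimes>\<^sub>M K)" by simp
  have [measurable]: "(\<lambda>x. tau n (snd x)) \<in> borel_measurable (borel \<Otimes>\<^sub>M K)"
    by (rule measurable_compose[OF measurable_snd tau])
  have "(\<lambda>x. if tau n (snd x) \<le> fst x then 1 else 0 :: real) \<in> borel_measurable (borel \<Otimes>\<^sub>M K)" by measurable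
  also have "(\<lambda>x. if tau n (snd x) \<le> fst x then 1 else 0 :: real) = (\<lambda>x. indicator {..fst x} (tau n (snd x)))"
    by (auto simp: fun_eq_iff indicator_def)
  finally show ?thesis using 1 by (cases "i = None") (simp_all add: Ibar0_def)
qed

lemma real_cond_exp_occ:
  assumes n: "n \<in> {1..N}" and s: "0 \<le> s"
  shows "AE \<omega> in M. real_cond_exp M F (occ (X n) i s) \<omega> = Ibar0 n i s \<omega>"
proof -
  have "(\<lambda>\<omega>. enn2real (ennreal (occ (X n) i s \<omega>))) \<in> borel_measurable M"
    using path_algebra_M[OF n occ_measurable[OF s]] by measurable
  then have "occ (X n) i s \<in> borel_measurable M" by (simp add: occ_def[abs_def])
  moreover have "0 \<le> occ (X n) i s \<omega>" for \<omega> by (simp add: occ_def)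
  ultimately show ?thesis
    using real_cond_exp_eq[OF _ _ is_cond_exp_occ_Ibar0[OF n s], of i] Ibar0_nonneg[OF n] by simp
qed

lemma cond_occ_version_Ibar0: "cond_occ_version M N X Ibar0"
  unfolding cond_occ_version_def
proof (intro ballI allI impI conjI)
  fix n i assume n: "n \<in> {1..N}"
  show "(\<lambda>(s, \<omega>). Ibar0 n i s \<omega>) \<in> borel_measurable (lborel \<Otimes>\<^sub>M M)"
    using Ibar0_measurable[OF n tau_M[OF n], of i] by (simp add: case_prod_unfold)
  show "AE \<omega> in M. Ibar0 n i s \<omega> = real_cond_exp M F (occ (X n) i s) \<omega>" if "0 \<le> s" for s
    using real_cond_exp_occ[OF n that, of i] by (auto elim: eventually_mono)
qed

lemma occ_version_eq:
  assumes "cond_occ_version M N X Ibar" and n: "n \<in> {1..N}" and s: "0 \<le> s"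
  shows "AE \<omega> in M. Ibar n i s \<omega> = Ibar0 n i s \<omega>"
proof -
  have "AE \<omega> in M. Ibar n i s \<omega> = real_cond_exp M F (occ (X n) i s) \<omega>"
    using assms unfolding cond_occ_version_def by blast
  then show ?thesis using real_cond_exp_occ[OF n s, of i] by eventually_elim simp
qed

end

section \<open>Extended-real bookkeeping\<close>

lemma ereal_split_triple:
  assumes "u < \<infinity> \<or> (v < \<infinity> \<and> w < \<infinity>)"
  shows "enn2ereal u - enn2ereal v - enn2ereal w = enn2ereal u - enn2ereal (v + w)"
  using assms by (cases u; cases v; cases w) (auto simp: ennreal_plus[symmetric] simp del: ennreal_plus)

lemma ereal_split_add:
  assumes "(u < \<infinity> \<and> u' < \<infinity>) \<or> (v < \<infinity> \<and> v' < \<infinity>)"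
  shows "(enn2ereal u - enn2ereal v) + (enn2ereal u' - enn2ereal v') = enn2ereal (u + u') - enn2ereal (v + v')"
  using assms by (cases u; cases v; cases u'; cases v')
    (auto simp: ennreal_plus[symmetric] simp del: ennreal_plus)

lemma ereal_split_sum:
  assumes "finite I" "(\<forall>i\<in>I. u i < \<infinity>) \<or> (\<forall>i\<in>I. v i < \<infinity>)"
  shows "(\<Sum>i\<in>I. enn2ereal (u i) - enn2ereal (v i)) = enn2ereal (\<Sum>i\<in>I. u i) - enn2ereal (\<Sum>i\<in>I. v i)"
  using assms
proof (induction I rule: finite_induct)
  case (insert x I)
  then have "(u x < \<infinity> \<and> (\<Sum>i\<in>I. u i) < \<infinity>) \<or> (v x < \<infinity> \<and> (\<Sum>i\<in>I. v i) < \<infinity>)"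
    by (auto simp: less_top[symmetric])
  from ereal_split_add[OF this] insert show ?case by auto
qed (simp add: zero_ennreal.rep_eq)

lemma ereal_parts:
  assumes "u < \<infinity>"
  shows "e2ennreal (enn2ereal u - enn2ereal v) = u - v" "e2ennreal (- (enn2ereal u - enn2ereal v)) = v - u"
  using assms
  by (cases u; cases v; simp add: ennreal_minus e2ennreal_neg ennreal_minus_top)+

text \<open>
  If two differences are balanced and the parts of the first are bounded by those of the second,
  then the differences agree, provided that the second is well defined.
\<close>

lemma ereal_diff_eq_of_sums:
  fixes p q u v :: ennreal
  assumes "p + v = q + u" "p \<le> u" "q \<le> v" "u < \<infinity> \<or> v < \<infinity>"
  shows "enn2ereal p - enn2ereal q = enn2ereal u - enn2ereal v"
  using assms
  by (cases p; cases q; cases u; cases v)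
     (auto simp: ennreal_plus[symmetric] top_unique simp del: ennreal_plus)

lemma elog_times:
  assumes "0 \<le> b" "x \<le> 1"
  shows "e2ennreal (- (ereal b * elog x)) = ennreal b * e2ennreal (- elog x)"
    and "ereal b * elog x = - enn2ereal (ennreal b * e2ennreal (- elog x))"
proof -
  have "e2ennreal (- (ereal b * elog x)) = ennreal b * e2ennreal (- elog x) \<and>
    ereal b * elog x = - enn2ereal (ennreal b * e2ennreal (- elog x))"
  proof (cases "0 < x")
    case True
    then have "ln x \<le> 0" using assms by simp
    then have "ennreal b * ennreal (- ln x) = ennreal (- (b * ln x))" "b * ln x \<le> 0"
      using assms by (simp_all add: ennreal_mult[symmetric] mult_nonneg_nonpos)
    then show ?thesis using True by (simp add: elog_def e2ennreal_ereal)
  next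
    case False
    then show ?thesis using assms by (cases "b = 0") (auto simp: elog_def ennreal_mult_top zero_ennreal.rep_eq)
  qed
  then show "e2ennreal (- (ereal b * elog x)) = ennreal b * e2ennreal (- elog x)"
    "ereal b * elog x = - enn2ereal (ennreal b * e2ennreal (- elog x))" by auto
qed

lemma e2ennreal_elog_finite: "e2ennreal (elog x) < \<infinity>"
  by (auto simp: elog_def e2ennreal_neg e2ennreal_ereal)

text \<open>
  Collects all terms of the log-likelihood as one difference of nonnegative quantities: \<open>jp\<close> are the
  positive parts of the jump integrals, whereas their negative parts \<open>jm\<close>, the initial terms \<open>v0\<close> and
  the occupation integrals \<open>oc\<close> are subtracted. The assumption excludes sums of infinities of
  opposite sign.
\<close>

lemma loglik_terms_sum:
  fixes v0 :: "'i::finite \<Rightarrow> ennreal" and jp jm oc :: "nat \<Rightarrow> 'j::finite \<Rightarrow> 'j \<Rightarrow> ennreal"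
  assumes "(\<forall>n\<in>{1..N}. \<forall>i j. i \<noteq> j \<longrightarrow> jp n i j < \<infinity>)
    \<or> (\<forall>i. v0 i < \<infinity>) \<and> (\<forall>n\<in>{1..N}. \<forall>i j. i \<noteq> j \<longrightarrow> jm n i j < \<infinity> \<and> oc n i j < \<infinity>)"
  shows "(\<Sum>i\<in>UNIV. - enn2ereal (v0 i)) + (\<Sum>i\<in>UNIV. \<Sum>j\<in>UNIV - {i}. \<Sum>n\<in>{1..N}.
      enn2ereal (jp n i j) - enn2ereal (jm n i j) - enn2ereal (oc n i j))
    = enn2ereal (\<Sum>i\<in>UNIV. \<Sum>j\<in>UNIV - {i}. \<Sum>n\<in>{1..N}. jp n i j)
      - enn2ereal ((\<Sum>i\<in>UNIV. v0 i) + (\<Sum>i\<in>UNIV. \<Sum>j\<in>UNIV - {i}. \<Sum>n\<in>{1..N}. jm n i j + oc n i j))"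
proof -
  let ?P = "\<forall>n\<in>{1..N}. \<forall>i j. i \<noteq> j \<longrightarrow> jp n i j < \<infinity>"
  let ?Q = "(\<forall>i. v0 i < \<infinity>) \<and> (\<forall>n\<in>{1..N}. \<forall>i j. i \<noteq> j \<longrightarrow> jm n i j < \<infinity> \<and> oc n i j < \<infinity>)"
  have fin: "(\<Sum>k\<in>K. h k) < \<infinity>" if "\<And>k. k \<in> K \<Longrightarrow> h k < \<infinity>" "finite K" for K and h :: "'c \<Rightarrow> ennreal"
    using that by (simp add: less_top[symmetric])
  have fin_i: "(\<Sum>k\<in>K. h k) < \<infinity>" if "\<And>k. k \<in> K \<Longrightarrow> h k < \<infinity>" "finite K" for K and h :: "'i \<Rightarrow> ennreal"
    using that by (simp add: less_top[symmetric])
  have fin_j: "(\<Sum>k\<in>K. h k) < \<infinity>" if "\<And>k. k \<in> K \<Longrightarrow> h k < \<infinity>" "finite K" for K and h :: "'j \<Rightarrow> ennreal"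
    using that by (simp add: less_top[symmetric])
  have fin_n: "(\<Sum>k\<in>K. h k) < \<infinity>" if "\<And>k. k \<in> K \<Longrightarrow> h k < \<infinity>" "finite K" for K and h :: "nat \<Rightarrow> ennreal"
    using that by (simp add: less_top[symmetric])
  have n: "(\<Sum>n\<in>{1..N}. enn2ereal (jp n i j) - enn2ereal (jm n i j) - enn2ereal (oc n i j))
      = enn2ereal (\<Sum>n\<in>{1..N}. jp n i j) - enn2ereal (\<Sum>n\<in>{1..N}. jm n i j + oc n i j)" if "i \<noteq> j" for i j
  proof -
    have "(\<Sum>n\<in>{1..N}. enn2ereal (jp n i j) - enn2ereal (jm n i j) - enn2ereal (oc n i j))
        = (\<Sum>n\<in>{1..N}. enn2ereal (jp n i j) - enn2ereal (jm n i j + oc n i j))"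
      using assms that by (intro sum.cong refl ereal_split_triple) blast
    then show ?thesis
      using assms that by (subst (asm) ereal_split_sum) auto
  qed
  have sj: "(\<Sum>j\<in>UNIV - {i}. \<Sum>n\<in>{1..N}. enn2ereal (jp n i j) - enn2ereal (jm n i j) - enn2ereal (oc n i j))
      = enn2ereal (\<Sum>j\<in>UNIV - {i}. \<Sum>n\<in>{1..N}. jp n i j) - enn2ereal (\<Sum>j\<in>UNIV - {i}. \<Sum>n\<in>{1..N}. jm n i j + oc n i j)" for i
  proof -
    have "(\<Sum>j\<in>UNIV - {i}. \<Sum>n\<in>{1..N}. enn2ereal (jp n i j) - enn2ereal (jm n i j) - enn2ereal (oc n i j))
      = (\<Sum>j\<in>UNIV - {i}. enn2ereal (\<Sum>n\<in>{1..N}. jp n i j) - enn2ereal (\<Sum>n\<in>{1..N}. jm n i j + oc n i j))"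
      by (intro sum.cong refl n) auto
    also have "\<dots> = enn2ereal (\<Sum>j\<in>UNIV - {i}. \<Sum>n\<in>{1..N}. jp n i j) - enn2ereal (\<Sum>j\<in>UNIV - {i}. \<Sum>n\<in>{1..N}. jm n i j + oc n i j)"
      using assms by (intro ereal_split_sum) (auto intro!: fin_n)
    finally show ?thesis .
  qed
  have si: "(\<Sum>i\<in>UNIV. \<Sum>j\<in>UNIV - {i}. \<Sum>n\<in>{1..N}. enn2ereal (jp n i j) - enn2ereal (jm n i j) - enn2ereal (oc n i j))
      = enn2ereal (\<Sum>i\<in>UNIV. \<Sum>j\<in>UNIV - {i}. \<Sum>n\<in>{1..N}. jp n i j)
        - enn2ereal (\<Sum>i\<in>UNIV. \<Sum>j\<in>UNIV - {i}. \<Sum>n\<in>{1..N}. jm n i j + oc n i j)"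
    unfolding sj using assms by (intro ereal_split_sum) (auto intro!: fin_n fin_j)
  have "(\<Sum>i\<in>UNIV. - enn2ereal (v0 i)) = (\<Sum>i\<in>UNIV. enn2ereal 0 - enn2ereal (v0 i))"
    by (simp add: zero_ennreal.rep_eq)
  also have "\<dots> = enn2ereal 0 - enn2ereal (\<Sum>i\<in>UNIV. v0 i)"
    by (subst ereal_split_sum) auto
  finally show ?thesis
    unfolding si using assms
    by (subst ereal_split_add[symmetric, of 0, simplified add_0_left])
       (auto intro!: fin_n fin_j fin_i)
qed

section \<open>The conditional expectation of the log-likelihood\<close>

lemma elog_measurable [measurable]: "elog \<in> borel_measurable borel"
  unfolding elog_def by measurable

context finite_cond_jumps
begin

lemma horizon_measurable: "1 \<le> N \<Longrightarrow> horizon N X \<in> borel_measurable M"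
  unfolding horizon_def by (rule borel_measurable_Max) (auto intro: tau_M)

lemma tau_le_horizon: "n \<in> {1..N} \<Longrightarrow> tau n \<omega> \<le> horizon N X \<omega>"
  unfolding horizon_def by (intro Max_ge) auto

text \<open>
  After the horizon there are no further jumps almost surely. As a function of an arbitrary
  path the integral up to the horizon is still measurable, because it is the infimum of
  the integrals up to later rational times.
\<close>

lemma is_cond_exp_jump_integral:
  fixes g :: "real \<Rightarrow> ennreal"
  assumes N: "1 \<le> N" and n: "n \<in> {1..N}" and ij: "i \<noteq> j"
    and g: "(\<lambda>s. indicator {0<..} s * g s) \<in> borel_measurable borel"
  shows "is_cond_exp M F (\<lambda>\<omega>. \<integral>\<^sup>+s\<in>{0<..horizon N X \<omega>}. g s \<partial>J n i j \<omega>)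
    (\<lambda>\<omega>. \<integral>\<^sup>+s\<in>{0<..tau n \<omega>}. g s \<partial>jkernel n i j (tau n \<omega>))"
proof -
  interpret P: absorbed_markov_process M "X n" a A by (rule process[OF n])
  let ?H = "horizon N X" let ?J = "\<lambda>\<omega>. jumps (\<lambda>t. X n t \<omega>) i j"
  have integral: "is_cond_exp M F (\<lambda>\<omega>. \<integral>\<^sup>+s. h s \<partial>J n i j \<omega>) (\<lambda>\<omega>. \<integral>\<^sup>+s. h s \<partial>jkernel n i j (tau n \<omega>))"
    if "h \<in> borel_measurable borel" for h :: "real \<Rightarrow> ennreal"
  proof (rule is_cond_exp_random_measure[OF _ _ _ _ _ _ _ _ that])
    fix \<omega> assume \<omega>: "\<omega> \<in> space M"
    show "emeasure (J n i j \<omega>) {..0} = 0"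
    proof -
      have "?J \<omega> \<inter> {..0} = {}" by (auto simp: jumps_def)
      then show ?thesis by (simp add: emeasure_J[OF n \<omega> ij])
    qed
    show "emeasure (J n i j \<omega>) {0<..t} < \<infinity>" for t by (simp add: emeasure_J_Ioc[OF n \<omega> ij])
  next
    show "(\<lambda>\<omega>. emeasure (jkernel n i j (tau n \<omega>)) B) \<in> borel_measurable F" if "B \<in> sets borel" for B
      by (rule measurable_compose[OF tau_F[OF n] P.emeasure_jump_kernel_measurable[OF that]])
    show "is_cond_exp M F (\<lambda>\<omega>. emeasure (J n i j \<omega>) {0<..t}) (\<lambda>\<omega>. emeasure (jkernel n i j (tau n \<omega>)) {0<..t})"
      if "0 \<le> t" for t by (rule is_cond_exp_jumps[OF n ij that])
    show "AE \<omega> in M. emeasure (jkernel n i j (tau n \<omega>)) {0<..t} < \<infinity>" for t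
      using jkernel_finite[OF n ij] by eventually_elim blast
  qed (use jkernel_neg[OF n] sets_jkernel[OF n] in auto)
  have count: "(\<integral>\<^sup>+s. h s \<partial>J n i j \<omega>) = (\<integral>\<^sup>+s. h s \<partial>count_space (?J \<omega>))"
    if "\<omega> \<in> space M" "h \<in> borel_measurable borel" for h and \<omega>
    unfolding interval_measure_jump_count[of "X n", OF P.path[OF that(1)] ij]
    using that(2) by (subst nn_integral_distr) auto
  define G where "G s = indicator {0<..} s * g s" for s
  have G [measurable]: "G \<in> borel_measurable borel" using g by (simp add: G_def[abs_def])
  have up_to: "(\<integral>\<^sup>+s\<in>{0<..t}. g s \<partial>\<mu>) = (\<integral>\<^sup>+s. G s * indicator {..t} s \<partial>\<mu>)" for t and \<mu> :: "real measure"
    by (intro nn_integral_cong) (auto simp: G_def indicator_def)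
  have Gt: "(\<lambda>s. G s * indicator {..t} s) \<in> borel_measurable borel" for t by measurable
  let ?R = "{r\<in>\<rat>. 0 \<le> (r :: real)}"
  \<comment> \<open>By finiteness of the jumps, the integral does not change if the horizon is replaced by a
      slightly larger rational number.\<close>
  have inf: "(\<integral>\<^sup>+s\<in>{0<..?H \<omega>}. g s \<partial>J n i j \<omega>)
      = (INF r\<in>?R. if ?H \<omega> < r then \<integral>\<^sup>+s. G s * indicator {..r} s \<partial>J n i j \<omega> else \<infinity>)" if \<omega>: "\<omega> \<in> space M" for \<omega>
  proof (rule antisym)
    show "(\<integral>\<^sup>+s\<in>{0<..?H \<omega>}. g s \<partial>J n i j \<omega>)
      \<le> (INF r\<in>?R. if ?H \<omega> < r then \<integral>\<^sup>+s. G s * indicator {..r} s \<partial>J n i j \<omega> else \<infinity>)"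
      unfolding up_to by (intro INF_greatest) (auto intro!: nn_integral_mono simp: indicator_def)
    show "(INF r\<in>?R. if ?H \<omega> < r then \<integral>\<^sup>+s. G s * indicator {..r} s \<partial>J n i j \<omega> else \<infinity>)
      \<le> (\<integral>\<^sup>+s\<in>{0<..?H \<omega>}. g s \<partial>J n i j \<omega>)"
    proof -
      define c where "c = max 0 (?H \<omega>)"
      define b where "b = Min (insert (c + 1) (?J \<omega> \<inter> {c<..c + 1}))"
      have fin: "finite (?J \<omega> \<inter> {c<..c + 1})" by (rule finite_jumps[OF P.path[OF \<omega>] ij])
      have b: "c < b" "b \<le> c + 1" unfolding b_def using fin by (auto simp: Min_gr_iff)
      have no: "\<not> (?H \<omega> < s \<and> s < b)" if s: "s \<in> ?J \<omega>" for s
      proof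
        assume *: "?H \<omega> < s \<and> s < b"
        have "0 < s" using s by (simp add: jumps_def)
        then have "s \<in> ?J \<omega> \<inter> {c<..c + 1}" using * s b by (auto simp: c_def)
        then have "b \<le> s" unfolding b_def using fin by (intro Min_le) auto
        then show False using * by simp
      qed
      obtain r where r: "r \<in> \<rat>" "max 0 (?H \<omega>) < r" "r < b"
        using Rats_dense_in_real[OF b(1)] by (auto simp: c_def)
      have "(\<integral>\<^sup>+s. G s * indicator {..r} s \<partial>J n i j \<omega>) = (\<integral>\<^sup>+s\<in>{0<..?H \<omega>}. g s \<partial>J n i j \<omega>)"
        unfolding up_to count[OF \<omega> Gt]
      proof (rule nn_integral_cong)
        fix s assume "s \<in> space (count_space (?J \<omega>))"
        then have "\<not> (?H \<omega> < s \<and> s < b)" using no by simp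
        then have "s \<le> r \<longleftrightarrow> s \<le> ?H \<omega>" using r by auto
        then show "G s * indicator {..r} s = G s * indicator {..?H \<omega>} s" by (simp add: indicator_def)
      qed
      then show ?thesis using r by (intro INF_lower2[of r]) auto
    qed
  qed
  have meas: "(\<lambda>\<omega>. \<integral>\<^sup>+s\<in>{0<..?H \<omega>}. g s \<partial>J n i j \<omega>) \<in> borel_measurable M"
  proof (subst measurable_cong[OF inf])
    have [measurable]: "?H \<in> borel_measurable M" by (rule horizon_measurable[OF N])
    have [measurable]: "(\<lambda>\<omega>. \<integral>\<^sup>+s. G s * indicator {..r} s \<partial>J n i j \<omega>) \<in> borel_measurable M" for r
      using integral[OF Gt] by (simp add: is_cond_exp_def)
    show "(\<lambda>\<omega>. INF r\<in>?R. if ?H \<omega> < r then \<integral>\<^sup>+s. G s * indicator {..r} s \<partial>J n i j \<omega> else \<infinity>) \<in> borel_measurable M"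
      by (intro borel_measurable_INF countable_subset[OF _ countable_rat]) auto
  qed
  have barG: "(\<integral>\<^sup>+s. G s \<partial>jkernel n i j (tau n \<omega>)) = (\<integral>\<^sup>+s\<in>{0<..tau n \<omega>}. g s \<partial>jkernel n i j (tau n \<omega>))" for \<omega>
    unfolding up_to
  proof (rule nn_integral_cong_AE)
    have "emeasure (jkernel n i j (tau n \<omega>)) {tau n \<omega><..} = 0"
      by (intro P.jump_kernel_outside) auto
    then have "AE s in jkernel n i j (tau n \<omega>). s \<notin> {tau n \<omega><..}"
      by (intro AE_not_in) (auto simp: null_sets_def)
    then show "AE s in jkernel n i j (tau n \<omega>). G s = G s * indicator {..tau n \<omega>} s"
      by eventually_elim (auto simp: indicator_def)
  qed
  show ?thesis
  proof (rule is_cond_exp_AE[OF integral[OF G] meas])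
    show "AE \<omega> in M. (\<integral>\<^sup>+s. G s \<partial>J n i j \<omega>) = (\<integral>\<^sup>+s\<in>{0<..?H \<omega>}. g s \<partial>J n i j \<omega>)"
      using P.no_jumps_after_\<tau> AE_space
    proof eventually_elim
      case (elim \<omega>)
      have "?J \<omega> \<subseteq> {0<..tau n \<omega>}" using elim(1) ij by blast
      then show ?case
        unfolding up_to count[OF elim(2) Gt] count[OF elim(2) G] using tau_le_horizon[OF n, of \<omega>]
        by (intro nn_integral_cong) (auto simp: indicator_def)
    qed
    show "(\<lambda>\<omega>. \<integral>\<^sup>+s\<in>{0<..tau n \<omega>}. g s \<partial>jkernel n i j (tau n \<omega>)) \<in> borel_measurable F"
      using integral[OF G] by (simp add: is_cond_exp_def barG)
    show "AE \<omega> in M. (\<integral>\<^sup>+s. G s \<partial>jkernel n i j (tau n \<omega>)) = (\<integral>\<^sup>+s\<in>{0<..tau n \<omega>}. g s \<partial>jkernel n i j (tau n \<omega>))"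
      by (simp add: barG)
  qed
qed

text \<open>
  Fubini's theorem exchanges the time integral with integration over events of absorption times.
  After absorption transient states are no longer occupied, so the horizon may be replaced by the
  own absorption time.
\<close>

lemma is_cond_exp_occ_integral:
  fixes g :: "real \<Rightarrow> real"
  assumes N: "1 \<le> N" and n: "n \<in> {1..N}" and i: "i \<noteq> None \<or> (\<forall>s. g s = 0)"
    and g: "(\<lambda>s. indicator {0..} s * g s) \<in> borel_measurable borel" "\<And>s. 0 \<le> s \<Longrightarrow> 0 \<le> g s"
  shows "is_cond_exp M F (\<lambda>\<omega>. \<integral>\<^sup>+s\<in>{0..horizon N X \<omega>}. ennreal (occ (X n) i s \<omega> * g s) \<partial>lborel)
    (\<lambda>\<omega>. \<integral>\<^sup>+s\<in>{0..tau n \<omega>}. ennreal (Ibar0 n i s \<omega> * g s) \<partial>lborel)"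
proof -
  interpret P: absorbed_markov_process M "X n" a A by (rule process[OF n])
  interpret pair: pair_sigma_finite "lborel :: real measure" M ..
  let ?H = "horizon N X"
  define G where "G s = ennreal (indicator {0..} s * g s)" for s
  have G [measurable]: "G \<in> borel_measurable borel" using g(1) unfolding G_def[abs_def] by measurable
  have occ_m: "(\<lambda>x. ennreal (of_bool (0 \<le> fst x \<and> X n (fst x) (snd x) = i))) \<in> borel_measurable (lborel \<Otimes>\<^sub>M M)"
  proof -
    have "(\<lambda>x. of_bool (0 \<le> fst x \<and> X n (fst x) (snd x) = i) :: real) \<in> borel_measurable (borel \<Otimes>\<^sub>M M)"
      using measurable_path_indicator[OF P.X_measurable P.path, of i] by (simp add: case_prod_unfold)
    then show ?thesis by simp
  qed
  have I_m: "(\<lambda>x. ennreal (Ibar0 n i (fst x) (snd x))) \<in> borel_measurable (lborel \<Otimes>\<^sub>M K)"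
    if "tau n \<in> borel_measurable K" for K
    using Ibar0_measurable[OF n that, of i] by simp
  have occ_form: "ennreal (occ (X n) i s \<omega> * g s) * indicator {0..t} s
      = (ennreal (of_bool (0 \<le> s \<and> X n s \<omega> = i)) * G s) * indicator {..t} s" for s t \<omega>
    by (auto simp: occ_def G_def indicator_def)
  have I_form: "ennreal (Ibar0 n i s \<omega> * g s) * indicator {0..t} s
      = (ennreal (Ibar0 n i s \<omega>) * G s) * indicator {..t} s" for s t \<omega>
    using Ibar0_nonneg[OF n, of i s \<omega>] g(2)[of s] by (auto simp: G_def indicator_def ennreal_mult)
  have occ_G: "(\<lambda>x. ennreal (of_bool (0 \<le> fst x \<and> X n (fst x) (snd x) = i)) * G (fst x)) \<in> borel_measurable (lborel \<Otimes>\<^sub>M M)"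
    using occ_m by measurable
  have I_G: "(\<lambda>x. ennreal (Ibar0 n i (fst x) (snd x)) * G (fst x)) \<in> borel_measurable (lborel \<Otimes>\<^sub>M K)"
    if "tau n \<in> borel_measurable K" for K
    using I_m[OF that] by measurable
  have swap: "(\<lambda>x. h (snd x) (fst x)) \<in> borel_measurable (K \<Otimes>\<^sub>M lborel)"
    if "(\<lambda>x. h (fst x) (snd x)) \<in> borel_measurable (lborel \<Otimes>\<^sub>M K)" for h :: "real \<Rightarrow> 'a \<Rightarrow> ennreal" and K
    using measurable_compose[OF measurable_pair_swap' that] by (simp add: case_prod_unfold)
  have total: "is_cond_exp M F (\<lambda>\<omega>. \<integral>\<^sup>+s. ennreal (of_bool (0 \<le> s \<and> X n s \<omega> = i)) * G s \<partial>lborel)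
      (\<lambda>\<omega>. \<integral>\<^sup>+s. ennreal (Ibar0 n i s \<omega>) * G s \<partial>lborel)"
    unfolding is_cond_exp_def
  proof (intro conjI ballI)
    show "(\<lambda>\<omega>. \<integral>\<^sup>+s. ennreal (of_bool (0 \<le> s \<and> X n s \<omega> = i)) * G s \<partial>lborel) \<in> borel_measurable M"
      using swap[OF occ_G] by (intro lborel.borel_measurable_nn_integral) (simp add: case_prod_unfold)
    show "(\<lambda>\<omega>. \<integral>\<^sup>+s. ennreal (Ibar0 n i s \<omega>) * G s \<partial>lborel) \<in> borel_measurable F"
      using swap[OF I_G[OF tau_F[OF n]]] by (intro lborel.borel_measurable_nn_integral) (simp add: case_prod_unfold)
    fix B assume B: "B \<in> sets F"
    have [measurable]: "B \<in> sets M" by (rule F_sets[OF B])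
    have fub: "(\<integral>\<^sup>+\<omega>\<in>B. (\<integral>\<^sup>+s. h s \<omega> * G s \<partial>lborel) \<partial>M) = (\<integral>\<^sup>+s. G s * (\<integral>\<^sup>+\<omega>\<in>B. h s \<omega> \<partial>M) \<partial>lborel)"
      if h [measurable]: "(\<lambda>x. h (fst x) (snd x)) \<in> borel_measurable (lborel \<Otimes>\<^sub>M M)" for h :: "real \<Rightarrow> 'a \<Rightarrow> ennreal"
    proof -
      have hs: "(\<lambda>\<omega>. h s \<omega>) \<in> borel_measurable M" for s
        using measurable_compose[OF measurable_Pair1' h, of s] by simp
      have hw: "(\<lambda>s. h s \<omega>) \<in> borel_measurable lborel" if "\<omega> \<in> space M" for \<omega>
        using measurable_compose[OF measurable_Pair2'[OF that] h] by simp
      have "(\<integral>\<^sup>+\<omega>\<in>B. (\<integral>\<^sup>+s. h s \<omega> * G s \<partial>lborel) \<partial>M) = (\<integral>\<^sup>+\<omega>. \<integral>\<^sup>+s. G s * (h s \<omega> * indicator B \<omega>) \<partial>lborel \<partial>M)"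
      proof (rule nn_integral_cong)
        fix \<omega> assume "\<omega> \<in> space M"
        then have [measurable]: "(\<lambda>s. h s \<omega>) \<in> borel_measurable lborel" by (rule hw)
        have "(\<integral>\<^sup>+s. h s \<omega> * G s \<partial>lborel) * indicator B \<omega> = (\<integral>\<^sup>+s. (h s \<omega> * G s) * indicator B \<omega> \<partial>lborel)"
          by (rule nn_integral_multc[symmetric]) measurable
        then show "(\<integral>\<^sup>+s. h s \<omega> * G s \<partial>lborel) * indicator B \<omega> = (\<integral>\<^sup>+s. G s * (h s \<omega> * indicator B \<omega>) \<partial>lborel)"
          by (simp only: mult_ac)
      qed
      also have "\<dots> = (\<integral>\<^sup>+s. \<integral>\<^sup>+\<omega>. G s * (h s \<omega> * indicator B \<omega>) \<partial>M \<partial>lborel)"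
      proof (rule pair.Fubini')
        show "(\<lambda>(s, \<omega>). G s * (h s \<omega> * indicator B \<omega>)) \<in> borel_measurable (lborel \<Otimes>\<^sub>M M)"
          unfolding case_prod_unfold by measurable
      qed
      also have "\<dots> = (\<integral>\<^sup>+s. G s * (\<integral>\<^sup>+\<omega>\<in>B. h s \<omega> \<partial>M) \<partial>lborel)"
      proof (rule nn_integral_cong)
        fix s :: real
        have [measurable]: "(\<lambda>\<omega>. h s \<omega>) \<in> borel_measurable M" by (rule hs)
        show "(\<integral>\<^sup>+\<omega>. G s * (h s \<omega> * indicator B \<omega>) \<partial>M) = G s * (\<integral>\<^sup>+\<omega>\<in>B. h s \<omega> \<partial>M)"
          by (rule nn_integral_cmult) measurable
      qed
      finally show ?thesis .
    qed
    have "G s * (\<integral>\<^sup>+\<omega>\<in>B. ennreal (of_bool (0 \<le> s \<and> X n s \<omega> = i)) \<partial>M) = G s * (\<integral>\<^sup>+\<omega>\<in>B. ennreal (Ibar0 n i s \<omega>) \<partial>M)" for s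
    proof (cases "0 \<le> s")
      case True
      have "(\<integral>\<^sup>+\<omega>\<in>B. ennreal (occ (X n) i s \<omega>) \<partial>M) = (\<integral>\<^sup>+\<omega>\<in>B. ennreal (Ibar0 n i s \<omega>) \<partial>M)"
        using is_cond_exp_occ_Ibar0[OF n True, of i] B by (simp add: is_cond_exp_def)
      moreover have "ennreal (occ (X n) i s \<omega>) = ennreal (of_bool (0 \<le> s \<and> X n s \<omega> = i))" for \<omega>
        using True by (simp add: occ_def)
      ultimately show ?thesis by simp
    qed (simp add: G_def)
    then show "(\<integral>\<^sup>+\<omega>\<in>B. (\<integral>\<^sup>+s. ennreal (of_bool (0 \<le> s \<and> X n s \<omega> = i)) * G s \<partial>lborel) \<partial>M)
        = (\<integral>\<^sup>+\<omega>\<in>B. (\<integral>\<^sup>+s. ennreal (Ibar0 n i s \<omega>) * G s \<partial>lborel) \<partial>M)"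
      by (simp only: fub[OF occ_m] fub[OF I_m[OF tau_M[OF n]]])
  qed
  show ?thesis
    unfolding occ_form I_form
  proof (rule is_cond_exp_AE[OF total])
    have cut: "(\<lambda>\<omega>. \<integral>\<^sup>+s. h s \<omega> * G s * indicator {..t \<omega>} s \<partial>lborel) \<in> borel_measurable K"
      if [measurable]: "t \<in> borel_measurable K" and h: "(\<lambda>x. h (fst x) (snd x) * G (fst x)) \<in> borel_measurable (lborel \<Otimes>\<^sub>M K)"
      for t K and h :: "real \<Rightarrow> 'a \<Rightarrow> ennreal"
    proof -
      have [measurable]: "(\<lambda>x. h (snd x) (fst x) * G (snd x)) \<in> borel_measurable (K \<Otimes>\<^sub>M lborel)"
        using swap[OF h] .
      have "(\<lambda>x. if snd x \<le> t (fst x) then h (snd x) (fst x) * G (snd x) else 0) \<in> borel_measurable (K \<Otimes>\<^sub>M lborel)"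
        by measurable
      also have "(\<lambda>x. if snd x \<le> t (fst x) then h (snd x) (fst x) * G (snd x) else 0)
          = (\<lambda>x. h (snd x) (fst x) * G (snd x) * indicator {..t (fst x)} (snd x))"
        by (auto simp: fun_eq_iff)
      finally show ?thesis
        by (intro lborel.borel_measurable_nn_integral) (simp add: case_prod_unfold)
    qed
    show "(\<lambda>\<omega>. \<integral>\<^sup>+s. ennreal (of_bool (0 \<le> s \<and> X n s \<omega> = i)) * G s * indicator {..?H \<omega>} s \<partial>lborel) \<in> borel_measurable M"
      by (rule cut[OF horizon_measurable[OF N] occ_G])
    show "(\<lambda>\<omega>. \<integral>\<^sup>+s. ennreal (Ibar0 n i s \<omega>) * G s * indicator {..tau n \<omega>} s \<partial>lborel) \<in> borel_measurable F"
      by (rule cut[OF tau_F[OF n] I_G[OF tau_F[OF n]]])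
    show "AE \<omega> in M. (\<integral>\<^sup>+s. ennreal (of_bool (0 \<le> s \<and> X n s \<omega> = i)) * G s \<partial>lborel)
        = (\<integral>\<^sup>+s. ennreal (of_bool (0 \<le> s \<and> X n s \<omega> = i)) * G s * indicator {..?H \<omega>} s \<partial>lborel)"
      using P.\<tau>_characterization
    proof eventually_elim
      case (elim \<omega>)
      show ?case
      proof (rule nn_integral_cong)
        fix s :: real
        have "X n s \<omega> = None" if "\<not> s \<le> ?H \<omega>" "0 \<le> s"
          using elim that tau_le_horizon[OF n, of \<omega>] by auto
        then show "ennreal (of_bool (0 \<le> s \<and> X n s \<omega> = i)) * G s
            = ennreal (of_bool (0 \<le> s \<and> X n s \<omega> = i)) * G s * indicator {..?H \<omega>} s"
          using i by (cases "s \<le> ?H \<omega>") (auto simp: G_def)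
      qed
    qed
    show "AE \<omega> in M. (\<integral>\<^sup>+s. ennreal (Ibar0 n i s \<omega>) * G s \<partial>lborel)
        = (\<integral>\<^sup>+s. ennreal (Ibar0 n i s \<omega>) * G s * indicator {..tau n \<omega>} s \<partial>lborel)"
    proof (intro AE_I2 nn_integral_cong)
      fix \<omega> and s :: real
      show "ennreal (Ibar0 n i s \<omega>) * G s = ennreal (Ibar0 n i s \<omega>) * G s * indicator {..tau n \<omega>} s"
        using i by (cases "s \<le> tau n \<omega>") (auto simp: Ibar0_def P.occ_density_def G_def)
    qed
  qed
qed

text \<open>
  At each time two versions agree outside a null set that depends on the time. By joint measurability
  and Fubini's theorem, almost surely they agree at almost every time.
\<close>

lemma occ_integral_version:
  assumes Ibar: "cond_occ_version M N X Ibar" and n: "n \<in> {1..N}"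
  shows "AE \<omega> in M. \<forall>g. (\<integral>\<^sup>+s\<in>{0..tau n \<omega>}. ennreal (Ibar n i s \<omega> * g s) \<partial>lborel)
    = (\<integral>\<^sup>+s\<in>{0..tau n \<omega>}. ennreal (Ibar0 n i s \<omega> * g s) \<partial>lborel)"
proof -
  interpret pair: pair_sigma_finite "lborel :: real measure" M ..
  have m1: "(\<lambda>x. Ibar n i (fst x) (snd x)) \<in> borel_measurable (lborel \<Otimes>\<^sub>M M)"
    using Ibar n unfolding cond_occ_version_def by (auto simp: case_prod_unfold)
  have m2: "(\<lambda>x. Ibar0 n i (fst x) (snd x)) \<in> borel_measurable (lborel \<Otimes>\<^sub>M M)"
    using Ibar0_measurable[OF n tau_M[OF n], of i] by simp
  have [measurable]: "Measurable.pred (lborel \<Otimes>\<^sub>M M) (\<lambda>x. 0 \<le> fst x \<longrightarrow> Ibar n i (fst x) (snd x) = Ibar0 n i (fst x) (snd x))"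
    using m1 m2 by measurable
  have sets: "{x\<in>space (lborel \<Otimes>\<^sub>M M). 0 \<le> fst x \<longrightarrow> Ibar n i (fst x) (snd x) = Ibar0 n i (fst x) (snd x)} \<in> sets (lborel \<Otimes>\<^sub>M M)"
    by measurable
  have "AE s in lborel. AE \<omega> in M. 0 \<le> s \<longrightarrow> Ibar n i s \<omega> = Ibar0 n i s \<omega>"
  proof (rule AE_I2)
    fix s :: real
    show "AE \<omega> in M. 0 \<le> s \<longrightarrow> Ibar n i s \<omega> = Ibar0 n i s \<omega>"
      using occ_version_eq[OF Ibar n, of s i] by (cases "0 \<le> s") (auto elim: eventually_mono)
  qed
  then have "AE \<omega> in M. AE s in lborel. 0 \<le> s \<longrightarrow> Ibar n i s \<omega> = Ibar0 n i s \<omega>"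
    using pair.AE_commute[of "\<lambda>s \<omega>. 0 \<le> s \<longrightarrow> Ibar n i s \<omega> = Ibar0 n i s \<omega>"] sets by simp
  then show ?thesis
  proof eventually_elim
    case (elim \<omega>)
    show ?case
      by (intro allI nn_integral_cong_AE) (use elim in eventually_elim, auto simp: indicator_def)
  qed
qed

lemma is_cond_exp_initial_count:
  "is_cond_exp M F (\<lambda>\<omega>. ennreal (initial_count N X i \<omega>)) (\<lambda>\<omega>. ennreal (\<Sum>n\<in>{1..N}. Ibar0 n (Some i) 0 \<omega>))"
proof -
  have "is_cond_exp M F (\<lambda>\<omega>. \<Sum>n\<in>{1..N}. ennreal (occ (X n) (Some i) 0 \<omega>)) (\<lambda>\<omega>. \<Sum>n\<in>{1..N}. ennreal (Ibar0 n (Some i) 0 \<omega>))"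
    by (intro is_cond_exp_sum is_cond_exp_occ_Ibar0) auto
  then show ?thesis
  proof (rule is_cond_exp_cong)
    show "(\<Sum>n\<in>{1..N}. ennreal (occ (X n) (Some i) 0 \<omega>)) = ennreal (initial_count N X i \<omega>)" for \<omega>
      unfolding initial_count_def by (rule sum_ennreal) (simp add: occ_def)
    show "(\<Sum>n\<in>{1..N}. ennreal (Ibar0 n (Some i) 0 \<omega>)) = ennreal (\<Sum>n\<in>{1..N}. Ibar0 n (Some i) 0 \<omega>)" for \<omega>
      by (rule sum_ennreal) (rule Ibar0_nonneg)
  qed
qed

lemma cond_initial_count_eq:
  "AE \<omega> in M. cond_initial_count M N X i \<omega> = (\<Sum>n\<in>{1..N}. Ibar0 n (Some i) 0 \<omega>)"
proof -
  have "(\<lambda>\<omega>. ennreal (initial_count N X i \<omega>)) \<in> borel_measurable M"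
    using is_cond_exp_initial_count[of i] by (simp add: is_cond_exp_def)
  then have "(\<lambda>\<omega>. enn2real (ennreal (initial_count N X i \<omega>))) \<in> borel_measurable M"
    by (rule borel_measurable_enn2real)
  moreover have nonneg: "0 \<le> initial_count N X i \<omega>" for \<omega>
    unfolding initial_count_def by (intro sum_nonneg) (simp add: occ_def)
  ultimately have "initial_count N X i \<in> borel_measurable M" by simp
  from real_cond_exp_eq[OF this nonneg is_cond_exp_initial_count]
  show ?thesis
    unfolding cond_initial_count_def
  proof eventually_elim
    case (elim \<omega>)
    have "0 \<le> (\<Sum>n\<in>{1..N}. Ibar0 n (Some i) 0 \<omega>)" by (intro sum_nonneg Ibar0_nonneg)
    then show ?case using elim by simp
  qed
qed

text \<open>
  The integral is a finite sum over the jumps of the path.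
\<close>

lemma jump_integral_finite:
  assumes n: "n \<in> {1..N}" and ij: "i \<noteq> j" and \<omega>: "\<omega> \<in> space M"
    and g: "(\<lambda>s. indicator {0<..} s * g s) \<in> borel_measurable borel" "\<And>s. g s < (\<infinity> :: ennreal)"
  shows "(\<integral>\<^sup>+s\<in>{0<..t}. g s \<partial>J n i j \<omega>) < \<infinity>"
proof -
  interpret P: absorbed_markov_process M "X n" a A by (rule process[OF n])
  let ?J = "jumps (\<lambda>t. X n t \<omega>) i j"
  have fin: "finite (?J \<inter> {0<..t})" by (rule finite_jumps[OF P.path[OF \<omega>] ij])
  have "(\<lambda>s. (indicator {0<..} s * g s) * indicator {0<..t} s) \<in> borel_measurable borel"
    using g(1) by measurable
  also have "(\<lambda>s. (indicator {0<..} s * g s) * indicator {0<..t} s) = (\<lambda>s. g s * indicator {0<..t} s)"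
    by (auto simp: fun_eq_iff indicator_def)
  finally have "(\<integral>\<^sup>+s\<in>{0<..t}. g s \<partial>J n i j \<omega>) = (\<integral>\<^sup>+s. g s * indicator {0<..t} s \<partial>count_space ?J)"
    unfolding interval_measure_jump_count[of "X n", OF P.path[OF \<omega>] ij]
    by (subst nn_integral_distr) auto
  also have "\<dots> = (\<Sum>s\<in>?J \<inter> {0<..t}. g s * indicator {0<..t} s)"
    by (rule nn_integral_count_space'[OF fin]) auto
  also have "\<dots> < \<infinity>" using g(2) fin by (simp add: less_top[symmetric] ennreal_mult_eq_top_iff)
  finally show ?thesis .
qed

text \<open>
  Write the log-likelihood as \<open>U - V\<close>; \<open>U\<close> is finite on every path. With \<open>Lp = (U - V)^+\<close> and
  \<open>Lm = (V - U)^+\<close> one has \<open>Lp + V = Lm + U\<close>, an identity of nonnegative functions that may be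
  conditioned term by term. Since \<open>Lp \<le> U\<close> and \<open>Lm \<le> V\<close>, it can be solved for the
  difference of the conditional expectations of \<open>Lp\<close> and \<open>Lm\<close> wherever the conditional expectation of
  \<open>U\<close> or that of \<open>V\<close> is finite, which is what well-definedness provides.
\<close>

lemma cond_exp_loglik:
  fixes a' :: "real^'b" and A' :: "real \<Rightarrow> real^'b^'b"
  assumes N: "1 \<le> N" and a': "a' \<in> probability_vectors" and A': "sub_intensity A'"
    and Ibar: "cond_occ_version M N X Ibar" and Nbar: "cond_jump_count_version M N X Nbar"
    and wd: "loglik_cond_exp_well_defined M N X a' A'"
  shows "AE \<omega> in M. ereal_cond_exp M F (complete_loglik N X a' A') \<omega> =
    cond_loglik_initial M N X a' \<omega> + (\<Sum>i\<in>UNIV. \<Sum>j\<in>UNIV - {i}. cond_loglik_jump N X Ibar Nbar A' i j \<omega>)"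
proof -
  let ?L = "\<lambda>i j s. intensity_matrix A' s $ i $ j" and ?H = "horizon N X"
  let ?S = "{(n, i, j). n \<in> {1..N} \<and> i \<noteq> (j :: 'b option)}"
  define V0 where "V0 i \<omega> = e2ennreal (- (ereal (initial_count N X i \<omega>) * elog (a' $ i)))" for i \<omega>
  define Jp where "Jp n i j \<omega> = (\<integral>\<^sup>+s\<in>{0<..?H \<omega>}. e2ennreal (elog (?L i j s)) \<partial>J n i j \<omega>)" for n i j \<omega>
  define Jm where "Jm n i j \<omega> = (\<integral>\<^sup>+s\<in>{0<..?H \<omega>}. e2ennreal (- elog (?L i j s)) \<partial>J n i j \<omega>)" for n i j \<omega>
  define Oc where "Oc n i j \<omega> = (\<integral>\<^sup>+s\<in>{0..?H \<omega>}. ennreal (occ (X n) i s \<omega> * ?L i j s) \<partial>lborel)" for n i j \<omega>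
  define bV0 where "bV0 i \<omega> = ennreal (\<Sum>n\<in>{1..N}. Ibar0 n (Some i) 0 \<omega>) * e2ennreal (- elog (a' $ i))" for i \<omega>
  define bJp where "bJp n i j \<omega> = (\<integral>\<^sup>+s\<in>{0<..tau n \<omega>}. e2ennreal (elog (?L i j s)) \<partial>jkernel n i j (tau n \<omega>))" for n i j \<omega>
  define bJm where "bJm n i j \<omega> = (\<integral>\<^sup>+s\<in>{0<..tau n \<omega>}. e2ennreal (- elog (?L i j s)) \<partial>jkernel n i j (tau n \<omega>))" for n i j \<omega>
  define bO where "bO n i j \<omega> = (\<integral>\<^sup>+s\<in>{0..tau n \<omega>}. ennreal (Ibar0 n i s \<omega> * ?L i j s) \<partial>lborel)" for n i j \<omega>
  define U where "U \<omega> = (\<Sum>i\<in>UNIV. \<Sum>j\<in>UNIV - {i}. \<Sum>n\<in>{1..N}. Jp n i j \<omega>)" for \<omega>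
  define V where "V \<omega> = (\<Sum>i\<in>UNIV. V0 i \<omega>) + (\<Sum>i\<in>UNIV. \<Sum>j\<in>UNIV - {i}. \<Sum>n\<in>{1..N}. Jm n i j \<omega> + Oc n i j \<omega>)" for \<omega>
  define bU where "bU \<omega> = (\<Sum>i\<in>UNIV. \<Sum>j\<in>UNIV - {i}. \<Sum>n\<in>{1..N}. bJp n i j \<omega>)" for \<omega>
  define bV where "bV \<omega> = (\<Sum>i\<in>UNIV. bV0 i \<omega>) + (\<Sum>i\<in>UNIV. \<Sum>j\<in>UNIV - {i}. \<Sum>n\<in>{1..N}. bJm n i j \<omega> + bO n i j \<omega>)" for \<omega>
  have prob_le: "a' $ i \<le> 1" for i
  proof -
    have "a' $ i \<le> (\<Sum>i\<in>UNIV. a' $ i)"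
      using a' by (intro member_le_sum) (auto simp: probability_vectors_def)
    then show ?thesis using a' by (simp add: probability_vectors_def)
  qed
  have L_m: "(\<lambda>s. indicator {0..} s * ?L i j s) \<in> borel_measurable borel" for i j
    by (rule intensity_matrix_measurable[OF A'])
  have L_nonneg: "0 \<le> ?L i j s" if "i \<noteq> j" "0 \<le> s" for i j s
    using A' that by (simp add: sub_intensity_def)
  have log_m: "(\<lambda>s. indicator {0<..} s * e2ennreal (elog (?L i j s))) \<in> borel_measurable borel"
    "(\<lambda>s. indicator {0<..} s * e2ennreal (- elog (?L i j s))) \<in> borel_measurable borel" for i j
  proof -
    have [measurable]: "(\<lambda>s. indicator {0..} s * ?L i j s) \<in> borel_measurable borel" by (rule L_m)
    have "(\<lambda>s. indicator {0<..} s * e2ennreal (elog (indicator {0..} s * ?L i j s))) \<in> borel_measurable borel"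
      "(\<lambda>s. indicator {0<..} s * e2ennreal (- elog (indicator {0..} s * ?L i j s))) \<in> borel_measurable borel"
      by measurable
    moreover have "indicator {0<..} s * e2ennreal (elog (indicator {0..} s * ?L i j s)) = indicator {0<..} s * e2ennreal (elog (?L i j s))"
      "indicator {0<..} s * e2ennreal (- elog (indicator {0..} s * ?L i j s)) = indicator {0<..} s * e2ennreal (- elog (?L i j s))" for s
      by (auto simp: indicator_def)
    ultimately show "(\<lambda>s. indicator {0<..} s * e2ennreal (elog (?L i j s))) \<in> borel_measurable borel"
      "(\<lambda>s. indicator {0<..} s * e2ennreal (- elog (?L i j s))) \<in> borel_measurable borel" by simp_all
  qed
  have count_nonneg: "0 \<le> initial_count N X i \<omega>" for i \<omega>
    unfolding initial_count_def by (intro sum_nonneg) (simp add: occ_def)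
  have ce_V0: "is_cond_exp M F (V0 i) (bV0 i)" for i
    using is_cond_exp_cmult[OF is_cond_exp_initial_count, of "e2ennreal (- elog (a' $ i))" i]
  proof (rule is_cond_exp_cong)
    show "e2ennreal (- elog (a' $ i)) * ennreal (initial_count N X i \<omega>) = V0 i \<omega>" for \<omega>
      unfolding V0_def elog_times(1)[OF count_nonneg prob_le] by (rule mult.commute)
    show "e2ennreal (- elog (a' $ i)) * ennreal (\<Sum>n\<in>{1..N}. Ibar0 n (Some i) 0 \<omega>) = bV0 i \<omega>" for \<omega>
      unfolding bV0_def by (rule mult.commute)
  qed
  have ce_Jp: "is_cond_exp M F (Jp n i j) (bJp n i j)" and ce_Jm: "is_cond_exp M F (Jm n i j) (bJm n i j)"
    and ce_O: "is_cond_exp M F (Oc n i j) (bO n i j)" if "n \<in> {1..N}" "i \<noteq> j" for n i j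
  proof -
    show "is_cond_exp M F (Jp n i j) (bJp n i j)"
      unfolding Jp_def[abs_def] bJp_def[abs_def] by (rule is_cond_exp_jump_integral[OF N that log_m(1)])
    show "is_cond_exp M F (Jm n i j) (bJm n i j)"
      unfolding Jm_def[abs_def] bJm_def[abs_def] by (rule is_cond_exp_jump_integral[OF N that log_m(2)])
    show "is_cond_exp M F (Oc n i j) (bO n i j)"
      unfolding Oc_def[abs_def] bO_def[abs_def]
      by (rule is_cond_exp_occ_integral[OF N that(1) _ L_m L_nonneg[OF that(2)]]) (auto simp: intensity_matrix_def)
  qed
  have ce_U: "is_cond_exp M F U bU"
    unfolding U_def[abs_def] bU_def[abs_def] by (intro is_cond_exp_sum ce_Jp) auto
  have ce_V: "is_cond_exp M F V bV"
    unfolding V_def[abs_def] bV_def[abs_def] by (intro is_cond_exp_add is_cond_exp_sum ce_V0 ce_Jm ce_O) auto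
  have U_m: "U \<in> borel_measurable M" and V_m: "V \<in> borel_measurable M"
    using ce_U ce_V by (simp_all add: is_cond_exp_def)
  have Jp_fin: "Jp n i j \<omega> < \<infinity>" if "n \<in> {1..N}" "i \<noteq> j" "\<omega> \<in> space M" for n i j \<omega>
    unfolding Jp_def by (rule jump_integral_finite[OF that log_m(1) e2ennreal_elog_finite])
  have U_fin: "U \<omega> < \<infinity>" if "\<omega> \<in> space M" for \<omega>
    unfolding U_def using Jp_fin[OF _ _ that] by (auto simp: less_top[symmetric])
  have L_eq: "complete_loglik N X a' A' \<omega> = enn2ereal (U \<omega>) - enn2ereal (V \<omega>)" if \<omega>: "\<omega> \<in> space M" for \<omega>
  proof -
    have "complete_loglik N X a' A' \<omega> = (\<Sum>i\<in>UNIV. - enn2ereal (V0 i \<omega>)) + (\<Sum>i\<in>UNIV. \<Sum>j\<in>UNIV - {i}. \<Sum>n\<in>{1..N}.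
        enn2ereal (Jp n i j \<omega>) - enn2ereal (Jm n i j \<omega>) - enn2ereal (Oc n i j \<omega>))"
      by (simp add: complete_loglik_def set_ereal_integral_def Jp_def Jm_def Oc_def V0_def
          elog_times[OF count_nonneg prob_le])
    also have "\<dots> = enn2ereal (U \<omega>) - enn2ereal (V \<omega>)"
      unfolding U_def V_def using Jp_fin[OF _ _ \<omega>] by (intro loglik_terms_sum) blast
    finally show ?thesis .
  qed
  let ?Lp = "\<lambda>\<omega>. e2ennreal (complete_loglik N X a' A' \<omega>)" and ?Lm = "\<lambda>\<omega>. e2ennreal (- complete_loglik N X a' A' \<omega>)"
  have Lp: "?Lp \<omega> = U \<omega> - V \<omega>" and Lm: "?Lm \<omega> = V \<omega> - U \<omega>" if "\<omega> \<in> space M" for \<omega>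
    using ereal_parts[OF U_fin[OF that]] L_eq[OF that] by simp_all
  have Lp_m: "?Lp \<in> borel_measurable M" and Lm_m: "?Lm \<in> borel_measurable M"
    using U_m V_m by (simp_all cong: measurable_cong add: Lp Lm)
  have balance: "AE \<omega> in M. nn_cond_exp M F ?Lp \<omega> + bV \<omega> = nn_cond_exp M F ?Lm \<omega> + bU \<omega>"
  proof -
    \<comment> \<open>Subtraction truncates at zero, so \<open>x - y + y\<close> is a maximum.\<close>
    have max: "x - y + y = max x y" if "y < \<infinity>" for x y :: ennreal
      using that by (cases "y \<le> x") (auto simp: max_def diff_add_cancel_ennreal diff_eq_0_iff_ennreal)
    have comm: "V \<omega> - U \<omega> + U \<omega> = U \<omega> - V \<omega> + V \<omega>" if "\<omega> \<in> space M" for \<omega>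
      by (cases "V \<omega> < \<infinity>") (use U_fin[OF that] max in \<open>auto simp: max.commute less_top[symmetric]\<close>)
    have "is_cond_exp M F (\<lambda>\<omega>. ?Lp \<omega> + V \<omega>) (\<lambda>\<omega>. nn_cond_exp M F ?Lm \<omega> + bU \<omega>)"
      by (intro is_cond_exp_cong[OF is_cond_exp_add[OF is_cond_exp_nn_cond_exp[OF Lm_m] ce_U]])
        (simp_all add: Lp Lm comm)
    from is_cond_expD[OF this] is_cond_expD[OF is_cond_exp_add[OF is_cond_exp_nn_cond_exp[OF Lp_m] ce_V]]
    show ?thesis by eventually_elim simp
  qed
  have upper: "AE \<omega> in M. nn_cond_exp M F ?Lp \<omega> \<le> bU \<omega>" "AE \<omega> in M. nn_cond_exp M F ?Lm \<omega> \<le> bV \<omega>"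
  proof -
    have "AE \<omega> in M. nn_cond_exp M F ?Lp \<omega> \<le> nn_cond_exp M F U \<omega>"
      by (intro nn_cond_exp_mono AE_I2 Lp_m U_m) (simp add: Lp diff_le_self_ennreal)
    with is_cond_expD[OF ce_U] show "AE \<omega> in M. nn_cond_exp M F ?Lp \<omega> \<le> bU \<omega>" by eventually_elim simp
    have "AE \<omega> in M. nn_cond_exp M F ?Lm \<omega> \<le> nn_cond_exp M F V \<omega>"
      by (intro nn_cond_exp_mono AE_I2 Lm_m V_m) (simp add: Lm diff_le_self_ennreal)
    with is_cond_expD[OF ce_V] show "AE \<omega> in M. nn_cond_exp M F ?Lm \<omega> \<le> bV \<omega>" by eventually_elim simp
  qed
  have fin_S: "finite ?S"
    by (rule finite_subset[of _ "{1..N} \<times> UNIV \<times> UNIV"]) auto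
  have terms: "AE \<omega> in M. \<forall>(n, i, j)\<in>?S. nn_cond_exp M F (Jp n i j) \<omega> = bJp n i j \<omega> \<and>
      nn_cond_exp M F (Jm n i j) \<omega> = bJm n i j \<omega> \<and> nn_cond_exp M F (Oc n i j) \<omega> = bO n i j \<omega> \<and>
      interval_measure (\<lambda>s. Nbar n i j s \<omega>) = jkernel n i j (tau n \<omega>) \<and>
      (\<forall>g. (\<integral>\<^sup>+s\<in>{0..tau n \<omega>}. ennreal (Ibar n i s \<omega> * g s) \<partial>lborel)
         = (\<integral>\<^sup>+s\<in>{0..tau n \<omega>}. ennreal (Ibar0 n i s \<omega> * g s) \<partial>lborel))"
  proof (rule AE_finite_allI[OF fin_S])
    fix x assume "x \<in> ?S"
    then obtain n i j where x: "x = (n, i, j)" and n: "n \<in> {1..N}" and ij: "i \<noteq> j" by auto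
    show "AE \<omega> in M. case x of (n, i, j) \<Rightarrow> nn_cond_exp M F (Jp n i j) \<omega> = bJp n i j \<omega> \<and>
      nn_cond_exp M F (Jm n i j) \<omega> = bJm n i j \<omega> \<and> nn_cond_exp M F (Oc n i j) \<omega> = bO n i j \<omega> \<and>
      interval_measure (\<lambda>s. Nbar n i j s \<omega>) = jkernel n i j (tau n \<omega>) \<and>
      (\<forall>g. (\<integral>\<^sup>+s\<in>{0..tau n \<omega>}. ennreal (Ibar n i s \<omega> * g s) \<partial>lborel)
         = (\<integral>\<^sup>+s\<in>{0..tau n \<omega>}. ennreal (Ibar0 n i s \<omega> * g s) \<partial>lborel))"
      unfolding x prod.case
      using is_cond_expD[OF ce_Jp[OF n ij]] is_cond_expD[OF ce_Jm[OF n ij]] is_cond_expD[OF ce_O[OF n ij]]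
        interval_measure_version[OF Nbar n ij] occ_integral_version[OF Ibar n, of i]
      by eventually_elim blast
  qed
  have initial: "AE \<omega> in M. \<forall>i\<in>UNIV. nn_cond_exp M F (V0 i) \<omega> = bV0 i \<omega> \<and>
      cond_initial_count M N X i \<omega> = (\<Sum>n\<in>{1..N}. Ibar0 n (Some i) 0 \<omega>)"
  proof (rule AE_finite_allI)
    fix i
    show "AE \<omega> in M. nn_cond_exp M F (V0 i) \<omega> = bV0 i \<omega> \<and>
      cond_initial_count M N X i \<omega> = (\<Sum>n\<in>{1..N}. Ibar0 n (Some i) 0 \<omega>)"
      using is_cond_expD[OF ce_V0[of i]] cond_initial_count_eq[of i] by eventually_elim blast
  qed simp
  have wd': "AE \<omega> in M. (\<forall>n\<in>{1..N}. \<forall>i j. i \<noteq> j \<longrightarrow> nn_cond_exp M F (Jp n i j) \<omega> < \<infinity>)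
      \<or> (\<forall>i. nn_cond_exp M F (V0 i) \<omega> < \<infinity>) \<and> (\<forall>n\<in>{1..N}. \<forall>i j. i \<noteq> j \<longrightarrow>
          nn_cond_exp M F (Jm n i j) \<omega> < \<infinity> \<and> nn_cond_exp M F (Oc n i j) \<omega> < \<infinity>)"
    using wd unfolding loglik_cond_exp_well_defined_def Let_def
      Jp_def[abs_def] Jm_def[abs_def] Oc_def[abs_def] V0_def[abs_def] .
  show ?thesis
    using balance upper terms initial wd'
  proof eventually_elim
    case (elim \<omega>)
    have T: "nn_cond_exp M F (Jp n i j) \<omega> = bJp n i j \<omega>" "nn_cond_exp M F (Jm n i j) \<omega> = bJm n i j \<omega>"
      "nn_cond_exp M F (Oc n i j) \<omega> = bO n i j \<omega>"
      "interval_measure (\<lambda>s. Nbar n i j s \<omega>) = jkernel n i j (tau n \<omega>)"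
      "(\<integral>\<^sup>+s\<in>{0..tau n \<omega>}. ennreal (Ibar n i s \<omega> * ?L i j s) \<partial>lborel) = bO n i j \<omega>"
      if "n \<in> {1..N}" "i \<noteq> j" for n i j
      using elim(4) that by (auto simp: bO_def)
    have B: "nn_cond_exp M F (V0 i) \<omega> = bV0 i \<omega>" "cond_initial_count M N X i \<omega> = (\<Sum>n\<in>{1..N}. Ibar0 n (Some i) 0 \<omega>)" for i
      using elim(5) by auto
    have fin: "(\<forall>n\<in>{1..N}. \<forall>i j. i \<noteq> j \<longrightarrow> bJp n i j \<omega> < \<infinity>)
      \<or> (\<forall>i. bV0 i \<omega> < \<infinity>) \<and> (\<forall>n\<in>{1..N}. \<forall>i j. i \<noteq> j \<longrightarrow> bJm n i j \<omega> < \<infinity> \<and> bO n i j \<omega> < \<infinity>)"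
      using elim(6) T(1-3) B(1) by simp
    then have fin_UV: "bU \<omega> < \<infinity> \<or> bV \<omega> < \<infinity>"
    proof
      assume "\<forall>n\<in>{1..N}. \<forall>i j. i \<noteq> j \<longrightarrow> bJp n i j \<omega> < \<infinity>"
      then have "bU \<omega> < \<infinity>" unfolding bU_def by (auto simp: less_top[symmetric])
      then show ?thesis ..
    next
      assume "(\<forall>i. bV0 i \<omega> < \<infinity>) \<and> (\<forall>n\<in>{1..N}. \<forall>i j. i \<noteq> j \<longrightarrow> bJm n i j \<omega> < \<infinity> \<and> bO n i j \<omega> < \<infinity>)"
      then have "bV \<omega> < \<infinity>" unfolding bV_def by (auto simp: less_top[symmetric])
      then show ?thesis ..
    qed
    have Ibar_sum: "0 \<le> (\<Sum>n\<in>{1..N}. Ibar0 n (Some i) 0 \<omega>)" for i by (intro sum_nonneg Ibar0_nonneg)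
    have init: "cond_loglik_initial M N X a' \<omega> = (\<Sum>i\<in>UNIV. - enn2ereal (bV0 i \<omega>))"
      unfolding cond_loglik_initial_def B(2) bV0_def by (simp only: elog_times(2)[OF Ibar_sum prob_le])
    have jump: "cond_loglik_jump N X Ibar Nbar A' i j \<omega>
        = (\<Sum>n\<in>{1..N}. enn2ereal (bJp n i j \<omega>) - enn2ereal (bJm n i j \<omega>) - enn2ereal (bO n i j \<omega>))" if "i \<noteq> j" for i j
      unfolding cond_loglik_jump_def set_ereal_integral_def
      by (intro sum.cong refl) (simp add: T[OF _ that] bJp_def bJm_def)
    have "ereal_cond_exp M F (complete_loglik N X a' A') \<omega> = enn2ereal (nn_cond_exp M F ?Lp \<omega>) - enn2ereal (nn_cond_exp M F ?Lm \<omega>)"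
      by (simp add: ereal_cond_exp_def)
    also have "\<dots> = enn2ereal (bU \<omega>) - enn2ereal (bV \<omega>)"
      by (rule ereal_diff_eq_of_sums[OF elim(1,2,3) fin_UV])
    also have "\<dots> = (\<Sum>i\<in>UNIV. - enn2ereal (bV0 i \<omega>)) + (\<Sum>i\<in>UNIV. \<Sum>j\<in>UNIV - {i}. \<Sum>n\<in>{1..N}.
        enn2ereal (bJp n i j \<omega>) - enn2ereal (bJm n i j \<omega>) - enn2ereal (bO n i j \<omega>))"
      unfolding bU_def bV_def by (rule loglik_terms_sum[OF fin, symmetric])
    also have "\<dots> = cond_loglik_initial M N X a' \<omega> + (\<Sum>i\<in>UNIV. \<Sum>j\<in>UNIV - {i}. cond_loglik_jump N X Ibar Nbar A' i j \<omega>)"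
      unfolding init by (intro arg_cong2[where f="(+)"] refl sum.cong jump[symmetric]) auto
    finally show ?case .
  qed
qed

end

section \<open>The conditional expected statistics in terms of product integrals\<close>

context absorbed_markov_process
begin

lemma occ_density_formula:
  assumes "0 \<le> s" "s < w"
  shows "occ_density s (Some i) w = ((a v* product_integral A 0 s) \<bullet> axis i 1)
    * (axis i 1 \<bullet> (product_integral A s w *v exit_rates A w)) / absorption_density a A w"
  using assms by (simp add: occ_density_def joint_density_eq tau_density_eq)

text \<open>
  The factor \<open>R\<close> carries the default value zero at times when \<open>X u = j\<close> has probability zero. These
  times may be neglected, because almost everywhere there is no influx into \<open>j\<close> then.
\<close>

lemma jump_kernel_Some_formula:
  assumes S: "S \<in> sets borel" "S \<subseteq> {0<..w}" and ij: "i \<noteq> j"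
  shows "emeasure (jump_kernel (Some i) (Some j) w) S
    = (\<integral>\<^sup>+s\<in>S. ennreal (((a v* product_integral A 0 s) \<bullet> axis i 1) * L s (Some i) (Some j)
        * (axis j 1 \<bullet> (product_integral A s w *v exit_rates A w)) / absorption_density a A w) \<partial>lborel)"
proof -
  have ij': "Some i \<noteq> Some j" using ij by simp
  have "AE u in lborel. ennreal (jump_density (Some i) (Some j) u w) * indicator S u
    = ennreal (((a v* product_integral A 0 u) \<bullet> axis i 1) * L u (Some i) (Some j)
        * (axis j 1 \<bullet> (product_integral A u w *v exit_rates A w)) / absorption_density a A w) * indicator S u"
    using AE_no_influx_to_null_state[OF ij'] AE_lborel_singleton[of w]
  proof eventually_elim
    case (elim u)
    show ?case
    proof (cases "u \<in> S")
      case True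
      then have u: "0 < u" "u < w" using S(2) elim(2) by force+
      have qi: "q u (Some i) = (a v* product_integral A 0 u) \<bullet> axis i 1" using u by (simp add: q_eq inner_axis)
      have qj: "q u (Some j) = (a v* product_integral A 0 u) \<bullet> axis j 1" using u by (simp add: q_eq inner_axis)
      show ?thesis
      proof (cases "q u (Some j) = 0")
        case True
        then have "q u (Some i) * L u (Some i) (Some j) = 0" using elim u ij by simp
        then show ?thesis using u by (auto simp: jump_density_def jump_rate_def qi)
      next
        case False
        then have "0 < q u (Some j)" using q_bounds(1)[of u "Some j"] by simp
        then have "R u w (Some j) = axis j 1 \<bullet> (product_integral A u w *v exit_rates A w)"
          using u by (simp add: R_def joint_density_eq qj)
        then show ?thesis using u by (simp add: jump_density_def jump_rate_def qi tau_density_eq)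
      qed
    qed simp
  qed
  then show ?thesis
    using S(1) by (subst emeasure_jump_kernel_Some) (auto intro: nn_integral_cong_AE)
qed

lemma jump_kernel_None_formula:
  assumes S: "S \<in> sets borel" "S \<subseteq> {0<..w}"
  shows "emeasure (jump_kernel (Some i) None w) S
    = (\<integral>\<^sup>+s\<in>S. ennreal (((a v* product_integral A 0 s) \<bullet> axis i 1) * exit_rates A s $ i
        / absorption_density a A w) \<partial>return borel w)"
proof -
  let ?h = "\<lambda>s. ennreal (((a v* product_integral A 0 s) \<bullet> axis i 1) * exit_rates A s $ i / absorption_density a A w) * indicator S s"
  have [measurable]: "S \<in> sets borel" by (rule S(1))
  have [measurable]: "(\<lambda>u. indicator {0..} u * jump_rate (Some i) None u) \<in> borel_measurable borel"
    by (rule jump_rate_measurable)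
  have rate: "jump_rate (Some i) None s = ((a v* product_integral A 0 s) \<bullet> axis i 1) * exit_rates A s $ i" if "0 \<le> s" for s
    using that by (simp add: jump_rate_def q_eq inner_axis intensity_matrix_def)
  have "?h s = ennreal (indicator {0..} s * jump_rate (Some i) None s / absorption_density a A w) * indicator S s" for s
    using S(2) by (cases "s \<in> S") (auto simp: rate)
  then have "?h = (\<lambda>s. ennreal (indicator {0..} s * jump_rate (Some i) None s / absorption_density a A w) * indicator S s)"
    by (rule ext)
  also have "\<dots> \<in> borel_measurable borel" by measurable
  finally have "(\<integral>\<^sup>+s. ?h s \<partial>return borel w) = ?h w" by (intro nn_integral_return) auto
  moreover have "ennreal (exit_weight (Some i) w) * indicator S w = ?h w"
    using S(2) by (cases "w \<in> S") (auto simp: exit_weight_def rate tau_density_eq)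
  ultimately show ?thesis using S(1) by (simp add: emeasure_jump_kernel_None)
qed

lemma initial_row: "(a v* product_integral A 0 0) \<bullet> axis i 1 = a $ i"
  using q_eq[of 0 i] by (simp add: q_0 inner_axis)

end

theorem theorem3p4:
  fixes Theta :: "'th::euclidean_space set"
    and T :: "real \<Rightarrow> 'th \<Rightarrow> real^'p^'p"
    and Pr :: "real^'p \<Rightarrow> 'th \<Rightarrow> 'w measure"
    and N :: nat
    and X :: "nat \<Rightarrow> real \<Rightarrow> 'w \<Rightarrow> 'p option"
    and pim :: "nat \<Rightarrow> real^'p"
    and thetam :: "nat \<Rightarrow> 'th"
    and m :: nat
  defines "M \<equiv> Pr (pim m) (thetam m)"
    and "F \<equiv> absorption_algebra (Pr (pim m) (thetam m)) N X"
    and "tau \<equiv> \<lambda>n. absorption_time (X n)"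
    and "P \<equiv> product_integral (\<lambda>u. T u (thetam m))"
    and "t \<equiv> exit_rates (\<lambda>u. T u (thetam m))"
    and "mu \<equiv> \<lambda>i j s. intensity_matrix (\<lambda>u. T u (thetam m)) s $ i $ j"
    and "f \<equiv> absorption_density (pim m) (\<lambda>u. T u (thetam m))"
  assumes "interior Theta \<noteq> {}"
    and "\<And>\<theta>. \<theta> \<in> Theta \<Longrightarrow> sub_intensity (\<lambda>u. T u \<theta>)"
    and "\<And>\<theta>. \<theta> \<in> Theta \<Longrightarrow> product_integrable (\<lambda>u. T u \<theta>)"
    and "1 \<le> N"
    and "\<And>\<pi> \<theta>. \<pi> \<in> probability_vectors \<Longrightarrow> \<theta> \<in> Theta \<Longrightarrow>
           iid_markov_jump_processes (Pr \<pi> \<theta>) N X \<pi> (\<lambda>u. T u \<theta>)"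
    and "\<And>\<pi> \<theta> n. \<pi> \<in> probability_vectors \<Longrightarrow> \<theta> \<in> Theta \<Longrightarrow> n \<in> {1..N} \<Longrightarrow>
           AE \<omega> in Pr \<pi> \<theta>. \<exists>s\<ge>0. X n s \<omega> = None"
    and "\<And>k. pim k \<in> probability_vectors" and "\<And>k. thetam k \<in> Theta"
    and "\<And>n i j s. n \<in> {1..N} \<Longrightarrow> i \<noteq> j \<Longrightarrow> 0 \<le> s \<Longrightarrow>
           AE \<omega> in M. nn_cond_exp M F (\<lambda>\<omega>. ennreal (jump_count (X n) i j s \<omega>)) \<omega> < \<infinity>"
  shows "(\<exists>Ibar. cond_occ_version M N X Ibar) \<and>
    (\<exists>Nbar. cond_jump_count_version M N X Nbar) \<and>
    (\<forall>i. AE \<omega> in M. cond_initial_count M N X i \<omega> =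
       (\<Sum>n\<in>{1..N}. pim m $ i * (axis i 1 \<bullet> (P 0 (tau n \<omega>) *v t (tau n \<omega>))) / f (tau n \<omega>))) \<and>
    (\<forall>Ibar Nbar. cond_occ_version M N X Ibar \<longrightarrow> cond_jump_count_version M N X Nbar \<longrightarrow>
       (\<forall>\<pi>\<in>probability_vectors. \<forall>\<theta>\<in>Theta.
          loglik_cond_exp_well_defined M N X \<pi> (\<lambda>u. T u \<theta>) \<longrightarrow>
          (AE \<omega> in M. ereal_cond_exp M F (complete_loglik N X \<pi> (\<lambda>u. T u \<theta>)) \<omega> =
             cond_loglik_initial M N X \<pi> \<omega>
             + (\<Sum>i\<in>UNIV. \<Sum>j\<in>UNIV - {i}. cond_loglik_jump N X Ibar Nbar (\<lambda>u. T u \<theta>) i j \<omega>))) \<and>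
       (\<forall>n\<in>{1..N}.
          (\<forall>i. \<forall>s>0. AE \<omega> in M. s < tau n \<omega> \<longrightarrow>
             Ibar n (Some i) s \<omega> =
               ((pim m v* P 0 s) \<bullet> axis i 1) * (axis i 1 \<bullet> (P s (tau n \<omega>) *v t (tau n \<omega>)))
               / f (tau n \<omega>)) \<and>
          (\<forall>s>0. AE \<omega> in M. s < tau n \<omega> \<longrightarrow> Ibar n None s \<omega> = 0) \<and>
          (\<forall>i j. i \<noteq> j \<longrightarrow>
             (AE \<omega> in M. \<forall>S\<in>sets borel. S \<subseteq> {0<..tau n \<omega>} \<longrightarrow>
                emeasure (interval_measure (\<lambda>s. Nbar n (Some i) (Some j) s \<omega>)) S =
                (\<integral>\<^sup>+s\<in>S. ennreal (((pim m v* P 0 s) \<bullet> axis i 1) * mu (Some i) (Some j) s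
                     * (axis j 1 \<bullet> (P s (tau n \<omega>) *v t (tau n \<omega>))) / f (tau n \<omega>)) \<partial>lborel))) \<and>
          (\<forall>i. AE \<omega> in M. \<forall>S\<in>sets borel. S \<subseteq> {0<..tau n \<omega>} \<longrightarrow>
                emeasure (interval_measure (\<lambda>s. Nbar n (Some i) None s \<omega>)) S =
                (\<integral>\<^sup>+s\<in>S. ennreal (((pim m v* P 0 s) \<bullet> axis i 1) * t s $ i
                     / f (tau n \<omega>)) \<partial>return borel (tau n \<omega>))) \<and>
          (\<forall>j. AE \<omega> in M. \<forall>S\<in>sets borel. S \<subseteq> {0<..tau n \<omega>} \<longrightarrow>
                emeasure (interval_measure (\<lambda>s. Nbar n None (Some j) s \<omega>)) S = 0)))"
proof -
  let ?A = "\<lambda>u. T u (thetam m)"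
  have "iid_markov_jump_processes M N X (pim m) ?A"
    unfolding M_def by (rule assms(12)) (rule assms(14) assms(15))+
  moreover have "AE \<omega> in M. \<exists>s\<ge>0. X n s \<omega> = None" if "n \<in> {1..N}" for n
    unfolding M_def by (rule assms(13)) (rule assms(14) assms(15) that)+
  moreover have "AE \<omega> in M. nn_cond_exp M (absorption_algebra M N X) (\<lambda>\<omega>. ennreal (jump_count (X n) i j s \<omega>)) \<omega> < \<infinity>"
    if "n \<in> {1..N}" "i \<noteq> j" "0 \<le> s" for n i j s
    using assms(16)[OF that] by (simp add: F_def M_def)
  ultimately interpret finite_cond_jumps M N X "pim m" ?A
    using assms(9)[OF assms(15)] assms(10)[OF assms(15)] by unfold_locales
  have F: "F = absorption_algebra M N X" by (simp add: F_def M_def)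
  have process: "absorbed_markov_process M (X n) (pim m) ?A" if "n \<in> {1..N}" for n
    by (rule process[OF that])
  have Ibar0_formula: "Ibar0 n (Some i) s \<omega> = ((pim m v* P 0 s) \<bullet> axis i 1)
      * (axis i 1 \<bullet> (P s (tau n \<omega>) *v t (tau n \<omega>))) / f (tau n \<omega>)"
    if "n \<in> {1..N}" "0 \<le> s" "s < tau n \<omega>" for n i s \<omega>
    using absorbed_markov_process.occ_density_formula[OF process[OF that(1)] that(2,3)[unfolded tau_def]]
    by (simp add: Ibar0_def P_def t_def f_def tau_def)
  have initial: "AE \<omega> in M. cond_initial_count M N X i \<omega> =
      (\<Sum>n\<in>{1..N}. pim m $ i * (axis i 1 \<bullet> (P 0 (tau n \<omega>) *v t (tau n \<omega>))) / f (tau n \<omega>))" for i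
  proof -
    have "AE \<omega> in M. \<forall>n\<in>{1..N}. 0 < tau n \<omega>"
    proof (rule AE_finite_allI)
      fix n assume "n \<in> {1..N}"
      from absorbed_markov_process.\<tau>_characterization[OF process[OF this]]
      show "AE \<omega> in M. 0 < tau n \<omega>" by eventually_elim (simp add: tau_def)
    qed simp
    then show ?thesis
      using cond_initial_count_eq[of i]
    proof eventually_elim
      case (elim \<omega>)
      show ?case unfolding elim(2)
      proof (rule sum.cong[OF refl])
        fix n assume n: "n \<in> {1..N}"
        have "(pim m v* P 0 0) \<bullet> axis i 1 = pim m $ i"
          unfolding P_def by (rule absorbed_markov_process.initial_row[OF process[OF n]])
        with Ibar0_formula[OF n order_refl, of \<omega> i] elim(1) n
        show "Ibar0 n (Some i) 0 \<omega> = pim m $ i * (axis i 1 \<bullet> (P 0 (tau n \<omega>) *v t (tau n \<omega>))) / f (tau n \<omega>)"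
          by simp
      qed
    qed
  qed
  show ?thesis
  proof (intro conjI allI impI ballI)
    show "\<exists>Ibar. cond_occ_version M N X Ibar" using cond_occ_version_Ibar0 by blast
    show "\<exists>Nbar. cond_jump_count_version M N X Nbar" using cond_jump_count_version_Nbar0 by blast
  next
    fix Ibar Nbar assume Ibar: "cond_occ_version M N X Ibar" and Nbar: "cond_jump_count_version M N X Nbar"
    show "AE \<omega> in M. ereal_cond_exp M F (complete_loglik N X \<pi> (\<lambda>u. T u \<theta>)) \<omega> =
             cond_loglik_initial M N X \<pi> \<omega>
             + (\<Sum>i\<in>UNIV. \<Sum>j\<in>UNIV - {i}. cond_loglik_jump N X Ibar Nbar (\<lambda>u. T u \<theta>) i j \<omega>)"
      if "\<pi> \<in> probability_vectors" "\<theta> \<in> Theta" "loglik_cond_exp_well_defined M N X \<pi> (\<lambda>u. T u \<theta>)" for \<pi> \<theta>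
      unfolding F by (rule cond_exp_loglik[OF assms(11) that(1) assms(9)[OF that(2)] Ibar Nbar that(3)])
    fix n assume n: "n \<in> {1..N}"
    show "AE \<omega> in M. s < tau n \<omega> \<longrightarrow> Ibar n (Some i) s \<omega> = ((pim m v* P 0 s) \<bullet> axis i 1)
        * (axis i 1 \<bullet> (P s (tau n \<omega>) *v t (tau n \<omega>))) / f (tau n \<omega>)" if "0 < s" for i s
      using occ_version_eq[OF Ibar n less_imp_le[OF that], of "Some i"]
      by eventually_elim (simp add: Ibar0_formula[OF n less_imp_le[OF that]])
    show "AE \<omega> in M. s < tau n \<omega> \<longrightarrow> Ibar n None s \<omega> = 0" if "0 < s" for s
      using occ_version_eq[OF Ibar n less_imp_le[OF that], of None]
      by eventually_elim (simp add: Ibar0_def tau_def)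
    show "AE \<omega> in M. \<forall>S\<in>sets borel. S \<subseteq> {0<..tau n \<omega>} \<longrightarrow>
        emeasure (interval_measure (\<lambda>s. Nbar n (Some i) (Some j) s \<omega>)) S =
        (\<integral>\<^sup>+s\<in>S. ennreal (((pim m v* P 0 s) \<bullet> axis i 1) * mu (Some i) (Some j) s
          * (axis j 1 \<bullet> (P s (tau n \<omega>) *v t (tau n \<omega>))) / f (tau n \<omega>)) \<partial>lborel)" if ij: "i \<noteq> j" for i j
    proof -
      have "Some i \<noteq> Some j" using ij by simp
      from interval_measure_version[OF Nbar n this] show ?thesis
      proof eventually_elim
        case (elim \<omega>)
        show ?case
          unfolding elim P_def t_def f_def mu_def tau_def
          using absorbed_markov_process.jump_kernel_Some_formula[OF process[OF n] _ _ ij] by blast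
      qed
    qed
    show "AE \<omega> in M. \<forall>S\<in>sets borel. S \<subseteq> {0<..tau n \<omega>} \<longrightarrow>
        emeasure (interval_measure (\<lambda>s. Nbar n (Some i) None s \<omega>)) S =
        (\<integral>\<^sup>+s\<in>S. ennreal (((pim m v* P 0 s) \<bullet> axis i 1) * t s $ i / f (tau n \<omega>))
          \<partial>return borel (tau n \<omega>))" for i
      using interval_measure_version[OF Nbar n, of "Some i" None, OF option.distinct(2)]
    proof eventually_elim
      case (elim \<omega>)
      show ?case
        unfolding elim P_def t_def f_def tau_def
        using absorbed_markov_process.jump_kernel_None_formula[OF process[OF n]] by blast
    qed
    show "AE \<omega> in M. \<forall>S\<in>sets borel. S \<subseteq> {0<..tau n \<omega>} \<longrightarrow>
        emeasure (interval_measure (\<lambda>s. Nbar n None (Some j) s \<omega>)) S = 0" for j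
      using interval_measure_version[OF Nbar n, of None "Some j", OF option.distinct(1)]
    proof eventually_elim
      case (elim \<omega>)
      show ?case
        unfolding elim using absorbed_markov_process.jump_kernel_from_None[OF process[OF n]] by blast
    qed
  qed (rule initial)
qed

end
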